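(* Let $\varphi$ be an analytic self-map of the unit disk $\mathbb{D}$ such that $|\varphi(e^{i\theta})|<1$ almost everywhere with respect to Lebesgue measure on $\partial\mathbb{D}$. Suppose that $\varphi$ agrees almost everywhere on $\partial\mathbb{D}$ with a bounded measurable function $\widehat{\varphi}$ which is continuous at each point of $E(\varphi)$. Then the following are equivalent: (i) $[T_z,C_\varphi]\in\mathcal{K}$. (ii) $[T_z^*,C_\varphi]\in\mathcal{K}$. (iii) For each $\zeta$ in $E(\varphi)$, $\widehat{\varphi}(\zeta)=\zeta$. When these conditions hold, $[T_w,C_\varphi]\in\mathcal{K}$ for every $w$ in $C(\partial\mathbb{D})$.
   Context: $H^2$ is the Hardy space on $\mathbb{D}$, viewed (via boundary values) as a closed subspace of $L^2=L^2(\partial\mathbb{D})$ with normalized arc-length measure; $P:L^2\to H^2$ is the orthogonal projection. $C_\varphi f=f\circ\varphi$ is the composition operator on $H^2$; for bounded measurable $w$ on $\partial\mathbb{D}$, $T_wf=P(wf)$ is the Toeplitz operator on $H^2$, and $T_z$ is the shift. $\mathcal{K}$ is the ideal of compact operators on $H^2$, and $[A,B]=AB-BA$. Boundary values $\varphi(e^{i\theta})$ are radial limits. For $|\alpha|=1$, the Clark measure $\mu_\alpha$ of $\varphi$ is the finite positive Borel measure on $\partial\mathbb{D}$ whose Poisson integral is the positive harmonic function $\mathrm{Re}\,\frac{\alpha+\varphi}{\alpha-\varphi}$ on $\mathbb{D}$; $\mu_\alpha^s$ is its singular part with respect to Lebesgue measure. $E(\varphi)$ is the closure in $\partial\mathbb{D}$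 of the union, over all $|\alpha|=1$, of the closed supports of the measures $\mu_\alpha^s$. *)

theory Defs
  imports "HOL-Analysis.Analysis"
begin

section \<open>Arc-length measure and boundary values\<close>

definition arc_measure :: "complex measure" where
  "arc_measure =
     distr (uniform_measure lborel {0..<2 * pi}) (restrict_space borel (sphere 0 1)) cis"

text \<open>\<open>arc_measure\<close> lives on the Borel sets of the unit circle; its completion has the
  Lebesgue measurable sets.\<close>

abbreviation arc_lebesgue :: "complex measure" where
  "arc_lebesgue \<equiv> completion arc_measure"

text \<open>Where the radial limit does not exist, the value of \<open>Lim\<close> is a fixed unspecified number;
  for functions in the Hardy space this happens on a null set only.\<close>

definition radial_limit :: "(complex \<Rightarrow> complex) \<Rightarrow> complex \<Rightarrow> complex" where
  "radial_limit f \<zeta> = Lim (at_left (1::real)) (\<lambda>r. f (of_real r * \<zeta>))"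


section \<open>The Hardy space\<close>

text \<open>Elements are analytic functions on the disk, normalised to vanish off the disk so that equal
  elements of the space are equal as HOL functions.\<close>

definition hardy2 :: "(complex \<Rightarrow> complex) set" where
  "hardy2 = {f. f holomorphic_on ball 0 1 \<and> (\<forall>z. z \<notin> ball 0 1 \<longrightarrow> f z = 0) \<and>
     bdd_above ((\<lambda>r. \<integral>\<zeta>. (norm (f (of_real r * \<zeta>)))\<^sup>2 \<partial>arc_lebesgue) ` {0..<1::real})}"

definition L2_inner :: "(complex \<Rightarrow> complex) \<Rightarrow> (complex \<Rightarrow> complex) \<Rightarrow> complex" where
  "L2_inner u v = (\<integral>\<zeta>. u \<zeta> * cnj (v \<zeta>) \<partial>arc_lebesgue)"

definition hardy_inner :: "(complex \<Rightarrow> complex) \<Rightarrow> (complex \<Rightarrow> complex) \<Rightarrow> complex" where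
  "hardy_inner f g = L2_inner (radial_limit f) (radial_limit g)"

definition hardy_norm :: "(complex \<Rightarrow> complex) \<Rightarrow> real" where
  "hardy_norm f = sqrt (Re (hardy_inner f f))"

text \<open>The orthogonal projection of \<open>L\<^sup>2\<close> onto the space of boundary functions of \<open>hardy2\<close>.\<close>

definition hardy_proj :: "(complex \<Rightarrow> complex) \<Rightarrow> (complex \<Rightarrow> complex)" where
  "hardy_proj u = (THE h. h \<in> hardy2 \<and>
     (\<forall>k\<in>hardy2. L2_inner (\<lambda>\<zeta>. u \<zeta> - radial_limit h \<zeta>) (radial_limit k) = 0))"


section \<open>Operators on the Hardy space\<close>

text \<open>Operators are functions whose values matter on \<open>hardy2\<close> only.\<close>

type_synonym hardy_op = "(complex \<Rightarrow> complex) \<Rightarrow> (complex \<Rightarrow> complex)"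

definition comp_op :: "(complex \<Rightarrow> complex) \<Rightarrow> hardy_op" where
  "comp_op \<phi> f = (\<lambda>z. if z \<in> ball 0 1 then f (\<phi> z) else 0)"

definition toeplitz :: "(complex \<Rightarrow> complex) \<Rightarrow> hardy_op" where
  "toeplitz w f = hardy_proj (\<lambda>\<zeta>. w \<zeta> * radial_limit f \<zeta>)"

definition hardy_adjoint :: "hardy_op \<Rightarrow> hardy_op" where
  "hardy_adjoint A g =
     (THE h. h \<in> hardy2 \<and> (\<forall>f\<in>hardy2. hardy_inner (A f) g = hardy_inner f h))"

definition commutator :: "hardy_op \<Rightarrow> hardy_op \<Rightarrow> hardy_op" where
  "commutator A B f = (\<lambda>z. A (B f) z - B (A f) z)"

definition hardy_linear :: "hardy_op \<Rightarrow> bool" where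
  "hardy_linear A \<longleftrightarrow>
     (\<forall>f\<in>hardy2. A f \<in> hardy2) \<and>
     (\<forall>f\<in>hardy2. \<forall>g\<in>hardy2. A (\<lambda>z. f z + g z) = (\<lambda>z. A f z + A g z)) \<and>
     (\<forall>c. \<forall>f\<in>hardy2. A (\<lambda>z. c * f z) = (\<lambda>z. c * A f z))"

definition compact_op :: "hardy_op \<Rightarrow> bool" where
  "compact_op A \<longleftrightarrow> hardy_linear A \<and>
     (\<forall>F :: nat \<Rightarrow> complex \<Rightarrow> complex.
        (\<forall>n. F n \<in> hardy2) \<and> bounded (range (\<lambda>n. hardy_norm (F n))) \<longrightarrow>
        (\<exists>g\<in>hardy2. \<exists>r :: nat \<Rightarrow> nat. strict_mono r \<and>
           (\<lambda>n. hardy_norm (\<lambda>z. A (F (r n)) z - g z)) \<longlonglongrightarrow> 0))"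


section \<open>Clark measures\<close>

definition poisson_integral :: "complex measure \<Rightarrow> complex \<Rightarrow> real" where
  "poisson_integral \<mu> z = (\<integral>\<zeta>. (1 - (norm z)\<^sup>2) / (norm (\<zeta> - z))\<^sup>2 \<partial>\<mu>)"

definition clark_measure :: "(complex \<Rightarrow> complex) \<Rightarrow> complex \<Rightarrow> complex measure" where
  "clark_measure \<phi> \<alpha> = (THE \<mu>. sets \<mu> = sets arc_measure \<and> finite_measure \<mu> \<and>
     (\<forall>z\<in>ball 0 1. poisson_integral \<mu> z = Re ((\<alpha> + \<phi> z) / (\<alpha> - \<phi> z))))"

definition mutually_singular :: "'a measure \<Rightarrow> 'a measure \<Rightarrow> bool" where
  "mutually_singular M N \<longleftrightarrow>
     (\<exists>A\<in>sets M. A \<in> sets N \<and> emeasure M A = 0 \<and> emeasure N (space N - A) = 0)"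

text \<open>The singular part of \<open>N\<close> in its Lebesgue decomposition with respect to \<open>M\<close>.\<close>

definition singular_part :: "'a measure \<Rightarrow> 'a measure \<Rightarrow> 'a measure" where
  "singular_part M N = (THE S. sets S = sets N \<and> mutually_singular M S \<and>
     (\<exists>R. sets R = sets N \<and> absolutely_continuous M R \<and>
        (\<forall>A\<in>sets N. emeasure N A = emeasure R A + emeasure S A)))"

definition measure_support :: "'a::topological_space measure \<Rightarrow> 'a set" where
  "measure_support M =
     {x \<in> space M. \<forall>U. open U \<and> x \<in> U \<longrightarrow> emeasure M (U \<inter> space M) > 0}"

definition clark_singular_set :: "(complex \<Rightarrow> complex) \<Rightarrow> complex set" where
  "clark_singular_set \<phi> =
     closure (\<Union>\<alpha>\<in>sphere 0 1. measure_support (singular_part arc_measure (clark_measure \<phi> \<alpha>)))"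

end

theory Submission
  imports Defs "HOL-Probability.Probability" "HOL-Complex_Analysis.Complex_Analysis"
begin

text \<open>
  Write \<open>S\<close> for the shift, \<open>C\<close> for the composition operator of \<open>\<phi>\<close>, and \<open>p\<close> for the boundary function
  of \<open>\<phi>\<close>, so that \<open>norm (p x) < 1\<close> almost everywhere on the circle.  The function \<open>[S, C] f\<close> is
  \<open>(z - \<phi> z) * f (\<phi> z)\<close>, and since \<open>f\<close> is continuous at the interior point \<open>p x\<close> its norm squared is the
  integral of \<open>(norm (x - p x))\<^sup>2 * (norm (f (p x)))\<^sup>2\<close> (\<open>shift_comm_norm\<close>).  A bounded operator is compact
  exactly when it maps weakly null sequences to norm null sequences (\<open>compact_op_iff\<close>), so (i) asks
  whether the measures \<open>(norm (f (p x)))\<^sup>2\<close> can concentrate, along a weakly null sequence, at points of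
  the circle where \<open>p x \<noteq> x\<close>.

  Clark measures answer this.  The absolutely continuous part of \<open>\<mu>\<^sub>\<alpha>\<close> has the density
  \<open>pois (p x) \<alpha>\<close>, and the singular part is the weak limit, as \<open>r \<rightarrow> 1\<close>, of the measures with density
  \<open>(norm (f (p x)))\<^sup>2\<close>, where \<open>f\<close> is the normalised reproducing kernel at \<open>r * \<alpha>\<close>
  (\<open>clark_singular_part\<close>).  These kernels form a weakly null sequence.  Hence compactness of \<open>[S, C]\<close>
  forces \<open>\<phi>' x = x\<close>, for the given representative \<open>\<phi>'\<close> of \<open>p\<close>, on the support of every singular part
  (\<open>compact_imp_fixed_on_support\<close>), and by continuity on the closure \<open>E\<close> of their union.

  Conversely, \<open>(norm (f w))\<^sup>2\<close> is at most the Poisson integral of \<open>(norm f)\<^sup>2\<close> at \<open>w\<close>.  Integrating this over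
  \<open>w = p x\<close> against a weight \<open>h\<close>, Tonelli's theorem bounds the integral of \<open>h x * (norm (f (p x)))\<^sup>2\<close> by
  \<open>(hardy_norm f)\<^sup>2\<close> times the largest mass that \<open>h\<close> gives to an absolutely continuous part
  (\<open>composition_tonelli\<close>); \<open>h = 1\<close> is the boundedness of \<open>C\<close>.  If \<open>h\<close> is continuous and vanishes on \<open>E\<close>, it
  does not see the singular parts, so its integral against the absolutely continuous part of \<open>\<mu>\<^sub>\<alpha>\<close>
  depends continuously on \<open>\<alpha>\<close>.  As in Dini's theorem, the share of these integrals that comes from
  \<open>norm (p x)\<close> near 1 is then small uniformly in \<open>\<alpha>\<close> (\<open>outer_mass_uniform\<close>), while on
  \<open>norm (p x) \<le> \<rho>\<close> a weakly null sequence tends to 0 boundedly.  So no mass concentrates off \<open>E\<close>, and under (iii)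
  the factor \<open>norm (x - p x)\<close> is small near \<open>E\<close>: this gives (i) (\<open>fixed_imp_compact\<close>).

  The other two claims hold for every bounded operator \<open>C\<close>.  The adjoint \<open>B\<close> of \<open>S\<close> is the Toeplitz
  operator with symbol \<open>cnj\<close>; it satisfies \<open>B S = 1\<close>, and \<open>S B - 1\<close> has rank one, so \<open>[B, C]\<close> is
  \<open>- B [S, C] B\<close> and \<open>[S, C]\<close> is \<open>- S [B, C] S\<close> up to operators of rank one (\<open>compact_commutator_shift_iff\<close>).  The
  continuous \<open>w\<close> for which the commutator of \<open>T\<^sub>w\<close> and \<open>C\<close> is compact form a uniformly closed space, closed under
  multiplication by \<open>z\<close> and \<open>cnj z\<close>, and the Stone-Weierstrass theorem finishes the proof
  (\<open>compact_commutator_continuous\<close>).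

  Three classical theorems carry this: Fatou's theorem on radial limits, the Herglotz representation of
  positive harmonic functions, and the Lebesgue decomposition of a measure.
\<close>

section \<open>Arc-length measure\<close>

lemma space_arc [simp]: "space arc_measure = sphere 0 1"
  by (simp add: arc_measure_def space_restrict_space)

lemma sets_arc [simp, measurable_cong]: "sets arc_measure = sets (restrict_space borel (sphere 0 1))"
  by (simp add: arc_measure_def)

lemma measurable_cis_arc [measurable]:
  "cis \<in> borel \<rightarrow>\<^sub>M restrict_space borel (sphere 0 1)"
  by (intro measurable_restrict_space2) (auto intro!: borel_measurable_continuous_onI continuous_intros)

lemma prob_space_arc: "prob_space arc_measure"
  unfolding arc_measure_def
  by (intro prob_space.prob_space_distr prob_space_uniform_measure) auto

interpretation arc: prob_space arc_measure
  by (rule prob_space_arc)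

lemma borel_measurable_arc_continuous:
  fixes f :: "complex \<Rightarrow> 'a::topological_space"
  assumes "continuous_on (sphere 0 1) f"
  shows "f \<in> borel_measurable arc_measure"
proof -
  have "f \<in> borel_measurable (restrict_space borel (sphere 0 1))"
    by (rule borel_measurable_continuous_on_restrict[OF assms])
  thus ?thesis by (simp cong: measurable_cong_sets)
qed

lemma integrable_arc_continuous:
  fixes f :: "complex \<Rightarrow> 'a::{banach, second_countable_topology}"
  assumes "continuous_on (sphere 0 1) f"
  shows "integrable arc_measure f"
proof -
  have "compact (f ` sphere 0 1)"
    using assms by (intro compact_continuous_image) auto
  then obtain B where "\<And>x. x \<in> sphere 0 1 \<Longrightarrow> norm (f x) \<le> B"
    using compact_imp_bounded[of "f ` sphere 0 1"] unfolding bounded_iff by blast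
  thus ?thesis
    by (intro arc.integrable_const_bound[of _ B] AE_I2 borel_measurable_arc_continuous assms) auto
qed

text \<open>A Lebesgue density on a closed interval of angles is what the change-of-variables theorems
  and the fundamental theorem of calculus need; the endpoint is a null set.\<close>

lemma arc_distr_density:
  "arc_measure = distr (density lborel (\<lambda>t. ennreal (indicator {0..2*pi} t / (2*pi)))) (restrict_space borel (sphere 0 1)) cis"
proof -
  have "uniform_measure lborel {0..<2*pi} = density lborel (\<lambda>t. ennreal (indicator {0..<2*pi} t / (2*pi)))"
    unfolding uniform_measure_def
    by (intro arg_cong2[of _ _ _ _ density] refl ext)
       (auto simp: indicator_def divide_ennreal[symmetric] ennreal_1[symmetric] simp del: ennreal_1)
  also have "\<dots> = density lborel (\<lambda>t. ennreal (indicator {0..2*pi} t / (2*pi)))"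
  proof (rule density_cong)
    show "AE x in lborel. ennreal (indicator {0..<2*pi} x / (2*pi)) = ennreal (indicator {0..2*pi} x / (2*pi))"
      using AE_lborel_singleton[of "2*pi"] by eventually_elim (auto simp: indicator_def)
  qed auto
  finally show ?thesis by (simp add: arc_measure_def)
qed

lemma borel_measurable_comp_cis:
  assumes "f \<in> borel_measurable arc_measure"
  shows "(\<lambda>t. f (cis t)) \<in> borel_measurable borel"
  using assms by (simp cong: measurable_cong_sets)

lemma integral_arc:
  fixes f :: "complex \<Rightarrow> 'a::{banach, second_countable_topology}"
  assumes [measurable]: "f \<in> borel_measurable arc_measure"
  shows "integral\<^sup>L arc_measure f = (LINT t:{0..2*pi}|lborel. f (cis t)) /\<^sub>R (2*pi)"
proof -
  have [measurable]: "(\<lambda>t. f (cis t)) \<in> borel_measurable borel"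
    by (rule borel_measurable_comp_cis[OF assms])
  have f': "f \<in> borel_measurable (restrict_space borel (sphere 0 1))"
    using assms by (simp cong: measurable_cong_sets)
  have "integral\<^sup>L arc_measure f = (\<integral>t. (indicator {0..2*pi} t / (2*pi)) *\<^sub>R f (cis t) \<partial>lborel)"
    unfolding arc_distr_density by (subst integral_distr[OF _ f'], simp, subst integral_density) auto
  also have "\<dots> = (\<integral>t. inverse (2*pi) *\<^sub>R (indicator {0..2*pi} t *\<^sub>R f (cis t)) \<partial>lborel)"
    by (intro Bochner_Integration.integral_cong refl) (simp only: scaleR_scaleR divide_inverse mult.commute)
  also have "\<dots> = inverse (2*pi) *\<^sub>R (\<integral>t. indicator {0..2*pi} t *\<^sub>R f (cis t) \<partial>lborel)"
    by (rule integral_scaleR_right)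
  finally show ?thesis unfolding set_lebesgue_integral_def .
qed

lemma integrable_arc:
  fixes f :: "complex \<Rightarrow> 'a::{banach, second_countable_topology}"
  assumes [measurable]: "f \<in> borel_measurable arc_measure"
  shows "integrable arc_measure f \<longleftrightarrow> set_integrable lborel {0..2*pi} (\<lambda>t. f (cis t))"
proof -
  have [measurable]: "(\<lambda>t. f (cis t)) \<in> borel_measurable borel"
    by (rule borel_measurable_comp_cis[OF assms])
  have f': "f \<in> borel_measurable (restrict_space borel (sphere 0 1))"
    using assms by (simp cong: measurable_cong_sets)
  have "integrable arc_measure f \<longleftrightarrow> integrable lborel (\<lambda>t. (indicator {0..2*pi} t / (2*pi)) *\<^sub>R f (cis t))"
    unfolding arc_distr_density
    by (subst integrable_distr_eq[OF _ f'], simp, subst integrable_density) (auto)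
  also have "\<dots> \<longleftrightarrow> integrable lborel (\<lambda>t. (1/(2*pi)) *\<^sub>R (indicator {0..2*pi} t *\<^sub>R f (cis t)))"
    by (intro Bochner_Integration.integrable_cong) auto
  also have "\<dots> \<longleftrightarrow> set_integrable lborel {0..2*pi} (\<lambda>t. f (cis t))"
    unfolding set_integrable_def
  proof
    assume "integrable lborel (\<lambda>t. (1/(2*pi)) *\<^sub>R (indicator {0..2*pi} t *\<^sub>R f (cis t)))"
    hence "integrable lborel (\<lambda>t. (2*pi) *\<^sub>R ((1/(2*pi)) *\<^sub>R (indicator {0..2*pi} t *\<^sub>R f (cis t))))"
      by (rule integrable_scaleR_right)
    moreover have "(2*pi) *\<^sub>R ((1/(2*pi)) *\<^sub>R x) = x" for x :: 'a by simp
    ultimately show "integrable lborel (\<lambda>t. indicator {0..2*pi} t *\<^sub>R f (cis t))" by (simp only:)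
  next
    assume "integrable lborel (\<lambda>t. indicator {0..2*pi} t *\<^sub>R f (cis t))"
    thus "integrable lborel (\<lambda>t. (1/(2*pi)) *\<^sub>R (indicator {0..2*pi} t *\<^sub>R f (cis t)))"
      by (intro integrable_scaleR_right)
  qed
  finally show ?thesis .
qed

lemma measurable_Arg2pi_arc: "Arg2pi \<in> borel_measurable arc_measure"
proof -
  define S where "S = - complex_of_real ` {0..}"
  have cl: "closed (complex_of_real ` {0..})"
  proof -
    have "complex_of_real ` {0..} = {z. Im z = 0 \<and> Re z \<ge> 0}"
      by (auto simp: image_iff complex_eq_iff)
    also have "closed \<dots>"
      by (intro closed_Collect_conj closed_Collect_eq closed_Collect_le continuous_intros)
    finally show ?thesis .
  qed
  have "(\<lambda>z. indicator S z *\<^sub>R Arg2pi z) \<in> borel_measurable borel"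
  proof (rule borel_measurable_continuous_on_indicator)
    show "S \<in> sets borel" using cl by (auto simp: S_def)
    show "continuous_on S Arg2pi"
      by (intro continuous_at_imp_continuous_on ballI continuous_at_Arg2pi)
         (auto simp: S_def image_iff complex_nonneg_Reals_iff complex_eq_iff)
  qed
  hence "(\<lambda>z. indicator S z *\<^sub>R Arg2pi z) \<in> borel_measurable (restrict_space borel (sphere 0 1))"
    by (rule measurable_restrict_space1)
  moreover have "(\<lambda>z. indicator S z *\<^sub>R Arg2pi z) = Arg2pi"
    by (auto simp: S_def indicator_def Arg2pi_of_real fun_eq_iff split: if_splits)
  ultimately show ?thesis by (simp cong: measurable_cong_sets)
qed

text \<open>An exceptional set of angles is transported to the circle through the measurable inverse
  \<open>Arg2pi\<close> of \<open>cis\<close>. The angle 0 is discarded, so that the remaining ones are interior points of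
  the interval and derivatives there are two-sided.\<close>

lemma AE_arc_cis:
  assumes N: "negligible N" and P: "\<And>t. t \<in> {0<..<2*pi} - N \<Longrightarrow> P (cis t)"
  shows "AE w in arc_measure. P w"
proof -
  obtain N' where N': "N' \<in> null_sets lborel" "N \<union> {0, 2*pi} \<subseteq> N'"
  proof -
    have "N \<union> {0, 2*pi} \<in> null_sets (completion lborel)"
      using N negligible_iff_null_sets by (metis negligible_Un negligible_finite finite.emptyI finite.insertI)
    thus ?thesis using that null_sets_completion_iff2[of "N \<union> {0, 2*pi}" lborel] by auto
  qed
  have [measurable]: "N' \<in> sets borel" using N' by auto
  have [measurable]: "Arg2pi \<in> borel_measurable (restrict_space borel (sphere 0 1))"
    using measurable_Arg2pi_arc by (simp cong: measurable_cong_sets)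
  have "AE w in arc_measure. Arg2pi w \<notin> N'"
    unfolding arc_distr_density
  proof (subst AE_distr_iff)
    show "AE x in density lborel (\<lambda>t. ennreal (indicat_real {0..2 * pi} t / (2 * pi))). Arg2pi (cis x) \<notin> N'"
    proof (subst AE_density)
      show "AE x in lborel. 0 < ennreal (indicat_real {0..2 * pi} x / (2 * pi)) \<longrightarrow> Arg2pi (cis x) \<notin> N'"
        using AE_not_in[OF N'(1)]
      proof eventually_elim
        case (elim x)
        show ?case
        proof
          assume "0 < ennreal (indicat_real {0..2 * pi} x / (2 * pi))"
          hence "x \<in> {0..2*pi}" by (cases "x \<in> {0..2*pi}") auto
          moreover have "x \<noteq> 2*pi" using elim N' by auto
          ultimately have "Arg2pi (cis x) = x" by (intro Arg2pi_unique[of 1]) (auto simp: cis_conv_exp)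
          thus "Arg2pi (cis x) \<notin> N'" using elim by simp
        qed
      qed
    qed simp
  next
    have "Arg2pi -` (- N') \<inter> space (restrict_space borel (sphere 0 1)) \<in> sets (restrict_space borel (sphere 0 1))"
      by measurable
    thus "{w \<in> space (restrict_space borel (sphere 0 1)). Arg2pi w \<notin> N'} \<in> sets (restrict_space borel (sphere 0 1))"
      by (simp add: vimage_def Int_def conj_commute)
  qed auto
  moreover have "AE w in arc_measure. w \<in> space arc_measure" by (rule AE_space)
  ultimately show ?thesis
  proof eventually_elim
    case (elim w)
    define t where "t = Arg2pi w"
    have "w = cis t" using elim complex_norm_eq_1_exp[of w] by (simp add: t_def cis_conv_exp)
    moreover have "t \<in> {0<..<2*pi} - N"
    proof -
      have "t \<noteq> 0" "t \<notin> N" using elim N' unfolding t_def by auto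
      thus ?thesis using Arg2pi[of w] unfolding t_def by auto
    qed
    ultimately show ?case using P by metis
  qed
qed

section \<open>Power series on the circle\<close>

lemma arc_moment:
  assumes "k \<ge> 1"
  shows "(\<integral>w. w ^ k \<partial>arc_measure) = (0::complex)"
proof -
  have "(\<integral>w. w ^ k \<partial>arc_measure) = (LINT t:{0..2*pi}|lborel. cis t ^ k) /\<^sub>R (2*pi)"
    by (rule integral_arc) (auto intro!: borel_measurable_arc_continuous continuous_intros)
  also have "(LINT t:{0..2*pi}|lborel. cis t ^ k) = cis (real k * (2*pi)) / (\<i> * k) - cis (real k * 0) / (\<i> * k)"
  proof -
    have D: "((\<lambda>t. cis (real k * t) / (\<i> * k)) has_vector_derivative cis (real k * x)) (at x within {0..2*pi})" for x
    proof -
      have "((\<lambda>z. exp (\<i> * of_nat k * z) / (\<i> * of_nat k)) has_field_derivative exp (\<i> * of_nat k * of_real x)) (at (of_real x))"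
        using assms by (auto intro!: derivative_eq_intros)
      from has_vector_derivative_real_field[OF this, of "{0..2*pi}"] show ?thesis
        by (simp add: cis_conv_exp mult.assoc)
    qed
    show ?thesis unfolding set_lebesgue_integral_def Complex.DeMoivre
      by (rule integral_FTC_atLeastAtMost[OF _ D]) (auto intro!: continuous_intros)
  qed
  also have "cis (k * (2*pi)) = 1"
    using cis_multiple_2pi[of "real k"] by (simp add: mult_ac)
  finally show ?thesis by simp
qed

lemma arc_moment_cnj:
  "(\<integral>x. x ^ n * cnj (x ^ m) \<partial>arc_measure) = (if n = m then 1 else 0 :: complex)"
proof -
  have 1: "(\<integral>x. x ^ n * cnj (x ^ m) \<partial>arc_measure) = (if n = m then 1 else 0 :: complex)" if "m \<le> n" for n m
  proof -
    have "(\<integral>x. x ^ n * cnj (x ^ m) \<partial>arc_measure) = (\<integral>x. x ^ (n - m) \<partial>arc_measure)"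
    proof (intro Bochner_Integration.integral_cong refl)
      fix x assume "x \<in> space arc_measure"
      hence "x * cnj x = 1" by (simp add: complex_norm_square[symmetric])
      hence "x ^ m * cnj x ^ m = 1" by (simp flip: power_mult_distrib)
      moreover have "x ^ n = x ^ (n - m) * x ^ m" using that by (simp flip: power_add)
      ultimately show "x ^ n * cnj (x ^ m) = x ^ (n - m)" by simp
    qed
    thus ?thesis using arc_moment[of "n - m"] that arc.prob_space by auto
  qed
  show ?thesis
  proof (cases "m \<le> n")
    case True thus ?thesis using 1 by auto
  next
    case False
    have "(\<integral>x. x ^ n * cnj (x ^ m) \<partial>arc_measure) = cnj (\<integral>x. x ^ m * cnj (x ^ n) \<partial>arc_measure)"
      by (simp only: Bochner_Integration.integral_cnj[symmetric]) (simp add: mult.commute)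
    thus ?thesis using 1[of n m] False by auto
  qed
qed

lemma arc_integral_series:
  fixes c :: "nat \<Rightarrow> complex"
  assumes c: "summable (\<lambda>n. norm (c n))" and [measurable]: "\<And>n. g n \<in> borel_measurable arc_measure"
    and g: "\<And>n x. x \<in> sphere 0 1 \<Longrightarrow> norm (g n x) \<le> B"
  shows "integrable arc_measure (\<lambda>x. \<Sum>n. c n * g n x)"
    and "(\<integral>x. (\<Sum>n. c n * g n x) \<partial>arc_measure) = (\<Sum>n. c n * (\<integral>x. g n x \<partial>arc_measure))"
proof -
  have int: "integrable arc_measure (g n)" for n
    by (rule arc.integrable_const_bound[of _ B]) (auto intro!: AE_I2 g)
  have le: "norm (c n * g n x) \<le> norm (c n) * B" if "x \<in> sphere 0 1" for n x
    using g[OF that, of n] by (simp add: norm_mult mult_left_mono)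
  have AE: "AE x in arc_measure. summable (\<lambda>n. norm (c n * g n x))"
  proof (rule AE_I2)
    fix x assume "x \<in> space arc_measure"
    thus "summable (\<lambda>n. norm (c n * g n x))"
      using le by (intro summable_comparison_test'[OF summable_mult2[OF c, of B]]) auto
  qed
  have sm: "summable (\<lambda>n. \<integral>x. norm (c n * g n x) \<partial>arc_measure)"
  proof (rule summable_comparison_test'[OF summable_mult2[OF c, of B]])
    fix n
    have "(\<integral>x. norm (c n * g n x) \<partial>arc_measure) \<le> (\<integral>x. norm (c n) * B \<partial>arc_measure)"
      using le int by (intro integral_mono) auto
    thus "norm (\<integral>x. norm (c n * g n x) \<partial>arc_measure) \<le> norm (c n) * B"
      using arc.prob_space by simp
  qed
  show "integrable arc_measure (\<lambda>x. \<Sum>n. c n * g n x)"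
    using int by (intro integrable_suminf AE sm) auto
  show "(\<integral>x. (\<Sum>n. c n * g n x) \<partial>arc_measure) = (\<Sum>n. c n * (\<integral>x. g n x \<partial>arc_measure))"
    using int by (subst integral_suminf[OF _ AE sm]) auto
qed

lemma summable_norm_mult_power:
  fixes a :: "nat \<Rightarrow> complex"
  assumes "summable (\<lambda>n. norm (a n))" "norm z \<le> 1"
  shows "summable (\<lambda>n. norm (a n * z ^ n))"
  using assms
  by (intro summable_comparison_test'[OF assms(1)]) (auto simp: norm_mult norm_power power_le_one mult_left_le)

lemma continuous_on_power_series_circle:
  fixes a :: "nat \<Rightarrow> complex"
  assumes "summable (\<lambda>n. norm (a n))"
  shows "continuous_on (cball 0 1) (\<lambda>z. \<Sum>n. a n * z ^ n)"
proof (rule uniform_limit_theorem[where F=sequentially])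
  show "uniform_limit (cball 0 1) (\<lambda>n z. \<Sum>k<n. a k * z ^ k) (\<lambda>z. \<Sum>n. a n * z ^ n) sequentially"
    using assms by (intro Weierstrass_m_test) (auto simp: norm_mult norm_power power_le_one mult_left_le)
qed (auto intro!: always_eventually continuous_intros)

text \<open>Two dominated interchanges of sum and integral; the Parseval formula and the mean value of
  a product are its cases \<open>h n = cnj (x ^ n)\<close> and \<open>h n = x ^ n\<close>.\<close>

lemma arc_integral_double_series:
  fixes a b :: "nat \<Rightarrow> complex"
  assumes a: "summable (\<lambda>n. norm (a n))" and b: "summable (\<lambda>n. norm (b n))"
    and g: "\<And>n. continuous_on (sphere 0 1) (g n)" "\<And>n x. x \<in> sphere 0 1 \<Longrightarrow> norm (g n x) \<le> 1"
    and h: "\<And>n. continuous_on (sphere 0 1) (h n)" "\<And>n x. x \<in> sphere 0 1 \<Longrightarrow> norm (h n x) \<le> 1"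
  shows "(\<integral>x. (\<Sum>n. a n * g n x) * (\<Sum>n. b n * h n x) \<partial>arc_measure)
       = (\<Sum>n. a n * (\<Sum>m. b m * (\<integral>x. g n x * h m x \<partial>arc_measure)))"
proof -
  have [measurable]: "g n \<in> borel_measurable arc_measure" "h n \<in> borel_measurable arc_measure" for n
    using g(1) h(1) by (auto intro: borel_measurable_arc_continuous)
  define V where "V x = (\<Sum>n. b n * h n x)" for x
  have sum: "summable (\<lambda>n. norm (c n * k n x))"
    if "summable (\<lambda>n. norm (c n))" "\<And>n x. x \<in> sphere 0 1 \<Longrightarrow> norm (k n x) \<le> 1" "x \<in> sphere 0 1"
    for c :: "nat \<Rightarrow> complex" and k and x :: complex
    using that by (intro summable_comparison_test'[OF that(1)]) (auto simp: norm_mult mult_left_le)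
  have Vm [measurable]: "V \<in> borel_measurable arc_measure"
    unfolding V_def using arc_integral_series(1)[OF b _ h(2)] by auto
  have Vb: "norm (V x) \<le> (\<Sum>n. norm (b n))" if z: "x \<in> sphere 0 1" for x
  proof -
    have "norm (V x) \<le> (\<Sum>n. norm (b n * h n x))"
      unfolding V_def by (intro summable_norm sum[OF b h(2) z])
    also have "\<dots> \<le> (\<Sum>n. norm (b n))"
      using h(2)[OF z] by (intro suminf_le sum[OF b h(2) z] b) (auto simp: norm_mult mult_left_le)
    finally show ?thesis .
  qed
  have inner: "(\<integral>x. g n x * V x \<partial>arc_measure) = (\<Sum>m. b m * (\<integral>x. g n x * h m x \<partial>arc_measure))" for n
  proof -
    have "(\<integral>x. g n x * V x \<partial>arc_measure) = (\<integral>x. (\<Sum>m. b m * (g n x * h m x)) \<partial>arc_measure)"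
    proof (intro Bochner_Integration.integral_cong refl)
      fix x assume "x \<in> space arc_measure"
      hence "summable (\<lambda>m. b m * h m x)"
        using summable_norm_cancel[OF sum[where x=x, OF b h(2)]] by auto
      from suminf_mult[OF this, of "g n x"]
      show "g n x * V x = (\<Sum>m. b m * (g n x * h m x))"
        by (simp add: V_def algebra_simps)
    qed
    also have "\<dots> = (\<Sum>m. b m * (\<integral>x. g n x * h m x \<partial>arc_measure))"
      by (rule arc_integral_series(2)[OF b, where B=1])
         (use g(2) h(2) in \<open>auto simp: norm_mult mult_le_one\<close>)
    finally show ?thesis .
  qed
  have "(\<integral>x. (\<Sum>n. a n * g n x) * V x \<partial>arc_measure) = (\<integral>x. (\<Sum>n. a n * (g n x * V x)) \<partial>arc_measure)"
  proof (intro Bochner_Integration.integral_cong refl)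
    fix x assume "x \<in> space arc_measure"
    hence "summable (\<lambda>m. a m * g m x)"
      using summable_norm_cancel[OF sum[where x=x, OF a g(2)]] by auto
    from suminf_mult2[OF this, of "V x"]
    show "(\<Sum>n. a n * g n x) * V x = (\<Sum>n. a n * (g n x * V x))"
      by (simp add: mult.assoc)
  qed
  also have "\<dots> = (\<Sum>n. a n * (\<integral>x. g n x * V x \<partial>arc_measure))"
  proof (rule arc_integral_series(2)[OF a, where B="\<Sum>n. norm (b n)"])
    fix n x assume z: "x \<in> sphere (0::complex) 1"
    have "norm (g n x * V x) \<le> 1 * (\<Sum>n. norm (b n))"
      unfolding norm_mult by (intro mult_mono g(2) Vb z) auto
    thus "norm (g n x * V x) \<le> (\<Sum>n. norm (b n))" by simp
  qed auto
  finally show ?thesis by (simp only: inner) (simp only: V_def)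
qed

lemma suminf_single:
  "(\<Sum>n. if n = k then f n else (0::complex)) = f k"
  using suminf_finite[of "{k}" "\<lambda>n. if n = k then f n else 0"] by simp

lemma arc_parseval_abs:
  fixes a b :: "nat \<Rightarrow> complex"
  assumes a: "summable (\<lambda>n. norm (a n))" and b: "summable (\<lambda>n. norm (b n))"
  shows "(\<integral>x. (\<Sum>n. a n * x ^ n) * cnj (\<Sum>n. b n * x ^ n) \<partial>arc_measure) = (\<Sum>n. a n * cnj (b n))"
proof -
  have "(\<integral>x. (\<Sum>n. a n * x ^ n) * cnj (\<Sum>n. b n * x ^ n) \<partial>arc_measure)
      = (\<integral>x. (\<Sum>n. a n * x ^ n) * (\<Sum>n. cnj (b n) * cnj (x ^ n)) \<partial>arc_measure)"
  proof (intro Bochner_Integration.integral_cong refl)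
    fix x assume "x \<in> space arc_measure"
    hence "summable (\<lambda>m. b m * x ^ m)"
      using summable_norm_cancel[OF summable_norm_mult_power[OF b, of x]] by auto
    hence "(\<lambda>m. cnj (b m * x ^ m)) sums cnj (\<Sum>m. b m * x ^ m)"
      unfolding sums_cnj by (rule summable_sums)
    hence "cnj (\<Sum>n. b n * x ^ n) = (\<Sum>n. cnj (b n) * cnj (x ^ n))"
      by (simp only: complex_cnj_mult sums_unique)
    thus "(\<Sum>n. a n * x ^ n) * cnj (\<Sum>n. b n * x ^ n) = (\<Sum>n. a n * x ^ n) * (\<Sum>n. cnj (b n) * cnj (x ^ n))"
      by (simp only:)
  qed
  also have "\<dots> = (\<Sum>n. a n * (\<Sum>m. cnj (b m) * (\<integral>x. x ^ n * cnj (x ^ m) \<partial>arc_measure)))"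
    by (rule arc_integral_double_series[OF a])
       (use b in \<open>auto intro!: continuous_intros simp: norm_power complex_mod_cnj simp del: complex_cnj_power\<close>)
  also have "\<dots> = (\<Sum>n. a n * (\<Sum>m. if m = n then cnj (b m) else 0))"
    by (intro suminf_cong arg_cong2[of _ _ _ _ "(*)"] refl) (simp only: arc_moment_cnj, simp)
  finally show ?thesis by (simp only: suminf_single)
qed

lemma arc_product_abs:
  fixes a b :: "nat \<Rightarrow> complex"
  assumes a: "summable (\<lambda>n. norm (a n))" and b: "summable (\<lambda>n. norm (b n))"
  shows "(\<integral>x. (\<Sum>n. a n * x ^ n) * (\<Sum>n. b n * x ^ n) \<partial>arc_measure) = a 0 * b 0"
proof -
  have "(\<integral>x. (\<Sum>n. a n * x ^ n) * (\<Sum>n. b n * x ^ n) \<partial>arc_measure)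
      = (\<Sum>n. a n * (\<Sum>m. b m * (\<integral>x. x ^ n * x ^ m \<partial>arc_measure)))"
    by (rule arc_integral_double_series[OF a b])
       (auto intro!: continuous_intros simp: norm_power)
  also have "(\<lambda>n m. (\<integral>x. x ^ n * x ^ m \<partial>arc_measure)) = (\<lambda>n m. if n = 0 \<and> m = 0 then 1 else (0::complex))"
  proof (intro ext)
    fix n m show "(\<integral>x. x ^ n * x ^ m \<partial>arc_measure) = (if n = 0 \<and> m = 0 then 1 else (0::complex))"
      using arc_moment[of "n + m"] arc.prob_space unfolding power_add by (cases "n + m = 0") auto
  qed
  also have "(\<Sum>n. a n * (\<Sum>m. b m * (if n = 0 \<and> m = 0 then 1 else 0))) = (\<Sum>n. if n = 0 then a n * b 0 else 0)"
  proof (intro suminf_cong)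
    fix n show "a n * (\<Sum>m. b m * (if n = 0 \<and> m = 0 then 1 else 0)) = (if n = 0 then a n * b 0 else 0)"
      using suminf_single[of 0 b] by (cases "n = 0") (auto simp: if_distrib cong: if_cong)
  qed
  also have "\<dots> = a 0 * b 0" by (rule suminf_single)
  finally show ?thesis .
qed

lemma summable_norm_finite_support:
  "finite A \<Longrightarrow> (\<And>n. n \<notin> A \<Longrightarrow> a n = 0) \<Longrightarrow> summable (\<lambda>n. norm (a n :: complex))"
  by (rule summable_finite) auto

lemma arc_coeff_abs:
  fixes a :: "nat \<Rightarrow> complex"
  assumes a: "summable (\<lambda>n. norm (a n))"
  shows "(\<integral>x. (\<Sum>n. a n * x ^ n) * cnj (x ^ k) \<partial>arc_measure) = a k"
proof -
  define b where "b n = (if n = k then 1 else 0 :: complex)" for n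
  have b: "summable (\<lambda>n. norm (b n))"
    by (rule summable_norm_finite_support[of "{k}"]) (auto simp: b_def)
  have "(\<lambda>n. b n * x ^ n) = (\<lambda>n. if n = k then x ^ n else 0)" for x
    by (auto simp: b_def)
  hence 1: "(\<Sum>n. b n * x ^ n) = x ^ k" for x
    using suminf_single[of k "\<lambda>n. x ^ n"] by simp
  have "(\<lambda>n. a n * cnj (b n)) = (\<lambda>n. if n = k then a n else 0)"
    by (auto simp: b_def)
  hence 2: "(\<Sum>n. a n * cnj (b n)) = a k"
    using suminf_single[of k a] by simp
  show ?thesis using arc_parseval_abs[OF a b] by (simp only: 1 2)
qed

section \<open>The Poisson kernel\<close>

definition pois :: "complex \<Rightarrow> complex \<Rightarrow> real" where
  "pois z x = (1 - (norm z)\<^sup>2) / (norm (x - z))\<^sup>2"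

lemma poisson_integral_pois: "poisson_integral \<mu> z = (\<integral>x. pois z x \<partial>\<mu>)"
  by (simp add: poisson_integral_def pois_def)

lemma pois_nonneg: "norm z < 1 \<Longrightarrow> 0 \<le> pois z x"
  by (auto simp: pois_def power_le_one)

lemma pois_upper: "norm z \<le> r \<Longrightarrow> r < 1 \<Longrightarrow> norm x = 1 \<Longrightarrow> pois z x \<le> 2 / (1 - r)"
proof -
  assume *: "norm z \<le> r" "r < 1" "norm x = 1"
  have d: "norm (x - z) \<ge> 1 - norm z" using norm_triangle_ineq2[of x z] * by auto
  have "pois z x \<le> (1 - (norm z)\<^sup>2) / (1 - norm z)\<^sup>2"
  proof -
    have "0 < norm (x - z)" "0 < 1 - norm z" using d * by linarith+
    thus ?thesis unfolding pois_def
      using * d by (intro divide_left_mono power_mono mult_pos_pos zero_less_power) (auto simp: power_le_one)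
  qed
  also have "\<dots> = (1 + norm z) / (1 - norm z)"
  proof -
    have "1 - (norm z)\<^sup>2 = (1 + norm z) * (1 - norm z)" by (simp add: power2_eq_square algebra_simps)
    thus ?thesis using * by (simp add: power2_eq_square)
  qed
  also have "\<dots> \<le> 2 / (1 - r)" using * by (intro frac_le) auto
  finally show ?thesis .
qed

text \<open>The kernel is a sum of geometric series in \<open>cnj z * x\<close> and its conjugate; in this form it
  acts on power series by Parseval.\<close>

lemma pois_alt:
  assumes "norm z < 1" "norm x = 1"
  shows "complex_of_real (pois z x) = cnj (1 / (1 - cnj z * x)) + (1 / (1 - cnj z * x) - 1)"
proof -
  define w where "w = cnj z * x"
  have w1: "norm w < 1" using assms by (simp add: w_def norm_mult)
  hence nz: "1 - w \<noteq> 0" "1 - cnj w \<noteq> 0"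
    by (metis eq_iff_diff_eq_0 less_irrefl norm_one complex_mod_cnj)+
  have "norm (x - z) = norm (1 - w)"
  proof -
    have "x - z = x * cnj (1 - w)"
    proof -
      have "x * cnj x = 1" using assms by (simp add: complex_norm_square[symmetric])
      hence "x * (z * cnj x) = z" by (metis mult.commute mult.left_commute mult_1_right)
      thus ?thesis by (simp add: w_def algebra_simps)
    qed
    thus ?thesis using assms by (simp add: norm_mult del: complex_cnj_diff)
  qed
  moreover have "norm z = norm w" using assms by (simp add: w_def norm_mult)
  ultimately have "complex_of_real (pois z x) = (1 - w * cnj w) / ((1 - w) * (1 - cnj w))"
    unfolding pois_def of_real_divide of_real_diff of_real_1
    by (simp only: complex_norm_square complex_cnj_diff complex_cnj_one)
  also have "\<dots> = 1 / (1 - cnj w) + (1 / (1 - w) - 1)"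
    using nz by (simp add: field_simps)
  finally show ?thesis by (simp add: w_def)
qed

text \<open>Rotation invariance: both sides depend only on \<open>r\<close> and on the angle between the two points.
  Fubini arguments use it to pass from a Poisson mean of a function to the Poisson integral of a
  measure.\<close>

lemma pois_swap:
  assumes "norm x = 1" "norm y = 1"
  shows "pois (of_real r * x) y = pois (of_real r * y) x"
proof -
  have "norm (y - of_real r * x) = norm (x - of_real r * y)"
  proof -
    have "(Re x)\<^sup>2 + (Im x)\<^sup>2 = 1" "(Re y)\<^sup>2 + (Im y)\<^sup>2 = 1"
      using assms by (metis cmod_power2 one_power2)+
    hence "(Re y - r * Re x)\<^sup>2 + (Im y - r * Im x)\<^sup>2 = (Re x - r * Re y)\<^sup>2 + (Im x - r * Im y)\<^sup>2"
      by algebra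
    hence "(norm (y - of_real r * x))\<^sup>2 = (norm (x - of_real r * y))\<^sup>2"
      by (simp add: cmod_power2)
    thus ?thesis by simp
  qed
  thus ?thesis using assms by (simp add: pois_def norm_mult)
qed

lemma continuous_on_pois: "norm z < 1 \<Longrightarrow> continuous_on (sphere 0 1) (pois z)"
  unfolding pois_def by (intro continuous_intros) auto

lemma continuous_on_pois_left: "norm x = 1 \<Longrightarrow> continuous_on (ball 0 1) (\<lambda>z. pois z x)"
  unfolding pois_def by (intro continuous_intros) auto

text \<open>The conjugate geometric series in the kernel reproduces the value at \<open>z\<close>, and the
  holomorphic one contributes only a constant term that cancels.\<close>

lemma poisson_power_series:
  fixes a :: "nat \<Rightarrow> complex"
  assumes a: "summable (\<lambda>n. norm (a n))" and z: "norm z < 1"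
  shows "(\<integral>x. (\<Sum>n. a n * x ^ n) * of_real (pois z x) \<partial>arc_measure) = (\<Sum>n. a n * z ^ n)"
proof -
  define b where "b n = cnj z ^ n" for n
  define b' where "b' n = (if n = 0 then 0 else b n)" for n
  have b: "summable (\<lambda>n. norm (b n))"
    using z by (simp add: b_def norm_power)
  have b's: "summable (\<lambda>n. norm (b' n))"
    by (rule summable_comparison_test'[OF b]) (auto simp: b'_def)
  have k: "(\<Sum>n. b n * x ^ n) = 1 / (1 - cnj z * x)" "(\<Sum>n. b' n * x ^ n) = 1 / (1 - cnj z * x) - 1"
    if "norm x = 1" for x
  proof -
    have 1: "(\<lambda>n. b n * x ^ n) sums (1 / (1 - cnj z * x))"
      using geometric_sums[of "cnj z * x"] z that by (simp add: b_def power_mult_distrib norm_mult)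
    thus "(\<Sum>n. b n * x ^ n) = 1 / (1 - cnj z * x)" by (simp add: sums_iff)
    have "(\<lambda>n. b n * x ^ n - (if n = 0 then 1 else 0)) sums (1 / (1 - cnj z * x) - 1)"
      by (intro sums_diff 1 sums_single)
    moreover have "(\<lambda>n. b n * x ^ n - (if n = 0 then 1 else 0)) = (\<lambda>n. b' n * x ^ n)"
      by (auto simp: b'_def b_def)
    ultimately show "(\<Sum>n. b' n * x ^ n) = 1 / (1 - cnj z * x) - 1" by (simp add: sums_iff)
  qed
  have Ac: "continuous_on (sphere 0 1) (\<lambda>x. \<Sum>n. c n * x ^ n)" if "summable (\<lambda>n. norm (c n))" for c :: "nat \<Rightarrow> complex"
    by (rule continuous_on_subset[OF continuous_on_power_series_circle[OF that]]) auto
  have "(\<integral>x. (\<Sum>n. a n * x ^ n) * of_real (pois z x) \<partial>arc_measure)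
      = (\<integral>x. (\<Sum>n. a n * x ^ n) * cnj (\<Sum>n. b n * x ^ n) + (\<Sum>n. a n * x ^ n) * (\<Sum>n. b' n * x ^ n) \<partial>arc_measure)"
    by (intro Bochner_Integration.integral_cong refl)
       (use z in \<open>simp_all only: k pois_alt space_arc mem_sphere_0 ring_distribs\<close>)
  also have "\<dots> = (\<integral>x. (\<Sum>n. a n * x ^ n) * cnj (\<Sum>n. b n * x ^ n) \<partial>arc_measure)
      + (\<integral>x. (\<Sum>n. a n * x ^ n) * (\<Sum>n. b' n * x ^ n) \<partial>arc_measure)"
    by (intro Bochner_Integration.integral_add integrable_arc_continuous continuous_intros Ac a b b's)
  also have "\<dots> = (\<Sum>n. a n * z ^ n)"
    by (simp only: arc_parseval_abs[OF a b] arc_product_abs[OF a b's]) (simp add: b_def b'_def)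
  finally show ?thesis .
qed

lemma integral_pois: "norm z < 1 \<Longrightarrow> (\<integral>x. pois z x \<partial>arc_measure) = 1"
proof -
  assume z: "norm z < 1"
  define a where "a n = (if n = 0 then 1 else 0 :: complex)" for n :: nat
  have a: "summable (\<lambda>n. norm (a n))"
    by (rule summable_norm_finite_support[of "{0}"]) (auto simp: a_def)
  have "(\<lambda>n. a n * w ^ n) = (\<lambda>n. if n = 0 then w ^ n else 0)" for w
    by (auto simp: a_def)
  hence "(\<Sum>n. a n * w ^ n) = 1" for w
    using suminf_single[of 0 "\<lambda>n. w ^ n"] by simp
  with poisson_power_series[OF a z]
  have "complex_of_real (\<integral>x. pois z x \<partial>arc_measure) = 1" by simp
  thus ?thesis using of_real_eq_1_iff by blast
qed

section \<open>Square-integrable functions\<close>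

definition sq_int :: "'a measure \<Rightarrow> ('a \<Rightarrow> complex) \<Rightarrow> bool" where
  "sq_int M u \<longleftrightarrow> u \<in> borel_measurable M \<and> integrable M (\<lambda>x. (norm (u x))\<^sup>2)"

definition L2norm :: "'a measure \<Rightarrow> ('a \<Rightarrow> complex) \<Rightarrow> real" where
  "L2norm M u = sqrt (\<integral>x. (norm (u x))\<^sup>2 \<partial>M)"

lemma L2norm_nonneg [simp]: "0 \<le> L2norm M u"
  by (simp add: L2norm_def)

lemma L2norm_sq: "(L2norm M u)\<^sup>2 = (\<integral>x. (norm (u x))\<^sup>2 \<partial>M)"
  by (simp add: L2norm_def)

lemma sq_int_measurable [measurable_dest]: "sq_int M u \<Longrightarrow> u \<in> borel_measurable M"
  by (simp add: sq_int_def)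

lemma sq_int_mult_integrable:
  assumes "sq_int M u" "sq_int M v"
  shows "integrable M (\<lambda>x. u x * v x)"
proof (rule Bochner_Integration.integrable_bound)
  show "integrable M (\<lambda>x. (norm (u x))\<^sup>2 + (norm (v x))\<^sup>2)"
    using assms by (simp add: sq_int_def)
  show "(\<lambda>x. u x * v x) \<in> borel_measurable M"
    using assms by (auto simp: sq_int_def)
  have "norm (u x) * norm (v x) \<le> (norm (u x))\<^sup>2 + (norm (v x))\<^sup>2" for x
    using sum_squares_bound[of "norm (u x)" "norm (v x)"] mult_nonneg_nonneg[OF norm_ge_zero norm_ge_zero, of "u x" "v x"]
    by linarith
  thus "AE x in M. norm (u x * v x) \<le> norm ((norm (u x))\<^sup>2 + (norm (v x))\<^sup>2)"
    by (intro AE_I2) (simp add: norm_mult)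
qed

lemma borel_measurable_cnj [measurable (raw)]:
  "f \<in> borel_measurable M \<Longrightarrow> (\<lambda>x. cnj (f x)) \<in> borel_measurable M"
  by (rule measurable_compose[where g=cnj and N=borel]) (auto intro!: borel_measurable_continuous_onI continuous_intros)

lemma sq_int_cnj: "sq_int M u \<Longrightarrow> sq_int M (\<lambda>x. cnj (u x))"
  by (auto simp: sq_int_def)

lemma sq_int_cmult: "sq_int M u \<Longrightarrow> sq_int M (\<lambda>x. c * u x)"
  by (auto simp: sq_int_def norm_mult power_mult_distrib)

lemma sq_int_dominated:
  assumes "sq_int M u" "v \<in> borel_measurable M" "AE x in M. norm (v x) \<le> B * norm (u x)"
  shows "sq_int M v"
  unfolding sq_int_def
proof
  show "integrable M (\<lambda>x. (norm (v x))\<^sup>2)"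
  proof (rule Bochner_Integration.integrable_bound)
    show "integrable M (\<lambda>x. B\<^sup>2 * (norm (u x))\<^sup>2)" using assms by (auto simp: sq_int_def)
    show "AE x in M. norm ((norm (v x))\<^sup>2) \<le> norm (B\<^sup>2 * (norm (u x))\<^sup>2)"
      using assms(3)
    proof eventually_elim
      case (elim x)
      have "(norm (v x))\<^sup>2 \<le> (B * norm (u x))\<^sup>2" using elim by (intro power_mono) auto
      thus ?case by (simp add: power_mult_distrib)
    qed
  qed (use assms in auto)
qed (use assms in auto)

lemma sq_int_add:
  assumes "sq_int M u" "sq_int M v"
  shows "sq_int M (\<lambda>x. u x + v x)"
  unfolding sq_int_def
proof
  have [measurable]: "u \<in> borel_measurable M" "v \<in> borel_measurable M" using assms by auto
  show "(\<lambda>x. u x + v x) \<in> borel_measurable M" by measurable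
  show "integrable M (\<lambda>x. (norm (u x + v x))\<^sup>2)"
  proof (rule Bochner_Integration.integrable_bound)
    show "integrable M (\<lambda>x. 2 * ((norm (u x))\<^sup>2 + (norm (v x))\<^sup>2))"
      using assms by (simp add: sq_int_def)
    have "(norm (u x + v x))\<^sup>2 \<le> 2 * ((norm (u x))\<^sup>2 + (norm (v x))\<^sup>2)" for x
    proof -
      have "(norm (u x + v x))\<^sup>2 \<le> (norm (u x) + norm (v x))\<^sup>2"
        by (intro power_mono norm_triangle_ineq) auto
      also have "\<dots> \<le> 2 * ((norm (u x))\<^sup>2 + (norm (v x))\<^sup>2)"
        using sum_squares_bound[of "norm (u x)" "norm (v x)"] by (simp add: power2_eq_square algebra_simps)
      finally show ?thesis .
    qed
    thus "AE x in M. norm ((norm (u x + v x))\<^sup>2) \<le> norm (2 * ((norm (u x))\<^sup>2 + (norm (v x))\<^sup>2))"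
      by (intro AE_I2) simp
  qed measurable
qed

lemma sq_int_diff:
  assumes "sq_int M u" "sq_int M v"
  shows "sq_int M (\<lambda>x. u x - v x)"
  using sq_int_add[OF assms(1) sq_int_cmult[OF assms(2), of "-1"]] by simp

lemma L2_cauchy_schwarz_abs:
  assumes u: "sq_int M u" and v: "sq_int M v"
  shows "(\<integral>x. norm (u x) * norm (v x) \<partial>M) \<le> L2norm M u * L2norm M v"
proof -
  define A B C where "A = (\<integral>x. (norm (u x))\<^sup>2 \<partial>M)" and "B = (\<integral>x. (norm (v x))\<^sup>2 \<partial>M)"
    and "C = (\<integral>x. norm (u x) * norm (v x) \<partial>M)"
  have iu: "integrable M (\<lambda>x. (norm (u x))\<^sup>2)" and iv: "integrable M (\<lambda>x. (norm (v x))\<^sup>2)"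
    using u v by (auto simp: sq_int_def)
  have iuv: "integrable M (\<lambda>x. norm (u x) * norm (v x))"
    using integrable_norm[OF sq_int_mult_integrable[OF u v]] by (simp add: norm_mult)
  have q: "0 \<le> A - 2 * t * C + t\<^sup>2 * B" for t
  proof -
    have "0 \<le> (\<integral>x. (norm (u x) - t * norm (v x))\<^sup>2 \<partial>M)" by simp
    also have "\<dots> = (\<integral>x. (norm (u x))\<^sup>2 - (2 * t) * (norm (u x) * norm (v x)) + t\<^sup>2 * (norm (v x))\<^sup>2 \<partial>M)"
      by (intro Bochner_Integration.integral_cong) (auto simp: power2_eq_square algebra_simps)
    also have "\<dots> = A - (2 * t) * C + t\<^sup>2 * B"
      using iu iv iuv by (simp add: A_def B_def C_def)
    finally show ?thesis by simp
  qed
  have nn: "0 \<le> A" "0 \<le> B" "0 \<le> C" by (auto simp: A_def B_def C_def)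
  have "C\<^sup>2 \<le> A * B"
  proof (cases "B = 0")
    case True
    have "C = 0"
    proof (rule ccontr)
      assume "C \<noteq> 0"
      hence "2 * ((A + 1) / (2 * C)) * C = A + 1" using nn by simp
      thus False using q[of "(A + 1) / (2 * C)"] True by simp
    qed
    thus ?thesis using nn by simp
  next
    case False
    have "t\<^sup>2 * B = t * C" if "t = C / B" for t using that False by (simp add: power2_eq_square)
    hence "0 \<le> A - C\<^sup>2 / B" using q[of "C / B"] False by (simp add: power2_eq_square)
    thus ?thesis using False nn by (simp add: field_simps)
  qed
  hence "sqrt (C\<^sup>2) \<le> sqrt (A * B)" by (rule real_sqrt_le_mono)
  thus ?thesis using nn by (simp add: real_sqrt_mult L2norm_def A_def B_def C_def)
qed

lemma L2_cauchy_schwarz: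
  assumes u: "sq_int M u" and v: "sq_int M v"
  shows "norm (\<integral>x. u x * v x \<partial>M) \<le> L2norm M u * L2norm M v"
proof -
  have "norm (\<integral>x. u x * v x \<partial>M) \<le> (\<integral>x. norm (u x * v x) \<partial>M)" by simp
  also have "\<dots> \<le> L2norm M u * L2norm M v"
    using L2_cauchy_schwarz_abs[OF u v] by (simp add: norm_mult)
  finally show ?thesis .
qed

lemma L2norm_triangle:
  assumes u: "sq_int M u" and v: "sq_int M v"
  shows "L2norm M (\<lambda>x. u x + v x) \<le> L2norm M u + L2norm M v"
proof (rule power2_le_imp_le)
  have iu: "integrable M (\<lambda>x. (norm (u x))\<^sup>2)" and iv: "integrable M (\<lambda>x. (norm (v x))\<^sup>2)"
    using u v by (auto simp: sq_int_def)
  have iuv: "integrable M (\<lambda>x. norm (u x) * norm (v x))"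
    using integrable_norm[OF sq_int_mult_integrable[OF u v]] by (simp add: norm_mult)
  have "(L2norm M (\<lambda>x. u x + v x))\<^sup>2 \<le> (\<integral>x. (norm (u x))\<^sup>2 + 2 * (norm (u x) * norm (v x)) + (norm (v x))\<^sup>2 \<partial>M)"
    unfolding L2norm_sq
  proof (intro integral_mono)
    show "integrable M (\<lambda>x. (norm (u x + v x))\<^sup>2)"
      using sq_int_add[OF u v] by (simp add: sq_int_def)
    fix x
    have "(norm (u x + v x))\<^sup>2 \<le> (norm (u x) + norm (v x))\<^sup>2"
      by (intro power_mono norm_triangle_ineq) auto
    thus "(norm (u x + v x))\<^sup>2 \<le> (norm (u x))\<^sup>2 + 2 * (norm (u x) * norm (v x)) + (norm (v x))\<^sup>2"
      by (simp add: power2_eq_square algebra_simps)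
  qed (use iu iv iuv in auto)
  also have "\<dots> = (L2norm M u)\<^sup>2 + 2 * (\<integral>x. norm (u x) * norm (v x) \<partial>M) + (L2norm M v)\<^sup>2"
    using iu iv iuv by (simp add: L2norm_sq)
  also have "\<dots> \<le> (L2norm M u)\<^sup>2 + 2 * (L2norm M u * L2norm M v) + (L2norm M v)\<^sup>2"
    using L2_cauchy_schwarz_abs[OF u v] by simp
  finally show "(L2norm M (\<lambda>x. u x + v x))\<^sup>2 \<le> (L2norm M u + L2norm M v)\<^sup>2"
    by (simp add: power2_eq_square algebra_simps)
qed auto

lemma L2norm_cmult: "L2norm M (\<lambda>x. c * u x) = norm c * L2norm M u"
  by (simp add: L2norm_def norm_mult power_mult_distrib real_sqrt_mult)

lemma L2norm_cong_AE:
  assumes "u \<in> borel_measurable M" "v \<in> borel_measurable M" "AE x in M. u x = v x"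
  shows "L2norm M u = L2norm M v"
  unfolding L2norm_def
  using assms by (intro arg_cong[of _ _ sqrt] integral_cong_AE) auto

lemma sq_int_cong_AE:
  assumes "sq_int M u" "v \<in> borel_measurable M" "AE x in M. u x = v x"
  shows "sq_int M v"
  by (rule sq_int_dominated[OF assms(1,2), of 1]) (use assms(3) in auto)

lemma sq_int_bounded_arc:
  assumes "u \<in> borel_measurable arc_measure" "AE x in arc_measure. norm (u x) \<le> B"
  shows "sq_int arc_measure u"
  by (rule sq_int_dominated[of arc_measure "\<lambda>_. 1" _ B]) (use assms in \<open>auto simp: sq_int_def\<close>)

lemma sq_int_continuous_arc:
  assumes "continuous_on (sphere 0 1) u"
  shows "sq_int arc_measure u"
  unfolding sq_int_def
  using assms by (auto intro!: borel_measurable_arc_continuous integrable_arc_continuous continuous_intros)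

lemma sq_int_arc_integrable:
  assumes "sq_int arc_measure u"
  shows "integrable arc_measure u" "(\<integral>x. norm (u x) \<partial>arc_measure) \<le> L2norm arc_measure u"
proof -
  have 1: "sq_int arc_measure (\<lambda>_. 1)" by (simp add: sq_int_def)
  show "integrable arc_measure u" using sq_int_mult_integrable[OF assms 1] by simp
  have "L2norm arc_measure (\<lambda>_. 1) = 1" using arc.prob_space by (simp add: L2norm_def)
  thus "(\<integral>x. norm (u x) \<partial>arc_measure) \<le> L2norm arc_measure u"
    using L2_cauchy_schwarz_abs[OF assms 1] by simp
qed

text \<open>Fatou's lemma for square means. With an eventual bound it applies to the tails of a Cauchy
  sequence.\<close>

lemma sq_int_fatou:
  assumes s: "\<And>k. sq_int M (s k)" and [measurable]: "u \<in> borel_measurable M"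
    and lim: "AE x in M. (\<lambda>k. s k x) \<longlonglongrightarrow> u x"
    and B: "eventually (\<lambda>k. (\<integral>x. (norm (s k x))\<^sup>2 \<partial>M) \<le> B) sequentially"
  shows "sq_int M u" "(\<integral>x. (norm (u x))\<^sup>2 \<partial>M) \<le> B"
proof -
  have [measurable]: "s k \<in> borel_measurable M" for k using s by auto
  have "(\<integral>\<^sup>+x. ennreal ((norm (u x))\<^sup>2) \<partial>M) = (\<integral>\<^sup>+x. liminf (\<lambda>k. ennreal ((norm (s k x))\<^sup>2)) \<partial>M)"
  proof (intro nn_integral_cong_AE, use lim in eventually_elim)
    case (elim x)
    have "(\<lambda>k. ennreal ((norm (s k x))\<^sup>2)) \<longlonglongrightarrow> ennreal ((norm (u x))\<^sup>2)"
      by (intro tendsto_intros elim)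
    from lim_imp_Liminf[OF _ this] show ?case by simp
  qed
  also have "\<dots> \<le> liminf (\<lambda>k. \<integral>\<^sup>+x. ennreal ((norm (s k x))\<^sup>2) \<partial>M)"
    by (intro nn_integral_liminf) auto
  also have "\<dots> \<le> ennreal B"
  proof (rule Liminf_le)
    show "\<forall>\<^sub>F k in sequentially. (\<integral>\<^sup>+x. ennreal ((norm (s k x))\<^sup>2) \<partial>M) \<le> ennreal B"
      using B
    proof eventually_elim
      case (elim k)
      have "(\<integral>\<^sup>+x. ennreal ((norm (s k x))\<^sup>2) \<partial>M) = ennreal (\<integral>x. (norm (s k x))\<^sup>2 \<partial>M)"
        using s[of k] by (intro nn_integral_eq_integral) (auto simp: sq_int_def)
      also have "\<dots> \<le> ennreal B" using elim by (intro ennreal_leI)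
      finally show ?case .
    qed
  qed auto
  finally have le: "(\<integral>\<^sup>+x. ennreal ((norm (u x))\<^sup>2) \<partial>M) \<le> ennreal B" .
  have int: "integrable M (\<lambda>x. (norm (u x))\<^sup>2)"
    by (rule integrableI_bounded) (use le in \<open>auto simp: ennreal_less_top order_le_less_trans[OF _ ennreal_less_top]\<close>)
  thus "sq_int M u" by (simp add: sq_int_def)
  from B obtain k where "(\<integral>x. (norm (s k x))\<^sup>2 \<partial>M) \<le> B" by (auto simp: eventually_sequentially)
  moreover have "0 \<le> (\<integral>x. (norm (s k x))\<^sup>2 \<partial>M)" by simp
  ultimately have "0 \<le> B" by linarith
  have "(\<integral>\<^sup>+x. ennreal ((norm (u x))\<^sup>2) \<partial>M) = ennreal (\<integral>x. (norm (u x))\<^sup>2 \<partial>M)"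
    by (intro nn_integral_eq_integral int) auto
  with le show "(\<integral>x. (norm (u x))\<^sup>2 \<partial>M) \<le> B" using \<open>0 \<le> B\<close> by (simp add: ennreal_le_iff)
qed

text \<open>The rate \<open>\<tau>\<close> of the Cauchy condition passes to the limit. This gives an explicit error for
  the Taylor polynomials of a function in the Hardy space.\<close>

lemma L2_complete_arc:
  assumes s: "\<And>N. sq_int arc_measure (s N)"
    and C: "\<And>M N. M \<le> N \<Longrightarrow> (\<integral>x. (norm (s N x - s M x))\<^sup>2 \<partial>arc_measure) \<le> \<tau> M"
    and \<tau>: "\<tau> \<longlonglongrightarrow> 0"
  obtains u where "sq_int arc_measure u" "\<And>N. (\<integral>x. (norm (u x - s N x))\<^sup>2 \<partial>arc_measure) \<le> \<tau> N"
proof -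
  have [measurable]: "s k \<in> borel_measurable arc_measure" for k using s by auto
  have "\<exists>N0. \<forall>n\<ge>N0. \<tau> n < (1/4)^k" for k
    using order_tendstoD(2)[OF \<tau>, of "(1/4)^k"] by (auto simp: eventually_sequentially)
  then obtain N0 where N0: "\<And>k n. n \<ge> N0 k \<Longrightarrow> \<tau> n < (1/4)^k" by metis
  \<comment> \<open>Along the indices \<open>K k\<close> consecutive differences have norm at most \<open>(1/2)^k\<close>, so their sum converges absolutely almost everywhere.\<close>
  define K where "K k = (\<Sum>j\<le>k. N0 j + 1)" for k
  have K_ge: "K k \<ge> N0 k" "K k \<le> K (Suc k)" for k
    by (cases k; simp add: K_def)+
  have K_mono: "K i \<le> K j" if "i \<le> j" for i j
    using lift_Suc_mono_le[of K] K_ge(2) that by blast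
  have K_id: "k \<le> K k" for k
    by (induction k) (auto simp: K_def)
  define d where "d k x = s (K (Suc k)) x - s (K k) x" for k x
  have d: "sq_int arc_measure (d k)" for k
    unfolding d_def by (intro sq_int_diff s)
  have [measurable]: "d k \<in> borel_measurable arc_measure" for k using d by auto
  have dle: "(\<integral>x. norm (d k x) \<partial>arc_measure) \<le> (1/2)^k" for k
  proof -
    have "(\<integral>x. (norm (d k x))\<^sup>2 \<partial>arc_measure) \<le> (1/4)^k"
      unfolding d_def using C[OF K_ge(2)[of k]] N0[OF K_ge(1)[of k]] by linarith
    hence "L2norm arc_measure (d k) \<le> sqrt ((1/4)^k)" unfolding L2norm_def by (rule real_sqrt_le_mono)
    also have "sqrt ((1/4)^k) = (1/2)^k" by (simp add: real_sqrt_power real_sqrt_divide)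
    finally show ?thesis using sq_int_arc_integrable(2)[OF d, of k] by linarith
  qed
  have "(\<integral>\<^sup>+x. (\<Sum>k. ennreal (norm (d k x))) \<partial>arc_measure) = (\<Sum>k. \<integral>\<^sup>+x. ennreal (norm (d k x)) \<partial>arc_measure)"
    by (rule nn_integral_suminf) auto
  also have "\<dots> \<le> (\<Sum>k. ennreal ((1/2)^k))"
  proof (intro suminf_le allI)
    fix k
    have "(\<integral>\<^sup>+x. ennreal (norm (d k x)) \<partial>arc_measure) = ennreal (\<integral>x. norm (d k x) \<partial>arc_measure)"
      using sq_int_arc_integrable(1)[OF d] by (intro nn_integral_eq_integral) auto
    thus "(\<integral>\<^sup>+x. ennreal (norm (d k x)) \<partial>arc_measure) \<le> ennreal ((1/2)^k)"
      using dle by (simp add: ennreal_leI)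
  qed auto
  also have "\<dots> = ennreal (\<Sum>k. (1/2)^k)"
    by (intro suminf_ennreal2) auto
  finally have "(\<integral>\<^sup>+x. (\<Sum>k. ennreal (norm (d k x))) \<partial>arc_measure) \<noteq> \<infinity>"
    by (auto simp: top_unique)
  hence "AE x in arc_measure. (\<Sum>k. ennreal (norm (d k x))) \<noteq> \<infinity>"
    by (intro nn_integral_PInf_AE) auto
  hence conv: "AE x in arc_measure. convergent (\<lambda>k. s (K k) x)"
  proof eventually_elim
    case (elim x)
    have "summable (\<lambda>k. norm (d k x))"
      using elim by (intro summable_suminf_not_top) auto
    hence "summable (\<lambda>k. d k x)" by (rule summable_norm_cancel)
    hence "convergent (\<lambda>n. \<Sum>k<n. d k x)" by (simp add: summable_iff_convergent)
    hence "convergent (\<lambda>n. (\<Sum>k<n. d k x) + s (K 0) x)" by (intro convergent_add convergent_const)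
    moreover have "(\<Sum>k<n. d k x) + s (K 0) x = s (K n) x" for n
      unfolding d_def by (subst sum_lessThan_telescope) simp
    ultimately show ?case by simp
  qed
  define u where "u x = lim (\<lambda>k. s (K k) x)" for x
  have um [measurable]: "u \<in> borel_measurable arc_measure"
    unfolding u_def by measurable
  have lim: "AE x in arc_measure. (\<lambda>k. s (K k) x) \<longlonglongrightarrow> u x"
    using conv by eventually_elim (simp add: u_def convergent_LIMSEQ_iff)
  have *: "sq_int arc_measure (\<lambda>x. u x - s N x)" "(\<integral>x. (norm (u x - s N x))\<^sup>2 \<partial>arc_measure) \<le> \<tau> N" for N
  proof -
    have ev: "eventually (\<lambda>k. (\<integral>x. (norm (s (K k) x - s N x))\<^sup>2 \<partial>arc_measure) \<le> \<tau> N) sequentially"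
      using eventually_ge_at_top[of N]
    proof eventually_elim
      case (elim k) thus ?case using K_id[of k] by (intro C) auto
    qed
    have lim': "AE x in arc_measure. (\<lambda>k. s (K k) x - s N x) \<longlonglongrightarrow> u x - s N x"
      using lim by eventually_elim (intro tendsto_intros)
    show "sq_int arc_measure (\<lambda>x. u x - s N x)"
      by (rule sq_int_fatou(1)[OF _ _ lim' ev]) (auto intro: sq_int_diff s)
    show "(\<integral>x. (norm (u x - s N x))\<^sup>2 \<partial>arc_measure) \<le> \<tau> N"
      by (rule sq_int_fatou(2)[OF _ _ lim' ev]) (auto intro: sq_int_diff s)
  qed
  have "sq_int arc_measure u"
    using sq_int_add[OF *(1)[of 0] s[of 0]] by simp
  thus ?thesis using * that by blast
qed

section \<open>Taylor coefficients\<close>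

definition hcoeff :: "(complex \<Rightarrow> complex) \<Rightarrow> nat \<Rightarrow> complex" where
  "hcoeff f n = (deriv ^^ n) f 0 / fact n"

lemma hcoeff_sums:
  assumes "f holomorphic_on ball 0 1" "norm z < 1"
  shows "(\<lambda>n. hcoeff f n * z ^ n) sums f z"
  using holomorphic_power_series[OF assms(1), of z] assms(2) by (simp add: hcoeff_def)

lemma hcoeff_summable_norm:
  assumes "f holomorphic_on ball 0 1" "norm z < 1"
  shows "summable (\<lambda>n. norm (hcoeff f n * z ^ n))"
proof -
  obtain r where r: "norm z < r" "r < 1" using dense assms(2) by blast
  moreover have "0 \<le> r" using r norm_ge_zero[of z] by linarith
  ultimately have "norm (complex_of_real r) < 1" "norm z < norm (complex_of_real r)" by auto
  thus ?thesis
    using powser_insidea[of "hcoeff f" "of_real r" z] sums_summable[OF hcoeff_sums[OF assms(1), of "of_real r"]] by auto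
qed

lemma hcoeff_dilate_sums:
  assumes "f holomorphic_on ball 0 1" "0 \<le> r" "r < 1"
  shows "summable (\<lambda>n. norm (hcoeff f n * of_real r ^ n))"
    and "norm x \<le> 1 \<Longrightarrow> f (of_real r * x) = (\<Sum>n. (hcoeff f n * of_real r ^ n) * x ^ n)"
proof -
  show "summable (\<lambda>n. norm (hcoeff f n * of_real r ^ n))"
    using hcoeff_summable_norm[OF assms(1), of "of_real r"] assms by simp
  assume "norm x \<le> 1"
  hence "norm (of_real r * x) < 1" using assms
    by (simp add: norm_mult) (meson le_less_trans mult_left_le)
  from sums_unique[OF hcoeff_sums[OF assms(1) this]]
  show "f (of_real r * x) = (\<Sum>n. (hcoeff f n * of_real r ^ n) * x ^ n)"
    by (simp add: power_mult_distrib mult.assoc)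
qed

lemma continuous_on_dilate:
  assumes "f holomorphic_on ball 0 1" "0 \<le> r" "r < 1"
  shows "continuous_on (sphere 0 1) (\<lambda>x. f (of_real r * x))"
proof (rule continuous_on_compose2[OF holomorphic_on_imp_continuous_on[OF assms(1)]])
  show "(\<lambda>x. of_real r * x) ` sphere 0 1 \<subseteq> ball (0::complex) 1"
  proof (rule image_subsetI)
    fix x :: complex assume "x \<in> sphere 0 1"
    thus "of_real r * x \<in> ball 0 1" using assms by (simp only: mem_ball_0 mem_sphere_0 norm_mult) simp
  qed
qed (auto intro!: continuous_intros)

text \<open>Uniqueness of power series, read off from the Fourier coefficients on the circle of radius
  1/2.\<close>

lemma powser_hcoeff:
  assumes "\<And>z. norm z < 1 \<Longrightarrow> (\<lambda>n. c n * z ^ n) sums f z"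
  shows "f holomorphic_on ball 0 1" "hcoeff f = c"
proof -
  show hol: "f holomorphic_on ball 0 1"
    using assms by (intro power_series_holomorphic[of 0 1 c]) auto
  show "hcoeff f = c"
  proof
    fix k
    have 1: "summable (\<lambda>n. norm (c n * of_real (1/2) ^ n))"
    proof -
      have "summable (\<lambda>n. c n * of_real (3/4) ^ n)"
        using sums_summable[OF assms[of "of_real (3/4)"]] by simp
      from powser_insidea[OF this, of "of_real (1/2)"] show ?thesis by simp
    qed
    have 2: "summable (\<lambda>n. norm (hcoeff f n * of_real (1/2) ^ n))"
      using hcoeff_dilate_sums(1)[OF hol, of "1/2"] by simp
    have eq: "(\<Sum>n. c n * of_real (1/2) ^ n * x ^ n) = (\<Sum>n. hcoeff f n * of_real (1/2) ^ n * x ^ n)"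
      if "norm x = 1" for x
    proof -
      have "(\<lambda>n. c n * (of_real (1/2) * x) ^ n) sums f (of_real (1/2) * x)"
        using that by (intro assms) (auto simp: norm_mult norm_divide)
      from sums_unique[OF this] have "f (of_real (1/2) * x) = (\<Sum>n. c n * of_real (1/2) ^ n * x ^ n)"
        by (simp only: power_mult_distrib mult.assoc)
      moreover have "f (of_real (1/2) * x) = (\<Sum>n. hcoeff f n * of_real (1/2) ^ n * x ^ n)"
        using that by (intro hcoeff_dilate_sums(2)[OF hol]) auto
      ultimately show ?thesis by (simp only:)
    qed
    have "c k * of_real (1/2) ^ k = (\<integral>x. (\<Sum>n. c n * of_real (1/2) ^ n * x ^ n) * cnj (x ^ k) \<partial>arc_measure)"
      by (rule arc_coeff_abs[OF 1, symmetric])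
    also have "\<dots> = (\<integral>x. (\<Sum>n. hcoeff f n * of_real (1/2) ^ n * x ^ n) * cnj (x ^ k) \<partial>arc_measure)"
      by (intro Bochner_Integration.integral_cong refl) (simp only: eq space_arc mem_sphere_0)
    also have "\<dots> = hcoeff f k * of_real (1/2) ^ k"
      by (rule arc_coeff_abs[OF 2])
    finally show "hcoeff f k = c k" by simp
  qed
qed

lemma abs_summable_square:
  fixes a :: "nat \<Rightarrow> complex"
  assumes "summable (\<lambda>n. norm (a n))"
  shows "summable (\<lambda>n. (norm (a n))\<^sup>2)"
proof -
  obtain B where B: "\<And>n. norm (a n) \<le> B"
    using summable_imp_bounded[OF assms] by (auto simp: bounded_iff)
  show ?thesis
  proof (rule summable_comparison_test'[OF summable_mult[OF assms, of B]])
    fix n show "norm ((norm (a n))\<^sup>2) \<le> B * norm (a n)"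
      using B[of n] by (auto simp: power2_eq_square intro: mult_right_mono)
  qed
qed

text \<open>Parseval on the circle of radius \<open>r\<close>: the means that define the Hardy space are power
  series in \<open>r\<^sup>2\<close> with nonnegative coefficients.\<close>

lemma circle_mean_square:
  assumes f: "f holomorphic_on ball 0 1" and r: "0 \<le> r" "r < 1"
  shows "summable (\<lambda>n. (norm (hcoeff f n))\<^sup>2 * r ^ (2 * n))"
    and "(\<integral>x. (norm (f (of_real r * x)))\<^sup>2 \<partial>arc_measure) = (\<Sum>n. (norm (hcoeff f n))\<^sup>2 * r ^ (2 * n))"
proof -
  let ?a = "\<lambda>n. hcoeff f n * of_real r ^ n"
  have a: "summable (\<lambda>n. norm (?a n))" by (rule hcoeff_dilate_sums(1)[OF f r])
  have sq: "?a n * cnj (?a n) = of_real ((norm (hcoeff f n))\<^sup>2 * r ^ (2 * n))" for n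
    by (simp only: complex_norm_square[symmetric]) (simp add: norm_mult norm_power power_mult_distrib power_mult[symmetric] mult.commute r)
  have "complex_of_real (\<integral>x. (norm (f (of_real r * x)))\<^sup>2 \<partial>arc_measure) = (\<integral>x. f (of_real r * x) * cnj (f (of_real r * x)) \<partial>arc_measure)"
    by (simp only: complex_norm_square[symmetric] integral_complex_of_real)
  also have "\<dots> = (\<integral>x. (\<Sum>n. ?a n * x ^ n) * cnj (\<Sum>n. ?a n * x ^ n) \<partial>arc_measure)"
    using hcoeff_dilate_sums(2)[OF f r] by (intro Bochner_Integration.integral_cong refl) auto
  also have "\<dots> = (\<Sum>n. ?a n * cnj (?a n))" by (rule arc_parseval_abs[OF a a])
  also have "\<dots> = (\<Sum>n. complex_of_real ((norm (hcoeff f n))\<^sup>2 * r ^ (2 * n)))" by (simp only: sq)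
  finally have 1: "complex_of_real (\<integral>x. (norm (f (of_real r * x)))\<^sup>2 \<partial>arc_measure) = (\<Sum>n. complex_of_real ((norm (hcoeff f n))\<^sup>2 * r ^ (2 * n)))" .
  have "summable (\<lambda>n. (norm (?a n))\<^sup>2)"
    using a by (intro abs_summable_square)
  thus s: "summable (\<lambda>n. (norm (hcoeff f n))\<^sup>2 * r ^ (2 * n))"
    by (simp add: norm_mult norm_power power_mult_distrib power_mult[symmetric] mult.commute r)
  show "(\<integral>x. (norm (f (of_real r * x)))\<^sup>2 \<partial>arc_measure) = (\<Sum>n. (norm (hcoeff f n))\<^sup>2 * r ^ (2 * n))"
    using 1 unfolding suminf_of_real[OF s, symmetric] using of_real_eq_iff by blast
qed

section \<open>Fatou's theorem\<close>

text \<open>Lebesgue's differentiation theorem for one-sided averages, applied to the function and to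
  its reflection.\<close>

lemma ae_derivative_indefinite_integral:
  fixes W :: "real \<Rightarrow> complex"
  assumes int: "\<And>a b. W integrable_on {a..b}"
  obtains N where "negligible N"
    "\<And>x c. x \<notin> N \<Longrightarrow> c < x \<Longrightarrow> ((\<lambda>x. integral {c..x} W) has_vector_derivative W x) (at x)"
proof -
  obtain N1 where N1: "negligible N1" "\<And>x e. x \<notin> N1 \<Longrightarrow> 0 < e \<Longrightarrow>
      \<exists>d>0. \<forall>h. 0 < h \<and> h < d \<longrightarrow> norm (integral {x..x+h} W /\<^sub>R h - W x) < e"
    using integrable_ccontinuous_explicit[of W] int by auto
  have int2: "(\<lambda>x. W (-x)) integrable_on {a..b}" for a b
    using int[of "-b" "-a"] Henstock_Kurzweil_Integration.integrable_reflect_real[where f=W and a="-b" and b="-a"] by simp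
  obtain N2 where N2: "negligible N2" "\<And>x e. x \<notin> N2 \<Longrightarrow> 0 < e \<Longrightarrow>
      \<exists>d>0. \<forall>h. 0 < h \<and> h < d \<longrightarrow> norm (integral {x..x+h} (\<lambda>x. W (-x)) /\<^sub>R h - W (-x)) < e"
    using integrable_ccontinuous_explicit[of "\<lambda>x. W (-x)"] int2 by auto
  define N where "N = N1 \<union> uminus ` N2"
  have "negligible N" unfolding N_def
    by (intro negligible_Un N1 negligible_differentiable_image_negligible N2)
       (auto intro!: derivative_intros)
  moreover have "((\<lambda>x. integral {c..x} W) has_vector_derivative W x) (at x)" if x: "x \<notin> N" and c: "c < x" for x c
    unfolding has_vector_derivative_def has_derivative_at_alt
  proof (intro conjI allI impI)
    show "bounded_linear (\<lambda>h. h *\<^sub>R W x)" by (rule bounded_linear_scaleR_left)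
    fix e :: real assume e: "e > 0"
    have "x \<notin> N1" "-x \<notin> N2" using x by (auto simp: N_def image_iff)
    obtain d1 where d1: "d1 > 0" "\<And>h. 0 < h \<Longrightarrow> h < d1 \<Longrightarrow> norm (integral {x..x+h} W /\<^sub>R h - W x) < e"
      using N1(2)[OF \<open>x \<notin> N1\<close> e] by blast
    obtain d2 where d2: "d2 > 0" "\<And>h. 0 < h \<Longrightarrow> h < d2 \<Longrightarrow> norm (integral {-x..-x+h} (\<lambda>x. W (-x)) /\<^sub>R h - W x) < e"
      using N2(2)[OF \<open>-x \<notin> N2\<close> e] by auto
    have scale: "norm (I - h *\<^sub>R v) \<le> e * h" if "norm (I /\<^sub>R h - v) < e" "h > 0" for I v :: complex and h
    proof -
      have "I - h *\<^sub>R v = h *\<^sub>R (I /\<^sub>R h - v)" using that by (simp add: scaleR_diff_right)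
      hence "norm (I - h *\<^sub>R v) = h * norm (I /\<^sub>R h - v)" using that by simp
      also have "\<dots> \<le> h * e" using that by (intro mult_left_mono) auto
      finally show ?thesis by (simp add: mult.commute)
    qed
    show "\<exists>d>0. \<forall>y. norm (y - x) < d \<longrightarrow>
        norm (integral {c..y} W - integral {c..x} W - (y - x) *\<^sub>R W x) \<le> e * norm (y - x)"
    proof (intro exI[of _ "min (min d1 d2) (x - c)"] conjI allI impI)
      show "min (min d1 d2) (x - c) > 0" using d1 d2 c by auto
      fix y assume y: "norm (y - x) < min (min d1 d2) (x - c)"
      consider "y = x" | "y > x" | "y < x" by linarith
      thus "norm (integral {c..y} W - integral {c..x} W - (y - x) *\<^sub>R W x) \<le> e * norm (y - x)"
      proof cases
        case 2
        have "integral {c..x} W + integral {x..y} W = integral {c..y} W"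
          using 2 c int by (intro Henstock_Kurzweil_Integration.integral_combine) auto
        hence "integral {c..y} W - integral {c..x} W = integral {x..y} W" by (simp add: algebra_simps)
        moreover have "norm (integral {x..x+(y-x)} W - (y-x) *\<^sub>R W x) \<le> e * (y-x)"
          using 2 y by (intro scale d1) auto
        ultimately show ?thesis using 2 by simp
      next
        case 3
        have "integral {c..y} W + integral {y..x} W = integral {c..x} W"
          using 3 y c int by (intro Henstock_Kurzweil_Integration.integral_combine) auto
        moreover have "norm (integral {-x..-x+(x-y)} (\<lambda>x. W (-x)) - (x-y) *\<^sub>R W x) \<le> e * (x-y)"
          using 3 y by (intro scale d2) auto
        moreover have "integral {-x..-x+(x-y)} (\<lambda>x. W (-x)) = integral {y..x} W"
          using Henstock_Kurzweil_Integration.integral_reflect_real[of x y W] by simp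
        moreover have "integral {c..x} W - integral {c..y} W = integral {y..x} W"
          using \<open>integral {c..y} W + integral {y..x} W = integral {c..x} W\<close> by (simp add: algebra_simps)
        ultimately have "norm (integral {c..x} W - integral {c..y} W - (x-y) *\<^sub>R W x) \<le> e * (x-y)"
          by simp
        moreover have "integral {c..y} W - integral {c..x} W - (y - x) *\<^sub>R W x
            = - (integral {c..x} W - integral {c..y} W - (x-y) *\<^sub>R W x)"
          by (simp add: algebra_simps)
        ultimately show ?thesis using 3 by (simp only: norm_minus_cancel) simp
      qed simp
    qed
  qed
  ultimately show ?thesis using that by blast
qed

text \<open>The derivative of the Poisson kernel with respect to the angle of \<open>z\<close>, divided by
  \<open>\<i>\<close>: integration against it applies \<open>z * deriv\<close> to a power series.\<close>

definition dpois :: "complex \<Rightarrow> complex \<Rightarrow> complex" where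
  "dpois z x = (let v = cnj z * x in cnj (v / (1 - v)\<^sup>2) - v / (1 - v)\<^sup>2)"

lemma dpois_power_series:
  fixes g :: "nat \<Rightarrow> complex"
  assumes g: "summable (\<lambda>n. norm (g n))" and z: "norm z < 1"
  shows "(\<integral>x. (\<Sum>n. g n * x ^ n) * dpois z x \<partial>arc_measure) = (\<Sum>n. g n * (of_nat n * z ^ n))"
proof -
  define b where "b n = of_nat n * cnj z ^ n" for n
  have sums: "(\<lambda>n. of_nat n * v ^ n) sums (v / (1 - v)\<^sup>2)" if "norm v < 1" for v :: complex
  proof -
    have "(\<lambda>n. v * (of_nat (Suc n) * v ^ n)) sums (v * (1 / (1 - v)\<^sup>2))"
      by (intro sums_mult geometric_deriv_sums that)
    hence "(\<lambda>n. of_nat (Suc n) * v ^ Suc n) sums (v / (1 - v)\<^sup>2)" by (simp add: mult_ac)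
    thus ?thesis by (rule sums_Suc_imp[where f="\<lambda>n. of_nat n * v ^ n", rotated]) simp
  qed
  have b: "summable (\<lambda>n. norm (b n))"
  proof -
    have "(\<lambda>n. of_nat n * complex_of_real (norm z) ^ n) sums (of_real (norm z) / (1 - of_real (norm z))\<^sup>2)"
      using z by (intro sums) simp
    hence "summable (\<lambda>n. complex_of_real (real n * norm z ^ n))" by (simp add: sums_iff)
    hence "summable (\<lambda>n. real n * norm z ^ n)" by (simp only: summable_of_real_iff)
    thus ?thesis by (simp add: b_def norm_mult norm_power)
  qed
  have k: "dpois z x = cnj (\<Sum>n. b n * x ^ n) - (\<Sum>n. b n * x ^ n)" if "norm x = 1" for x
  proof -
    have "(\<lambda>n. b n * x ^ n) sums (cnj z * x / (1 - cnj z * x)\<^sup>2)"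
      using sums[of "cnj z * x"] z that by (simp add: b_def power_mult_distrib norm_mult mult.assoc)
    thus ?thesis unfolding dpois_def Let_def by (simp only: sums_iff)
  qed
  have Ac: "continuous_on (sphere 0 1) (\<lambda>x. \<Sum>n. c n * x ^ n)" if "summable (\<lambda>n. norm (c n))" for c :: "nat \<Rightarrow> complex"
    by (rule continuous_on_subset[OF continuous_on_power_series_circle[OF that]]) auto
  have "(\<integral>x. (\<Sum>n. g n * x ^ n) * dpois z x \<partial>arc_measure)
      = (\<integral>x. (\<Sum>n. g n * x ^ n) * cnj (\<Sum>n. b n * x ^ n) - (\<Sum>n. g n * x ^ n) * (\<Sum>n. b n * x ^ n) \<partial>arc_measure)"
    by (intro Bochner_Integration.integral_cong refl)
       (simp only: k space_arc mem_sphere_0 right_diff_distrib)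
  also have "\<dots> = (\<integral>x. (\<Sum>n. g n * x ^ n) * cnj (\<Sum>n. b n * x ^ n) \<partial>arc_measure)
      - (\<integral>x. (\<Sum>n. g n * x ^ n) * (\<Sum>n. b n * x ^ n) \<partial>arc_measure)"
    by (intro Bochner_Integration.integral_diff integrable_arc_continuous continuous_intros Ac g b)
  also have "\<dots> = (\<Sum>n. g n * (of_nat n * z ^ n))"
    by (simp only: arc_parseval_abs[OF g b] arc_product_abs[OF g b]) (simp add: b_def)
  finally show ?thesis .
qed

lemma continuous_on_dpois: "norm z < 1 \<Longrightarrow> continuous_on (sphere 0 1) (dpois z)"
proof -
  assume z: "norm z < 1"
  have "(1 - cnj z * x)\<^sup>2 \<noteq> 0" if "x \<in> sphere 0 1" for x
  proof
    assume "(1 - cnj z * x)\<^sup>2 = 0"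
    hence "norm (cnj z * x) = 1" by simp
    thus False using z that by (simp add: norm_mult)
  qed
  thus ?thesis unfolding dpois_def Let_def by (intro continuous_intros) auto
qed

text \<open>The decisive estimate for radial limits: multiplication by the distance to the boundary
  point compensates the differentiation of the kernel.\<close>

lemma dpois_bound:
  assumes r: "0 \<le> r" "r < 1" and n: "norm w = 1" "norm w0 = 1"
  shows "norm (dpois (of_real r * w0) w) * norm (w - w0) \<le> 8 * pois (of_real r * w0) w"
proof -
  define z where "z = of_real r * w0"
  define v where "v = cnj z * w"
  define D where "D = norm (w - z)"
  have nz: "norm z = r" using r n by (simp add: z_def norm_mult)
  have nv: "norm v = r" using nz n by (simp add: v_def norm_mult)
  have v1: "1 - v \<noteq> 0" using nv r by (metis eq_iff_diff_eq_0 less_irrefl norm_one)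
  hence v2: "1 - cnj v \<noteq> 0" by (metis complex_cnj_one complex_cnj_diff complex_cnj_zero_iff)
  have D: "D = norm (1 - v)"
  proof -
    have "w * cnj w = 1" using n by (simp add: complex_norm_square[symmetric])
    hence "w * (z * cnj w) = z" by (metis mult.commute mult.left_commute mult_1_right)
    hence "w - z = w * cnj (1 - v)" by (simp add: v_def algebra_simps)
    thus ?thesis using n by (simp add: norm_mult D_def del: complex_cnj_diff)
  qed
  have Dpos: "D > 0" using D v1 by simp
  have "1 - r \<le> D" using norm_triangle_ineq2[of w z] n nz by (simp add: D_def)
  moreover have "norm (z - w0) = 1 - r"
  proof -
    have "z - w0 = of_real (r - 1) * w0" by (simp add: z_def algebra_simps)
    thus ?thesis using n r by (simp add: norm_mult del: of_real_diff)
  qed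
  \<comment> \<open>As \<open>z\<close> is on the radius of \<open>w0\<close>, it is at least as close to \<open>w0\<close> as to \<open>w\<close>.\<close>
  ultimately have d2: "norm (w - w0) \<le> 2 * D"
    using norm_triangle_ineq[of "w - z" "z - w0"] by (simp add: D_def)
  \<comment> \<open>The kernel contains the factor \<open>cnj v - v\<close>, which vanishes to first order at the boundary point.\<close>
  have imv: "norm (cnj v - v) \<le> 2 * norm (w - w0)"
  proof -
    have e: "v = of_real r * (cnj w0 * (w - w0)) + of_real r"
    proof -
      have "cnj w0 * w0 = 1" using n by (simp add: complex_norm_square[symmetric] mult.commute)
      thus ?thesis by (simp add: v_def z_def algebra_simps)
    qed
    define t where "t = of_real r * (cnj w0 * (w - w0))"
    have "cnj v - v = cnj t - t" using e by (simp add: t_def)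
    hence "norm (cnj v - v) \<le> norm t + norm t" using norm_triangle_ineq4[of "cnj t" t] by simp
    also have "norm t \<le> norm (w - w0)" using r n by (simp add: t_def norm_mult mult_left_le_one_le)
    finally show ?thesis by simp
  qed
  have "dpois z w = cnj v / (1 - cnj v)\<^sup>2 - v / (1 - v)\<^sup>2"
    unfolding dpois_def Let_def v_def[symmetric] by simp
  also have "\<dots> = (cnj v - v) * (1 - v * cnj v) / ((1 - v) * (1 - cnj v))\<^sup>2"
  proof -
    have "cnj v * (1 - v)\<^sup>2 - v * (1 - cnj v)\<^sup>2 = (cnj v - v) * (1 - v * cnj v)"
      by (simp add: power2_eq_square algebra_simps)
    moreover have "x / q\<^sup>2 - y / p\<^sup>2 = (x * p\<^sup>2 - y * q\<^sup>2) / (p * q)\<^sup>2" if "p \<noteq> 0" "q \<noteq> 0" for x y p q :: complex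
      using that by (simp add: power_mult_distrib diff_frac_eq mult.commute)
    ultimately show ?thesis using v1 v2 by metis
  qed
  also have "(1 - v) * (1 - cnj v) = of_real (D\<^sup>2)"
    unfolding D complex_norm_square by simp
  also have "1 - v * cnj v = of_real (1 - r\<^sup>2)"
    unfolding of_real_diff nv[symmetric] complex_norm_square by simp
  finally have "norm (dpois z w) = norm (cnj v - v) * (1 - r\<^sup>2) / (D\<^sup>2)\<^sup>2"
    using r by (simp add: norm_mult norm_divide norm_power abs_square_le_1 power_le_one del: of_real_diff of_real_power)
  hence "norm (dpois z w) * norm (w - w0) = norm (cnj v - v) * norm (w - w0) * (1 - r\<^sup>2) / (D\<^sup>2)\<^sup>2"
    by simp
  also have "\<dots> \<le> (2 * norm (w - w0)) * norm (w - w0) * (1 - r\<^sup>2) / (D\<^sup>2)\<^sup>2"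
    using imv r by (intro divide_right_mono mult_right_mono) (auto simp: power_le_one)
  also have "\<dots> \<le> (2 * (2 * D)) * (2 * D) * (1 - r\<^sup>2) / (D\<^sup>2)\<^sup>2"
    using d2 r Dpos by (intro divide_right_mono mult_right_mono mult_mono) (auto simp: power_le_one)
  also have "\<dots> = 8 * ((1 - r\<^sup>2) / D\<^sup>2)"
    using Dpos by (simp add: power2_eq_square field_simps)
  finally show ?thesis unfolding pois_def z_def[symmetric] nz D_def .
qed

text \<open>The differentiated kernel annihilates constants, and it sends the linear part of a function
  at the boundary point to its slope times \<open>- \<i> * r\<close>.\<close>

lemma dpois_moments:
  assumes r: "0 \<le> r" "r < 1" and n: "norm t0 = 1"
  shows "(\<integral>t. dpois (of_real r * t0) t \<partial>arc_measure) = 0"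
    and "(\<integral>t. of_real (Im (t * cnj t0)) * dpois (of_real r * t0) t \<partial>arc_measure) = - \<i> * of_real r"
proof -
  define z where "z = of_real r * t0"
  have z: "norm z < 1" using r n by (simp add: z_def norm_mult)
  note dc = continuous_on_dpois[OF z]
  have poly: "(\<integral>t. c * t ^ k * dpois z t \<partial>arc_measure) = c * (of_nat k * z ^ k)" for c k
  proof -
    define g where "g n = (if n = k then c else 0)" for n
    have g: "summable (\<lambda>n. norm (g n))"
      by (rule summable_norm_finite_support[of "{k}"]) (auto simp: g_def)
    have "(\<lambda>n. g n * h n) = (\<lambda>n. if n = k then c * h n else 0)" for h by (auto simp: g_def)
    hence "(\<Sum>n. g n * h n) = c * h k" for h using suminf_single[of k "\<lambda>n. c * h n"] by simp
    thus ?thesis using dpois_power_series[OF g z] by simp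
  qed
  show "(\<integral>t. dpois (of_real r * t0) t \<partial>arc_measure) = 0"
    using poly[of 1 0] by (simp add: z_def)
  have one: "(\<integral>t. (t * cnj t0) * dpois z t \<partial>arc_measure) = of_real r"
  proof -
    have "cnj t0 * (1 * z ^ 1) = of_real r"
    proof -
      have "cnj t0 * t0 = 1" using n by (simp add: complex_norm_square[symmetric] mult.commute)
      thus ?thesis by (simp add: z_def mult.left_commute)
    qed
    thus ?thesis using poly[of "cnj t0" 1] by (simp add: mult_ac)
  qed
  have cd: "cnj (dpois z t) = - dpois z t" for t by (simp add: dpois_def Let_def)
  have two: "(\<integral>t. cnj (t * cnj t0) * dpois z t \<partial>arc_measure) = - of_real r"
  proof -
    have "(\<integral>t. cnj (t * cnj t0) * dpois z t \<partial>arc_measure) = (\<integral>t. - cnj ((t * cnj t0) * dpois z t) \<partial>arc_measure)"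
      by (intro Bochner_Integration.integral_cong refl) (simp add: cd)
    also have "\<dots> = - cnj (\<integral>t. (t * cnj t0) * dpois z t \<partial>arc_measure)"
      by (simp only: Bochner_Integration.integral_minus Bochner_Integration.integral_cnj)
    finally show ?thesis by (simp only: one) simp
  qed
  have im: "complex_of_real (Im x) = (x - cnj x) / (2 * \<i>)" for x
    by (simp add: complex_eq_iff)
  have "(\<integral>t. of_real (Im (t * cnj t0)) * dpois z t \<partial>arc_measure)
      = (\<integral>t. ((t * cnj t0) * dpois z t - cnj (t * cnj t0) * dpois z t) / (2 * \<i>) \<partial>arc_measure)"
    unfolding im by (intro Bochner_Integration.integral_cong refl) (simp add: algebra_simps)
  also have "\<dots> = ((\<integral>t. (t * cnj t0) * dpois z t \<partial>arc_measure) - (\<integral>t. cnj (t * cnj t0) * dpois z t \<partial>arc_measure)) / (2 * \<i>)"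
    by (subst integral_divide_zero, subst Bochner_Integration.integral_diff)
       (intro integrable_arc_continuous continuous_intros dc refl)+
  also have "\<dots> = - \<i> * of_real r" by (simp only: one two) (simp add: field_simps)
  finally show "(\<integral>t. of_real (Im (t * cnj t0)) * dpois (of_real r * t0) t \<partial>arc_measure) = - \<i> * of_real r"
    by (simp add: z_def)
qed

text \<open>Fatou's theorem for the angular derivative: subtract the linear part of the boundary
  function at the given point, which the kernel maps to the limit; the remainder is small of
  first order near that point, and there the kernel estimate turns it into a Poisson mean of a
  small quantity, while away from it the kernel itself tends to 0.\<close>

lemma fatou_derivative:
  fixes g :: "nat \<Rightarrow> complex"
  defines "G \<equiv> (\<lambda>t. \<Sum>n. g n * t ^ n)"
  assumes g: "summable (\<lambda>n. norm (g n))" and n: "norm t0 = 1"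
    and diff: "\<And>\<epsilon>. \<epsilon> > 0 \<Longrightarrow> \<exists>\<delta>>0. \<forall>t. norm t = 1 \<longrightarrow> norm (t - t0) < \<delta> \<longrightarrow>
       norm (G t - G t0 - d * of_real (Im (t * cnj t0))) \<le> \<epsilon> * norm (t - t0)"
  shows "((\<lambda>r. \<Sum>n. g n * (of_nat n * (of_real r * t0) ^ n)) \<longlongrightarrow> - \<i> * d) (at_left (1::real))"
proof (rule tendstoI)
  fix e :: real assume e: "e > 0"
  define E where "E t = G t - G t0 - d * of_real (Im (t * cnj t0))" for t
  have Gc: "continuous_on (sphere 0 1) G"
    unfolding G_def by (rule continuous_on_subset[OF continuous_on_power_series_circle[OF g]]) auto
  have Ec: "continuous_on (sphere 0 1) E"
    unfolding E_def by (intro continuous_intros Gc)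
  \<comment> \<open>The constant 16 makes the contribution of the points near \<open>t0\<close> at most \<open>e / 2\<close>, because of the factor 8 in the kernel estimate.\<close>
  obtain \<delta> where \<delta>: "\<delta> > 0" "\<And>t. norm t = 1 \<Longrightarrow> norm (t - t0) < \<delta> \<Longrightarrow> norm (E t) \<le> (e/16) * norm (t - t0)"
    using diff[of "e/16"] e unfolding E_def by auto
  have "compact (E ` sphere 0 1)" using Ec by (intro compact_continuous_image) auto
  then obtain B where "\<forall>x\<in>E ` sphere 0 1. norm x \<le> B"
    using compact_imp_bounded bounded_iff by blast
  hence B: "\<And>t. norm t = 1 \<Longrightarrow> norm (E t) \<le> B" by auto
  have B0: "0 \<le> B" using B[OF n] norm_ge_zero[of "E t0"] by linarith
  have bound: "norm ((\<Sum>n. g n * (of_nat n * (of_real r * t0) ^ n)) - (- \<i> * d)) \<le> e / 2 + 32 * B * (1 - r\<^sup>2) / \<delta> ^ 3 + (1 - r) * norm d"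
    if r: "0 \<le> r" "r < 1" for r
  proof -
    define z where "z = of_real r * t0"
    have z: "norm z < 1" "norm z = r" using r n by (simp_all add: z_def norm_mult)
    note dc = continuous_on_dpois[OF z(1)]
    define S where "S = (\<Sum>n. g n * (of_nat n * z ^ n))"
    have "(\<integral>t. E t * dpois z t \<partial>arc_measure) = (\<integral>t. G t * dpois z t - G t0 * dpois z t - d * (of_real (Im (t * cnj t0)) * dpois z t) \<partial>arc_measure)"
      unfolding E_def by (intro Bochner_Integration.integral_cong refl) (simp add: algebra_simps)
    also have "\<dots> = (\<integral>t. G t * dpois z t \<partial>arc_measure) - G t0 * (\<integral>t. dpois z t \<partial>arc_measure) - d * (\<integral>t. of_real (Im (t * cnj t0)) * dpois z t \<partial>arc_measure)"
    proof -
      have "integrable arc_measure (\<lambda>t. G t * dpois z t)" "integrable arc_measure (\<lambda>t. G t0 * dpois z t)"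
        "integrable arc_measure (\<lambda>t. d * (of_real (Im (t * cnj t0)) * dpois z t))"
        by (intro integrable_arc_continuous continuous_intros dc Gc)+
      thus ?thesis by simp
    qed
    also have "\<dots> = S - (d * (- \<i> * of_real r))"
      unfolding z_def S_def dpois_moments[OF r n] using dpois_power_series[OF g z(1)] by (simp add: G_def z_def)
    finally have 1: "S - (- \<i> * d) = (\<integral>t. E t * dpois z t \<partial>arc_measure) + \<i> * d * of_real (1 - r)"
      by (simp add: algebra_simps)
    have pw: "norm (E t * dpois z t) \<le> (e/2) * pois z t + 32 * B * (1 - r\<^sup>2) / \<delta> ^ 3" if t: "norm t = 1" for t
    proof (cases "norm (t - t0) < \<delta>")
      case True
      have "norm (E t * dpois z t) \<le> ((e/16) * norm (t - t0)) * norm (dpois z t)"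
        unfolding norm_mult by (intro mult_right_mono \<delta> t True) auto
      also have "\<dots> = (e/16) * (norm (dpois z t) * norm (t - t0))" by simp
      also have "\<dots> \<le> (e/16) * (8 * pois z t)"
        unfolding z_def using e by (intro mult_left_mono dpois_bound r t n) auto
      also have "\<dots> = (e/2) * pois z t" by simp
      also have "\<dots> \<le> (e/2) * pois z t + 32 * B * (1 - r\<^sup>2) / \<delta> ^ 3"
        using B0 r \<delta>(1) by (simp add: power_le_one)
      finally show ?thesis .
    next
      case False
      hence d0: "\<delta> \<le> norm (t - t0)" by simp
      have "norm (z - t0) = 1 - r"
      proof -
        have "z - t0 = of_real (r - 1) * t0" by (simp add: z_def algebra_simps)
        thus ?thesis using n r by (simp add: norm_mult del: of_real_diff)
      qed
      moreover have "1 - r \<le> norm (t - z)" using norm_triangle_ineq2[of t z] t z by simp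
      ultimately have d2: "\<delta> \<le> 2 * norm (t - z)"
        using norm_triangle_ineq[of "t - z" "z - t0"] d0 by simp
      have "pois z t \<le> (1 - r\<^sup>2) / (\<delta>/2)\<^sup>2"
        unfolding pois_def z(2) using d2 \<delta>(1) r
        by (intro divide_left_mono power_mono mult_pos_pos zero_less_power) (auto simp: power_le_one)
      hence p: "pois z t \<le> 4 * (1 - r\<^sup>2) / \<delta>\<^sup>2" by (simp add: power_divide mult.commute)
      have "norm (dpois z t) * \<delta> \<le> norm (dpois z t) * norm (t - t0)"
        using d0 by (intro mult_left_mono) auto
      also have "\<dots> \<le> 8 * pois z t" unfolding z_def by (intro dpois_bound r t n)
      also have "\<dots> \<le> 8 * (4 * (1 - r\<^sup>2) / \<delta>\<^sup>2)" using p by (intro mult_left_mono) auto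
      finally have "norm (dpois z t) \<le> 8 * (4 * (1 - r\<^sup>2) / \<delta>\<^sup>2) / \<delta>"
        using \<delta>(1) by (simp only: pos_le_divide_eq)
      also have "\<dots> = 32 * (1 - r\<^sup>2) / \<delta> ^ 3" by (simp add: power3_eq_cube power2_eq_square)
      finally have "norm (E t * dpois z t) \<le> B * (32 * (1 - r\<^sup>2) / \<delta> ^ 3)"
        unfolding norm_mult by (intro mult_mono B t B0) auto
      moreover have "0 \<le> (e/2) * pois z t" using e pois_nonneg[OF z(1), of t] by simp
      moreover have "B * (32 * (1 - r\<^sup>2) / \<delta> ^ 3) = 32 * B * (1 - r\<^sup>2) / \<delta> ^ 3" by simp
      ultimately show ?thesis by linarith
    qed
    have "norm (\<integral>t. E t * dpois z t \<partial>arc_measure) \<le> (\<integral>t. norm (E t * dpois z t) \<partial>arc_measure)" by simp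
    also have "\<dots> \<le> (\<integral>t. (e/2) * pois z t + 32 * B * (1 - r\<^sup>2) / \<delta> ^ 3 \<partial>arc_measure)"
      using pw by (intro integral_mono integrable_arc_continuous continuous_intros Ec dc continuous_on_pois z) auto
    also have "\<dots> = e/2 + 32 * B * (1 - r\<^sup>2) / \<delta> ^ 3"
      using integral_pois[OF z(1)] arc.prob_space integrable_arc_continuous[OF continuous_on_pois[OF z(1)]] by simp
    finally have 2: "norm (\<integral>t. E t * dpois z t \<partial>arc_measure) \<le> e/2 + 32 * B * (1 - r\<^sup>2) / \<delta> ^ 3" .
    have "norm (\<i> * d * of_real (1 - r)) = (1 - r) * norm d" using r by (simp add: norm_mult del: of_real_diff)
    thus ?thesis
      unfolding z_def[symmetric] S_def[symmetric] 1
      using 2 norm_triangle_ineq[of "\<integral>t. E t * dpois z t \<partial>arc_measure" "\<i> * d * of_real (1 - r)"] by linarith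
  qed
  have "((\<lambda>r. 32 * B * (1 - r\<^sup>2) / \<delta> ^ 3 + (1 - r) * norm d) \<longlongrightarrow> 32 * B * (1 - 1\<^sup>2) / \<delta> ^ 3 + (1 - 1) * norm d) (at_left (1::real))"
    using \<delta>(1) by (intro tendsto_intros) auto
  hence "\<forall>\<^sub>F r in at_left (1::real). 32 * B * (1 - r\<^sup>2) / \<delta> ^ 3 + (1 - r) * norm d < e / 2"
    using e by (intro order_tendstoD(2)) auto
  moreover have "\<forall>\<^sub>F r in at_left (1::real). r \<in> {0<..<1}" by (rule eventually_at_leftI[of 0]) auto
  ultimately show "\<forall>\<^sub>F r in at_left (1::real). dist (\<Sum>n. g n * (of_nat n * (of_real r * t0) ^ n)) (- \<i> * d) < e"
  proof eventually_elim
    case (elim r)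
    thus ?case using bound[of r] by (simp add: dist_norm)
  qed
qed

lemma arc_poly_norm:
  fixes a :: "nat \<Rightarrow> complex"
  assumes "finite A"
  shows "(\<integral>x. (norm (\<Sum>n\<in>A. a n * x ^ n))\<^sup>2 \<partial>arc_measure) = (\<Sum>n\<in>A. (norm (a n))\<^sup>2)"
proof -
  define b where "b n = (if n \<in> A then a n else 0)" for n
  have b: "summable (\<lambda>n. norm (b n))"
    by (rule summable_norm_finite_support[OF assms]) (auto simp: b_def)
  have 1: "(\<Sum>n. b n * x ^ n) = (\<Sum>n\<in>A. a n * x ^ n)" for x
    using suminf_finite[OF assms, of "\<lambda>n. b n * x ^ n"] by (simp add: b_def)
  have 2: "(\<Sum>n. b n * cnj (b n)) = (\<Sum>n\<in>A. a n * cnj (a n))"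
    using suminf_finite[OF assms, of "\<lambda>n. b n * cnj (b n)"] by (simp add: b_def)
  have "complex_of_real (\<integral>x. (norm (\<Sum>n\<in>A. a n * x ^ n))\<^sup>2 \<partial>arc_measure) = complex_of_real (\<Sum>n\<in>A. (norm (a n))\<^sup>2)"
    using arc_parseval_abs[OF b b]
    unfolding 1 2 by (simp only: complex_norm_square[symmetric] integral_complex_of_real of_real_sum)
  thus ?thesis using of_real_eq_iff by blast
qed

lemma sum_lessThan_split:
  fixes h :: "nat \<Rightarrow> 'b::ab_group_add"
  assumes "M \<le> N"
  shows "(\<Sum>n<N. h n) = (\<Sum>n<M. h n) + (\<Sum>n=M..<N. h n)"
proof -
  have "{..<N} = {..<M} \<union> {M..<N}" using assms by auto
  thus ?thesis by (metis sum.union_disjoint finite_lessThan finite_atLeastLessThan ivl_disj_int_one(2))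
qed

text \<open>The Taylor series \<open>g\<close> with coefficients \<open>a n / n\<close> converges absolutely on the closed disk,
  as \<open>norm (a n) / n\<close> is at most the sum of the squares of its factors. Its boundary function is,
  up to a linear term and the factor \<open>\<i>\<close>, the indefinite integral of the square mean limit
  \<open>u\<close> of the Taylor polynomials. Hence it is differentiable almost everywhere, its derivative is
  known from \<open>u\<close>, and the theorem on the angular derivative applies, since \<open>z * deriv\<close> turns the
  coefficients \<open>a n / n\<close> back into \<open>a n\<close>.\<close>

lemma fatou_L2:
  fixes a :: "nat \<Rightarrow> complex"
  assumes sq: "summable (\<lambda>n. (norm (a n))\<^sup>2)"
  obtains u where "sq_int arc_measure u"
    "(\<lambda>N. L2norm arc_measure (\<lambda>w. u w - (\<Sum>n<N. a n * w ^ n))) \<longlonglongrightarrow> 0"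
    "AE w in arc_measure. ((\<lambda>r. \<Sum>n. a n * (of_real r * w) ^ n) \<longlongrightarrow> u w) (at_left (1::real))"
proof -
  define s where "s N w = (\<Sum>n<N. a n * w ^ n)" for N w
  define \<tau> where "\<tau> N = (\<Sum>n. (norm (a n))\<^sup>2) - (\<Sum>n<N. (norm (a n))\<^sup>2)" for N
  have sc: "continuous_on A (s N)" for N A unfolding s_def by (intro continuous_intros)
  have ssq: "sq_int arc_measure (s N)" for N
    by (intro sq_int_continuous_arc sc)
  have "\<tau> \<longlonglongrightarrow> (\<Sum>n. (norm (a n))\<^sup>2) - (\<Sum>n. (norm (a n))\<^sup>2)"
    unfolding \<tau>_def by (intro tendsto_intros summable_LIMSEQ sq)
  hence \<tau>0: "\<tau> \<longlonglongrightarrow> 0" by simp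
  have cau: "(\<integral>x. (norm (s N x - s M x))\<^sup>2 \<partial>arc_measure) \<le> \<tau> M" if "M \<le> N" for M N
  proof -
    note split = sum_lessThan_split[OF that]
    have "s N x - s M x = (\<Sum>n=M..<N. a n * x ^ n)" for x unfolding s_def split by simp
    hence "(\<integral>x. (norm (s N x - s M x))\<^sup>2 \<partial>arc_measure) = (\<Sum>n=M..<N. (norm (a n))\<^sup>2)"
      by (simp add: arc_poly_norm)
    also have "\<dots> = (\<Sum>n<N. (norm (a n))\<^sup>2) - (\<Sum>n<M. (norm (a n))\<^sup>2)"
      using split[of "\<lambda>n. (norm (a n))\<^sup>2"] by simp
    also have "\<dots> \<le> \<tau> M" unfolding \<tau>_def using sq by (intro diff_right_mono sum_le_suminf) auto
    finally show ?thesis .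
  qed
  obtain u where u: "sq_int arc_measure u" "\<And>N. (\<integral>x. (norm (u x - s N x))\<^sup>2 \<partial>arc_measure) \<le> \<tau> N"
    using L2_complete_arc[OF ssq cau \<tau>0] by blast
  have um [measurable]: "u \<in> borel_measurable arc_measure" using u(1) by auto
  have L2: "(\<lambda>N. L2norm arc_measure (\<lambda>w. u w - s N w)) \<longlonglongrightarrow> 0"
  proof (rule tendsto_sandwich[OF _ _ tendsto_const])
    show "(\<lambda>N. sqrt (\<tau> N)) \<longlonglongrightarrow> 0" using tendsto_real_sqrt[OF \<tau>0] by simp
    show "\<forall>\<^sub>F N in sequentially. L2norm arc_measure (\<lambda>w. u w - s N w) \<le> sqrt (\<tau> N)"
      using u(2) by (intro always_eventually allI) (simp add: L2norm_def)
  qed auto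
  define g where "g n = (if n = 0 then 0 else a n / of_nat n)" for n
  have ga: "of_nat n * g n = (if n = 0 then 0 else a n)" for n by (simp add: g_def)
  have g: "summable (\<lambda>n. norm (g n))"
  proof (rule summable_comparison_test')
    show "summable (\<lambda>n. (norm (a n))\<^sup>2 + inverse (real n ^ 2))"
      by (intro summable_add sq inverse_power_summable) auto
    fix n
    have "2 * norm (a n) * inverse (real n) \<le> (norm (a n))\<^sup>2 + (inverse (real n))\<^sup>2"
      by (rule sum_squares_bound)
    moreover have "0 \<le> norm (a n) * inverse (real n)" by simp
    ultimately have "norm (a n) * inverse (real n) \<le> (norm (a n))\<^sup>2 + (inverse (real n))\<^sup>2" by linarith
    thus "norm (norm (g n)) \<le> (norm (a n))\<^sup>2 + inverse (real n ^ 2)"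
      by (auto simp: g_def norm_mult norm_inverse divide_inverse power_inverse)
  qed
  define G where "G w = (\<Sum>n. g n * w ^ n)" for w
  \<comment> \<open>The boundary function in the angle, extended by 0 outside one period so that it is integrable on the line.\<close>
  define W where "W t = indicator {0..2*pi} t *\<^sub>R u (cis t)" for t
  have Wint: "integrable lborel W"
    using integrable_arc[OF um] sq_int_arc_integrable(1)[OF u(1)] unfolding set_integrable_def W_def by simp
  have Won: "W integrable_on {x..y}" for x y
    using integrable_on_subinterval[OF integrable_on_lborel[OF Wint], of x y] by simp
  have \<Phi>: "integral {0..\<theta>} W = a 0 * of_real \<theta> - \<i> * (G (cis \<theta>) - G 1)" if \<theta>: "0 \<le> \<theta>" "\<theta> \<le> 2*pi" for \<theta>
  proof -
    \<comment> \<open>Both sides are limits of the integrals of the Taylor polynomials: the left one by convergence in mean, the right one by integrating term by term.\<close>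
    define L where "L N = (LINT t:{0..\<theta>}|lborel. s N (cis t))" for N
    have Wset: "set_integrable lborel {0..\<theta>} W"
      unfolding set_integrable_def using Wint by (intro integrable_mult_indicator) auto
    have sset: "set_integrable lborel A (\<lambda>t. s N (cis t))" if "A = {0..x}" for A x N
      unfolding that by (intro borel_integrable_atLeastAtMost' continuous_on_compose2[OF sc[of UNIV]] continuous_intros) auto
    have "L \<longlonglongrightarrow> integral {0..\<theta>} W"
    proof (rule LIM_zero_cancel, rule tendsto_norm_zero_cancel, rule tendsto_sandwich[OF _ _ tendsto_const])
      show "(\<lambda>N. 2 * pi * L2norm arc_measure (\<lambda>w. u w - s N w)) \<longlonglongrightarrow> 0"
        using tendsto_mult_right_zero[OF L2, of "2*pi"] by simp
      show "\<forall>\<^sub>F N in sequentially. norm (L N - integral {0..\<theta>} W) \<le> 2 * pi * L2norm arc_measure (\<lambda>w. u w - s N w)"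
      proof (intro always_eventually allI)
        fix N
        have dsq: "sq_int arc_measure (\<lambda>w. u w - s N w)" by (intro sq_int_diff u ssq)
        hence [measurable]: "(\<lambda>w. u w - s N w) \<in> borel_measurable arc_measure" by auto
        have nm: "(\<lambda>w. norm (u w - s N w)) \<in> borel_measurable arc_measure" by measurable
        have int1: "integrable lborel (\<lambda>t. indicator {0..2*pi} t *\<^sub>R norm (u (cis t) - s N (cis t)))"
          using integrable_arc[OF nm] integrable_norm[OF sq_int_arc_integrable(1)[OF dsq]] by (simp add: set_integrable_def)
        have "L N - integral {0..\<theta>} W = (LINT t:{0..\<theta>}|lborel. s N (cis t) - W t)"
          unfolding L_def set_borel_integral_eq_integral(2)[OF Wset, symmetric]
          by (rule set_integral_diff(2)[symmetric]) (use sset Wset in auto)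
        also have "norm \<dots> \<le> (\<integral>t. norm (indicator {0..\<theta>} t *\<^sub>R (s N (cis t) - W t)) \<partial>lborel)"
          unfolding set_lebesgue_integral_def by (rule integral_norm_bound)
        also have "\<dots> \<le> (\<integral>t. indicator {0..2*pi} t *\<^sub>R norm (u (cis t) - s N (cis t)) \<partial>lborel)"
        proof (rule integral_mono)
          show "integrable lborel (\<lambda>t. norm (indicator {0..\<theta>} t *\<^sub>R (s N (cis t) - W t)))"
            using set_integral_diff(1)[OF sset[OF refl] Wset] by (intro integrable_norm) (simp add: set_integrable_def)
          show "integrable lborel (\<lambda>t. indicator {0..2*pi} t *\<^sub>R norm (u (cis t) - s N (cis t)))" by (rule int1)
          fix t
          show "norm (indicator {0..\<theta>} t *\<^sub>R (s N (cis t) - W t)) \<le> indicator {0..2*pi} t *\<^sub>R norm (u (cis t) - s N (cis t))"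
            using \<theta> by (auto simp: indicator_def W_def norm_minus_commute)
        qed
        also have "\<dots> = 2 * pi * (\<integral>w. norm (u w - s N w) \<partial>arc_measure)"
          unfolding integral_arc[OF nm] set_lebesgue_integral_def by simp
        also have "\<dots> \<le> 2 * pi * L2norm arc_measure (\<lambda>w. u w - s N w)"
          using sq_int_arc_integrable(2)[OF dsq] by (intro mult_left_mono) auto
        finally show "norm (L N - integral {0..\<theta>} W) \<le> 2 * pi * L2norm arc_measure (\<lambda>w. u w - s N w)" .
      qed
    qed auto
    moreover have "L \<longlonglongrightarrow> a 0 * of_real \<theta> - \<i> * (G (cis \<theta>) - G 1)"
    proof -
      define F where "F N t = (\<Sum>n<N. if n = 0 then a 0 * of_real t else - \<i> * g n * cis (real n * t))" for N t
      have D: "(F N has_vector_derivative s N (cis t)) (at t within T)" for N t T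
        unfolding F_def s_def
      proof (rule has_vector_derivative_sum)
        fix n
        show "((\<lambda>t. if n = 0 then a 0 * of_real t else - \<i> * g n * cis (real n * t)) has_vector_derivative a n * cis t ^ n) (at t within T)"
        proof (cases "n = 0")
          case True
          have "((\<lambda>z. a 0 * z) has_field_derivative a 0) (at (of_real t))"
            by (auto intro!: derivative_eq_intros)
          from has_vector_derivative_real_field[OF this, of T] show ?thesis using True by simp
        next
          case False
          have "((\<lambda>z. - \<i> * g n * exp (\<i> * of_nat n * z)) has_field_derivative a n * exp (\<i> * of_nat n * of_real t)) (at (of_real t))"
            using False by (auto intro!: derivative_eq_intros simp: g_def)
          note D = has_vector_derivative_real_field[OF this, of T]
          have "cis t ^ n = exp (\<i> * of_nat n * of_real t)"
            unfolding Complex.DeMoivre unfolding cis_conv_exp by (simp add: mult.assoc)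
          moreover have "cis (real n * t) = exp (\<i> * of_nat n * of_real t)" for t
            by (simp only: cis_conv_exp) (simp add: mult.assoc)
          ultimately show ?thesis using False D by (simp only: if_False)
        qed
      qed
      have LF: "L N = F N \<theta> - F N 0" for N
        unfolding L_def set_lebesgue_integral_def
        by (rule integral_FTC_atLeastAtMost[OF \<theta>(1) D]) (intro continuous_on_compose2[OF sc[of UNIV]] continuous_intros, auto)
      have LF2: "L N = a 0 * of_real \<theta> - \<i> * ((\<Sum>n<N. g n * cis \<theta> ^ n) - (\<Sum>n<N. g n * 1 ^ n))" if "N \<ge> 1" for N
      proof -
        have "F N t = (if 0 < N then a 0 * of_real t else 0) + (- \<i> * (\<Sum>n<N. g n * cis t ^ n))" for t
        proof -
          have "F N t = (\<Sum>n<N. (if n = 0 then a 0 * of_real t else 0) + (- \<i> * (g n * cis t ^ n)))"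
            unfolding F_def by (intro sum.cong refl) (auto simp: g_def Complex.DeMoivre)
          also have "\<dots> = (\<Sum>n<N. (if n = 0 then a 0 * of_real t else 0)) + (- \<i> * (\<Sum>n<N. g n * cis t ^ n))"
            by (simp only: sum.distrib sum_distrib_left)
          finally show ?thesis by simp
        qed
        from this[of \<theta>] this[of 0] show ?thesis unfolding LF using that by (simp add: algebra_simps)
      qed
      have "(\<lambda>N. a 0 * of_real \<theta> - \<i> * ((\<Sum>n<N. g n * cis \<theta> ^ n) - (\<Sum>n<N. g n * 1 ^ n))) \<longlonglongrightarrow> a 0 * of_real \<theta> - \<i> * (G (cis \<theta>) - G 1)"
        unfolding G_def
        by (intro tendsto_intros summable_LIMSEQ summable_norm_cancel[OF summable_norm_mult_power[OF g]]) auto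
      moreover have "\<forall>\<^sub>F N in sequentially. a 0 * of_real \<theta> - \<i> * ((\<Sum>n<N. g n * cis \<theta> ^ n) - (\<Sum>n<N. g n * 1 ^ n)) = L N"
        using eventually_ge_at_top[of 1] by eventually_elim (simp only: LF2)
      ultimately show ?thesis by (rule Lim_transform_eventually)
    qed
    ultimately show ?thesis by (rule LIMSEQ_unique)
  qed
  obtain Z where Z: "negligible Z" "\<And>x c. x \<notin> Z \<Longrightarrow> c < x \<Longrightarrow> ((\<lambda>x. integral {c..x} W) has_vector_derivative W x) (at x)"
    using ae_derivative_indefinite_integral[OF Won] by blast
  have "AE w in arc_measure. ((\<lambda>r. \<Sum>n. a n * (of_real r * w) ^ n) \<longlongrightarrow> u w) (at_left (1::real))"
  proof (rule AE_arc_cis[OF Z(1)])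
    fix \<theta> assume \<theta>: "\<theta> \<in> {0<..<2 * pi} - Z"
    define w0 where "w0 = cis \<theta>"
    have n0: "norm w0 = 1" by (simp add: w0_def)
    have cc: "w0 * cnj w0 = 1" using n0 by (simp add: complex_norm_square[symmetric])
    define d where "d = \<i> * (u w0 - a 0)"
    have "((\<lambda>x. integral {0..x} W) has_vector_derivative W \<theta>) (at \<theta>)"
      using Z(2)[of \<theta> 0] \<theta> by auto
    moreover have "W \<theta> = u w0" using \<theta> by (simp add: W_def w0_def)
    ultimately have d1: "((\<lambda>x. integral {0..x} W) has_vector_derivative u w0) (at \<theta>)" by simp
    have d2: "((\<lambda>t. G 1 + \<i> * (integral {0..t} W - a 0 * of_real t)) has_vector_derivative d) (at \<theta>)"
      unfolding d_def
      by (rule derivative_eq_intros has_vector_derivative_mult_right has_vector_derivative_diff d1 has_vector_derivative_of_real | simp)+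
    have \<Gamma>: "((\<lambda>t. G (cis t)) has_derivative (\<lambda>h. h *\<^sub>R d)) (at \<theta>)"
      unfolding has_vector_derivative_def[symmetric]
    proof (rule has_vector_derivative_transform_within_open[OF d2, of "{0<..<2*pi}"])
      fix t assume "t \<in> {0<..<2*pi}"
      thus "G 1 + \<i> * (integral {0..t} W - a 0 * of_real t) = G (cis t)"
        by (subst \<Phi>) (auto simp: algebra_simps)
    qed (use \<theta> in auto)
    \<comment> \<open>A smooth local angle function at \<open>w0\<close>, to transfer the derivative from the line to the circle.\<close>
    define q where "q w = \<theta> + Im (Ln (w * cnj w0))" for w
    have q: "(q has_derivative (\<lambda>h. Im (h * cnj w0))) (at w0)"
    proof -
      have "((\<lambda>w. Ln (w * cnj w0)) has_field_derivative cnj w0) (at w0)"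
        by (auto intro!: derivative_eq_intros simp: cc)
      hence "((\<lambda>w. Ln (w * cnj w0)) has_derivative (\<lambda>h. h * cnj w0)) (at w0)"
        by (simp add: has_field_derivative_def mult_commute_abs)
      from has_derivative_add[OF has_derivative_const has_derivative_Im[OF this], of \<theta>] show ?thesis
        unfolding q_def by simp
    qed
    have q0: "q w0 = \<theta>" by (simp add: q_def cc)
    have "((\<lambda>w. G (cis (q w))) has_derivative (\<lambda>h. Im (h * cnj w0) *\<^sub>R d)) (at w0)"
      using has_derivative_compose[OF q, of "\<lambda>t. G (cis t)" "\<lambda>h. h *\<^sub>R d"] \<Gamma> q0 by simp
    note D = this[unfolded has_derivative_at_alt, THEN conjunct2, rule_format]
    have cq: "cis (q w) = w" if "norm w = 1" for w
    proof -
      have nz: "w * cnj w0 \<noteq> 0" using that n0 by (metis norm_mult complex_mod_cnj mult_1 norm_zero zero_neq_one)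
      have "cis (Im (Ln (w * cnj w0))) = sgn (w * cnj w0)"
        using cis_Arg[OF nz] Arg_eq_Im_Ln[OF nz] by simp
      also have "\<dots> = w * cnj w0" using that n0 by (simp add: sgn_eq norm_mult)
      finally have "cis (q w) = w0 * (w * cnj w0)"
        by (simp add: q_def w0_def flip: cis_mult)
      also have "\<dots> = w" using cc by (simp add: mult.left_commute)
      finally show ?thesis .
    qed
    have lim: "((\<lambda>r. \<Sum>n. g n * (of_nat n * (of_real r * w0) ^ n)) \<longlongrightarrow> - \<i> * d) (at_left (1::real))"
    proof (rule fatou_derivative[OF g n0])
      fix \<epsilon> :: real assume "\<epsilon> > 0"
      from D[OF this] obtain \<delta> where \<delta>: "\<delta> > 0" "\<And>y. norm (y - w0) < \<delta> \<Longrightarrow>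
          norm (G (cis (q y)) - G (cis (q w0)) - Im ((y - w0) * cnj w0) *\<^sub>R d) \<le> \<epsilon> * norm (y - w0)" by blast
      show "\<exists>\<delta>>0. \<forall>w. norm w = 1 \<longrightarrow> norm (w - w0) < \<delta> \<longrightarrow>
         norm ((\<Sum>n. g n * w ^ n) - (\<Sum>n. g n * w0 ^ n) - d * of_real (Im (w * cnj w0))) \<le> \<epsilon> * norm (w - w0)"
      proof (intro exI[of _ \<delta>] conjI allI impI \<delta>(1))
        fix w assume w: "norm w = 1" "norm (w - w0) < \<delta>"
        have "Im ((w - w0) * cnj w0) = Im (w * cnj w0)"
          by (simp only: left_diff_distrib cc) simp
        thus "norm ((\<Sum>n. g n * w ^ n) - (\<Sum>n. g n * w0 ^ n) - d * of_real (Im (w * cnj w0))) \<le> \<epsilon> * norm (w - w0)"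
          using \<delta>(2)[OF w(2)] unfolding cq[OF w(1)] cq[OF n0] G_def
          by (simp only: scaleR_conv_of_real mult.commute)
      qed
    qed
    have "((\<lambda>r. a 0 + (\<Sum>n. g n * (of_nat n * (of_real r * w0) ^ n))) \<longlongrightarrow> a 0 + - \<i> * d) (at_left (1::real))"
      by (intro tendsto_intros lim)
    moreover have "a 0 + - \<i> * d = u (cis \<theta>)" by (simp add: d_def w0_def algebra_simps)
    moreover have "\<forall>\<^sub>F r in at_left (1::real). a 0 + (\<Sum>n. g n * (of_nat n * (of_real r * w0) ^ n)) = (\<Sum>n. a n * (of_real r * w0) ^ n)"
    proof -
      have "\<forall>\<^sub>F r in at_left (1::real). r \<in> {0<..<1}" by (rule eventually_at_leftI[of 0]) auto
      thus ?thesis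
      proof eventually_elim
        case (elim r)
        define z where "z = of_real r * w0"
        have z: "norm z < 1" using elim n0 by (simp add: z_def norm_mult)
        have "summable (\<lambda>n. a n * z ^ n)"
        proof (rule summable_norm_cancel, rule summable_comparison_test')
          show "summable (\<lambda>n. (norm (a n))\<^sup>2 + (norm z ^ 2) ^ n)"
            using z by (intro summable_add sq summable_geometric) (simp add: abs_square_less_1)
          fix n
          have "2 * norm (a n) * norm z ^ n \<le> (norm (a n))\<^sup>2 + (norm z ^ n)\<^sup>2"
            by (rule sum_squares_bound)
          moreover have "0 \<le> norm (a n) * norm z ^ n" by simp
          ultimately have "norm (a n) * norm z ^ n \<le> (norm (a n))\<^sup>2 + (norm z ^ n)\<^sup>2" by linarith
          moreover have "(norm z ^ n)\<^sup>2 = (norm z ^ 2) ^ n" by (metis power_mult mult.commute)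
          ultimately show "norm (norm (a n * z ^ n)) \<le> (norm (a n))\<^sup>2 + (norm z ^ 2) ^ n"
            by (simp add: norm_mult norm_power)
        qed
        from suminf_split_head[OF this]
        have e: "(\<Sum>n. a (Suc n) * z ^ Suc n) = (\<Sum>n. a n * z ^ n) - a 0" by simp
        have eq: "(\<lambda>n. g n * (of_nat n * z ^ n)) = (\<lambda>n. (if n = 0 then 0 else a n * z ^ n))"
          by (auto simp: g_def)
        have "(\<lambda>n. a (Suc n) * z ^ Suc n) sums ((\<Sum>n. a n * z ^ n) - a 0)"
          using \<open>summable (\<lambda>n. a n * z ^ n)\<close> unfolding e[symmetric] by (intro summable_sums) (subst summable_Suc_iff)
        hence "(\<lambda>n. (if n = 0 then 0 else a n * z ^ n)) sums ((\<Sum>n. a n * z ^ n) - a 0)"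
          by (intro sums_Suc_imp[where f="\<lambda>n. if n = 0 then 0 else a n * z ^ n"]) simp_all
        hence "(\<Sum>n. g n * (of_nat n * z ^ n)) = (\<Sum>n. a n * z ^ n) - a 0"
          unfolding eq by (simp add: sums_iff)
        thus ?case unfolding z_def by simp
      qed
    qed
    ultimately show "((\<lambda>r. \<Sum>n. a n * (of_real r * cis \<theta>) ^ n) \<longlongrightarrow> u (cis \<theta>)) (at_left (1::real))"
      unfolding w0_def[symmetric] using Lim_transform_eventually by fastforce
  qed
  thus ?thesis using that u(1) L2 unfolding s_def by blast
qed

section \<open>The Hardy space as a Hilbert space\<close>

text \<open>Radial limits are specified only where they exist, so they are measurable for the completed
  measure only; every integral of them is reduced to one of a Borel function.\<close>

lemma borel_measurable_completion_AE:
  assumes g: "g \<in> borel_measurable M" and eq: "AE x in M. f x = g x"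
  shows "f \<in> borel_measurable (completion M)"
proof (rule measurableI)
  fix A :: "'b set" assume A: "A \<in> sets borel"
  have "g -` A \<inter> space M \<in> sets (completion M)"
    using measurable_sets[OF g A] by auto
  hence 1: "Measurable.pred (completion M) (\<lambda>x. g x \<in> A)"
    by (simp add: pred_def vimage_def Int_def conj_commute)
  have 2: "Measurable.pred (completion M) (\<lambda>x. f x \<noteq> g x)"
    by (rule sets_completion_AE) (use eq in auto)
  have 3: "Measurable.pred (completion M) (\<lambda>x. f x \<noteq> g x \<and> f x \<in> A)"
    by (rule sets_completion_AE) (use eq in auto)
  have "Measurable.pred (completion M) (\<lambda>x. (g x \<in> A \<and> \<not> (f x \<noteq> g x)) \<or> (f x \<noteq> g x \<and> f x \<in> A))"
    using 1 2 3 by measurable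
  moreover have "(\<lambda>x. (g x \<in> A \<and> \<not> (f x \<noteq> g x)) \<or> (f x \<noteq> g x \<and> f x \<in> A)) = (\<lambda>x. f x \<in> A)"
    by auto
  ultimately have "Measurable.pred (completion M) (\<lambda>x. f x \<in> A)" by (simp only:)
  thus "f -` A \<inter> space (completion M) \<in> sets (completion M)"
    by (simp add: pred_def vimage_def Int_def conj_commute)
qed auto

lemma integral_completion_AE:
  fixes g :: "'a \<Rightarrow> 'b::{banach, second_countable_topology}"
  assumes g: "g \<in> borel_measurable M" and eq: "AE x in M. f x = g x"
  shows "integral\<^sup>L (completion M) f = integral\<^sup>L M g"
proof -
  have "integral\<^sup>L (completion M) f = integral\<^sup>L (completion M) g"
    by (intro integral_cong_AE borel_measurable_completion_AE[OF assms] measurable_completion g AE_completion eq)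
  thus ?thesis using integral_completion[OF g] by simp
qed

text \<open>The means increase with \<open>r\<close> to the sum of the squares of the coefficients.\<close>

lemma hardy2_iff:
  "f \<in> hardy2 \<longleftrightarrow> f holomorphic_on ball 0 1 \<and> (\<forall>z. z \<notin> ball 0 1 \<longrightarrow> f z = 0) \<and>
     summable (\<lambda>n. (norm (hcoeff f n))\<^sup>2)"
proof -
  have "bdd_above ((\<lambda>r. \<integral>x. (norm (f (of_real r * x)))\<^sup>2 \<partial>arc_lebesgue) ` {0..<1::real}) \<longleftrightarrow> summable (\<lambda>n. (norm (hcoeff f n))\<^sup>2)"
    if f: "f holomorphic_on ball 0 1"
  proof -
    have eq: "(\<integral>x. (norm (f (of_real r * x)))\<^sup>2 \<partial>arc_lebesgue) = (\<Sum>n. (norm (hcoeff f n))\<^sup>2 * r ^ (2 * n))"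
      if "r \<in> {0..<1}" for r
    proof -
      have "(\<lambda>x. (norm (f (of_real r * x)))\<^sup>2) \<in> borel_measurable arc_measure"
        using that by (intro borel_measurable_arc_continuous continuous_intros continuous_on_dilate f) auto
      thus ?thesis using circle_mean_square(2)[OF f, of r] that by (simp add: integral_completion)
    qed
    show ?thesis
    proof
      assume "bdd_above ((\<lambda>r. \<integral>x. (norm (f (of_real r * x)))\<^sup>2 \<partial>arc_lebesgue) ` {0..<1::real})"
      then obtain B where "\<forall>r\<in>{0..<1}. (\<integral>x. (norm (f (of_real r * x)))\<^sup>2 \<partial>arc_lebesgue) \<le> B"
        unfolding bdd_above_def by blast
      hence B: "\<And>r. r \<in> {0..<1} \<Longrightarrow> (\<Sum>n. (norm (hcoeff f n))\<^sup>2 * r ^ (2 * n)) \<le> B"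
        using eq by simp
      have "(\<Sum>n<N. (norm (hcoeff f n))\<^sup>2) \<le> B" for N
      proof (rule tendsto_upperbound)
        show "((\<lambda>r. \<Sum>n<N. (norm (hcoeff f n))\<^sup>2 * r ^ (2 * n)) \<longlongrightarrow> (\<Sum>n<N. (norm (hcoeff f n))\<^sup>2)) (at_left (1::real))"
          by (auto intro!: tendsto_eq_intros)
        have "\<forall>\<^sub>F r in at_left (1::real). r \<in> {0<..<1}" by (rule eventually_at_leftI[of 0]) auto
        thus "\<forall>\<^sub>F r in at_left (1::real). (\<Sum>n<N. (norm (hcoeff f n))\<^sup>2 * r ^ (2 * n)) \<le> B"
        proof eventually_elim
          case (elim r)
          have "(\<Sum>n<N. (norm (hcoeff f n))\<^sup>2 * r ^ (2 * n)) \<le> (\<Sum>n. (norm (hcoeff f n))\<^sup>2 * r ^ (2 * n))"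
            using elim by (intro sum_le_suminf circle_mean_square(1)[OF f]) auto
          thus ?case using B[of r] elim by auto
        qed
      qed auto
      thus "summable (\<lambda>n. (norm (hcoeff f n))\<^sup>2)"
        by (intro summableI_nonneg_bounded[of _ B]) auto
    next
      assume s: "summable (\<lambda>n. (norm (hcoeff f n))\<^sup>2)"
      show "bdd_above ((\<lambda>r. \<integral>x. (norm (f (of_real r * x)))\<^sup>2 \<partial>arc_lebesgue) ` {0..<1::real})"
      proof (rule bdd_aboveI2)
        fix r :: real assume r: "r \<in> {0..<1}"
        have "(\<Sum>n. (norm (hcoeff f n))\<^sup>2 * r ^ (2 * n)) \<le> (\<Sum>n. (norm (hcoeff f n))\<^sup>2)"
          using r by (intro suminf_le s circle_mean_square(1)[OF f]) (auto intro!: mult_left_le power_le_one)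
        thus "(\<integral>x. (norm (f (of_real r * x)))\<^sup>2 \<partial>arc_lebesgue) \<le> (\<Sum>n. (norm (hcoeff f n))\<^sup>2)"
          using eq[OF r] by simp
      qed
    qed
  qed
  thus ?thesis unfolding hardy2_def by auto
qed

lemma hardy2_holomorphic: "f \<in> hardy2 \<Longrightarrow> f holomorphic_on ball 0 1"
  and hardy2_outside: "f \<in> hardy2 \<Longrightarrow> \<not> norm z < 1 \<Longrightarrow> f z = 0"
  and hardy2_summable: "f \<in> hardy2 \<Longrightarrow> summable (\<lambda>n. (norm (hcoeff f n))\<^sup>2)"
  by (auto simp: hardy2_iff)

lemma hardy2_sums: "f \<in> hardy2 \<Longrightarrow> norm z < 1 \<Longrightarrow> (\<lambda>n. hcoeff f n * z ^ n) sums f z"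
  by (rule hcoeff_sums[OF hardy2_holomorphic])

definition hfun :: "(nat \<Rightarrow> complex) \<Rightarrow> complex \<Rightarrow> complex" where
  "hfun c z = (if norm z < 1 then \<Sum>n. c n * z ^ n else 0)"

lemma sq_summable_powser:
  fixes c :: "nat \<Rightarrow> complex"
  assumes "summable (\<lambda>n. (norm (c n))\<^sup>2)" "norm z < 1"
  shows "summable (\<lambda>n. norm (c n * z ^ n))"
proof (rule summable_comparison_test')
  show "summable (\<lambda>n. (norm (c n))\<^sup>2 + (norm z ^ 2) ^ n)"
    using assms by (intro summable_add summable_geometric) (simp_all add: abs_square_less_1)
  fix n
  have "2 * norm (c n) * norm z ^ n \<le> (norm (c n))\<^sup>2 + (norm z ^ n)\<^sup>2"
    by (rule sum_squares_bound)
  moreover have "0 \<le> norm (c n) * norm z ^ n" by simp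
  ultimately have "norm (c n) * norm z ^ n \<le> (norm (c n))\<^sup>2 + (norm z ^ n)\<^sup>2" by linarith
  moreover have "(norm z ^ n)\<^sup>2 = (norm z ^ 2) ^ n" by (metis power_mult mult.commute)
  ultimately show "norm (norm (c n * z ^ n)) \<le> (norm (c n))\<^sup>2 + (norm z ^ 2) ^ n"
    by (simp add: norm_mult norm_power)
qed

lemma hfun:
  assumes "summable (\<lambda>n. (norm (c n))\<^sup>2)"
  shows "hfun c \<in> hardy2" "hcoeff (hfun c) = c"
proof -
  have *: "(\<lambda>n. c n * z ^ n) sums hfun c z" if "norm z < 1" for z
    using summable_norm_cancel[OF sq_summable_powser[OF assms that]] that by (simp add: hfun_def summable_sums)
  note powser_hcoeff[OF this]
  thus "hfun c \<in> hardy2" "hcoeff (hfun c) = c" using assms by (simp_all only: hardy2_iff) (simp add: hfun_def)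
qed

lemma hardy2_eqI:
  assumes "f \<in> hardy2" "g \<in> hardy2" "hcoeff f = hcoeff g"
  shows "f = g"
proof
  fix z show "f z = g z"
    using hardy2_sums[OF assms(1), of z] hardy2_sums[OF assms(2), of z] assms(3)
      hardy2_outside[OF assms(1), of z] hardy2_outside[OF assms(2), of z] sums_unique2
    by (cases "norm z < 1") auto
qed

lemma hardy2_lincomb:
  assumes f: "f \<in> hardy2" and g: "g \<in> hardy2"
  shows "(\<lambda>z. c * f z + d * g z) \<in> hardy2" "hcoeff (\<lambda>z. c * f z + d * g z) = (\<lambda>n. c * hcoeff f n + d * hcoeff g n)"
proof -
  have *: "(\<lambda>n. (c * hcoeff f n + d * hcoeff g n) * z ^ n) sums (c * f z + d * g z)" if "norm z < 1" for z
  proof -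
    have "(\<lambda>n. c * (hcoeff f n * z ^ n) + d * (hcoeff g n * z ^ n)) sums (c * f z + d * g z)"
      by (intro sums_add sums_mult hardy2_sums f g that)
    thus ?thesis by (simp add: algebra_simps)
  qed
  note p = powser_hcoeff[OF this]
  show "hcoeff (\<lambda>z. c * f z + d * g z) = (\<lambda>n. c * hcoeff f n + d * hcoeff g n)" by (rule p(2))
  have "summable (\<lambda>n. (norm (c * hcoeff f n + d * hcoeff g n))\<^sup>2)"
  proof (rule summable_comparison_test')
    show "summable (\<lambda>n. 2 * ((norm c)\<^sup>2 * (norm (hcoeff f n))\<^sup>2 + (norm d)\<^sup>2 * (norm (hcoeff g n))\<^sup>2))"
      by (intro summable_mult summable_add hardy2_summable f g)
    fix n
    have "(norm (c * hcoeff f n + d * hcoeff g n))\<^sup>2 \<le> (norm (c * hcoeff f n) + norm (d * hcoeff g n))\<^sup>2"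
      by (intro power_mono norm_triangle_ineq) auto
    also have "\<dots> \<le> 2 * ((norm (c * hcoeff f n))\<^sup>2 + (norm (d * hcoeff g n))\<^sup>2)"
      using sum_squares_bound[of "norm (c * hcoeff f n)" "norm (d * hcoeff g n)"] by (simp add: power2_eq_square algebra_simps)
    finally show "norm ((norm (c * hcoeff f n + d * hcoeff g n))\<^sup>2) \<le> 2 * ((norm c)\<^sup>2 * (norm (hcoeff f n))\<^sup>2 + (norm d)\<^sup>2 * (norm (hcoeff g n))\<^sup>2)"
      by (simp add: norm_mult power_mult_distrib)
  qed
  thus "(\<lambda>z. c * f z + d * g z) \<in> hardy2"
    using p hardy2_outside[OF f] hardy2_outside[OF g] by (simp add: hardy2_iff)
qed

lemma hardy2_add: "f \<in> hardy2 \<Longrightarrow> g \<in> hardy2 \<Longrightarrow> (\<lambda>z. f z + g z) \<in> hardy2"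
  using hardy2_lincomb(1)[of f g 1 1] by simp

lemma hardy2_diff: "f \<in> hardy2 \<Longrightarrow> g \<in> hardy2 \<Longrightarrow> (\<lambda>z. f z - g z) \<in> hardy2"
  using hardy2_lincomb(1)[of f g 1 "-1"] by simp

lemma hardy2_cmult: "f \<in> hardy2 \<Longrightarrow> (\<lambda>z. c * f z) \<in> hardy2"
  using hardy2_lincomb(1)[of f f c 0] by simp

subsection \<open>Boundary functions\<close>

definition bdry :: "(complex \<Rightarrow> complex) \<Rightarrow> complex \<Rightarrow> complex" where
  "bdry f = (SOME u. u \<in> borel_measurable arc_measure \<and>
     (AE x in arc_measure. ((\<lambda>r. f (of_real r * x)) \<longlongrightarrow> u x) (at_left (1::real))))"

lemma bdry:
  assumes f: "f \<in> hardy2"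
  shows "sq_int arc_measure (bdry f)"
    and "AE x in arc_measure. ((\<lambda>r. f (of_real r * x)) \<longlongrightarrow> bdry f x) (at_left (1::real))"
    and "(\<lambda>N. L2norm arc_measure (\<lambda>x. bdry f x - (\<Sum>n<N. hcoeff f n * x ^ n))) \<longlonglongrightarrow> 0"
proof -
  obtain u where u: "sq_int arc_measure u"
    "(\<lambda>N. L2norm arc_measure (\<lambda>x. u x - (\<Sum>n<N. hcoeff f n * x ^ n))) \<longlonglongrightarrow> 0"
    "AE x in arc_measure. ((\<lambda>r. \<Sum>n. hcoeff f n * (of_real r * x) ^ n) \<longlongrightarrow> u x) (at_left (1::real))"
    using fatou_L2[OF hardy2_summable[OF f]] by blast
  have "AE x in arc_measure. x \<in> sphere 0 1" using AE_space[of arc_measure] by simp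
  with u(3) have lim: "AE x in arc_measure. ((\<lambda>r. f (of_real r * x)) \<longlongrightarrow> u x) (at_left (1::real))"
  proof eventually_elim
    case (elim x)
    have "\<forall>\<^sub>F r in at_left (1::real). r \<in> {0<..<1}" by (rule eventually_at_leftI[of 0]) auto
    hence "\<forall>\<^sub>F r in at_left (1::real). (\<Sum>n. hcoeff f n * (of_real r * x) ^ n) = f (of_real r * x)"
    proof eventually_elim
      case (elim r)
      have "norm (of_real r * x) < 1" using elim \<open>x \<in> sphere 0 1\<close> by (simp add: norm_mult)
      from sums_unique[OF hardy2_sums[OF f this]] show ?case by simp
    qed
    with elim(1) show ?case by (rule Lim_transform_eventually)
  qed
  have "u \<in> borel_measurable arc_measure" using u by auto
  with lim have "\<exists>u. u \<in> borel_measurable arc_measure \<and>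
     (AE x in arc_measure. ((\<lambda>r. f (of_real r * x)) \<longlongrightarrow> u x) (at_left (1::real)))" by blast
  hence b: "bdry f \<in> borel_measurable arc_measure \<and>
     (AE x in arc_measure. ((\<lambda>r. f (of_real r * x)) \<longlongrightarrow> bdry f x) (at_left (1::real)))"
    unfolding bdry_def by (rule someI_ex)
  thus "AE x in arc_measure. ((\<lambda>r. f (of_real r * x)) \<longlongrightarrow> bdry f x) (at_left (1::real))" by simp
  with lim have eq: "AE x in arc_measure. u x = bdry f x"
    by eventually_elim (rule tendsto_unique[OF trivial_limit_at_left_real])
  thus "sq_int arc_measure (bdry f)" using sq_int_cong_AE[OF u(1)] b by blast
  have [measurable]: "u \<in> borel_measurable arc_measure" "bdry f \<in> borel_measurable arc_measure" using u b by auto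
  have [measurable]: "(\<lambda>x. \<Sum>n<N. hcoeff f n * x ^ n) \<in> borel_measurable arc_measure" for N
    by (intro borel_measurable_arc_continuous continuous_intros)
  have "L2norm arc_measure (\<lambda>x. u x - (\<Sum>n<N. hcoeff f n * x ^ n)) = L2norm arc_measure (\<lambda>x. bdry f x - (\<Sum>n<N. hcoeff f n * x ^ n))" for N
    by (rule L2norm_cong_AE) (measurable, use eq in auto)
  thus "(\<lambda>N. L2norm arc_measure (\<lambda>x. bdry f x - (\<Sum>n<N. hcoeff f n * x ^ n))) \<longlonglongrightarrow> 0"
    using u(2) by simp
qed

lemma bdry_measurable: "f \<in> hardy2 \<Longrightarrow> bdry f \<in> borel_measurable arc_measure"
  using bdry(1) by auto

lemma bdry_unique:
  assumes "f \<in> hardy2" "AE x in arc_measure. ((\<lambda>r. f (of_real r * x)) \<longlongrightarrow> v x) (at_left (1::real))"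
  shows "AE x in arc_measure. bdry f x = v x"
  using bdry(2)[OF assms(1)] assms(2) by eventually_elim (rule tendsto_unique[OF trivial_limit_at_left_real])

lemma bdry_lincomb:
  assumes f: "f \<in> hardy2" and g: "g \<in> hardy2"
  shows "AE x in arc_measure. bdry (\<lambda>z. c * f z + d * g z) x = c * bdry f x + d * bdry g x"
  by (rule bdry_unique[OF hardy2_lincomb(1)[OF f g]])
     (use bdry(2)[OF f] bdry(2)[OF g] in \<open>eventually_elim, intro tendsto_intros\<close>)

lemma radial_limit_bdry:
  assumes "f \<in> hardy2"
  shows "AE x in arc_measure. radial_limit f x = bdry f x"
  using bdry(2)[OF assms]
  by eventually_elim (auto simp: radial_limit_def intro!: tendsto_Lim)

lemma L2_inner_AE:
  assumes "sq_int arc_measure u'" "sq_int arc_measure v'"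
    "AE x in arc_measure. u x = u' x" "AE x in arc_measure. v x = v' x"
  shows "L2_inner u v = (\<integral>x. u' x * cnj (v' x) \<partial>arc_measure)"
  unfolding L2_inner_def
proof (rule integral_completion_AE)
  have [measurable]: "u' \<in> borel_measurable arc_measure" "v' \<in> borel_measurable arc_measure" using assms by auto
  show "(\<lambda>x. u' x * cnj (v' x)) \<in> borel_measurable arc_measure" by measurable
  show "AE x in arc_measure. u x * cnj (v x) = u' x * cnj (v' x)"
    using assms(3,4) by eventually_elim simp
qed

lemma hardy_inner_eq:
  assumes "f \<in> hardy2" "g \<in> hardy2"
  shows "hardy_inner f g = (\<integral>x. bdry f x * cnj (bdry g x) \<partial>arc_measure)"
  unfolding hardy_inner_def
  by (intro L2_inner_AE bdry radial_limit_bdry assms)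

lemma hardy_norm_eq:
  assumes f: "f \<in> hardy2"
  shows "hardy_norm f = L2norm arc_measure (bdry f)"
proof -
  have "hardy_inner f f = complex_of_real (\<integral>x. (norm (bdry f x))\<^sup>2 \<partial>arc_measure)"
    unfolding hardy_inner_eq[OF f f] complex_norm_square[symmetric] by (rule integral_complex_of_real)
  thus ?thesis by (simp add: hardy_norm_def L2norm_def)
qed

lemma hardy_norm_nonneg: "f \<in> hardy2 \<Longrightarrow> 0 \<le> hardy_norm f"
  by (simp add: hardy_norm_eq)

lemma hardy_norm_sq:
  "f \<in> hardy2 \<Longrightarrow> complex_of_real ((hardy_norm f)\<^sup>2) = hardy_inner f f"
  unfolding hardy_norm_eq L2norm_sq
  by (simp add: hardy_inner_eq complex_norm_square[symmetric] del: of_real_power)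

lemma hardy_inner_lincomb_left:
  assumes "f \<in> hardy2" "g \<in> hardy2" "k \<in> hardy2"
  shows "hardy_inner (\<lambda>z. c * f z + d * g z) k = c * hardy_inner f k + d * hardy_inner g k"
proof -
  note k = sq_int_cnj[OF bdry(1)[OF assms(3)]]
  note [measurable] = bdry_measurable[OF assms(1)] bdry_measurable[OF assms(2)] bdry_measurable[OF assms(3)]
    bdry_measurable[OF hardy2_lincomb(1)[OF assms(1,2)]]
  have "hardy_inner (\<lambda>z. c * f z + d * g z) k = (\<integral>x. c * (bdry f x * cnj (bdry k x)) + d * (bdry g x * cnj (bdry k x)) \<partial>arc_measure)"
    unfolding hardy_inner_eq[OF hardy2_lincomb(1)[OF assms(1,2)] assms(3)]
    by (rule integral_cong_AE) (measurable, use bdry_lincomb[OF assms(1,2), of c d] in \<open>eventually_elim, simp add: algebra_simps\<close>)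
  also have "\<dots> = c * hardy_inner f k + d * hardy_inner g k"
    using sq_int_mult_integrable[OF bdry(1)[OF assms(1)] k] sq_int_mult_integrable[OF bdry(1)[OF assms(2)] k] assms
    by (simp add: hardy_inner_eq)
  finally show ?thesis .
qed

lemma hardy_inner_commute: "f \<in> hardy2 \<Longrightarrow> g \<in> hardy2 \<Longrightarrow> hardy_inner f g = cnj (hardy_inner g f)"
  by (simp add: hardy_inner_eq Bochner_Integration.integral_cnj[symmetric] mult.commute del: Bochner_Integration.integral_cnj)

lemma hardy_inner_diff_left:
  "f \<in> hardy2 \<Longrightarrow> g \<in> hardy2 \<Longrightarrow> k \<in> hardy2 \<Longrightarrow> hardy_inner (\<lambda>z. f z - g z) k = hardy_inner f k - hardy_inner g k"
  using hardy_inner_lincomb_left[of f g k 1 "-1"] by simp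

lemma hardy_inner_diff_right:
  assumes "f \<in> hardy2" "g \<in> hardy2" "k \<in> hardy2"
  shows "hardy_inner k (\<lambda>z. f z - g z) = hardy_inner k f - hardy_inner k g"
  using assms hardy_inner_diff_left[OF assms] hardy2_diff[OF assms(1,2)]
  by (simp add: hardy_inner_commute[of k])

lemma hardy_cauchy_schwarz:
  assumes "f \<in> hardy2" "g \<in> hardy2"
  shows "norm (hardy_inner f g) \<le> hardy_norm f * hardy_norm g"
  using L2_cauchy_schwarz[OF bdry(1)[OF assms(1)] sq_int_cnj[OF bdry(1)[OF assms(2)]]] assms
  by (simp add: hardy_inner_eq hardy_norm_eq L2norm_def)

lemma hardy_norm_lincomb:
  assumes "f \<in> hardy2" "g \<in> hardy2"
  shows "hardy_norm (\<lambda>z. c * f z + d * g z) = L2norm arc_measure (\<lambda>x. c * bdry f x + d * bdry g x)"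
proof -
  note [measurable] = bdry_measurable[OF assms(1)] bdry_measurable[OF assms(2)] bdry_measurable[OF hardy2_lincomb(1)[OF assms(1,2)]]
  show ?thesis unfolding hardy_norm_eq[OF hardy2_lincomb(1)[OF assms]]
    by (rule L2norm_cong_AE) (measurable, rule bdry_lincomb[OF assms])
qed

lemma hardy_norm_triangle:
  assumes "f \<in> hardy2" "g \<in> hardy2"
  shows "hardy_norm (\<lambda>z. f z + g z) \<le> hardy_norm f + hardy_norm g"
  using hardy_norm_lincomb[OF assms, of 1 1] L2norm_triangle[OF bdry(1)[OF assms(1)] bdry(1)[OF assms(2)]] assms
  by (simp add: hardy_norm_eq)

lemma hardy_norm_cmult: "f \<in> hardy2 \<Longrightarrow> hardy_norm (\<lambda>z. c * f z) = norm c * hardy_norm f"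
  using hardy_norm_lincomb[of f f c 0] by (simp add: L2norm_cmult hardy_norm_eq)

lemma hardy_norm_triangle_diff:
  assumes "f \<in> hardy2" "g \<in> hardy2"
  shows "hardy_norm (\<lambda>z. f z - g z) \<le> hardy_norm f + hardy_norm g"
  using hardy_norm_triangle[OF assms(1) hardy2_cmult[OF assms(2), of "-1"]] hardy_norm_cmult[OF assms(2), of "-1"] by simp

lemma hardy_norm_zero: "hardy_norm (\<lambda>z. 0) = 0"
  by (simp add: hardy_norm_def hardy_inner_def L2_inner_def radial_limit_def tendsto_Lim[OF trivial_limit_at_left_real tendsto_const])

subsection \<open>Coefficients and truncations\<close>

text \<open>The Taylor polynomials converge to the boundary function in the mean. With \<open>v\<close> a monomial
  this identifies the Fourier coefficients, with \<open>v\<close> a Poisson kernel it is the Poisson formula.\<close>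

lemma hardy_inner_partial_sums:
  assumes f: "f \<in> hardy2" and v: "sq_int arc_measure v"
  shows "(\<lambda>N. \<Sum>n<N. hcoeff f n * (\<integral>x. x ^ n * v x \<partial>arc_measure)) \<longlonglongrightarrow> (\<integral>x. bdry f x * v x \<partial>arc_measure)"
proof -
  let ?S = "\<lambda>N x. \<Sum>n<N. hcoeff f n * x ^ n"
  have S: "sq_int arc_measure (?S N)" for N by (intro sq_int_continuous_arc continuous_intros)
  have pw: "sq_int arc_measure (\<lambda>x. x ^ n)" for n by (intro sq_int_continuous_arc continuous_intros)
  have eq: "(\<integral>x. ?S N x * v x \<partial>arc_measure) = (\<Sum>n<N. hcoeff f n * (\<integral>x. x ^ n * v x \<partial>arc_measure))" for N
  proof -
    have "(\<integral>x. ?S N x * v x \<partial>arc_measure) = (\<integral>x. (\<Sum>n<N. hcoeff f n * (x ^ n * v x)) \<partial>arc_measure)"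
      by (simp only: sum_distrib_right mult.assoc)
    also have "\<dots> = (\<Sum>n<N. (\<integral>x. hcoeff f n * (x ^ n * v x) \<partial>arc_measure))"
      by (rule Bochner_Integration.integral_sum) (intro integrable_mult_right sq_int_mult_integrable[OF pw v])
    finally show ?thesis by simp
  qed
  show ?thesis
  proof (rule LIM_zero_cancel, rule tendsto_norm_zero_cancel, rule tendsto_sandwich[OF _ _ tendsto_const])
    show "(\<lambda>N. L2norm arc_measure (\<lambda>x. bdry f x - ?S N x) * L2norm arc_measure v) \<longlonglongrightarrow> 0"
      by (rule tendsto_mult_left_zero[OF bdry(3)[OF f]])
    show "\<forall>\<^sub>F N in sequentially. norm ((\<Sum>n<N. hcoeff f n * (\<integral>x. x ^ n * v x \<partial>arc_measure)) - (\<integral>x. bdry f x * v x \<partial>arc_measure)) \<le> L2norm arc_measure (\<lambda>x. bdry f x - ?S N x) * L2norm arc_measure v"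
    proof (intro always_eventually allI)
      fix N
      have d: "(\<integral>x. bdry f x * v x \<partial>arc_measure) - (\<integral>x. ?S N x * v x \<partial>arc_measure) = (\<integral>x. (bdry f x - ?S N x) * v x \<partial>arc_measure)"
        unfolding left_diff_distrib
        by (rule Bochner_Integration.integral_diff[symmetric])
           (rule sq_int_mult_integrable[OF bdry(1)[OF f] v] sq_int_mult_integrable[OF S v])+
      have "norm ((\<Sum>n<N. hcoeff f n * (\<integral>x. x ^ n * v x \<partial>arc_measure)) - (\<integral>x. bdry f x * v x \<partial>arc_measure))
          = norm ((\<integral>x. bdry f x * v x \<partial>arc_measure) - (\<integral>x. ?S N x * v x \<partial>arc_measure))"
        unfolding eq by (rule norm_minus_commute)
      also have "\<dots> \<le> L2norm arc_measure (\<lambda>x. bdry f x - ?S N x) * L2norm arc_measure v"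
        unfolding d by (rule L2_cauchy_schwarz[OF sq_int_diff[OF bdry(1)[OF f] S] v])
      finally show "norm ((\<Sum>n<N. hcoeff f n * (\<integral>x. x ^ n * v x \<partial>arc_measure)) - (\<integral>x. bdry f x * v x \<partial>arc_measure)) \<le> L2norm arc_measure (\<lambda>x. bdry f x - ?S N x) * L2norm arc_measure v" .
    qed
  qed auto
qed

lemma bdry_coeff:
  assumes f: "f \<in> hardy2"
  shows "(\<integral>x. bdry f x * cnj (x ^ k) \<partial>arc_measure) = hcoeff f k"
proof -
  have "sq_int arc_measure (\<lambda>x. cnj (x ^ k))" by (intro sq_int_continuous_arc continuous_intros)
  note lim = hardy_inner_partial_sums[OF f this, unfolded arc_moment_cnj]
  have "\<forall>\<^sub>F N in sequentially. (\<Sum>n<N. hcoeff f n * (if n = k then 1 else 0)) = hcoeff f k"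
    using eventually_gt_at_top[of k]
  proof eventually_elim
    case (elim N)
    have "(\<Sum>n<N. hcoeff f n * (if n = k then 1 else 0)) = (\<Sum>n<N. if n = k then hcoeff f n else 0)"
      by (intro sum.cong) auto
    thus ?case using elim by simp
  qed
  from Lim_transform_eventually[OF lim this] show ?thesis
    by (rule LIMSEQ_unique) simp
qed

lemma hardy_parseval:
  assumes f: "f \<in> hardy2" and g: "g \<in> hardy2"
  shows "(\<lambda>n. hcoeff f n * cnj (hcoeff g n)) sums hardy_inner f g"
proof -
  have "(\<integral>x. x ^ n * cnj (bdry g x) \<partial>arc_measure) = cnj (hcoeff g n)" for n
    unfolding bdry_coeff[OF g, symmetric] Bochner_Integration.integral_cnj[symmetric]
    by (simp add: mult.commute)
  thus ?thesis
    using hardy_inner_partial_sums[OF f sq_int_cnj[OF bdry(1)[OF g]]]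
    by (simp add: sums_def hardy_inner_eq f g)
qed

lemma hardy_norm_sums:
  assumes f: "f \<in> hardy2"
  shows "(\<lambda>n. (norm (hcoeff f n))\<^sup>2) sums (hardy_norm f)\<^sup>2"
  using hardy_parseval[OF f f] unfolding complex_norm_square[symmetric] hardy_norm_sq[OF f, symmetric]
  by (simp only: sums_of_real_iff)

lemma hardy_norm_eq_0:
  assumes f: "f \<in> hardy2" and 0: "hardy_norm f = 0"
  shows "f = (\<lambda>z. 0)"
proof -
  have "(norm (hcoeff f n))\<^sup>2 = 0" for n
  proof -
    have "(\<Sum>n. (norm (hcoeff f n))\<^sup>2) = 0" using hardy_norm_sums[OF f] 0 by (simp add: sums_iff)
    thus ?thesis using suminf_eq_zero_iff[OF hardy2_summable[OF f]] by auto
  qed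
  hence 1: "hcoeff f n = 0" for n by simp
  show ?thesis
  proof
    fix z show "f z = 0"
      using hardy2_sums[OF f, of z] hardy2_outside[OF f, of z] by (cases "norm z < 1") (auto simp: 1 sums_iff)
  qed
qed

lemma hardy_inner_unique:
  assumes "h \<in> hardy2" "h' \<in> hardy2" "\<And>f. f \<in> hardy2 \<Longrightarrow> hardy_inner f h = hardy_inner f h'"
  shows "h = h'"
proof -
  let ?d = "\<lambda>z. h z - h' z"
  have d: "?d \<in> hardy2" by (intro hardy2_diff assms)
  have "hardy_inner ?d ?d = 0"
    using hardy_inner_diff_right[OF assms(1,2) d] assms(3)[OF d] by simp
  hence "hardy_norm ?d = 0" by (simp add: hardy_norm_def)
  from hardy_norm_eq_0[OF d this] show ?thesis by (metis (no_types) eq_iff_diff_eq_0 ext)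
qed

definition htrunc :: "(complex \<Rightarrow> complex) \<Rightarrow> nat \<Rightarrow> complex \<Rightarrow> complex" where
  "htrunc f N = hfun (\<lambda>n. if n < N then hcoeff f n else 0)"

lemma summable_sq_finite_support:
  "finite A \<Longrightarrow> (\<And>n. n \<notin> A \<Longrightarrow> a n = 0) \<Longrightarrow> summable (\<lambda>n. (norm (a n :: complex))\<^sup>2)"
  by (rule summable_finite) auto

lemma htrunc: "htrunc f N \<in> hardy2" "hcoeff (htrunc f N) = (\<lambda>n. if n < N then hcoeff f n else 0)"
proof -
  have "summable (\<lambda>n. (norm (if n < N then hcoeff f n else 0))\<^sup>2)"
    by (rule summable_sq_finite_support[of "{..<N}"]) auto
  from hfun[OF this] show "htrunc f N \<in> hardy2" "hcoeff (htrunc f N) = (\<lambda>n. if n < N then hcoeff f n else 0)"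
    by (auto simp: htrunc_def)
qed

lemma hardy_norm_htrunc:
  assumes f: "f \<in> hardy2"
  shows "(\<lambda>N. hardy_norm (\<lambda>z. f z - htrunc f N z)) \<longlonglongrightarrow> 0"
proof -
  have sq: "(hardy_norm (\<lambda>z. f z - htrunc f N z))\<^sup>2 = (\<Sum>n. (norm (hcoeff f n))\<^sup>2) - (\<Sum>n<N. (norm (hcoeff f n))\<^sup>2)" for N
  proof -
    have c: "hcoeff (\<lambda>z. f z - htrunc f N z) = (\<lambda>n. if n < N then 0 else hcoeff f n)"
      using hardy2_lincomb(2)[OF f htrunc(1)[of f N], of 1 "-1"] by (auto simp: htrunc(2))
    have "(\<lambda>n. if n < N then (norm (hcoeff f n))\<^sup>2 else 0) sums (\<Sum>n<N. (norm (hcoeff f n))\<^sup>2)"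
      using sums_If_finite[of "\<lambda>n. n < N" "\<lambda>n. (norm (hcoeff f n))\<^sup>2"] by (simp add: lessThan_def)
    from sums_diff[OF summable_sums[OF hardy2_summable[OF f]] this]
    have "(\<lambda>n. (norm (hcoeff (\<lambda>z. f z - htrunc f N z) n))\<^sup>2) sums ((\<Sum>n. (norm (hcoeff f n))\<^sup>2) - (\<Sum>n<N. (norm (hcoeff f n))\<^sup>2))"
      by (rule sums_cong[THEN iffD1, rotated]) (simp add: c)
    from sums_unique2[OF hardy_norm_sums[OF hardy2_diff[OF f htrunc(1)]] this] show ?thesis .
  qed
  have "(\<lambda>N. (\<Sum>n. (norm (hcoeff f n))\<^sup>2) - (\<Sum>n<N. (norm (hcoeff f n))\<^sup>2)) \<longlonglongrightarrow> (\<Sum>n. (norm (hcoeff f n))\<^sup>2) - (\<Sum>n. (norm (hcoeff f n))\<^sup>2)"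
    by (intro tendsto_intros summable_LIMSEQ hardy2_summable f)
  hence "(\<lambda>N. sqrt ((hardy_norm (\<lambda>z. f z - htrunc f N z))\<^sup>2)) \<longlonglongrightarrow> sqrt 0"
    unfolding sq by (intro tendsto_real_sqrt) simp
  thus ?thesis using hardy_norm_nonneg[OF hardy2_diff[OF f htrunc(1)[of f]]] by simp
qed

lemma htrunc_0: "htrunc f 0 = (\<lambda>z. 0)"
  by (simp add: htrunc_def hfun_def fun_eq_iff)

definition hmono :: "nat \<Rightarrow> complex \<Rightarrow> complex" where
  "hmono k = hfun (\<lambda>n. if n = k then 1 else 0)"

lemma hmono: "hmono k \<in> hardy2" "hcoeff (hmono k) = (\<lambda>n. if n = k then 1 else 0)"
proof -
  have "summable (\<lambda>n. (norm (if n = k then 1 else 0 :: complex))\<^sup>2)"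
    by (rule summable_sq_finite_support[of "{k}"]) auto
  from hfun[OF this] show "hmono k \<in> hardy2" "hcoeff (hmono k) = (\<lambda>n. if n = k then 1 else 0)"
    by (auto simp: hmono_def)
qed

lemma htrunc_Suc: "htrunc f (Suc N) = (\<lambda>z. htrunc f N z + hcoeff f N * hmono N z)"
proof (rule hardy2_eqI)
  show "hcoeff (htrunc f (Suc N)) = hcoeff (\<lambda>z. htrunc f N z + hcoeff f N * hmono N z)"
    using hardy2_lincomb(2)[OF htrunc(1)[of f N] hmono(1)[of N], of 1 "hcoeff f N"]
    by (auto simp: htrunc(2) hmono(2) fun_eq_iff less_Suc_eq)
qed (intro htrunc hardy2_add hardy2_cmult hmono)+

lemma hardy_inner_htrunc:
  assumes "g \<in> hardy2"
  shows "hardy_inner (htrunc f N) g = (\<Sum>n<N. hcoeff f n * cnj (hcoeff g n))"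
proof -
  have "(\<lambda>n. if n < N then hcoeff f n * cnj (hcoeff g n) else 0) sums (\<Sum>n<N. hcoeff f n * cnj (hcoeff g n))"
    using sums_If_finite[of "\<lambda>n. n < N" "\<lambda>n. hcoeff f n * cnj (hcoeff g n)"] by (simp add: lessThan_def)
  moreover have "(\<lambda>n. hcoeff (htrunc f N) n * cnj (hcoeff g n)) = (\<lambda>n. if n < N then hcoeff f n * cnj (hcoeff g n) else 0)"
    by (auto simp: htrunc(2))
  ultimately show ?thesis using hardy_parseval[OF htrunc(1) assms, of f N] sums_unique2 by metis
qed

section \<open>Bounded and compact operators\<close>

text \<open>The norm estimate makes weak convergence usable: bounded operators preserve weakly null
  sequences.\<close>

definition bounded_op :: "hardy_op \<Rightarrow> bool" where
  "bounded_op A \<longleftrightarrow> hardy_linear A \<and> (\<exists>C\<ge>0. \<forall>f\<in>hardy2. hardy_norm (A f) \<le> C * hardy_norm f)"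

lemma bounded_op_mem: "bounded_op A \<Longrightarrow> f \<in> hardy2 \<Longrightarrow> A f \<in> hardy2"
  by (simp add: bounded_op_def hardy_linear_def)

lemma bounded_op_lincomb:
  assumes A: "bounded_op A" and f: "f \<in> hardy2" and g: "g \<in> hardy2"
  shows "A (\<lambda>z. c * f z + d * g z) = (\<lambda>z. c * A f z + d * A g z)"
proof -
  have add: "\<And>f g. f \<in> hardy2 \<Longrightarrow> g \<in> hardy2 \<Longrightarrow> A (\<lambda>z. f z + g z) = (\<lambda>z. A f z + A g z)"
    and mult: "\<And>c f. f \<in> hardy2 \<Longrightarrow> A (\<lambda>z. c * f z) = (\<lambda>z. c * A f z)"
    using A unfolding bounded_op_def hardy_linear_def by blast+
  show ?thesis
    unfolding add[OF hardy2_cmult[OF f, of c] hardy2_cmult[OF g, of d]] mult[OF f] mult[OF g] ..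
qed

lemma bounded_op_diff:
  assumes "bounded_op A" "f \<in> hardy2" "g \<in> hardy2"
  shows "A (\<lambda>z. f z - g z) = (\<lambda>z. A f z - A g z)"
  using bounded_op_lincomb[OF assms, of 1 "-1"] by simp

lemma bounded_opI:
  assumes "\<And>f. f \<in> hardy2 \<Longrightarrow> A f \<in> hardy2"
    and "\<And>f g c d. f \<in> hardy2 \<Longrightarrow> g \<in> hardy2 \<Longrightarrow> A (\<lambda>z. c * f z + d * g z) = (\<lambda>z. c * A f z + d * A g z)"
    and "\<And>f. f \<in> hardy2 \<Longrightarrow> hardy_norm (A f) \<le> C * hardy_norm f" "0 \<le> C"
  shows "bounded_op A"
  unfolding bounded_op_def hardy_linear_def
proof (intro conjI ballI allI)
  fix f g assume "f \<in> hardy2" "g \<in> hardy2"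
  thus "A (\<lambda>z. f z + g z) = (\<lambda>z. A f z + A g z)" using assms(2)[of f g 1 1] by simp
next
  fix c f assume "f \<in> hardy2"
  thus "A (\<lambda>z. c * f z) = (\<lambda>z. c * A f z)" using assms(2)[of f f c 0] by simp
next
  fix f assume "f \<in> hardy2"
  thus "A f \<in> hardy2" by (rule assms(1))
next
  show "\<exists>C\<ge>0. \<forall>f\<in>hardy2. hardy_norm (A f) \<le> C * hardy_norm f" using assms(3,4) by blast
qed

lemma bounded_op_comp:
  assumes "bounded_op A" "bounded_op B"
  shows "bounded_op (\<lambda>f. A (B f))"
proof -
  obtain C D where C: "C \<ge> 0" "\<And>f. f \<in> hardy2 \<Longrightarrow> hardy_norm (A f) \<le> C * hardy_norm f"
    and D: "D \<ge> 0" "\<And>f. f \<in> hardy2 \<Longrightarrow> hardy_norm (B f) \<le> D * hardy_norm f"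
    using assms unfolding bounded_op_def by blast
  show ?thesis
  proof (rule bounded_opI[where C="C * D"])
    fix f assume f: "f \<in> hardy2"
    have "hardy_norm (A (B f)) \<le> C * hardy_norm (B f)"
      using C(2)[OF bounded_op_mem[OF assms(2) f]] .
    also have "\<dots> \<le> C * (D * hardy_norm f)" by (intro mult_left_mono D f C)
    finally show "hardy_norm (A (B f)) \<le> C * D * hardy_norm f" by simp
  next
    fix f g c d assume f: "f \<in> hardy2" and g: "g \<in> hardy2"
    show "A (B (\<lambda>z. c * f z + d * g z)) = (\<lambda>z. c * A (B f) z + d * A (B g) z)"
      unfolding bounded_op_lincomb[OF assms(2) f g]
      by (rule bounded_op_lincomb[OF assms(1) bounded_op_mem[OF assms(2) f] bounded_op_mem[OF assms(2) g]])
  next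
    fix f assume f: "f \<in> hardy2"
    show "A (B f) \<in> hardy2" by (rule bounded_op_mem[OF assms(1) bounded_op_mem[OF assms(2) f]])
  next
    show "0 \<le> C * D" using C(1) D(1) by simp
  qed
qed

lemma bounded_op_minus:
  assumes "bounded_op A" "bounded_op B"
  shows "bounded_op (\<lambda>f z. A f z - B f z)"
proof -
  obtain C D where C: "C \<ge> 0" "\<And>f. f \<in> hardy2 \<Longrightarrow> hardy_norm (A f) \<le> C * hardy_norm f"
    and D: "D \<ge> 0" "\<And>f. f \<in> hardy2 \<Longrightarrow> hardy_norm (B f) \<le> D * hardy_norm f"
    using assms unfolding bounded_op_def by blast
  show ?thesis
  proof (rule bounded_opI[where C="C + D"])
    fix f assume f: "f \<in> hardy2"
    have "hardy_norm (\<lambda>z. A f z - B f z) \<le> hardy_norm (A f) + hardy_norm (B f)"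
      by (rule hardy_norm_triangle_diff[OF bounded_op_mem[OF assms(1) f] bounded_op_mem[OF assms(2) f]])
    also have "\<dots> \<le> C * hardy_norm f + D * hardy_norm f" by (intro add_mono C D f)
    finally show "hardy_norm (\<lambda>z. A f z - B f z) \<le> (C + D) * hardy_norm f" by (simp add: algebra_simps)
  next
    fix f g c d assume f: "f \<in> hardy2" and g: "g \<in> hardy2"
    show "(\<lambda>z. A (\<lambda>z. c * f z + d * g z) z - B (\<lambda>z. c * f z + d * g z) z) = (\<lambda>z. c * (A f z - B f z) + d * (A g z - B g z))"
      unfolding bounded_op_lincomb[OF assms(2) f g] bounded_op_lincomb[OF assms(1) f g]
      by (simp add: algebra_simps)
  next
    fix f assume f: "f \<in> hardy2"
    show "(\<lambda>z. A f z - B f z) \<in> hardy2"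
      by (rule hardy2_diff[OF bounded_op_mem[OF assms(1) f] bounded_op_mem[OF assms(2) f]])
  next
    show "0 \<le> C + D" using C(1) D(1) by simp
  qed
qed

lemma bounded_op_commutator:
  "bounded_op A \<Longrightarrow> bounded_op B \<Longrightarrow> bounded_op (commutator A B)"
  unfolding commutator_def[abs_def] by (rule bounded_op_minus[OF bounded_op_comp bounded_op_comp])

text \<open>The coefficients of the representing function are the conjugates of the values on the
  monomials; testing the bound on their truncations shows that they are square summable.\<close>

lemma hardy_riesz:
  fixes l :: "(complex \<Rightarrow> complex) \<Rightarrow> complex"
  assumes lin: "\<And>f g c d. f \<in> hardy2 \<Longrightarrow> g \<in> hardy2 \<Longrightarrow> l (\<lambda>z. c * f z + d * g z) = c * l f + d * l g"
    and bd: "\<And>f. f \<in> hardy2 \<Longrightarrow> norm (l f) \<le> C * hardy_norm f"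
  obtains h where "h \<in> hardy2" "\<And>f. f \<in> hardy2 \<Longrightarrow> l f = hardy_inner f h"
proof -
  define c where "c n = cnj (l (hmono n))" for n
  have tr: "l (htrunc f N) = (\<Sum>n<N. hcoeff f n * cnj (c n))" for f N
  proof (induction N)
    case 0
    have "l (\<lambda>z. 0) = 0" using lin[OF htrunc(1) htrunc(1), of 0 f 0 0 f 0] by simp
    thus ?case by (simp add: htrunc_0)
  next
    case (Suc N)
    show ?case unfolding htrunc_Suc using lin[OF htrunc(1) hmono(1), of 1 f N "hcoeff f N" N] Suc by (simp add: c_def)
  qed
  have "(\<Sum>n<N. (norm (c n))\<^sup>2) \<le> C\<^sup>2" for N
  proof -
    define s where "s = (\<Sum>n<N. (norm (c n))\<^sup>2)"
    define q where "q n = (if n < N then c n else 0)" for n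
    define p where "p = hfun q"
    have qs: "summable (\<lambda>n. (norm (q n))\<^sup>2)"
      by (rule summable_sq_finite_support[of "{..<N}"]) (auto simp: q_def)
    note p = hfun[OF qs, folded p_def]
    have pt: "htrunc p N = p"
      by (rule hardy2_eqI) (auto simp: htrunc p fun_eq_iff q_def)
    have "(\<lambda>n. (norm (hcoeff p n))\<^sup>2) = (\<lambda>n. if n < N then (norm (c n))\<^sup>2 else 0)" by (auto simp: p q_def)
    moreover have "(\<lambda>n. if n < N then (norm (c n))\<^sup>2 else 0) sums s"
      using sums_If_finite[of "\<lambda>n. n < N" "\<lambda>n. (norm (c n))\<^sup>2"] by (simp add: lessThan_def s_def)
    ultimately have np: "(hardy_norm p)\<^sup>2 = s"
      using hardy_norm_sums[OF p(1)] sums_unique2 by metis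
    have "l p = (\<Sum>n<N. hcoeff p n * cnj (c n))" using tr[of p N] pt by simp
    also have "\<dots> = (\<Sum>n<N. c n * cnj (c n))" by (intro sum.cong) (auto simp: p q_def)
    also have "\<dots> = of_real s" by (simp add: s_def complex_norm_square[symmetric] del: of_real_power)
    finally have "l p = of_real s" .
    moreover have "0 \<le> s" by (simp add: s_def sum_nonneg)
    ultimately have "norm (l p) = s" by simp
    hence "s \<le> C * hardy_norm p" using bd[OF p(1)] by simp
    hence "hardy_norm p * hardy_norm p \<le> C * hardy_norm p" using np by (simp add: power2_eq_square)
    hence "hardy_norm p \<le> C \<or> hardy_norm p = 0"
      using hardy_norm_nonneg[OF p(1)] by (cases "hardy_norm p = 0") auto
    hence "(hardy_norm p)\<^sup>2 \<le> C\<^sup>2" using hardy_norm_nonneg[OF p(1)] by (auto intro: power_mono)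
    thus ?thesis using np by (simp add: s_def)
  qed
  hence cs: "summable (\<lambda>n. (norm (c n))\<^sup>2)"
    by (intro summableI_nonneg_bounded[of _ "C\<^sup>2"]) auto
  note h = hfun[OF this]
  have "l f = hardy_inner f (hfun c)" if f: "f \<in> hardy2" for f
  proof (rule LIMSEQ_unique)
    show "(\<lambda>N. l (htrunc f N)) \<longlonglongrightarrow> hardy_inner f (hfun c)"
      using hardy_parseval[OF f h(1)] unfolding tr sums_def h(2) .
    show "(\<lambda>N. l (htrunc f N)) \<longlonglongrightarrow> l f"
    proof (rule LIM_zero_cancel, rule tendsto_norm_zero_cancel, rule tendsto_sandwich[OF _ _ tendsto_const])
      show "(\<lambda>N. C * hardy_norm (\<lambda>z. f z - htrunc f N z)) \<longlonglongrightarrow> 0"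
        by (rule tendsto_mult_right_zero[OF hardy_norm_htrunc[OF f]])
      show "\<forall>\<^sub>F N in sequentially. norm (l (htrunc f N) - l f) \<le> C * hardy_norm (\<lambda>z. f z - htrunc f N z)"
      proof (intro always_eventually allI)
        fix N
        have "l (\<lambda>z. f z - htrunc f N z) = l f - l (htrunc f N)"
          using lin[OF f htrunc(1), of 1 "-1" f N] by simp
        thus "norm (l (htrunc f N) - l f) \<le> C * hardy_norm (\<lambda>z. f z - htrunc f N z)"
          using bd[OF hardy2_diff[OF f htrunc(1)], of f N] by (simp add: norm_minus_commute)
      qed
    qed auto
  qed
  thus ?thesis using that h(1) by blast
qed

subsection \<open>Weakly null sequences\<close>

definition weak_null :: "(nat \<Rightarrow> complex \<Rightarrow> complex) \<Rightarrow> bool" where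
  "weak_null F \<longleftrightarrow> (\<forall>n. F n \<in> hardy2) \<and> bounded (range (\<lambda>n. hardy_norm (F n))) \<and>
     (\<forall>g\<in>hardy2. (\<lambda>n. hardy_inner (F n) g) \<longlonglongrightarrow> 0)"

lemma weak_null_mem: "weak_null F \<Longrightarrow> F n \<in> hardy2"
  by (simp add: weak_null_def)

lemma weak_null_bounded:
  assumes "weak_null F"
  obtains M where "M \<ge> 0" "\<And>n. hardy_norm (F n) \<le> M"
proof -
  obtain M where M: "\<And>n. norm (hardy_norm (F n)) \<le> M"
    using assms unfolding weak_null_def bounded_iff by auto
  have "hardy_norm (F n) \<le> M" for n using M[of n] by simp
  moreover have "M \<ge> 0" using M[of 0] norm_ge_zero order_trans by blast
  ultimately show ?thesis using that by blast
qed

lemma weak_null_bounded_op: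
  assumes A: "bounded_op A" and F: "weak_null F"
  shows "weak_null (\<lambda>n. A (F n))"
proof -
  obtain M where M: "M \<ge> 0" "\<And>n. hardy_norm (F n) \<le> M" using weak_null_bounded[OF F] by blast
  obtain C where C: "C \<ge> 0" "\<And>f. f \<in> hardy2 \<Longrightarrow> hardy_norm (A f) \<le> C * hardy_norm f"
    using A unfolding bounded_op_def by blast
  note Fm = weak_null_mem[OF F]
  have "norm (hardy_norm (A (F n))) \<le> C * M" for n
    using C(2)[OF Fm, of n] mult_left_mono[OF M(2) C(1), of n] hardy_norm_nonneg[OF bounded_op_mem[OF A Fm], of n]
    by simp
  hence "bounded (range (\<lambda>n. hardy_norm (A (F n))))" by (auto simp: bounded_iff)
  moreover have "(\<lambda>n. hardy_inner (A (F n)) g) \<longlonglongrightarrow> 0" if g: "g \<in> hardy2" for g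
  proof -
    obtain h where h: "h \<in> hardy2" "\<And>f. f \<in> hardy2 \<Longrightarrow> hardy_inner (A f) g = hardy_inner f h"
    proof (rule hardy_riesz[of "\<lambda>f. hardy_inner (A f) g" "C * hardy_norm g"])
      fix f assume f: "f \<in> hardy2"
      have "norm (hardy_inner (A f) g) \<le> hardy_norm (A f) * hardy_norm g"
        by (rule hardy_cauchy_schwarz[OF bounded_op_mem[OF A f] g])
      also have "\<dots> \<le> (C * hardy_norm f) * hardy_norm g"
        by (intro mult_right_mono C f hardy_norm_nonneg g)
      finally show "norm (hardy_inner (A f) g) \<le> C * hardy_norm g * hardy_norm f" by (simp add: mult_ac)
    next
      fix f k c d assume f: "f \<in> hardy2" and k: "k \<in> hardy2"
      show "hardy_inner (A (\<lambda>z. c * f z + d * k z)) g = c * hardy_inner (A f) g + d * hardy_inner (A k) g"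
        unfolding bounded_op_lincomb[OF A f k]
        by (rule hardy_inner_lincomb_left[OF bounded_op_mem[OF A f] bounded_op_mem[OF A k] g])
    qed blast
    show ?thesis using F h Fm by (simp add: weak_null_def)
  qed
  ultimately show ?thesis using bounded_op_mem[OF A Fm] by (simp add: weak_null_def)
qed

text \<open>For bounded sequences weak convergence is convergence of the coefficients, because
  polynomials are dense.\<close>

lemma weak_null_coeffI:
  assumes F: "\<And>n. F n \<in> hardy2" and M: "\<And>n. hardy_norm (F n) \<le> M"
    and c: "\<And>k. (\<lambda>n. hcoeff (F n) k) \<longlonglongrightarrow> 0"
  shows "weak_null F"
proof -
  have "(\<lambda>n. hardy_inner (F n) g) \<longlonglongrightarrow> 0" if g: "g \<in> hardy2" for g
  proof (rule tendstoI)
    fix e :: real assume e: "e > 0"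
    have M0: "M \<ge> 0" using M[of 0] hardy_norm_nonneg[OF F[of 0]] by linarith
    have "\<forall>\<^sub>F N in sequentially. hardy_norm (\<lambda>z. g z - htrunc g N z) < e / (2 * (M + 1))"
      using hardy_norm_htrunc[OF g] e M0 by (intro order_tendstoD(2)) auto
    then obtain N where N: "hardy_norm (\<lambda>z. g z - htrunc g N z) < e / (2 * (M + 1))"
      by (auto simp: eventually_sequentially)
    have "(\<lambda>n. cnj (\<Sum>k<N. hcoeff g k * cnj (hcoeff (F n) k))) \<longlonglongrightarrow> cnj (\<Sum>k<N. hcoeff g k * cnj 0)"
      by (intro tendsto_intros c)
    hence "(\<lambda>n. hardy_inner (F n) (htrunc g N)) \<longlonglongrightarrow> 0"
      by (simp add: hardy_inner_commute[OF F htrunc(1)] hardy_inner_htrunc[OF F])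
    hence "\<forall>\<^sub>F n in sequentially. norm (hardy_inner (F n) (htrunc g N)) < e / 2"
      using e by (auto dest: tendstoD[where e="e/2"])
    thus "\<forall>\<^sub>F n in sequentially. dist (hardy_inner (F n) g) 0 < e"
    proof eventually_elim
      case (elim n)
      have "norm (hardy_inner (F n) (\<lambda>z. g z - htrunc g N z)) \<le> hardy_norm (F n) * hardy_norm (\<lambda>z. g z - htrunc g N z)"
        by (intro hardy_cauchy_schwarz F hardy2_diff g htrunc)
      also have "\<dots> \<le> (M + 1) * (e / (2 * (M + 1)))"
      proof (rule mult_mono)
        show "hardy_norm (F n) \<le> M + 1" using M[of n] by linarith
        show "hardy_norm (\<lambda>z. g z - htrunc g N z) \<le> e / (2 * (M + 1))" using N by linarith
        show "0 \<le> hardy_norm (\<lambda>z. g z - htrunc g N z)" by (intro hardy_norm_nonneg hardy2_diff g htrunc)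
      qed (use M0 in auto)
      also have "\<dots> = e / 2" using M0 by (simp add: field_simps)
      finally have "norm (hardy_inner (F n) (\<lambda>z. g z - htrunc g N z)) \<le> e / 2" .
      moreover have "hardy_inner (F n) g = hardy_inner (F n) (htrunc g N) + hardy_inner (F n) (\<lambda>z. g z - htrunc g N z)"
        using hardy_inner_diff_right[OF g htrunc(1)[of g N] F[of n]] by simp
      ultimately show ?case
        using elim norm_triangle_ineq[of "hardy_inner (F n) (htrunc g N)" "hardy_inner (F n) (\<lambda>z. g z - htrunc g N z)"]
        by (simp add: dist_norm)
    qed
  qed
  moreover have "norm (hardy_norm (F n)) \<le> M" for n using M[of n] hardy_norm_nonneg[OF F[of n]] by simp
  hence "bounded (range (\<lambda>n. hardy_norm (F n)))" by (auto simp: bounded_iff)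
  ultimately show ?thesis using F by (simp add: weak_null_def)
qed

lemma hardy_coeff_le: "f \<in> hardy2 \<Longrightarrow> norm (hcoeff f k) \<le> hardy_norm f"
proof (rule power2_le_imp_le)
  assume f: "f \<in> hardy2"
  have "(norm (hcoeff f k))\<^sup>2 \<le> (\<Sum>n. (norm (hcoeff f n))\<^sup>2)"
    using sum_le_suminf[OF hardy2_summable[OF f], of "{k}"] by simp
  thus "(norm (hcoeff f k))\<^sup>2 \<le> (hardy_norm f)\<^sup>2" using hardy_norm_sums[OF f] by (simp add: sums_iff)
qed (rule hardy_norm_nonneg)

text \<open>A diagonal subsequence makes all coefficients converge; the partial sums of their squares
  stay bounded.\<close>

lemma hardy_weak_compactness:
  assumes F: "\<And>n. F n \<in> hardy2" and M: "\<And>n. hardy_norm (F n) \<le> M"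
  obtains f0 r where "f0 \<in> hardy2" "strict_mono (r :: nat \<Rightarrow> nat)" "weak_null (\<lambda>n z. F (r n) z - f0 z)"
proof -
  have "norm (hcoeff (F n) k) \<le> M" for n k using hardy_coeff_le[OF F, of n k] M[of n] by linarith
  then obtain r where r: "strict_mono (r::nat\<Rightarrow>nat)" "\<And>k. k \<in> UNIV \<Longrightarrow> \<exists>l. (\<lambda>n. hcoeff (F (r n)) k) \<longlonglongrightarrow> l"
    using function_convergent_subsequence[of "UNIV :: nat set" "\<lambda>n k. hcoeff (F n) k" M] by (metis countableI_type)
  then obtain c where c: "\<And>k. (\<lambda>n. hcoeff (F (r n)) k) \<longlonglongrightarrow> c k" by (metis UNIV_I)
  have "(\<Sum>k<N. (norm (c k))\<^sup>2) \<le> M\<^sup>2" for N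
  proof (rule tendsto_upperbound)
    show "(\<lambda>n. \<Sum>k<N. (norm (hcoeff (F (r n)) k))\<^sup>2) \<longlonglongrightarrow> (\<Sum>k<N. (norm (c k))\<^sup>2)"
      by (intro tendsto_intros c)
    show "\<forall>\<^sub>F n in sequentially. (\<Sum>k<N. (norm (hcoeff (F (r n)) k))\<^sup>2) \<le> M\<^sup>2"
    proof (intro always_eventually allI)
      fix n
      have "(\<Sum>k<N. (norm (hcoeff (F (r n)) k))\<^sup>2) \<le> (\<Sum>k. (norm (hcoeff (F (r n)) k))\<^sup>2)"
        by (intro sum_le_suminf hardy2_summable F) auto
      also have "\<dots> = (hardy_norm (F (r n)))\<^sup>2" using hardy_norm_sums[OF F] by (simp add: sums_iff)
      also have "\<dots> \<le> M\<^sup>2" by (intro power_mono M hardy_norm_nonneg F)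
      finally show "(\<Sum>k<N. (norm (hcoeff (F (r n)) k))\<^sup>2) \<le> M\<^sup>2" .
    qed
  qed auto
  hence "summable (\<lambda>n. (norm (c n))\<^sup>2)"
    by (intro summableI_nonneg_bounded[of _ "M\<^sup>2"]) auto
  note f0 = hfun[OF this]
  have "weak_null (\<lambda>n z. F (r n) z - hfun c z)"
  proof (rule weak_null_coeffI[where M="M + hardy_norm (hfun c)"])
    fix n k
    show "(\<lambda>z. F (r n) z - hfun c z) \<in> hardy2" by (intro hardy2_diff F f0)
    show "hardy_norm (\<lambda>z. F (r n) z - hfun c z) \<le> M + hardy_norm (hfun c)"
      using hardy_norm_triangle_diff[OF F f0(1), of "r n"] M[of "r n"] by linarith
  next
    fix k
    have "hcoeff (\<lambda>z. F (r n) z - hfun c z) k = hcoeff (F (r n)) k - c k" for n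
      using hardy2_lincomb(2)[OF F f0(1), of 1 "r n" "-1"] f0(2) by simp
    thus "(\<lambda>n. hcoeff (\<lambda>z. F (r n) z - hfun c z) k) \<longlonglongrightarrow> 0"
      using LIM_zero[OF c[of k]] by simp
  qed
  thus ?thesis using that f0(1) r(1) by blast
qed

text \<open>One direction uses that the only possible limit of the image of a weakly null sequence is
  0; the other one subtracts the weak limit of a subsequence.\<close>

lemma compact_op_iff:
  assumes A: "bounded_op A"
  shows "compact_op A \<longleftrightarrow> (\<forall>F. weak_null F \<longrightarrow> (\<lambda>n. hardy_norm (A (F n))) \<longlonglongrightarrow> 0)"
proof
  assume L: "compact_op A"
  show "\<forall>F. weak_null F \<longrightarrow> (\<lambda>n. hardy_norm (A (F n))) \<longlonglongrightarrow> 0"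
  proof (intro allI impI, rule ccontr)
    fix F assume F: "weak_null F" and n: "\<not> (\<lambda>n. hardy_norm (A (F n))) \<longlonglongrightarrow> 0"
    note AF = bounded_op_mem[OF A weak_null_mem[OF F]]
    have "\<exists>e>0. \<exists>\<^sub>F n in sequentially. e \<le> hardy_norm (A (F n))"
      using n hardy_norm_nonneg[OF AF] by (auto simp: tendsto_iff frequently_def not_le)
    then obtain e where e: "e > 0" "\<exists>\<^sub>F n in sequentially. e \<le> hardy_norm (A (F n))" by blast
    then obtain s :: "nat \<Rightarrow> nat" where s: "strict_mono s" "\<And>n. e \<le> hardy_norm (A (F (s n)))"
      using infinite_enumerate[of "{n. e \<le> hardy_norm (A (F n))}"]
      by (auto simp: cofinite_eq_sequentially[symmetric] frequently_cofinite)
    have "bounded (range (\<lambda>n. hardy_norm (F (s n))))"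
      using F unfolding weak_null_def by (auto elim: bounded_subset)
    then obtain g r where g: "g \<in> hardy2" and r: "strict_mono (r::nat\<Rightarrow>nat)"
      and lim: "(\<lambda>n. hardy_norm (\<lambda>z. A (F (s (r n))) z - g z)) \<longlonglongrightarrow> 0"
      using L[unfolded compact_op_def, THEN conjunct2, rule_format, of "\<lambda>n. F (s n)"] weak_null_mem[OF F] by auto
    have sr: "strict_mono (\<lambda>n. s (r n))" using s(1) r by (simp add: strict_mono_def)
    have wn: "(\<lambda>n. hardy_inner (A (F n)) g) \<longlonglongrightarrow> 0"
      using weak_null_bounded_op[OF A F] g by (simp add: weak_null_def)
    have w: "(\<lambda>n. hardy_inner (A (F (s (r n)))) g) \<longlonglongrightarrow> 0"
      using LIMSEQ_subseq_LIMSEQ[OF wn sr] by (simp add: o_def)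
    have "(\<lambda>n. hardy_inner (\<lambda>z. A (F (s (r n))) z - g z) g) \<longlonglongrightarrow> 0"
    proof (rule tendsto_norm_zero_cancel, rule tendsto_sandwich[OF _ _ tendsto_const])
      show "(\<lambda>n. hardy_norm (\<lambda>z. A (F (s (r n))) z - g z) * hardy_norm g) \<longlonglongrightarrow> 0"
        by (rule tendsto_mult_left_zero[OF lim])
      show "\<forall>\<^sub>F n in sequentially. norm (hardy_inner (\<lambda>z. A (F (s (r n))) z - g z) g) \<le> hardy_norm (\<lambda>z. A (F (s (r n))) z - g z) * hardy_norm g"
        by (intro always_eventually allI hardy_cauchy_schwarz hardy2_diff AF g)
    qed auto
    from tendsto_diff[OF w this] have "(\<lambda>n. hardy_inner g g) \<longlonglongrightarrow> 0"
      by (simp add: hardy_inner_diff_left[OF AF g g])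
    hence "hardy_inner g g = 0" by (rule LIMSEQ_const_iff[THEN iffD1])
    hence g0: "g = (\<lambda>z. 0)" by (intro hardy_norm_eq_0 g) (simp add: hardy_norm_def)
    have "e \<le> 0"
      by (rule LIMSEQ_le_const[OF lim]) (use s(2) g0 in auto)
    thus False using e(1) by simp
  qed
next
  assume R: "\<forall>F. weak_null F \<longrightarrow> (\<lambda>n. hardy_norm (A (F n))) \<longlonglongrightarrow> 0"
  show "compact_op A" unfolding compact_op_def
  proof (intro conjI allI impI)
    show "hardy_linear A" using A by (simp add: bounded_op_def)
    fix F :: "nat \<Rightarrow> complex \<Rightarrow> complex"
    assume F: "(\<forall>n. F n \<in> hardy2) \<and> bounded (range (\<lambda>n. hardy_norm (F n)))"
    then obtain M where M': "\<And>n. norm (hardy_norm (F n)) \<le> M" unfolding bounded_iff by auto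
    have M: "hardy_norm (F n) \<le> M" for n using M'[of n] by simp
    obtain f0 r where f0: "f0 \<in> hardy2" and r: "strict_mono (r :: nat \<Rightarrow> nat)" and w: "weak_null (\<lambda>n z. F (r n) z - f0 z)"
      using hardy_weak_compactness[of F M] F M by blast
    have "(\<lambda>n. hardy_norm (A (\<lambda>z. F (r n) z - f0 z))) \<longlonglongrightarrow> 0" using R w by blast
    moreover have "A (\<lambda>z. F (r n) z - f0 z) = (\<lambda>z. A (F (r n)) z - A f0 z)" for n
      by (rule bounded_op_diff[where f="F (r n)" and g=f0, OF A _ f0]) (use F in blast)
    ultimately have "(\<lambda>n. hardy_norm (\<lambda>z. A (F (r n)) z - A f0 z)) \<longlonglongrightarrow> 0"
      by (simp only:)
    thus "\<exists>g\<in>hardy2. \<exists>r. strict_mono r \<and> (\<lambda>n. hardy_norm (\<lambda>z. A (F (r n)) z - g z)) \<longlonglongrightarrow> 0"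
      using bounded_op_mem[OF A f0] r by blast
  qed
qed

subsection \<open>Reproducing kernels\<close>

definition hker :: "complex \<Rightarrow> complex \<Rightarrow> complex" where
  "hker a = hfun (\<lambda>n. cnj a ^ n)"

lemma hker:
  assumes a: "norm a < 1"
  shows "hker a \<in> hardy2" "hcoeff (hker a) = (\<lambda>n. cnj a ^ n)" "(hardy_norm (hker a))\<^sup>2 = 1 / (1 - (norm a)\<^sup>2)"
    and "f \<in> hardy2 \<Longrightarrow> hardy_inner f (hker a) = f a"
    and "norm z < 1 \<Longrightarrow> hker a z = 1 / (1 - cnj a * z)"
proof -
  have e: "(norm (cnj a ^ n))\<^sup>2 = ((norm a)\<^sup>2) ^ n" for n
    by (simp add: norm_power flip: power_mult) (simp add: mult.commute)
  have n2: "norm ((norm a)\<^sup>2) < 1" using a by (simp add: abs_square_less_1)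
  have s: "summable (\<lambda>n. (norm (cnj a ^ n))\<^sup>2)" unfolding e by (rule summable_geometric[OF n2])
  show 1: "hker a \<in> hardy2" and 2: "hcoeff (hker a) = (\<lambda>n. cnj a ^ n)" using hfun[OF s] by (auto simp: hker_def)
  have "(\<lambda>n. ((norm a)\<^sup>2) ^ n) sums (hardy_norm (hker a))\<^sup>2" using hardy_norm_sums[OF 1] unfolding 2 e .
  thus "(hardy_norm (hker a))\<^sup>2 = 1 / (1 - (norm a)\<^sup>2)" using geometric_sums[OF n2] sums_unique2 by blast
  show "hardy_inner f (hker a) = f a" if f: "f \<in> hardy2"
    using hardy_parseval[OF f 1] hardy2_sums[OF f a] unfolding 2 by (simp add: sums_unique2)
  show "hker a z = 1 / (1 - cnj a * z)" if z: "norm z < 1"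
  proof -
    have "norm a * norm z \<le> norm a * 1" using z by (intro mult_left_mono) auto
    hence "norm (cnj a * z) < 1" using a by (simp add: norm_mult)
    from geometric_sums[OF this] show ?thesis using z by (simp add: hker_def hfun_def sums_iff power_mult_distrib)
  qed
qed

lemma hardy_pointwise_bound:
  assumes "f \<in> hardy2" "norm a < 1"
  shows "norm (f a) \<le> hardy_norm f / sqrt (1 - (norm a)\<^sup>2)"
proof -
  have "hardy_norm (hker a) = sqrt ((hardy_norm (hker a))\<^sup>2)" using hardy_norm_nonneg[OF hker(1)[OF assms(2)]] by simp
  also have "\<dots> = 1 / sqrt (1 - (norm a)\<^sup>2)" unfolding hker(3)[OF assms(2)] by (simp add: real_sqrt_divide)
  finally show ?thesis using hardy_cauchy_schwarz[OF assms(1) hker(1)[OF assms(2)]] hker(4)[OF assms(2,1)] by simp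
qed

lemma weak_null_pointwise:
  assumes "weak_null F" "norm a < 1"
  shows "(\<lambda>n. F n a) \<longlonglongrightarrow> 0"
proof -
  have "(\<lambda>n. hardy_inner (F n) (hker a)) \<longlonglongrightarrow> 0"
    using assms(1) hker(1)[OF assms(2)] by (simp add: weak_null_def)
  thus ?thesis by (simp only: hker(4)[OF assms(2) weak_null_mem[OF assms(1)]])
qed

section \<open>Toeplitz operators\<close>

text \<open>The orthogonal projection exists by the Riesz representation of \<open>f \<mapsto> \<integral> f u\<^sup>*\<close>. The function
  \<open>u\<close> is known up to a null set, because it will be a product with a radial limit.\<close>

lemma hardy_proj:
  assumes u': "sq_int arc_measure u'" and eq: "AE x in arc_measure. u x = u' x"
  shows "hardy_proj u \<in> hardy2"
    and "\<And>k. k \<in> hardy2 \<Longrightarrow> hardy_inner (hardy_proj u) k = (\<integral>x. u' x * cnj (bdry k x) \<partial>arc_measure)"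
proof -
  have P: "(h \<in> hardy2 \<and> (\<forall>k\<in>hardy2. L2_inner (\<lambda>x. u x - radial_limit h x) (radial_limit k) = 0)) \<longleftrightarrow>
    (h \<in> hardy2 \<and> (\<forall>k\<in>hardy2. hardy_inner h k = (\<integral>x. u' x * cnj (bdry k x) \<partial>arc_measure)))" for h
  proof (intro conj_cong refl ball_cong)
    fix k assume h: "h \<in> hardy2" and k: "k \<in> hardy2"
    note ck = sq_int_cnj[OF bdry(1)[OF k]]
    have "L2_inner (\<lambda>x. u x - radial_limit h x) (radial_limit k) = (\<integral>x. (u' x - bdry h x) * cnj (bdry k x) \<partial>arc_measure)"
    proof (rule L2_inner_AE)
      show "AE x in arc_measure. u x - radial_limit h x = u' x - bdry h x"
        using eq radial_limit_bdry[OF h] by eventually_elim simp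
    qed (intro sq_int_diff u' bdry h k radial_limit_bdry)+
    also have "\<dots> = (\<integral>x. u' x * cnj (bdry k x) \<partial>arc_measure) - hardy_inner h k"
      unfolding hardy_inner_eq[OF h k] left_diff_distrib
      by (rule Bochner_Integration.integral_diff) (rule sq_int_mult_integrable[OF u' ck] sq_int_mult_integrable[OF bdry(1)[OF h] ck])+
    finally show "(L2_inner (\<lambda>x. u x - radial_limit h x) (radial_limit k) = 0) = (hardy_inner h k = (\<integral>x. u' x * cnj (bdry k x) \<partial>arc_measure))"
      by auto
  qed
  note cu = sq_int_cnj[OF u']
  obtain h where h: "h \<in> hardy2" "\<And>f. f \<in> hardy2 \<Longrightarrow> (\<integral>x. bdry f x * cnj (u' x) \<partial>arc_measure) = hardy_inner f h"
  proof (rule hardy_riesz[of "\<lambda>f. \<integral>x. bdry f x * cnj (u' x) \<partial>arc_measure" "L2norm arc_measure u'"])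
    fix f g c d assume f: "f \<in> hardy2" and g: "g \<in> hardy2"
    note [measurable] = bdry_measurable[OF f] bdry_measurable[OF g] bdry_measurable[OF hardy2_lincomb(1)[OF f g]] sq_int_measurable[OF u']
    have "(\<integral>x. bdry (\<lambda>z. c * f z + d * g z) x * cnj (u' x) \<partial>arc_measure) = (\<integral>x. c * (bdry f x * cnj (u' x)) + d * (bdry g x * cnj (u' x)) \<partial>arc_measure)"
      by (rule integral_cong_AE) (measurable, use bdry_lincomb[OF f g, of c d] in \<open>eventually_elim, simp add: algebra_simps\<close>)
    thus "(\<integral>x. bdry (\<lambda>z. c * f z + d * g z) x * cnj (u' x) \<partial>arc_measure)
        = c * (\<integral>x. bdry f x * cnj (u' x) \<partial>arc_measure) + d * (\<integral>x. bdry g x * cnj (u' x) \<partial>arc_measure)"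
      using sq_int_mult_integrable[OF bdry(1)[OF f] cu] sq_int_mult_integrable[OF bdry(1)[OF g] cu] by simp
  next
    fix f assume f: "f \<in> hardy2"
    show "norm (\<integral>x. bdry f x * cnj (u' x) \<partial>arc_measure) \<le> L2norm arc_measure u' * hardy_norm f"
      using L2_cauchy_schwarz[OF bdry(1)[OF f] cu] by (simp add: hardy_norm_eq[OF f] L2norm_def mult.commute)
  qed blast
  have Qh: "hardy_inner h k = (\<integral>x. u' x * cnj (bdry k x) \<partial>arc_measure)" if k: "k \<in> hardy2" for k
    unfolding hardy_inner_commute[OF h(1) k] h(2)[OF k, symmetric] Bochner_Integration.integral_cnj[symmetric]
    by (simp add: mult.commute)
  have uniq: "h' = h" if "h' \<in> hardy2 \<and> (\<forall>k\<in>hardy2. hardy_inner h' k = (\<integral>x. u' x * cnj (bdry k x) \<partial>arc_measure))" for h'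
    using that Qh h(1) by (intro hardy_inner_unique) (auto simp: hardy_inner_commute[of _ h'] hardy_inner_commute[of _ h])
  have "hardy_proj u = h"
    unfolding hardy_proj_def P by (rule the_equality) (use Qh h(1) uniq in auto)
  thus "hardy_proj u \<in> hardy2" "\<And>k. k \<in> hardy2 \<Longrightarrow> hardy_inner (hardy_proj u) k = (\<integral>x. u' x * cnj (bdry k x) \<partial>arc_measure)"
    using h(1) Qh by auto
qed

text \<open>The bound is an argument because it controls the norm of the Toeplitz operator, which
  uniform approximation of symbols relies on.\<close>

definition symbol :: "(complex \<Rightarrow> complex) \<Rightarrow> real \<Rightarrow> bool" where
  "symbol w B \<longleftrightarrow> w \<in> borel_measurable arc_measure \<and> (\<forall>x\<in>sphere 0 1. norm (w x) \<le> B)"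

lemma symbol_nonneg: "symbol w B \<Longrightarrow> 0 \<le> B"
proof -
  assume "symbol w B"
  hence "norm (w 1) \<le> B" by (simp add: symbol_def)
  thus ?thesis using norm_ge_zero order_trans by blast
qed

lemma symbol_mult_sq_int:
  assumes w: "symbol w B" and u: "sq_int arc_measure u"
  shows "sq_int arc_measure (\<lambda>x. w x * u x)" "L2norm arc_measure (\<lambda>x. w x * u x) \<le> B * L2norm arc_measure u"
proof -
  have [measurable]: "w \<in> borel_measurable arc_measure" "u \<in> borel_measurable arc_measure"
    using w u by (auto simp: symbol_def)
  have le: "norm (w x * u x) \<le> B * norm (u x)" if "x \<in> space arc_measure" for x
    using w that by (auto simp: symbol_def norm_mult intro!: mult_right_mono)
  show s: "sq_int arc_measure (\<lambda>x. w x * u x)"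
    by (rule sq_int_dominated[OF u]) (measurable, use le in \<open>auto intro!: AE_I2\<close>)
  show "L2norm arc_measure (\<lambda>x. w x * u x) \<le> B * L2norm arc_measure u"
  proof (rule power2_le_imp_le)
    have "(L2norm arc_measure (\<lambda>x. w x * u x))\<^sup>2 \<le> (\<integral>x. B\<^sup>2 * (norm (u x))\<^sup>2 \<partial>arc_measure)"
      unfolding L2norm_sq
    proof (rule integral_mono)
      fix x assume "x \<in> space arc_measure"
      from power_mono[OF le[OF this] norm_ge_zero, of 2]
      show "(norm (w x * u x))\<^sup>2 \<le> B\<^sup>2 * (norm (u x))\<^sup>2" by (simp add: power_mult_distrib)
    qed (use s u in \<open>auto simp: sq_int_def\<close>)
    thus "(L2norm arc_measure (\<lambda>x. w x * u x))\<^sup>2 \<le> (B * L2norm arc_measure u)\<^sup>2"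
      by (simp add: power_mult_distrib L2norm_sq)
  qed (use symbol_nonneg[OF w] in auto)
qed

lemma toeplitz:
  assumes w: "symbol w B" and f: "f \<in> hardy2"
  shows "toeplitz w f \<in> hardy2"
    and "k \<in> hardy2 \<Longrightarrow> hardy_inner (toeplitz w f) k = (\<integral>x. w x * bdry f x * cnj (bdry k x) \<partial>arc_measure)"
proof -
  have "AE x in arc_measure. w x * radial_limit f x = w x * bdry f x"
    using radial_limit_bdry[OF f] by eventually_elim simp
  note P = hardy_proj[OF symbol_mult_sq_int(1)[OF w bdry(1)[OF f]] this]
  show "toeplitz w f \<in> hardy2"
    and "k \<in> hardy2 \<Longrightarrow> hardy_inner (toeplitz w f) k = (\<integral>x. w x * bdry f x * cnj (bdry k x) \<partial>arc_measure)"
    using P by (auto simp: toeplitz_def)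
qed

lemma hardy_inner_unique_left:
  assumes "h \<in> hardy2" "h' \<in> hardy2" "\<And>f. f \<in> hardy2 \<Longrightarrow> hardy_inner h f = hardy_inner h' f"
  shows "h = h'"
  using assms by (intro hardy_inner_unique) (auto simp: hardy_inner_commute[of _ h'] hardy_inner_commute[of _ h])

lemma toeplitz_norm:
  assumes w: "symbol w B" and f: "f \<in> hardy2"
  shows "hardy_norm (toeplitz w f) \<le> B * hardy_norm f"
proof -
  note T = toeplitz(1)[OF w f]
  note wf = symbol_mult_sq_int[OF w bdry(1)[OF f]]
  have "(hardy_norm (toeplitz w f))\<^sup>2 = norm (hardy_inner (toeplitz w f) (toeplitz w f))"
    unfolding hardy_norm_sq[OF T, symmetric] by (simp del: of_real_power)
  also have "\<dots> \<le> L2norm arc_measure (\<lambda>x. w x * bdry f x) * L2norm arc_measure (bdry (toeplitz w f))"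
    unfolding toeplitz(2)[OF w f T]
    using L2_cauchy_schwarz[OF wf(1) sq_int_cnj[OF bdry(1)[OF T]]] by (simp add: L2norm_def)
  also have "\<dots> \<le> (B * hardy_norm f) * hardy_norm (toeplitz w f)"
    using wf(2) by (auto simp: hardy_norm_eq f T intro!: mult_right_mono)
  finally have "hardy_norm (toeplitz w f) * hardy_norm (toeplitz w f) \<le> (B * hardy_norm f) * hardy_norm (toeplitz w f)"
    by (simp add: power2_eq_square)
  thus ?thesis
    using hardy_norm_nonneg[OF T] hardy_norm_nonneg[OF f] symbol_nonneg[OF w]
    by (cases "hardy_norm (toeplitz w f) = 0") auto
qed

lemma toeplitz_lincomb:
  assumes w: "symbol w B" and f: "f \<in> hardy2" and g: "g \<in> hardy2"
  shows "toeplitz w (\<lambda>z. c * f z + d * g z) = (\<lambda>z. c * toeplitz w f z + d * toeplitz w g z)"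
proof (rule hardy_inner_unique_left)
  note fg = hardy2_lincomb(1)[OF f g, of c d]
  fix k assume k: "k \<in> hardy2"
  note ck = sq_int_cnj[OF bdry(1)[OF k]]
  note wf = symbol_mult_sq_int(1)[OF w bdry(1)[OF f]] and wg = symbol_mult_sq_int(1)[OF w bdry(1)[OF g]]
  have [measurable]: "w \<in> borel_measurable arc_measure" using w by (simp add: symbol_def)
  note [measurable] = bdry_measurable[OF f] bdry_measurable[OF g] bdry_measurable[OF fg] bdry_measurable[OF k]
  have "hardy_inner (toeplitz w (\<lambda>z. c * f z + d * g z)) k = (\<integral>x. c * (w x * bdry f x * cnj (bdry k x)) + d * (w x * bdry g x * cnj (bdry k x)) \<partial>arc_measure)"
    unfolding toeplitz(2)[OF w fg k]
    by (rule integral_cong_AE) (measurable, use bdry_lincomb[OF f g, of c d] in \<open>eventually_elim, simp add: algebra_simps\<close>)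
  also have "\<dots> = c * hardy_inner (toeplitz w f) k + d * hardy_inner (toeplitz w g) k"
    using sq_int_mult_integrable[OF wf ck] sq_int_mult_integrable[OF wg ck]
    by (simp add: toeplitz(2)[OF w f k] toeplitz(2)[OF w g k])
  also have "\<dots> = hardy_inner (\<lambda>z. c * toeplitz w f z + d * toeplitz w g z) k"
    by (rule hardy_inner_lincomb_left[symmetric]) (intro toeplitz(1)[OF w] f g k)+
  finally show "hardy_inner (toeplitz w (\<lambda>z. c * f z + d * g z)) k = hardy_inner (\<lambda>z. c * toeplitz w f z + d * toeplitz w g z) k" .
qed (intro toeplitz(1)[OF w] hardy2_lincomb f g)+

lemma bounded_op_toeplitz: "symbol w B \<Longrightarrow> bounded_op (toeplitz w)"
  by (rule bounded_opI[where C=B]) (blast intro: toeplitz toeplitz_lincomb toeplitz_norm symbol_nonneg)+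

lemma symbol_continuous:
  assumes "continuous_on (sphere 0 1) w"
  obtains B where "symbol w B"
proof -
  have "compact (w ` sphere 0 1)" using assms by (intro compact_continuous_image) auto
  then obtain B where "\<forall>x\<in>w ` sphere 0 1. norm x \<le> B"
    using compact_imp_bounded bounded_iff by blast
  thus ?thesis using that borel_measurable_arc_continuous[OF assms] by (auto simp: symbol_def)
qed

lemma toeplitz_eqI:
  assumes w: "symbol w B" and f: "f \<in> hardy2" and g: "g \<in> hardy2"
    and eq: "AE x in arc_measure. bdry g x = w x * bdry f x"
  shows "toeplitz w f = g"
proof (rule hardy_inner_unique_left)
  fix k assume k: "k \<in> hardy2"
  have [measurable]: "w \<in> borel_measurable arc_measure" using w by (simp add: symbol_def)
  note [measurable] = bdry_measurable[OF f] bdry_measurable[OF g] bdry_measurable[OF k]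
  show "hardy_inner (toeplitz w f) k = hardy_inner g k"
    unfolding toeplitz(2)[OF w f k] hardy_inner_eq[OF g k]
    by (rule integral_cong_AE) (measurable, use eq in \<open>eventually_elim, simp\<close>)
qed (intro toeplitz(1)[OF w f] g)+

lemma symbol_id: "symbol (\<lambda>x. x) 1" and symbol_cnj: "symbol cnj 1"
  by (auto simp: symbol_def intro!: borel_measurable_arc_continuous continuous_intros)

lemma hardy2_shift:
  assumes f: "f \<in> hardy2"
  shows "(\<lambda>z. z * f z) \<in> hardy2" "AE x in arc_measure. bdry (\<lambda>z. z * f z) x = x * bdry f x"
proof -
  define c where "c n = (if n = 0 then 0 else hcoeff f (n - 1))" for n
  have "(\<lambda>n. c n * z ^ n) sums (z * f z)" if "norm z < 1" for z
  proof -
    have "(\<lambda>n. z * (hcoeff f n * z ^ n)) sums (z * f z)" by (intro sums_mult hardy2_sums f that)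
    hence "(\<lambda>n. c (Suc n) * z ^ Suc n) sums (z * f z)" by (simp add: c_def mult_ac)
    thus ?thesis by (intro sums_Suc_imp[where f="\<lambda>n. c n * z ^ n"]) (simp_all add: c_def)
  qed
  note p = powser_hcoeff[OF this]
  have "summable (\<lambda>n. (norm (c (Suc n)))\<^sup>2)" using hardy2_summable[OF f] by (simp add: c_def)
  hence "summable (\<lambda>n. (norm (c n))\<^sup>2)" by (subst (asm) summable_Suc_iff)
  thus m: "(\<lambda>z. z * f z) \<in> hardy2" using p hardy2_outside[OF f] by (simp add: hardy2_iff)
  show "AE x in arc_measure. bdry (\<lambda>z. z * f z) x = x * bdry f x"
    by (rule bdry_unique[OF m]) (use bdry(2)[OF f] in \<open>eventually_elim, auto intro!: tendsto_eq_intros\<close>)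
qed

lemma toeplitz_shift: "f \<in> hardy2 \<Longrightarrow> toeplitz (\<lambda>x. x) f = (\<lambda>z. z * f z)"
  by (rule toeplitz_eqI[OF symbol_id _ hardy2_shift]) auto

lemma toeplitz_adjoint:
  assumes w: "symbol w B" and f: "f \<in> hardy2" and g: "g \<in> hardy2"
  shows "hardy_inner (toeplitz w f) g = hardy_inner f (toeplitz (\<lambda>x. cnj (w x)) g)"
proof -
  have w': "symbol (\<lambda>x. cnj (w x)) B" using w by (auto simp: symbol_def)
  show ?thesis
    unfolding toeplitz(2)[OF w f g] hardy_inner_commute[OF f toeplitz(1)[OF w' g]] toeplitz(2)[OF w' g f]
      Bochner_Integration.integral_cnj[symmetric]
    by (simp add: mult_ac)
qed

lemma hardy_adjoint_shift:
  assumes g: "g \<in> hardy2"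
  shows "hardy_adjoint (toeplitz (\<lambda>x. x)) g = toeplitz cnj g"
  unfolding hardy_adjoint_def
proof (rule the_equality)
  have "hardy_inner (toeplitz (\<lambda>x. x) f) g = hardy_inner f (toeplitz cnj g)" if "f \<in> hardy2" for f
    using toeplitz_adjoint[OF symbol_id that g] by simp
  thus T: "toeplitz cnj g \<in> hardy2 \<and> (\<forall>f\<in>hardy2. hardy_inner (toeplitz (\<lambda>x. x) f) g = hardy_inner f (toeplitz cnj g))"
    using toeplitz(1)[OF symbol_cnj g] by blast
  fix h assume "h \<in> hardy2 \<and> (\<forall>f\<in>hardy2. hardy_inner (toeplitz (\<lambda>x. x) f) g = hardy_inner f h)"
  thus "h = toeplitz cnj g" using T by (intro hardy_inner_unique) auto
qed

section \<open>Finite measures on the circle and their Poisson integrals\<close>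

definition circle_measure :: "complex measure \<Rightarrow> bool" where
  "circle_measure \<mu> \<longleftrightarrow> sets \<mu> = sets arc_measure \<and> finite_measure \<mu>"

lemma sphere_in_sets_arc [simp]: "sphere 0 1 \<in> sets (restrict_space borel (sphere (0::complex) 1))"
  by (simp add: sets_restrict_space_iff)

lemma circle_measureD:
  assumes "circle_measure \<mu>"
  shows "sets \<mu> = sets arc_measure" "finite_measure \<mu>" "space \<mu> = sphere 0 1"
    "borel_measurable \<mu> = borel_measurable arc_measure"
proof -
  show 1: "sets \<mu> = sets arc_measure" and "finite_measure \<mu>" using assms by (auto simp: circle_measure_def)
  show "space \<mu> = sphere 0 1" using sets_eq_imp_space_eq[OF 1] by simp
  show "borel_measurable \<mu> = borel_measurable arc_measure" by (rule measurable_cong_sets[OF 1 refl])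
qed

lemma circle_measure_integrable:
  fixes f :: "complex \<Rightarrow> 'a::{banach, second_countable_topology}"
  assumes "circle_measure \<mu>" "f \<in> borel_measurable arc_measure" "\<And>x. x \<in> sphere 0 1 \<Longrightarrow> norm (f x) \<le> B"
  shows "integrable \<mu> f"
proof -
  interpret finite_measure \<mu> using circle_measureD(2)[OF assms(1)] .
  show ?thesis
    by (rule integrable_const_bound[of _ B]) (use assms circle_measureD[OF assms(1)] in \<open>auto intro!: AE_I2\<close>)
qed

lemma continuous_circle_bounded:
  fixes f :: "complex \<Rightarrow> 'a::real_normed_vector"
  assumes "continuous_on (sphere 0 1) f"
  obtains B where "B \<ge> 0" "\<And>t. t \<in> sphere 0 1 \<Longrightarrow> norm (f t) \<le> B"
proof -
  have "compact (f ` sphere 0 1)" using assms by (intro compact_continuous_image) auto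
  then obtain B where B: "\<forall>x\<in>f ` sphere 0 1. norm x \<le> B"
    using compact_imp_bounded bounded_iff by blast
  hence "norm (f 1) \<le> B" by auto
  hence "B \<ge> 0" using norm_ge_zero order_trans by blast
  thus ?thesis using B that by blast
qed

lemma circle_measure_integrable_continuous:
  fixes f :: "complex \<Rightarrow> 'a::{banach, second_countable_topology}"
  assumes "circle_measure \<mu>" "continuous_on (sphere 0 1) f"
  shows "integrable \<mu> f"
proof -
  obtain B where "\<And>x. x \<in> sphere 0 1 \<Longrightarrow> norm (f x) \<le> B" using continuous_circle_bounded[OF assms(2)] by blast
  thus ?thesis by (rule circle_measure_integrable[OF assms(1) borel_measurable_arc_continuous[OF assms(2)]])
qed

lemma poisson_integral_0: "circle_measure \<mu> \<Longrightarrow> poisson_integral \<mu> 0 = measure \<mu> (sphere 0 1)"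
proof -
  assume c: "circle_measure \<mu>"
  have "poisson_integral \<mu> 0 = (\<integral>x. 1 \<partial>\<mu>)"
    unfolding poisson_integral_def
    by (intro Bochner_Integration.integral_cong refl) (simp add: circle_measureD(3)[OF c])
  thus ?thesis by (simp add: circle_measureD(3)[OF c])
qed

text \<open>The Poisson means of a continuous function converge uniformly, by the usual splitting of
  the kernel at distance \<open>\<delta>\<close> from its peak.\<close>

lemma poisson_approximation:
  fixes h :: "complex \<Rightarrow> real"
  assumes h: "continuous_on (sphere 0 1) h" and e: "e > 0"
  obtains r where "0 < r" "r < 1" "\<And>t. norm t = 1 \<Longrightarrow> \<bar>(\<integral>s. h s * pois (of_real r * t) s \<partial>arc_measure) - h t\<bar> \<le> e"
proof -
  obtain B where B: "B \<ge> 0" "\<And>t. t \<in> sphere 0 1 \<Longrightarrow> norm (h t) \<le> B" using continuous_circle_bounded[OF h] by blast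
  have "uniformly_continuous_on (sphere 0 1) h"
    using h by (intro compact_uniformly_continuous) auto
  then obtain \<delta> where \<delta>: "\<delta> > 0" "\<And>x y. x \<in> sphere 0 1 \<Longrightarrow> y \<in> sphere 0 1 \<Longrightarrow> dist y x < \<delta> \<Longrightarrow> dist (h y) (h x) < e / 2"
    unfolding uniformly_continuous_on_def using e by (metis half_gt_zero)
  have "((\<lambda>r. 8 * B * (1 - r\<^sup>2) / \<delta>\<^sup>2) \<longlongrightarrow> 8 * B * (1 - 1\<^sup>2) / \<delta>\<^sup>2) (at_left (1::real))"
    using \<delta>(1) by (intro tendsto_intros) auto
  hence "\<forall>\<^sub>F r in at_left (1::real). 8 * B * (1 - r\<^sup>2) / \<delta>\<^sup>2 < e / 2"
    using e by (intro order_tendstoD(2)) auto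
  moreover have "\<forall>\<^sub>F r in at_left (1::real). r \<in> {0<..<1}" by (rule eventually_at_leftI[of 0]) auto
  ultimately have "\<forall>\<^sub>F r in at_left (1::real). r \<in> {0<..<1} \<and> 8 * B * (1 - r\<^sup>2) / \<delta>\<^sup>2 < e / 2"
    by eventually_elim auto
  from eventually_happens'[OF trivial_limit_at_left_real this]
  obtain r where r: "0 < r" "r < 1" "8 * B * (1 - r\<^sup>2) / \<delta>\<^sup>2 < e / 2" by auto
  have "\<bar>(\<integral>s. h s * pois (of_real r * t) s \<partial>arc_measure) - h t\<bar> \<le> e" if t: "norm t = 1" for t
  proof -
    define z where "z = of_real r * t"
    have z: "norm z < 1" "norm z = r" using r t by (simp_all add: z_def norm_mult)
    note pc = continuous_on_pois[OF z(1)]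
    have pw: "norm ((h s - h t) * pois z s) \<le> (e/2) * pois z s + 8 * B * (1 - r\<^sup>2) / \<delta>\<^sup>2" if s: "norm s = 1" for s
    proof (cases "dist s t < \<delta>")
      case True
      hence "\<bar>h s - h t\<bar> \<le> e / 2" using \<delta>(2)[of t s] s t by (simp add: dist_real_def)
      hence "\<bar>h s - h t\<bar> * pois z s \<le> (e/2) * pois z s" by (intro mult_right_mono pois_nonneg z)
      moreover have "0 \<le> 8 * B * (1 - r\<^sup>2) / \<delta>\<^sup>2" using B(1) r by (simp add: power_le_one)
      ultimately show ?thesis using pois_nonneg[OF z(1), of s] by (simp add: abs_mult)
    next
      case False
      have "norm (z - t) = 1 - r"
      proof -
        have "z - t = of_real (r - 1) * t" by (simp add: z_def algebra_simps)
        thus ?thesis using t r by (simp add: norm_mult del: of_real_diff)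
      qed
      moreover have "1 - r \<le> norm (s - z)" using norm_triangle_ineq2[of s z] s z by simp
      ultimately have d2: "\<delta> \<le> 2 * norm (s - z)"
        using norm_triangle_ineq[of "s - z" "z - t"] False by (simp add: dist_norm)
      have "pois z s \<le> (1 - r\<^sup>2) / (\<delta>/2)\<^sup>2"
        unfolding pois_def z(2) using d2 \<delta>(1) r
        by (intro divide_left_mono power_mono mult_pos_pos zero_less_power) (auto simp: power_le_one)
      hence p: "pois z s \<le> 4 * (1 - r\<^sup>2) / \<delta>\<^sup>2" by (simp add: power_divide mult.commute)
      have "\<bar>h s - h t\<bar> \<le> 2 * B" using B(2)[of s] B(2)[of t] s t by simp
      hence "\<bar>h s - h t\<bar> * pois z s \<le> (2 * B) * (4 * (1 - r\<^sup>2) / \<delta>\<^sup>2)"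
        using p B(1) by (intro mult_mono pois_nonneg z) auto
      moreover have "(2 * B) * (4 * (1 - r\<^sup>2) / \<delta>\<^sup>2) = 8 * B * (1 - r\<^sup>2) / \<delta>\<^sup>2" by simp
      moreover have "0 \<le> (e/2) * pois z s" using e pois_nonneg[OF z(1), of s] by simp
      moreover have "norm ((h s - h t) * pois z s) = \<bar>h s - h t\<bar> * pois z s"
        using pois_nonneg[OF z(1), of s] by (simp add: abs_mult)
      ultimately show ?thesis by linarith
    qed
    have ip: "integrable arc_measure (pois z)" by (rule integrable_arc_continuous[OF pc])
    have "(\<integral>s. h s * pois z s \<partial>arc_measure) - h t = (\<integral>s. h s * pois z s \<partial>arc_measure) - (\<integral>s. h t * pois z s \<partial>arc_measure)"
      using integral_pois[OF z(1)] by simp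
    also have "\<dots> = (\<integral>s. (h s - h t) * pois z s \<partial>arc_measure)"
      unfolding left_diff_distrib
      by (rule Bochner_Integration.integral_diff[symmetric]) (intro integrable_arc_continuous continuous_intros h pc)+
    also have "norm \<dots> \<le> (\<integral>s. norm ((h s - h t) * pois z s) \<partial>arc_measure)" by (rule integral_norm_bound)
    also have "\<dots> \<le> (\<integral>s. (e/2) * pois z s + 8 * B * (1 - r\<^sup>2) / \<delta>\<^sup>2 \<partial>arc_measure)"
      using pw by (intro integral_mono integrable_arc_continuous continuous_intros h pc) auto
    also have "\<dots> = e/2 + 8 * B * (1 - r\<^sup>2) / \<delta>\<^sup>2"
      using integral_pois[OF z(1)] arc.prob_space ip by simp
    also have "\<dots> \<le> e" using r(3) by simp
    finally show ?thesis by (simp add: z_def)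
  qed
  thus ?thesis using that r by blast
qed

lemma borel_measurable_id_arc: "(\<lambda>x. x) \<in> borel_measurable arc_measure"
  by (intro borel_measurable_arc_continuous continuous_intros)

text \<open>The Poisson mean is self-adjoint: averaging a function against a measure equals averaging
  the harmonic extension of the measure against the function.\<close>

lemma poisson_fubini:
  fixes h :: "complex \<Rightarrow> real"
  assumes \<mu>: "circle_measure \<mu>" and h: "continuous_on (sphere 0 1) h" and r: "0 \<le> r" "r < 1"
  shows "(\<integral>y. (\<integral>t. h t * pois (of_real r * y) t \<partial>arc_measure) \<partial>\<mu>)
       = (\<integral>t. h t * poisson_integral \<mu> (of_real r * t) \<partial>arc_measure)"
proof -
  interpret M: finite_measure \<mu> using circle_measureD(2)[OF \<mu>] .
  interpret P: pair_sigma_finite arc_measure \<mu> ..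
  interpret F: finite_measure "arc_measure \<Otimes>\<^sub>M \<mu>"
    by (rule finite_measure_pair_measure) unfold_locales
  obtain B where B: "B \<ge> 0" "\<And>t. t \<in> sphere 0 1 \<Longrightarrow> norm (h t) \<le> B" using continuous_circle_bounded[OF h] by blast
  have [measurable]: "h \<in> borel_measurable arc_measure" by (rule borel_measurable_arc_continuous[OF h])
  have [measurable]: "(\<lambda>t. t) \<in> borel_measurable arc_measure" by (rule borel_measurable_id_arc)
  have [measurable]: "(\<lambda>t. t) \<in> borel_measurable \<mu>" unfolding circle_measureD(4)[OF \<mu>] by (rule borel_measurable_id_arc)
  have [measurable]: "fst \<in> borel_measurable (arc_measure \<Otimes>\<^sub>M \<mu>)" "snd \<in> borel_measurable (arc_measure \<Otimes>\<^sub>M \<mu>)"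
    using measurable_compose[OF measurable_fst[of arc_measure \<mu>] borel_measurable_id_arc]
      measurable_compose[OF measurable_snd[of arc_measure \<mu>], of "\<lambda>t. t" borel] by auto
  have "integrable (arc_measure \<Otimes>\<^sub>M \<mu>) (\<lambda>(t, y). h t * pois (of_real r * y) t)"
  proof (rule F.integrable_const_bound[of _ "B * (2 / (1 - r))"])
    show "AE x in arc_measure \<Otimes>\<^sub>M \<mu>. norm (case x of (t, y) \<Rightarrow> h t * pois (of_real r * y) t) \<le> B * (2 / (1 - r))"
    proof (rule AE_I2)
      fix x assume "x \<in> space (arc_measure \<Otimes>\<^sub>M \<mu>)"
      then obtain t y where x: "x = (t, y)" "norm t = 1" "norm y = 1"
        by (auto simp: space_pair_measure circle_measureD(3)[OF \<mu>])
      have n: "norm (of_real r * y) \<le> r" using x r by (simp add: norm_mult)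
      have "\<bar>h t\<bar> * \<bar>pois (of_real r * y) t\<bar> \<le> B * (2 / (1 - r))"
        using B(2)[of t] x pois_upper[OF n r(2) x(2)] pois_nonneg[of "of_real r * y" t] n r B(1)
        by (intro mult_mono) auto
      thus "norm (case x of (t, y) \<Rightarrow> h t * pois (of_real r * y) t) \<le> B * (2 / (1 - r))"
        by (simp add: x(1) abs_mult)
    qed
    show "(\<lambda>(t, y). h t * pois (of_real r * y) t) \<in> borel_measurable (arc_measure \<Otimes>\<^sub>M \<mu>)"
      unfolding pois_def case_prod_beta by measurable
  qed
  from P.Fubini_integral[OF this]
  have "(\<integral>y. (\<integral>t. h t * pois (of_real r * y) t \<partial>arc_measure) \<partial>\<mu>) = (\<integral>t. (\<integral>y. h t * pois (of_real r * y) t \<partial>\<mu>) \<partial>arc_measure)" .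
  also have "\<dots> = (\<integral>t. h t * poisson_integral \<mu> (of_real r * t) \<partial>arc_measure)"
  proof (intro Bochner_Integration.integral_cong refl)
    fix t assume z: "t \<in> space arc_measure"
    have "(\<integral>y. h t * pois (of_real r * y) t \<partial>\<mu>) = (\<integral>y. h t * pois (of_real r * t) y \<partial>\<mu>)"
      using z by (intro Bochner_Integration.integral_cong refl) (auto simp: circle_measureD(3)[OF \<mu>] pois_swap)
    thus "(\<integral>y. h t * pois (of_real r * y) t \<partial>\<mu>) = h t * poisson_integral \<mu> (of_real r * t)"
      by (simp add: poisson_integral_pois)
  qed
  finally show ?thesis .
qed

lemma poisson_integral_bounds:
  assumes \<mu>: "circle_measure \<mu>" and z: "norm z \<le> r" "r < 1"
  shows "0 \<le> poisson_integral \<mu> z" "poisson_integral \<mu> z \<le> 2 / (1 - r) * measure \<mu> (sphere 0 1)"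
proof -
  have z1: "norm z < 1" using z by linarith
  show "0 \<le> poisson_integral \<mu> z" unfolding poisson_integral_pois by (intro integral_nonneg_AE AE_I2 pois_nonneg z1)
  interpret M: finite_measure \<mu> using circle_measureD(2)[OF \<mu>] .
  have "poisson_integral \<mu> z \<le> (\<integral>x. 2 / (1 - r) \<partial>\<mu>)"
    unfolding poisson_integral_pois
    using z by (intro integral_mono circle_measure_integrable_continuous[OF \<mu>] continuous_on_pois z1)
       (auto simp: circle_measureD(3)[OF \<mu>] intro!: pois_upper)
  thus "poisson_integral \<mu> z \<le> 2 / (1 - r) * measure \<mu> (sphere 0 1)"
    by (simp add: circle_measureD(3)[OF \<mu>] mult.commute)
qed

lemma poisson_integral_measurable:
  assumes \<mu>: "circle_measure \<mu>" and r: "0 \<le> r" "r < 1"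
  shows "(\<lambda>x. poisson_integral \<mu> (of_real r * x)) \<in> borel_measurable arc_measure"
proof -
  interpret M: finite_measure \<mu> using circle_measureD(2)[OF \<mu>] .
  have [measurable]: "fst \<in> borel_measurable (arc_measure \<Otimes>\<^sub>M \<mu>)"
    using measurable_compose[OF measurable_fst[of arc_measure \<mu>] borel_measurable_id_arc] by simp
  have "(\<lambda>x. x) \<in> borel_measurable \<mu>" unfolding circle_measureD(4)[OF \<mu>] by (rule borel_measurable_id_arc)
  from measurable_compose[OF measurable_snd[of arc_measure \<mu>] this]
  have [measurable]: "snd \<in> borel_measurable (arc_measure \<Otimes>\<^sub>M \<mu>)" by simp
  have "(\<lambda>(x, y). pois (of_real r * x) y) \<in> borel_measurable (arc_measure \<Otimes>\<^sub>M \<mu>)"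
    unfolding pois_def case_prod_beta by measurable
  from M.borel_measurable_lebesgue_integral[OF this] show ?thesis unfolding poisson_integral_pois .
qed

text \<open>Poisson integrals at the single point 0 bound the masses; then a continuous function is
  replaced by a Poisson mean, up to a uniformly small error, and Fubini turns its integrals into
  integrals of the Poisson integrals.\<close>

theorem poisson_weak_convergence:
  fixes h :: "complex \<Rightarrow> real"
  assumes \<mu>n: "\<And>n. circle_measure (\<mu>n n)" and \<mu>: "circle_measure \<mu>"
    and lim: "\<And>z. norm z < 1 \<Longrightarrow> (\<lambda>n. poisson_integral (\<mu>n n) z) \<longlonglongrightarrow> poisson_integral \<mu> z"
    and h: "continuous_on (sphere 0 1) h"
  shows "(\<lambda>n. \<integral>x. h x \<partial>\<mu>n n) \<longlonglongrightarrow> (\<integral>x. h x \<partial>\<mu>)"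
proof (rule tendstoI)
  fix e :: real assume e: "e > 0"
  have "Bseq (\<lambda>n. poisson_integral (\<mu>n n) 0)" using lim[of 0] by (intro convergent_imp_Bseq convergentI) auto
  then obtain K where K: "K > 0" "\<And>n. norm (poisson_integral (\<mu>n n) 0) \<le> K" by (auto elim: BseqE)
  have mass: "measure (\<mu>n n) (sphere 0 1) \<le> K" for n
    using K(2)[of n] poisson_integral_0[OF \<mu>n, of n] by simp
  have mass': "measure \<mu> (sphere 0 1) \<le> K"
  proof (rule tendsto_upperbound)
    show "(\<lambda>n. poisson_integral (\<mu>n n) 0) \<longlonglongrightarrow> measure \<mu> (sphere 0 1)"
      using lim[of 0] poisson_integral_0[OF \<mu>] by simp
    show "\<forall>\<^sub>F n in sequentially. poisson_integral (\<mu>n n) 0 \<le> K"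
      using mass by (simp add: poisson_integral_0[OF \<mu>n])
  qed auto
  obtain r where r: "0 < r" "r < 1" "\<And>x. norm x = 1 \<Longrightarrow> \<bar>(\<integral>y. h y * pois (of_real r * x) y \<partial>arc_measure) - h x\<bar> \<le> e / (4 * K)"
    using poisson_approximation[OF h, of "e / (4 * K)"] e K(1) by auto
  define S where "S x = (\<integral>y. h y * pois (of_real r * x) y \<partial>arc_measure)" for x
  obtain B where B: "B \<ge> 0" "\<And>x. x \<in> sphere 0 1 \<Longrightarrow> norm (h x) \<le> B" using continuous_circle_bounded[OF h] by blast
  have hm [measurable]: "h \<in> borel_measurable arc_measure" by (rule borel_measurable_arc_continuous[OF h])
  have Sm: "S \<in> borel_measurable arc_measure"
  proof -
    have [measurable]: "fst \<in> borel_measurable (arc_measure \<Otimes>\<^sub>M arc_measure)" "snd \<in> borel_measurable (arc_measure \<Otimes>\<^sub>M arc_measure)"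
      using measurable_compose[OF measurable_fst[of arc_measure arc_measure] borel_measurable_id_arc]
        measurable_compose[OF measurable_snd[of arc_measure arc_measure] borel_measurable_id_arc] by auto
    have "(\<lambda>(x, y). h y * pois (of_real r * x) y) \<in> borel_measurable (arc_measure \<Otimes>\<^sub>M arc_measure)"
      unfolding pois_def case_prod_beta by measurable
    from arc.borel_measurable_lebesgue_integral[OF this] show ?thesis unfolding S_def .
  qed
  have Sb: "norm (S x) \<le> B + e / (4 * K)" if "x \<in> sphere 0 1" for x
    using r(3)[of x] B(2)[OF that] that unfolding S_def[symmetric] by simp
  have diff: "\<bar>(\<integral>x. S x \<partial>\<nu>) - (\<integral>x. h x \<partial>\<nu>)\<bar> \<le> e / 4" if \<nu>: "circle_measure \<nu>" "measure \<nu> (sphere 0 1) \<le> K" for \<nu>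
  proof -
    interpret finite_measure \<nu> using circle_measureD(2)[OF \<nu>(1)] .
    have i: "integrable \<nu> S" "integrable \<nu> h"
      using circle_measure_integrable[OF \<nu>(1) Sm Sb] circle_measure_integrable_continuous[OF \<nu>(1) h] by auto
    have "\<bar>(\<integral>x. S x \<partial>\<nu>) - (\<integral>x. h x \<partial>\<nu>)\<bar> = norm (\<integral>x. S x - h x \<partial>\<nu>)" using i by simp
    also have "\<dots> \<le> (\<integral>x. norm (S x - h x) \<partial>\<nu>)" by (rule integral_norm_bound)
    also have "\<dots> \<le> (\<integral>x. e / (4 * K) \<partial>\<nu>)"
      using i r(3) by (intro integral_mono integrable_norm Bochner_Integration.integrable_diff)
        (auto simp: S_def[symmetric] circle_measureD(3)[OF \<nu>(1)])
    also have "\<dots> = e / (4 * K) * measure \<nu> (sphere 0 1)" by (simp add: circle_measureD(3)[OF \<nu>(1)])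
    also have "\<dots> \<le> e / (4 * K) * K" using \<nu>(2) e K(1) by (intro mult_left_mono) auto
    also have "\<dots> = e / 4" using K(1) by simp
    finally show ?thesis .
  qed
  have "(\<lambda>n. \<integral>x. h x * poisson_integral (\<mu>n n) (of_real r * x) \<partial>arc_measure) \<longlonglongrightarrow> (\<integral>x. h x * poisson_integral \<mu> (of_real r * x) \<partial>arc_measure)"
  proof (rule integral_dominated_convergence[where w="\<lambda>_. B * (2 / (1 - r) * K)"])
    have [measurable]: "(\<lambda>x. poisson_integral \<mu> (of_real r * x)) \<in> borel_measurable arc_measure"
      "(\<lambda>x. poisson_integral (\<mu>n n) (of_real r * x)) \<in> borel_measurable arc_measure" for n
      using r by (auto intro!: poisson_integral_measurable \<mu> \<mu>n)
    show "(\<lambda>x. h x * poisson_integral \<mu> (of_real r * x)) \<in> borel_measurable arc_measure" by measurable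
    show "(\<lambda>x. h x * poisson_integral (\<mu>n n) (of_real r * x)) \<in> borel_measurable arc_measure" for n by measurable
    show "AE x in arc_measure. (\<lambda>n. h x * poisson_integral (\<mu>n n) (of_real r * x)) \<longlonglongrightarrow> h x * poisson_integral \<mu> (of_real r * x)"
      using r by (intro AE_I2 tendsto_intros lim) (auto simp: norm_mult)
    show "AE x in arc_measure. norm (h x * poisson_integral (\<mu>n n) (of_real r * x)) \<le> B * (2 / (1 - r) * K)" for n
    proof (rule AE_I2)
      fix x assume z: "x \<in> space arc_measure"
      hence n: "norm (of_real r * x) \<le> r" using r by (simp add: norm_mult)
      note pb = poisson_integral_bounds[OF \<mu>n n r(2), of n]
      have "2 / (1 - r) * measure (\<mu>n n) (sphere 0 1) \<le> 2 / (1 - r) * K"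
        using mass[of n] r by (intro mult_left_mono) auto
      hence "\<bar>poisson_integral (\<mu>n n) (of_real r * x)\<bar> \<le> 2 / (1 - r) * K" using pb by linarith
      thus "norm (h x * poisson_integral (\<mu>n n) (of_real r * x)) \<le> B * (2 / (1 - r) * K)"
        unfolding norm_mult using B z by (intro mult_mono) auto
    qed
  qed auto
  hence "(\<lambda>n. \<integral>x. S x \<partial>\<mu>n n) \<longlonglongrightarrow> (\<integral>x. S x \<partial>\<mu>)"
    unfolding S_def using poisson_fubini[OF \<mu>n h, of r] poisson_fubini[OF \<mu> h, of r] r by simp
  hence "\<forall>\<^sub>F n in sequentially. dist (\<integral>x. S x \<partial>\<mu>n n) (\<integral>x. S x \<partial>\<mu>) < e / 2" using e by (intro tendstoD) auto
  thus "\<forall>\<^sub>F n in sequentially. dist (\<integral>x. h x \<partial>\<mu>n n) (\<integral>x. h x \<partial>\<mu>) < e"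
  proof eventually_elim
    case (elim n)
    thus ?case using diff[OF \<mu>n mass, of n] diff[OF \<mu> mass'] unfolding dist_real_def by linarith
  qed
qed

text \<open>The continuous functions \<open>max 0 (1 - n * infdist x C)\<close> decrease to the indicator of a
  closed set \<open>C\<close>, and closed sets form a generator that is stable under intersection.\<close>

lemma circle_measure_eqI:
  assumes \<mu>: "circle_measure \<mu>" and \<nu>: "circle_measure \<nu>"
    and eq: "\<And>h :: complex \<Rightarrow> real. continuous_on (sphere 0 1) h \<Longrightarrow> (\<integral>x. h x \<partial>\<mu>) = (\<integral>x. h x \<partial>\<nu>)"
  shows "\<mu> = \<nu>"
proof -
  interpret M: finite_measure \<mu> using circle_measureD(2)[OF \<mu>] .
  interpret N: finite_measure \<nu> using circle_measureD(2)[OF \<nu>] .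
  have id: "(\<lambda>x. x) \<in> borel_measurable \<mu>" "(\<lambda>x. x) \<in> borel_measurable \<nu>"
    unfolding circle_measureD(4)[OF \<mu>] circle_measureD(4)[OF \<nu>] by (rule borel_measurable_id_arc)+
  have closed_eq: "measure \<mu> (C \<inter> sphere 0 1) = measure \<nu> (C \<inter> sphere 0 1)" if C: "closed C" for C
  proof (cases "C = {}")
    case False
    define h where "h n x = max 0 (1 - real n * infdist x C)" for n :: nat and x
    have hc: "continuous_on (sphere 0 1) (h n)" for n unfolding h_def by (intro continuous_intros)
    have Cm: "C \<inter> sphere 0 1 \<in> sets arc_measure"
      using C by (simp add: sets_restrict_space_iff)
    have conv: "(\<lambda>n. \<integral>x. h n x \<partial>\<rho>) \<longlonglongrightarrow> measure \<rho> (C \<inter> sphere 0 1)" if \<rho>: "circle_measure \<rho>" for \<rho>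
    proof -
      interpret R: finite_measure \<rho> using circle_measureD(2)[OF \<rho>] .
      have "(\<lambda>n. \<integral>x. h n x \<partial>\<rho>) \<longlonglongrightarrow> (\<integral>x. indicator (C \<inter> sphere 0 1) x \<partial>\<rho>)"
      proof (rule integral_dominated_convergence[where w="\<lambda>_. 1"])
        show "h n \<in> borel_measurable \<rho>" for n
          unfolding circle_measureD(4)[OF \<rho>] by (rule borel_measurable_arc_continuous[OF hc])
        show "(indicator (C \<inter> sphere 0 1) :: complex \<Rightarrow> real) \<in> borel_measurable \<rho>"
          unfolding circle_measureD(4)[OF \<rho>] using Cm by (rule borel_measurable_indicator)
        show "AE x in \<rho>. (\<lambda>n. h n x) \<longlonglongrightarrow> indicator (C \<inter> sphere 0 1) x"
        proof (rule AE_I2)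
          fix x assume "x \<in> space \<rho>"
          hence z: "x \<in> sphere 0 1" by (simp add: circle_measureD(3)[OF \<rho>])
          show "(\<lambda>n. h n x) \<longlonglongrightarrow> indicator (C \<inter> sphere 0 1) x"
          proof (cases "x \<in> C")
            case True thus ?thesis using z by (simp add: h_def)
          next
            case nC: False
            hence d: "infdist x C > 0" using C False infdist_pos_not_in_closed by blast
            obtain N :: nat where N: "1 / infdist x C < real N" using reals_Archimedean2 by blast
            have "\<forall>\<^sub>F n in sequentially. h n x = 0"
              using eventually_ge_at_top[of N]
            proof eventually_elim
              case (elim n)
              hence "1 / infdist x C < real n" using N by linarith
              thus ?case using d by (simp add: h_def divide_less_eq)
            qed
            from tendsto_eventually[OF this] show ?thesis using nC by simp
          qed
        qed
        show "AE x in \<rho>. norm (h n x) \<le> 1" for n by (intro AE_I2) (auto simp: h_def infdist_nonneg)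
      qed auto
      moreover have "C \<inter> sphere 0 1 \<in> sets \<rho>" using Cm circle_measureD(1)[OF \<rho>] by simp
      ultimately show ?thesis using circle_measureD(3)[OF \<rho>] by (simp add: Int_assoc)
    qed
    have "(\<lambda>n. \<integral>x. h n x \<partial>\<mu>) = (\<lambda>n. \<integral>x. h n x \<partial>\<nu>)" using eq[OF hc] by simp
    thus ?thesis using conv[OF \<mu>] conv[OF \<nu>] LIMSEQ_unique by metis
  qed simp
  have "distr \<mu> borel (\<lambda>x. x) = distr \<nu> borel (\<lambda>x. x)"
  proof (rule measure_eqI_generator_eq[where E="Collect closed" and \<Omega>=UNIV and A="\<lambda>_. UNIV"])
    show "Int_stable (Collect (closed :: complex set \<Rightarrow> bool))" by (auto simp: Int_stable_def)
    fix X :: "complex set" assume "X \<in> Collect closed"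
    hence X: "closed X" by simp
    show "emeasure (distr \<mu> borel (\<lambda>x. x)) X = emeasure (distr \<nu> borel (\<lambda>x. x)) X"
      using X closed_eq[OF X] by (simp add: emeasure_distr id circle_measureD(3)[OF \<mu>] circle_measureD(3)[OF \<nu>] M.emeasure_eq_measure N.emeasure_eq_measure)
  next
    show "emeasure (distr \<mu> borel (\<lambda>x. x)) UNIV \<noteq> \<infinity>"
      by (simp add: emeasure_distr id M.emeasure_eq_measure)
  qed (simp_all add: borel_eq_closed)
  hence d: "emeasure (distr \<mu> borel (\<lambda>x. x)) A = emeasure (distr \<nu> borel (\<lambda>x. x)) A" for A by simp
  show ?thesis
  proof (rule measure_eqI)
    show "sets \<mu> = sets \<nu>" by (simp add: circle_measureD(1)[OF \<mu>] circle_measureD(1)[OF \<nu>])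
    fix A assume "A \<in> sets \<mu>"
    hence A: "A \<subseteq> sphere 0 1" "A \<in> sets borel"
      by (auto simp: circle_measureD(1)[OF \<mu>] sets_restrict_space_iff)
    hence "A \<inter> sphere 0 1 = A" by blast
    thus "emeasure \<mu> A = emeasure \<nu> A"
      using d[of A] A by (simp add: emeasure_distr id circle_measureD(3)[OF \<mu>] circle_measureD(3)[OF \<nu>])
  qed
qed

lemma poisson_integral_unique:
  assumes \<mu>: "circle_measure \<mu>" and \<nu>: "circle_measure \<nu>"
    and eq: "\<And>z. norm z < 1 \<Longrightarrow> poisson_integral \<mu> z = poisson_integral \<nu> z"
  shows "\<mu> = \<nu>"
proof (rule circle_measure_eqI[OF \<mu> \<nu>])
  fix h :: "complex \<Rightarrow> real" assume h: "continuous_on (sphere 0 1) h"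
  have "(\<lambda>n. \<integral>x. h x \<partial>\<mu>) \<longlonglongrightarrow> (\<integral>x. h x \<partial>\<nu>)"
    by (rule poisson_weak_convergence[OF \<mu> \<nu> _ h]) (simp add: eq)
  thus "(\<integral>x. h x \<partial>\<mu>) = (\<integral>x. h x \<partial>\<nu>)" using LIMSEQ_const_iff by blast
qed

lemma circle_measure_density:
  fixes v :: "complex \<Rightarrow> real"
  assumes v: "integrable arc_measure v" and nn: "AE x in arc_measure. 0 \<le> v x"
  shows "circle_measure (density arc_measure (\<lambda>x. ennreal (v x)))"
    and "f \<in> borel_measurable arc_measure \<Longrightarrow> integral\<^sup>L (density arc_measure (\<lambda>x. ennreal (v x))) f = (\<integral>x. v x *\<^sub>R (f x :: 'a::{banach,second_countable_topology}) \<partial>arc_measure)"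
proof -
  have [measurable]: "v \<in> borel_measurable arc_measure" using v by auto
  have "(\<integral>\<^sup>+x. ennreal (v x) \<partial>arc_measure) = ennreal (\<integral>x. v x \<partial>arc_measure)"
    by (rule nn_integral_eq_integral[OF v nn])
  hence "finite_measure (density arc_measure (\<lambda>x. ennreal (v x)))"
  proof (intro finite_measureI)
    have "emeasure (density arc_measure (\<lambda>x. ennreal (v x))) (space arc_measure) = (\<integral>\<^sup>+x. ennreal (v x) \<partial>arc_measure)"
      by (subst emeasure_density) (auto intro!: nn_integral_cong)
    moreover assume "(\<integral>\<^sup>+x. ennreal (v x) \<partial>arc_measure) = ennreal (\<integral>x. v x \<partial>arc_measure)"
    ultimately show "emeasure (density arc_measure (\<lambda>x. ennreal (v x))) (space (density arc_measure (\<lambda>x. ennreal (v x)))) \<noteq> \<infinity>"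
      by simp
  qed
  thus "circle_measure (density arc_measure (\<lambda>x. ennreal (v x)))" by (simp add: circle_measure_def)
  show "f \<in> borel_measurable arc_measure \<Longrightarrow> integral\<^sup>L (density arc_measure (\<lambda>x. ennreal (v x))) f = (\<integral>x. v x *\<^sub>R (f x :: 'a) \<partial>arc_measure)"
    using nn by (intro integral_density) auto
qed

section \<open>The Herglotz representation\<close>

lemma poisson_dilate:
  assumes F: "F holomorphic_on ball 0 1" and r: "0 \<le> r" "r < 1" and z: "norm z < 1"
  shows "(\<integral>x. F (of_real r * x) * of_real (pois z x) \<partial>arc_measure) = F (of_real r * z)"
    and "(\<integral>x. Re (F (of_real r * x)) * pois z x \<partial>arc_measure) = Re (F (of_real r * z))"
proof -
  let ?a = "\<lambda>n. hcoeff F n * of_real r ^ n"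
  have "(\<integral>x. F (of_real r * x) * of_real (pois z x) \<partial>arc_measure) = (\<integral>x. (\<Sum>n. ?a n * x ^ n) * of_real (pois z x) \<partial>arc_measure)"
    using hcoeff_dilate_sums(2)[OF F r] by (intro Bochner_Integration.integral_cong refl) auto
  also have "\<dots> = (\<Sum>n. ?a n * z ^ n)" by (rule poisson_power_series[OF hcoeff_dilate_sums(1)[OF F r] z])
  also have "\<dots> = F (of_real r * z)" using hcoeff_dilate_sums(2)[OF F r, of z] z by simp
  finally show 1: "(\<integral>x. F (of_real r * x) * of_real (pois z x) \<partial>arc_measure) = F (of_real r * z)" .
  have i: "integrable arc_measure (\<lambda>x. F (of_real r * x) * of_real (pois z x))"
    by (intro integrable_arc_continuous continuous_intros continuous_on_dilate F r continuous_on_pois z)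
  have "Re (\<integral>x. F (of_real r * x) * of_real (pois z x) \<partial>arc_measure) = (\<integral>x. Re (F (of_real r * x) * of_real (pois z x)) \<partial>arc_measure)"
    by (rule integral_Re[OF i, symmetric])
  thus "(\<integral>x. Re (F (of_real r * x)) * pois z x \<partial>arc_measure) = Re (F (of_real r * z))"
    unfolding 1 by simp
qed

text \<open>Helly's selection theorem on the line, applied to the distributions of the angle after
  normalising the total mass. The limit is mapped back to the circle by \<open>cis\<close>, so it does not
  matter how it treats the two endpoints.\<close>

theorem poisson_compactness:
  assumes D: "\<And>n. circle_measure (D n)"
    and lim: "\<And>z. norm z < 1 \<Longrightarrow> (\<lambda>n. poisson_integral (D n) z) \<longlonglongrightarrow> U z"
  obtains \<mu> where "circle_measure \<mu>" "\<And>z. norm z < 1 \<Longrightarrow> poisson_integral \<mu> z = U z"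
proof (cases "U 0 = 0")
  case True
  have n: "circle_measure (null_measure arc_measure)"
    by (auto simp: circle_measure_def intro!: finite_measureI)
  have "poisson_integral (null_measure arc_measure) z = U z" if z: "norm z < 1" for z
  proof -
    have "(\<lambda>n. poisson_integral (D n) z) \<longlonglongrightarrow> 0"
    proof (rule tendsto_sandwich[OF _ _ tendsto_const])
      show "\<forall>\<^sub>F n in sequentially. 0 \<le> poisson_integral (D n) z"
        using poisson_integral_bounds(1)[OF D _ z] by simp
      show "\<forall>\<^sub>F n in sequentially. poisson_integral (D n) z \<le> 2 / (1 - norm z) * poisson_integral (D n) 0"
        using poisson_integral_bounds(2)[OF D _ z] by (simp add: poisson_integral_0[OF D])
      show "(\<lambda>n. 2 / (1 - norm z) * poisson_integral (D n) 0) \<longlonglongrightarrow> 0"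
        using lim[of 0] True by (intro tendsto_mult_right_zero) simp
    qed
    from LIMSEQ_unique[OF this lim[OF z]] show ?thesis by (simp add: poisson_integral_def)
  qed
  thus ?thesis using that n by blast
next
  case False
  have "0 \<le> U 0"
    by (rule tendsto_lowerbound[OF lim]) (auto simp: poisson_integral_0[OF D])
  hence U0: "0 < U 0" using False by simp
  hence "\<forall>\<^sub>F n in sequentially. 0 < poisson_integral (D n) 0" using lim[of 0] by (intro order_tendstoD(1)) auto
  then obtain n0 where n0: "\<And>n. n \<ge> n0 \<Longrightarrow> 0 < poisson_integral (D n) 0" by (auto simp: eventually_sequentially)
  define C where "C n = D (n + n0)" for n
  define m where "m n = poisson_integral (C n) 0" for n
  have C: "circle_measure (C n)" for n by (simp add: C_def D)
  have Clim: "(\<lambda>n. poisson_integral (C n) z) \<longlonglongrightarrow> U z" if "norm z < 1" for z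
    unfolding C_def by (rule LIMSEQ_ignore_initial_segment[OF lim[OF that]])
  have m: "m n > 0" "m n = measure (C n) (sphere 0 1)" for n
    using n0[of "n + n0"] poisson_integral_0[OF C, of n] by (simp_all add: m_def C_def)
  \<comment> \<open>The masses are normalised, and the circle is unrolled to an interval of angles.\<close>
  define N where "N n = distr (density (C n) (\<lambda>_. ennreal (1 / m n))) borel Arg2pi" for n
  have am: "Arg2pi \<in> borel_measurable (density (C n) (\<lambda>_. ennreal (1 / m n)))" for n
    by (simp add: circle_measureD(4)[OF C] measurable_Arg2pi_arc)
  have Cprob: "prob_space (density (C n) (\<lambda>_. ennreal (1 / m n)))" for n
  proof (rule prob_spaceI)
    interpret finite_measure "C n" using circle_measureD(2)[OF C] .
    have "emeasure (density (C n) (\<lambda>_. ennreal (1 / m n))) (space (C n)) = ennreal (1 / m n) * emeasure (C n) (space (C n))"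
      by (subst emeasure_density) (auto simp: nn_integral_cmult_indicator)
    also have "\<dots> = 1" using m[of n] by (simp add: emeasure_eq_measure circle_measureD(3)[OF C] ennreal_mult'[symmetric])
    finally show "emeasure (density (C n) (\<lambda>_. ennreal (1 / m n))) (space (density (C n) (\<lambda>_. ennreal (1 / m n)))) = 1" by simp
  qed
  have Nreal: "real_distribution (N n)" for n
    unfolding N_def by (rule prob_space.real_distribution_distr[OF Cprob am])
  have "tight N"
    unfolding tight_def
  proof (intro conjI allI impI)
    fix \<epsilon> :: real assume e: "\<epsilon> > 0"
    have "measure (N n) {-1<..2*pi} = 1" for n
    proof -
      interpret P: prob_space "density (C n) (\<lambda>_. ennreal (1 / m n))" by (rule Cprob)
      have "Arg2pi -` {-1<..2*pi} \<inter> space (density (C n) (\<lambda>_. ennreal (1 / m n))) = space (density (C n) (\<lambda>_. ennreal (1 / m n)))"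
      proof -
        have "Arg2pi x \<in> {-1<..2*pi}" for x using Arg2pi[of x] by auto
        thus ?thesis by auto
      qed
      hence "measure (N n) {-1<..2*pi} = measure (density (C n) (\<lambda>_. ennreal (1 / m n))) (space (density (C n) (\<lambda>_. ennreal (1 / m n))))"
        unfolding N_def by (simp only: measure_distr[OF am] greaterThanAtMost_borel)
      thus ?thesis by (simp only: P.prob_space)
    qed
    thus "\<exists>a b. a < b \<and> (\<forall>n. 1 - \<epsilon> < measure (N n) {a<..b})"
      using e by (intro exI[of _ "-1"] exI[of _ "2*pi"]) (auto intro: less_trans[of "-1" 0])
  qed (rule Nreal)
  from tight_imp_convergent_subsubsequence[OF this strict_mono_id]
  obtain s M where s: "strict_mono s" and M: "real_distribution M" and w: "weak_conv_m (N \<circ> s) M" by auto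
  interpret M: real_distribution M by (rule M)
  have cism: "cis \<in> M \<rightarrow>\<^sub>M restrict_space borel (sphere 0 1)"
    using measurable_cis_arc by (simp cong: measurable_cong_sets)
  define \<mu> where "\<mu> = density (distr M (restrict_space borel (sphere 0 1)) cis) (\<lambda>_. ennreal (U 0))"
  have \<mu>: "circle_measure \<mu>"
  proof -
    interpret Q: prob_space "distr M (restrict_space borel (sphere 0 1)) cis" by (rule M.prob_space_distr[OF cism])
    have "emeasure \<mu> (space \<mu>) = ennreal (U 0)"
      unfolding \<mu>_def using Q.emeasure_space_1 by (subst emeasure_density) (auto simp: nn_integral_cmult_indicator)
    hence "finite_measure \<mu>" by (intro finite_measureI) auto
    thus ?thesis by (simp add: circle_measure_def \<mu>_def)
  qed
  have "poisson_integral \<mu> z = U z" if z: "norm z < 1" for z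
  proof (rule LIMSEQ_unique)
    have pm: "pois z \<in> borel_measurable arc_measure" by (rule borel_measurable_arc_continuous[OF continuous_on_pois[OF z]])
    hence pm': "pois z \<in> borel_measurable (restrict_space borel (sphere 0 1))" by (simp cong: measurable_cong_sets)
    have P: "poisson_integral \<mu> z = U 0 * (\<integral>t. pois z (cis t) \<partial>M)"
      unfolding poisson_integral_pois \<mu>_def using U0
      by (subst integral_density) (auto simp: pm' integral_distr[OF cism pm'])
    have cc: "isCont (\<lambda>t. pois z (cis t)) t" for t
    proof -
      have "continuous_on UNIV (\<lambda>t. pois z (cis t))"
        by (rule continuous_on_compose2[OF continuous_on_pois[OF z]]) (auto intro!: continuous_intros)
      thus ?thesis by (simp add: continuous_on_eq_continuous_at)
    qed
    have bb: "norm (pois z (cis t)) \<le> 2 / (1 - norm z)" for t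
      using pois_upper[of z "norm z" "cis t"] pois_nonneg[OF z, of "cis t"] z by simp
    have wc: "(\<lambda>n. \<integral>t. pois z (cis t) \<partial>N (s n)) \<longlonglongrightarrow> (\<integral>t. pois z (cis t) \<partial>M)"
      using weak_conv_imp_integral_bdd_continuous_conv[OF _ M w cc bb] Nreal by (simp add: o_def)
    have "m \<longlonglongrightarrow> U 0" unfolding m_def using Clim[of 0] by simp
    from LIMSEQ_subseq_LIMSEQ[OF this s] have "(\<lambda>n. m (s n)) \<longlonglongrightarrow> U 0" by (simp add: o_def)
    from tendsto_mult[OF this wc]
    have "(\<lambda>n. m (s n) * (\<integral>t. pois z (cis t) \<partial>N (s n))) \<longlonglongrightarrow> poisson_integral \<mu> z" unfolding P .
    moreover have "m n * (\<integral>t. pois z (cis t) \<partial>N n) = poisson_integral (C n) z" for n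
    proof -
      have "(\<integral>t. pois z (cis t) \<partial>N n) = (\<integral>q. pois z (cis (Arg2pi q)) \<partial>density (C n) (\<lambda>_. ennreal (1 / m n)))"
        unfolding N_def using cc
        by (intro integral_distr am borel_measurable_continuous_onI continuous_at_imp_continuous_on) auto
      also have "\<dots> = (\<integral>q. pois z q \<partial>density (C n) (\<lambda>_. ennreal (1 / m n)))"
      proof (intro Bochner_Integration.integral_cong refl)
        fix q assume "q \<in> space (density (C n) (\<lambda>_. ennreal (1 / m n)))"
        hence "norm q = 1" by (simp add: circle_measureD(3)[OF C])
        thus "pois z (cis (Arg2pi q)) = pois z q" using complex_norm_eq_1_exp[of q] by (simp add: cis_conv_exp)
      qed
      also have "\<dots> = (\<integral>q. (1 / m n) *\<^sub>R pois z q \<partial>C n)"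
        using m(1)[of n] pm by (intro integral_density) (auto simp: circle_measureD(4)[OF C])
      finally show ?thesis using m(1)[of n] by (simp add: poisson_integral_pois)
    qed
    ultimately show "(\<lambda>n. poisson_integral (C (s n)) z) \<longlonglongrightarrow> poisson_integral \<mu> z" by simp
    show "(\<lambda>n. poisson_integral (C (s n)) z) \<longlonglongrightarrow> U z"
      using LIMSEQ_subseq_LIMSEQ[OF Clim[OF z] s] by (simp add: o_def)
  qed
  thus ?thesis using that \<mu> by blast
qed

lemma poisson_integral_density:
  fixes v :: "complex \<Rightarrow> real"
  assumes v: "integrable arc_measure v" and nn: "AE x in arc_measure. 0 \<le> v x" and z: "norm z < 1"
  shows "poisson_integral (density arc_measure (\<lambda>x. ennreal (v x))) z = (\<integral>x. v x * pois z x \<partial>arc_measure)"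
  unfolding poisson_integral_pois
  using circle_measure_density(2)[OF v nn borel_measurable_arc_continuous[OF continuous_on_pois[OF z]]] by simp

text \<open>A sequence for radial limits, since dominated convergence and weak compactness work along
  sequences.\<close>

definition approach :: "nat \<Rightarrow> real" where
  "approach n = 1 - 1 / (real n + 2)"

lemma approach: "0 \<le> approach n" "approach n < 1" "0 < approach n" "approach \<longlonglongrightarrow> 1"
proof -
  show "0 \<le> approach n" "approach n < 1" "0 < approach n" by (auto simp: approach_def field_simps)
  have "(\<lambda>n. 1 / real (n + 2)) \<longlonglongrightarrow> 0" by (rule LIMSEQ_ignore_initial_segment[OF lim_1_over_n])
  from tendsto_diff[OF tendsto_const[of 1] this] show "approach \<longlonglongrightarrow> 1" by (simp add: approach_def[abs_def] add.commute)
qed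

text \<open>The restrictions of the harmonic function to the circles of radius \<open>approach n\<close> are
  densities of measures whose Poisson integrals converge.\<close>

theorem herglotz:
  assumes F: "F holomorphic_on ball 0 1" and pos: "\<And>z. norm z < 1 \<Longrightarrow> 0 \<le> Re (F z)"
  obtains \<mu> where "circle_measure \<mu>" "\<And>z. norm z < 1 \<Longrightarrow> poisson_integral \<mu> z = Re (F z)"
proof -
  define v where "v n x = Re (F (of_real (approach n) * x))" for n x
  have vc: "continuous_on (sphere 0 1) (v n)" for n
    unfolding v_def using approach(1,2)[of n] by (intro continuous_intros continuous_on_dilate F) auto
  have vpos: "0 \<le> v n x" if "x \<in> sphere 0 1" for n x
    unfolding v_def using that approach(1,2)[of n] by (intro pos) (auto simp: norm_mult)
  note vi = integrable_arc_continuous[OF vc]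
  have vAE: "AE x in arc_measure. 0 \<le> v n x" for n by (rule AE_I2) (simp add: vpos)
  show ?thesis
  proof (rule poisson_compactness[of "\<lambda>n. density arc_measure (\<lambda>x. ennreal (v n x))" "\<lambda>z. Re (F z)"])
    show "circle_measure (density arc_measure (\<lambda>x. ennreal (v n x)))" for n
      by (rule circle_measure_density(1)[OF vi vAE])
    fix z :: complex assume z: "norm z < 1"
    have "isCont F z"
      using F z holomorphic_on_imp_continuous_on[OF F] by (simp add: continuous_on_eq_continuous_at)
    moreover have "(\<lambda>n. of_real (approach n) * z) \<longlonglongrightarrow> of_real 1 * z"
      by (intro tendsto_intros approach)
    ultimately have "(\<lambda>n. Re (F (of_real (approach n) * z))) \<longlonglongrightarrow> Re (F z)"
      by (intro tendsto_Re isCont_tendsto_compose[of z F]) auto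
    moreover have "poisson_integral (density arc_measure (\<lambda>x. ennreal (v n x))) z = Re (F (of_real (approach n) * z))" for n
      unfolding poisson_integral_density[OF vi vAE z] unfolding v_def by (rule poisson_dilate(2)[OF F approach(1,2) z])
    ultimately show "(\<lambda>n. poisson_integral (density arc_measure (\<lambda>x. ennreal (v n x))) z) \<longlonglongrightarrow> Re (F z)"
      by (simp only:)
  qed (use that in blast)
qed

section \<open>Lebesgue decomposition\<close>

text \<open>A null set of maximal measure for \<open>\<mu>\<close>, as the union of a maximising sequence, carries the
  whole singular part.\<close>

lemma lebesgue_null_carrier:
  assumes \<mu>: "circle_measure \<mu>"
  obtains A where "A \<in> sets arc_measure" "emeasure arc_measure A = 0"
    "\<And>B. B \<in> sets arc_measure \<Longrightarrow> emeasure arc_measure B = 0 \<Longrightarrow> emeasure \<mu> (B - A) = 0"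
proof -
  interpret M: finite_measure \<mu> using circle_measureD(2)[OF \<mu>] .
  define X where "X = {measure \<mu> A | A. A \<in> sets arc_measure \<and> emeasure arc_measure A = 0}"
  have ne: "X \<noteq> {}" unfolding X_def by (auto intro!: exI[of _ "{}"])
  have bd: "bdd_above X" unfolding X_def using M.bounded_measure by (auto intro!: bdd_aboveI[of _ "measure \<mu> (space \<mu>)"])
  have "\<exists>A. A \<in> sets arc_measure \<and> emeasure arc_measure A = 0 \<and> Sup X - 1 / real (Suc n) < measure \<mu> A" for n
    using less_cSup_iff[OF ne bd, of "Sup X - 1 / real (Suc n)"] unfolding X_def by auto
  then obtain A where A: "\<And>n. A n \<in> sets arc_measure" "\<And>n. emeasure arc_measure (A n) = 0"
    "\<And>n. Sup X - 1 / real (Suc n) < measure \<mu> (A n)" by metis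
  define U where "U = (\<Union>n. A n)"
  have U: "U \<in> sets arc_measure" unfolding U_def using A by (intro sets.countable_UN) blast
  have U0: "emeasure arc_measure U = 0"
  proof -
    have "(\<Union>n. A n) \<in> null_sets arc_measure" using A by (intro null_sets_UN) (auto simp: null_sets_def)
    thus ?thesis by (auto simp: U_def null_sets_def)
  qed
  have \<mu>s: "B \<in> sets \<mu>" if "B \<in> sets arc_measure" for B using that circle_measureD(1)[OF \<mu>] by simp
  have SU: "Sup X \<le> measure \<mu> U"
  proof (rule field_le_epsilon)
    fix e :: real assume "e > 0"
    then obtain n where n: "1 / real (Suc n) < e" using nat_approx_posE by blast
    have "measure \<mu> (A n) \<le> measure \<mu> U" using U by (intro M.finite_measure_mono \<mu>s) (auto simp: U_def)
    thus "Sup X \<le> measure \<mu> U + e" using A(3)[of n] n by linarith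
  qed
  have "emeasure \<mu> (B - U) = 0" if B: "B \<in> sets arc_measure" "emeasure arc_measure B = 0" for B
  proof -
    have "U \<union> B \<in> null_sets arc_measure" using U U0 B by (intro null_sets.Un) (auto simp: null_sets_def)
    hence "measure \<mu> (U \<union> B) \<in> X" by (auto simp: X_def null_sets_def)
    hence "measure \<mu> (U \<union> B) \<le> measure \<mu> U" using cSup_upper[OF _ bd] SU by force
    moreover have "measure \<mu> (U \<union> (B - U)) = measure \<mu> U + measure \<mu> (B - U)"
      using U B by (intro M.finite_measure_Union \<mu>s) auto
    moreover have "U \<union> (B - U) = U \<union> B" by blast
    ultimately have "measure \<mu> (B - U) \<le> 0" by simp
    thus ?thesis by (simp add: M.emeasure_eq_measure measure_le_0_iff)
  qed
  thus ?thesis using that U U0 by blast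
qed

text \<open>Both singular parts are the restriction of \<open>N\<close> to the union of the two null sets that carry
  them. This makes the description by a definite choice meaningful.\<close>

lemma singular_part_unique:
  assumes M1: "sets S = sets N" "mutually_singular M S" "sets R = sets N" "absolutely_continuous M R"
      "\<And>A. A \<in> sets N \<Longrightarrow> emeasure N A = emeasure R A + emeasure S A"
    and M2: "sets S' = sets N" "mutually_singular M S'" "sets R' = sets N" "absolutely_continuous M R'"
      "\<And>A. A \<in> sets N \<Longrightarrow> emeasure N A = emeasure R' A + emeasure S' A"
    and MN: "sets M = sets N"
  shows "S = S'"
proof -
  have sp: "space S = space N" "space S' = space N" using M1(1) M2(1) sets_eq_imp_space_eq by blast+
  obtain A where A: "A \<in> sets N" "emeasure M A = 0" "emeasure S (space N - A) = 0"
    using M1(2) MN sp unfolding mutually_singular_def by auto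
  obtain A' where A': "A' \<in> sets N" "emeasure M A' = 0" "emeasure S' (space N - A') = 0"
    using M2(2) MN sp unfolding mutually_singular_def by auto
  define U where "U = A \<union> A'"
  have U: "U \<in> sets N" using A A' by (auto simp: U_def)
  have "A \<union> A' \<in> null_sets M" using A A' MN by (intro null_sets.Un) (auto simp: null_sets_def)
  hence UM: "U \<in> null_sets M" by (simp add: U_def)
  have key: "emeasure T B = emeasure N (B \<inter> U)"
    if T: "sets T = sets N" "sets Q = sets N" "absolutely_continuous M Q" "\<And>A. A \<in> sets N \<Longrightarrow> emeasure N A = emeasure Q A + emeasure T A"
      and C: "C \<in> sets N" "C \<subseteq> U" "emeasure T (space N - C) = 0" and B: "B \<in> sets N" for T Q C B
  proof -
    have "U \<in> null_sets Q" using T(3) UM by (auto simp: absolutely_continuous_def)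
    hence "emeasure Q (B \<inter> U) = 0"
      using B T(2) U by (meson Int_lower2 emeasure_eq_0 null_setsD1 null_setsD2)
    hence "emeasure N (B \<inter> U) = emeasure T (B \<inter> U)" using T(4)[of "B \<inter> U"] B U by auto
    also have "\<dots> = emeasure T B"
    proof (rule antisym)
      show "emeasure T (B \<inter> U) \<le> emeasure T B" using B U T(1) by (intro emeasure_mono) auto
      have "B \<subseteq> (B \<inter> U) \<union> (space N - C)" using C(2) sets.sets_into_space[OF B] by blast
      hence "emeasure T B \<le> emeasure T ((B \<inter> U) \<union> (space N - C))"
        using B U C T(1) by (intro emeasure_mono) auto
      also have "\<dots> \<le> emeasure T (B \<inter> U) + emeasure T (space N - C)"
        using B U C T(1) by (intro emeasure_subadditive) auto
      finally show "emeasure T B \<le> emeasure T (B \<inter> U)" using C(3) by simp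
    qed
    finally show ?thesis ..
  qed
  show ?thesis
  proof (rule measure_eqI)
    show "sets S = sets S'" using M1(1) M2(1) by simp
    fix B assume "B \<in> sets S"
    hence B: "B \<in> sets N" using M1(1) by simp
    show "emeasure S B = emeasure S' B"
      using key[OF M1(1,3,4,5) A(1) _ A(3) B] key[OF M2(1,3,4,5) A'(1) _ A'(3) B] by (simp add: U_def)
  qed
qed

text \<open>Restriction to the null carrier and to its complement; the theorem of Radon and Nikodym
  gives the density of the second part.\<close>

theorem lebesgue_decomposition:
  assumes \<mu>: "circle_measure \<mu>"
  obtains g where "integrable arc_measure g" "\<And>x. 0 \<le> (g x :: real)"
    "circle_measure (singular_part arc_measure \<mu>)"
    "mutually_singular arc_measure (singular_part arc_measure \<mu>)"
    "\<And>A. A \<in> sets arc_measure \<Longrightarrow> emeasure \<mu> A = emeasure (density arc_measure (\<lambda>x. ennreal (g x))) A + emeasure (singular_part arc_measure \<mu>) A"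
proof -
  interpret M: finite_measure \<mu> using circle_measureD(2)[OF \<mu>] .
  obtain A where A: "A \<in> sets arc_measure" "emeasure arc_measure A = 0"
    "\<And>B. B \<in> sets arc_measure \<Longrightarrow> emeasure arc_measure B = 0 \<Longrightarrow> emeasure \<mu> (B - A) = 0"
    using lebesgue_null_carrier[OF \<mu>] by blast
  note s\<mu> = circle_measureD(1)[OF \<mu>] and sp = circle_measureD(3)[OF \<mu>]
  have Am: "A \<in> sets \<mu>" using A(1) s\<mu> by simp
  define S where "S = density \<mu> (indicator A)"
  define R where "R = density \<mu> (indicator (space \<mu> - A))"
  have eS: "emeasure S B = emeasure \<mu> (B \<inter> A)" if "B \<in> sets arc_measure" for B
    using that Am s\<mu> unfolding S_def by (subst emeasure_density) (auto simp: indicator_inter_arith[symmetric] Int_commute intro!: nn_integral_indicator)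
  have eR: "emeasure R B = emeasure \<mu> (B - A)" if B: "B \<in> sets arc_measure" for B
  proof -
    have "(space \<mu> - A) \<inter> B = B - A" using sets.sets_into_space[OF B] sp by auto
    thus ?thesis using B Am s\<mu> unfolding R_def
      by (subst emeasure_density) (auto simp: indicator_inter_arith[symmetric] intro!: nn_integral_indicator)
  qed
  have dec: "emeasure \<mu> B = emeasure R B + emeasure S B" if B: "B \<in> sets arc_measure" for B
  proof -
    have "emeasure \<mu> ((B - A) \<union> (B \<inter> A)) = emeasure \<mu> (B - A) + emeasure \<mu> (B \<inter> A)"
      using B A(1) s\<mu> by (intro plus_emeasure[symmetric]) auto
    moreover have "(B - A) \<union> (B \<inter> A) = B" by blast
    ultimately show ?thesis using eS[OF B] eR[OF B] by simp
  qed
  have sS: "sets S = sets arc_measure" and sR: "sets R = sets arc_measure" by (simp_all add: S_def R_def s\<mu>)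
  have sing: "mutually_singular arc_measure S"
    unfolding mutually_singular_def
  proof (intro bexI conjI)
    have "space S - A \<in> sets arc_measure" unfolding sets_eq_imp_space_eq[OF sS] using A(1) by (intro sets.Diff sets.top)
    moreover have "(space S - A) \<inter> A = {}" by blast
    ultimately show "emeasure S (space S - A) = 0" using eS[of "space S - A"] by simp
  qed (use A sS in auto)
  have ac: "absolutely_continuous arc_measure R"
    unfolding absolutely_continuous_def null_sets_def using A(3) eR sR by auto
  have fS: "finite_measure S" "finite_measure R"
    using eS[of "sphere 0 1"] eR[of "sphere 0 1"] sets_eq_imp_space_eq[OF sS] sets_eq_imp_space_eq[OF sR] sets.top[of arc_measure]
    by (auto intro!: finite_measureI simp: M.emeasure_eq_measure)
  have sp: "singular_part arc_measure \<mu> = S"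
    unfolding singular_part_def
  proof (rule the_equality)
    show "sets S = sets \<mu> \<and> mutually_singular arc_measure S \<and> (\<exists>R. sets R = sets \<mu> \<and> absolutely_continuous arc_measure R \<and> (\<forall>A\<in>sets \<mu>. emeasure \<mu> A = emeasure R A + emeasure S A))"
      using sS sing sR ac dec s\<mu> by blast
    fix S' assume "sets S' = sets \<mu> \<and> mutually_singular arc_measure S' \<and> (\<exists>R. sets R = sets \<mu> \<and> absolutely_continuous arc_measure R \<and> (\<forall>A\<in>sets \<mu>. emeasure \<mu> A = emeasure R A + emeasure S' A))"
    then obtain R' where S': "sets S' = sets \<mu>" "mutually_singular arc_measure S'" "sets R' = sets \<mu>" "absolutely_continuous arc_measure R'"
      "\<And>A. A \<in> sets \<mu> \<Longrightarrow> emeasure \<mu> A = emeasure R' A + emeasure S' A" by blast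
    show "S' = S"
      by (rule singular_part_unique[OF S' _ sing _ ac]) (use sS sR s\<mu> dec in auto)
  qed
  obtain f where f: "f \<in> borel_measurable arc_measure" "density arc_measure f = R"
    using arc.Radon_Nikodym[OF ac sR] by blast
  have "(\<integral>\<^sup>+x. f x \<partial>arc_measure) = emeasure R (space arc_measure)"
    unfolding f(2)[symmetric] using f(1) by (subst emeasure_density) (auto intro!: nn_integral_cong)
  also have "\<dots> \<noteq> \<infinity>" using eR[of "sphere 0 1"] sets.top[of arc_measure] by (simp add: M.emeasure_eq_measure)
  finally have fin: "(\<integral>\<^sup>+x. f x \<partial>arc_measure) \<noteq> \<infinity>" .
  define g where "g x = enn2real (f x)" for x
  have gm [measurable]: "g \<in> borel_measurable arc_measure" unfolding g_def using f(1) by measurable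
  have fg: "AE x in arc_measure. f x = ennreal (g x)"
    using nn_integral_PInf_AE[OF f(1) fin] by eventually_elim (simp add: g_def less_top)
  have dg: "density arc_measure (\<lambda>x. ennreal (g x)) = R"
    unfolding f(2)[symmetric] by (rule density_cong) (use fg f(1) in auto)
  have "(\<integral>\<^sup>+x. ennreal (g x) \<partial>arc_measure) = (\<integral>\<^sup>+x. f x \<partial>arc_measure)"
    by (rule nn_integral_cong_AE) (use fg in auto)
  hence gi: "integrable arc_measure g"
    using fin by (intro integrableI_nonneg gm) (auto simp: g_def less_top)
  show ?thesis
    by (rule that[of g]) (use gi dg dec sing fS sS in \<open>auto simp: sp circle_measure_def g_def\<close>)
qed

section \<open>Poisson formulas for the Hardy space\<close>

lemma hardy_poisson:
  assumes f: "f \<in> hardy2" and z: "norm z < 1"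
  shows "(\<integral>x. bdry f x * of_real (pois z x) \<partial>arc_measure) = f z"
proof -
  have p: "sq_int arc_measure (\<lambda>x. of_real (pois z x))"
    by (intro sq_int_continuous_arc continuous_intros continuous_on_pois z)
  have m: "(\<integral>x. x ^ k * of_real (pois z x) \<partial>arc_measure) = z ^ k" for k
  proof -
    define g where "g n = (if n = k then 1 else 0 :: complex)" for n
    have g: "summable (\<lambda>n. norm (g n))"
      by (rule summable_norm_finite_support[of "{k}"]) (auto simp: g_def)
    have "(\<lambda>n. g n * w ^ n) = (\<lambda>n. if n = k then w ^ n else 0)" for w by (auto simp: g_def)
    hence "(\<Sum>n. g n * w ^ n) = w ^ k" for w using suminf_single[of k "\<lambda>n. w ^ n"] by simp
    thus ?thesis using poisson_power_series[OF g z] by simp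
  qed
  have "(\<lambda>N. \<Sum>n<N. hcoeff f n * z ^ n) \<longlonglongrightarrow> (\<integral>x. bdry f x * of_real (pois z x) \<partial>arc_measure)"
    using hardy_inner_partial_sums[OF f p] unfolding m .
  moreover have "(\<lambda>N. \<Sum>n<N. hcoeff f n * z ^ n) \<longlonglongrightarrow> f z"
    using hardy2_sums[OF f z] by (simp add: sums_def)
  ultimately show ?thesis by (rule LIMSEQ_unique)
qed

lemma sq_int_pois_integrable:
  assumes "sq_int arc_measure u" "norm z < 1"
  shows "integrable arc_measure (\<lambda>x. (norm (u x))\<^sup>2 * pois z x)"
proof (rule Bochner_Integration.integrable_bound)
  show "integrable arc_measure (\<lambda>x. (norm (u x))\<^sup>2 * (2 / (1 - norm z)))"
    using assms by (auto simp: sq_int_def)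
  have [measurable]: "u \<in> borel_measurable arc_measure" "pois z \<in> borel_measurable arc_measure"
    using assms borel_measurable_arc_continuous[OF continuous_on_pois] by auto
  show "(\<lambda>x. (norm (u x))\<^sup>2 * pois z x) \<in> borel_measurable arc_measure" by measurable
  show "AE x in arc_measure. norm ((norm (u x))\<^sup>2 * pois z x) \<le> norm ((norm (u x))\<^sup>2 * (2 / (1 - norm z)))"
  proof (rule AE_I2)
    fix x assume "x \<in> space arc_measure"
    hence "pois z x \<le> 2 / (1 - norm z)" using assms(2) by (intro pois_upper) auto
    hence "(norm (u x))\<^sup>2 * pois z x \<le> (norm (u x))\<^sup>2 * (2 / (1 - norm z))"
      by (rule mult_left_mono) simp
    thus "norm ((norm (u x))\<^sup>2 * pois z x) \<le> norm ((norm (u x))\<^sup>2 * (2 / (1 - norm z)))"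
      using pois_nonneg[OF assms(2), of x] assms(2) by (simp add: abs_mult)
  qed
qed

text \<open>The Poisson kernel is the density of a probability measure, so this is the Cauchy-Schwarz
  inequality for the mean value formula.\<close>

lemma hardy_poisson_le:
  assumes f: "f \<in> hardy2" and z: "norm z < 1"
  shows "(norm (f z))\<^sup>2 \<le> (\<integral>x. (norm (bdry f x))\<^sup>2 * pois z x \<partial>arc_measure)"
proof -
  let ?s = "\<lambda>x. complex_of_real (sqrt (pois z x))"
  have sc: "continuous_on (sphere 0 1) ?s"
    by (intro continuous_intros continuous_on_pois z)
  have s: "sq_int arc_measure ?s" by (rule sq_int_continuous_arc[OF sc])
  have ss: "?s x * ?s x = of_real (pois z x)" for x
    using pois_nonneg[OF z, of x] by (simp add: of_real_mult[symmetric] del: of_real_mult)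
  have ns: "(norm (?s x))\<^sup>2 = pois z x" for x using pois_nonneg[OF z, of x] by simp
  have [measurable]: "bdry f \<in> borel_measurable arc_measure" "?s \<in> borel_measurable arc_measure"
    using bdry_measurable[OF f] borel_measurable_arc_continuous[OF sc] by auto
  have u: "sq_int arc_measure (\<lambda>x. bdry f x * ?s x)"
    unfolding sq_int_def using sq_int_pois_integrable[OF bdry(1)[OF f] z]
    by (simp add: norm_mult power_mult_distrib ns del: norm_of_real)
  have "f z = (\<integral>x. (bdry f x * ?s x) * ?s x \<partial>arc_measure)"
    unfolding mult.assoc ss hardy_poisson[OF f z] ..
  hence "norm (f z) \<le> L2norm arc_measure (\<lambda>x. bdry f x * ?s x) * L2norm arc_measure ?s"
    using L2_cauchy_schwarz[OF u s] by simp
  also have "L2norm arc_measure ?s = 1" unfolding L2norm_def ns integral_pois[OF z] by simp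
  finally have "(norm (f z))\<^sup>2 \<le> (L2norm arc_measure (\<lambda>x. bdry f x * ?s x))\<^sup>2" by (intro power_mono) auto
  also have "\<dots> = (\<integral>x. (norm (bdry f x))\<^sup>2 * pois z x \<partial>arc_measure)"
    unfolding L2norm_sq norm_mult power_mult_distrib ns ..
  finally show ?thesis .
qed

text \<open>The Poisson integral of a bounded real function is \<open>2 * Re h - c\<close>, where \<open>h\<close> is its
  projection to the Hardy space, so it has radial limits almost everywhere. The limit function
  has the same Poisson integral and therefore coincides with the given function.\<close>

lemma fatou_bounded:
  fixes v :: "complex \<Rightarrow> real"
  assumes vm [measurable]: "v \<in> borel_measurable arc_measure" and v: "\<And>x. 0 \<le> v x" "\<And>x. v x \<le> B"
  shows "AE x in arc_measure. ((\<lambda>r. \<integral>y. v y * pois (of_real r * x) y \<partial>arc_measure) \<longlongrightarrow> v x) (at_left (1::real))"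
proof -
  let ?v = "\<lambda>x. complex_of_real (v x)"
  have vs: "sq_int arc_measure ?v"
    using v by (intro sq_int_bounded_arc[of _ B] AE_I2) (auto simp: abs_le_iff intro: order_trans[of "- v _" 0])
  note vi = sq_int_arc_integrable(1)[OF vs]
  have vi': "integrable arc_measure v" using integrable_Re[OF vi] by simp
  define h where "h = hardy_proj ?v"
  have h: "h \<in> hardy2" and hi: "\<And>k. k \<in> hardy2 \<Longrightarrow> hardy_inner h k = (\<integral>x. ?v x * cnj (bdry k x) \<partial>arc_measure)"
    using hardy_proj[OF vs] by (auto simp: h_def)
  have kb: "AE x in arc_measure. bdry (hker a) x = 1 / (1 - cnj a * x)" if a: "norm a < 1" for a
  proof (rule bdry_unique[OF hker(1)[OF a]], rule AE_I2)
    fix x assume "x \<in> space arc_measure"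
    hence z: "norm x = 1" by simp
    have nz: "1 - cnj a * (of_real 1 * x) \<noteq> 0"
    proof
      assume "1 - cnj a * (of_real 1 * x) = 0"
      hence "norm (cnj a * x) = 1" by simp
      thus False using a z by (simp add: norm_mult)
    qed
    have "((\<lambda>r. 1 / (1 - cnj a * (of_real r * x))) \<longlongrightarrow> 1 / (1 - cnj a * (of_real 1 * x))) (at_left (1::real))"
      by (intro tendsto_intros nz)
    moreover have "\<forall>\<^sub>F r in at_left (1::real). r \<in> {0<..<1}" by (rule eventually_at_leftI[of 0]) auto
    hence "\<forall>\<^sub>F r in at_left (1::real). 1 / (1 - cnj a * (of_real r * x)) = hker a (of_real r * x)"
      by eventually_elim (use z a in \<open>simp add: hker(5) norm_mult\<close>)
    ultimately show "((\<lambda>r. hker a (of_real r * x)) \<longlongrightarrow> 1 / (1 - cnj a * x)) (at_left (1::real))"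
      using Lim_transform_eventually by fastforce
  qed
  have hval: "h a = (\<integral>x. ?v x * cnj (1 / (1 - cnj a * x)) \<partial>arc_measure)" if a: "norm a < 1" for a
  proof -
    note [measurable] = bdry_measurable[OF hker(1)[OF a]] borel_measurable_id_arc
    have "h a = (\<integral>x. ?v x * cnj (bdry (hker a) x) \<partial>arc_measure)"
      using hi[OF hker(1)[OF a]] hker(4)[OF a h] by simp
    also have "\<dots> = (\<integral>x. ?v x * cnj (1 / (1 - cnj a * x)) \<partial>arc_measure)"
      by (rule integral_cong_AE) (measurable, use kb[OF a] in \<open>eventually_elim, simp\<close>)
    finally show ?thesis .
  qed
  define c where "c = (\<integral>x. v x \<partial>arc_measure)"
  have Pz: "(\<integral>x. v x * pois z x \<partial>arc_measure) = 2 * Re (h z) - c" if z: "norm z < 1" for z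
  proof -
    have nz: "1 - cnj z * x \<noteq> 0" if "x \<in> sphere 0 1" for x
    proof
      assume "1 - cnj z * x = 0"
      hence "norm (cnj z * x) = 1" by simp
      thus False using z that by (simp add: norm_mult)
    qed
    define k where "k x = 1 / (1 - cnj z * x)" for x
    have kc: "continuous_on (sphere 0 1) k" unfolding k_def using nz by (intro continuous_intros) auto
    have ck: "integrable arc_measure (\<lambda>x. ?v x * cnj (k x))" "integrable arc_measure (\<lambda>x. ?v x * k x)"
      by (intro sq_int_mult_integrable vs sq_int_continuous_arc continuous_intros kc)+
    have "complex_of_real (\<integral>x. v x * pois z x \<partial>arc_measure) = (\<integral>x. ?v x * of_real (pois z x) \<partial>arc_measure)"
      by (simp only: integral_complex_of_real[symmetric] of_real_mult)
    also have "\<dots> = (\<integral>x. ?v x * cnj (k x) + (?v x * k x - ?v x) \<partial>arc_measure)"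
      using z by (intro Bochner_Integration.integral_cong refl) (simp add: pois_alt k_def algebra_simps)
    also have "\<dots> = (\<integral>x. ?v x * cnj (k x) \<partial>arc_measure) + ((\<integral>x. ?v x * k x \<partial>arc_measure) - (\<integral>x. ?v x \<partial>arc_measure))"
      using ck vi by simp
    also have "(\<integral>x. ?v x * k x \<partial>arc_measure) = cnj (\<integral>x. ?v x * cnj (k x) \<partial>arc_measure)"
      unfolding Bochner_Integration.integral_cnj[symmetric] by simp
    also have "(\<integral>x. ?v x * cnj (k x) \<partial>arc_measure) = h z" unfolding k_def by (rule hval[OF z, symmetric])
    also have "(\<integral>x. ?v x \<partial>arc_measure) = of_real c" by (simp add: c_def)
    finally have "complex_of_real (\<integral>x. v x * pois z x \<partial>arc_measure) = complex_of_real (2 * Re (h z) - c)"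
      by (simp add: complex_eq_iff)
    thus ?thesis using of_real_eq_iff by blast
  qed
  define v' where "v' x = 2 * Re (bdry h x) - c" for x
  have v'm [measurable]: "v' \<in> borel_measurable arc_measure" unfolding v'_def using bdry_measurable[OF h] by measurable
  have v'i: "integrable arc_measure v'" unfolding v'_def using sq_int_arc_integrable(1)[OF bdry(1)[OF h]] by simp
  have lim: "AE x in arc_measure. ((\<lambda>r. \<integral>y. v y * pois (of_real r * x) y \<partial>arc_measure) \<longlongrightarrow> v' x) (at_left (1::real))"
    using bdry(2)[OF h] AE_space
  proof eventually_elim
    case (elim x)
    have "((\<lambda>r. 2 * Re (h (of_real r * x)) - c) \<longlongrightarrow> v' x) (at_left (1::real))"
      unfolding v'_def by (intro tendsto_intros elim)
    moreover have "\<forall>\<^sub>F r in at_left (1::real). r \<in> {0<..<1}" by (rule eventually_at_leftI[of 0]) auto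
    hence "\<forall>\<^sub>F r in at_left (1::real). 2 * Re (h (of_real r * x)) - c = (\<integral>y. v y * pois (of_real r * x) y \<partial>arc_measure)"
      by eventually_elim (use elim(2) in \<open>simp add: Pz norm_mult\<close>)
    ultimately show ?case by (rule Lim_transform_eventually)
  qed
  have v'nn: "AE x in arc_measure. 0 \<le> v' x"
    using lim AE_space
  proof eventually_elim
    case (elim x)
    have "\<forall>\<^sub>F r in at_left (1::real). r \<in> {0<..<1}" by (rule eventually_at_leftI[of 0]) auto
    hence "\<forall>\<^sub>F r in at_left (1::real). 0 \<le> (\<integral>y. v y * pois (of_real r * x) y \<partial>arc_measure)"
      by eventually_elim (use elim(2) v in \<open>auto intro!: integral_nonneg_AE AE_I2 mult_nonneg_nonneg pois_nonneg simp: norm_mult\<close>)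
    with elim(1) show ?case by (rule tendsto_lowerbound) simp
  qed
  have vnn: "AE x in arc_measure. 0 \<le> v x" using v by simp
  have "density arc_measure (\<lambda>x. ennreal (v x)) = density arc_measure (\<lambda>x. ennreal (v' x))"
  proof (rule poisson_integral_unique)
    fix z :: complex assume z: "norm z < 1"
    have i: "integrable arc_measure (\<lambda>x. bdry h x * of_real (pois z x))"
      by (intro sq_int_mult_integrable bdry h sq_int_continuous_arc continuous_intros continuous_on_pois z)
    have ip: "integrable arc_measure (pois z)" by (rule integrable_arc_continuous[OF continuous_on_pois[OF z]])
    have "(\<integral>x. v' x * pois z x \<partial>arc_measure) = (\<integral>x. 2 * Re (bdry h x * of_real (pois z x)) - c * pois z x \<partial>arc_measure)"
      by (intro Bochner_Integration.integral_cong refl) (simp add: v'_def algebra_simps)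
    also have "\<dots> = 2 * Re (h z) - c"
      using i ip integral_Re[OF i] by (simp add: hardy_poisson[OF h z] integral_pois[OF z] del: Re_complex_of_real times_complex.sel)
    finally show "poisson_integral (density arc_measure (\<lambda>x. ennreal (v x))) z = poisson_integral (density arc_measure (\<lambda>x. ennreal (v' x))) z"
      unfolding poisson_integral_density[OF vi' vnn z] poisson_integral_density[OF v'i v'nn z] Pz[OF z] by simp
  qed (intro circle_measure_density vi' vnn v'i v'nn)+
  hence "AE x in arc_measure. ennreal (v x) = ennreal (v' x)"
    by (intro arc.density_unique) auto
  hence "AE x in arc_measure. v x = v' x"
    using v'nn by eventually_elim (use v in simp)
  with lim show ?thesis by eventually_elim simp
qed

section \<open>Clark measures\<close>

lemma hardy2_bounded:
  assumes F: "F holomorphic_on ball 0 1" and B: "\<And>z. norm z < 1 \<Longrightarrow> norm (F z) \<le> B"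
  shows "(\<lambda>z. if norm z < 1 then F z else 0) \<in> hardy2"
proof -
  let ?f = "\<lambda>z. if norm z < 1 then F z else 0"
  have hol: "?f holomorphic_on ball 0 1"
    by (rule holomorphic_transform[OF F]) simp
  have "bdd_above ((\<lambda>r. \<integral>x. (norm (?f (of_real r * x)))\<^sup>2 \<partial>arc_lebesgue) ` {0..<1::real})"
  proof (rule bdd_aboveI2)
    fix r :: real assume r: "r \<in> {0..<1}"
    have c: "continuous_on (sphere 0 1) (\<lambda>x. (norm (?f (of_real r * x)))\<^sup>2)"
      using r by (intro continuous_intros continuous_on_dilate[OF hol]) auto
    have "(\<integral>x. (norm (?f (of_real r * x)))\<^sup>2 \<partial>arc_lebesgue) = (\<integral>x. (norm (?f (of_real r * x)))\<^sup>2 \<partial>arc_measure)"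
      by (rule integral_completion[OF borel_measurable_arc_continuous[OF c]])
    also have "\<dots> \<le> (\<integral>x. B\<^sup>2 \<partial>arc_measure)"
      using r by (intro integral_mono integrable_arc_continuous c) (auto simp: norm_mult intro!: power_mono B)
    also have "\<dots> = B\<^sup>2" using arc.prob_space by simp
    finally show "(\<integral>x. (norm (?f (of_real r * x)))\<^sup>2 \<partial>arc_lebesgue) \<le> B\<^sup>2" .
  qed
  thus ?thesis using hol unfolding hardy2_def by auto
qed

text \<open>The harmonic function that defines the Clark measure is a Poisson kernel with the roles of
  the variables exchanged.\<close>

lemma pois_clark:
  assumes "norm \<alpha> = 1" "norm w < 1"
  shows "Re ((\<alpha> + w) / (\<alpha> - w)) = pois w \<alpha>"
proof -
  have "Re ((\<alpha> + w) * cnj (\<alpha> - w)) = (norm \<alpha>)\<^sup>2 - (norm w)\<^sup>2"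
    unfolding cmod_power2 by (simp add: power2_eq_square algebra_simps)
  moreover have "(\<alpha> + w) / (\<alpha> - w) = (\<alpha> + w) * cnj (\<alpha> - w) / complex_of_real ((norm (\<alpha> - w))\<^sup>2)"
    by (rule complex_div_cnj)
  ultimately show ?thesis
    using assms(1) by (simp only: Re_divide_of_real) (simp add: pois_def)
qed

text \<open>The boundary function \<open>p\<close> is modified on a null set so that its values lie in the open disk
  everywhere.\<close>

locale disk_map =
  fixes \<phi> p :: "complex \<Rightarrow> complex"
  assumes hol: "\<phi> holomorphic_on ball 0 1"
    and maps: "\<And>z. norm z < 1 \<Longrightarrow> norm (\<phi> z) < 1"
    and p_measurable [measurable]: "p \<in> borel_measurable arc_measure"
    and p_disk: "\<And>x. norm (p x) < 1"
    and p_limit: "AE x in arc_measure. ((\<lambda>r. \<phi> (of_real r * x)) \<longlongrightarrow> p x) (at_left (1::real))"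
begin

lemma poisson_boundary:
  assumes G: "G holomorphic_on ball 0 1" and B: "\<And>w. norm w < 1 \<Longrightarrow> norm (G w) \<le> B" and z: "norm z < 1"
  shows "(\<integral>x. G (p x) * of_real (pois z x) \<partial>arc_measure) = G (\<phi> z)"
proof -
  define F where "F z = (if norm z < 1 then G (\<phi> z) else 0)" for z
  have GF: "(\<lambda>z. G (\<phi> z)) holomorphic_on ball 0 1"
  proof -
    have "\<phi> ` ball 0 1 \<subseteq> ball 0 1" using maps by auto
    from holomorphic_on_compose_gen[OF hol G this] show ?thesis by (simp add: o_def)
  qed
  have F: "F \<in> hardy2" unfolding F_def by (rule hardy2_bounded[OF GF B]) (use maps in auto)
  have b: "AE x in arc_measure. bdry F x = G (p x)"
  proof (rule bdry_unique[OF F], use p_limit AE_space in eventually_elim)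
    case (elim x)
    have "isCont G (p x)"
      using p_disk[of x] holomorphic_on_imp_continuous_on[OF G] by (simp add: continuous_on_eq_continuous_at)
    hence "((\<lambda>r. G (\<phi> (of_real r * x))) \<longlongrightarrow> G (p x)) (at_left (1::real))"
      by (rule isCont_tendsto_compose) (rule elim(1))
    moreover have "\<forall>\<^sub>F r in at_left (1::real). r \<in> {0<..<1}" by (rule eventually_at_leftI[of 0]) auto
    hence "\<forall>\<^sub>F r in at_left (1::real). G (\<phi> (of_real r * x)) = F (of_real r * x)"
      by eventually_elim (use elim(2) in \<open>simp add: F_def norm_mult\<close>)
    ultimately show ?case by (rule Lim_transform_eventually)
  qed
  have Gpm: "(\<lambda>x. G (p x)) \<in> borel_measurable arc_measure"
  proof -
    have "(\<lambda>w. indicator (ball 0 1) w *\<^sub>R G w) \<in> borel_measurable borel"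
      using G by (intro borel_measurable_continuous_on_indicator holomorphic_on_imp_continuous_on) auto
    from measurable_compose[OF p_measurable this] show ?thesis using p_disk by simp
  qed
  have pm: "(\<lambda>x. complex_of_real (pois z x)) \<in> borel_measurable arc_measure"
    by (intro borel_measurable_arc_continuous continuous_intros continuous_on_pois z)
  have "(\<integral>x. G (p x) * of_real (pois z x) \<partial>arc_measure) = (\<integral>x. bdry F x * of_real (pois z x) \<partial>arc_measure)"
    by (rule integral_cong_AE) (use Gpm pm bdry_measurable[OF F] b in auto)
  thus ?thesis using hardy_poisson[OF F z] z by (simp add: F_def)
qed

text \<open>The factor \<open>s < 1\<close> keeps the harmonic function bounded, so that it is the Poisson integral
  of its boundary values. For \<open>s = 1\<close> the formula fails exactly by the singular part of the Clark
  measure.\<close>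

lemma poisson_boundary_kernel:
  assumes \<alpha>: "norm \<alpha> = 1" and s: "0 \<le> s" "s < 1" and z: "norm z < 1"
  shows "(\<integral>x. pois (of_real s * p x) \<alpha> * pois z x \<partial>arc_measure) = pois (of_real s * \<phi> z) \<alpha>"
proof -
  define G where "G w = (\<alpha> + of_real s * w) / (\<alpha> - of_real s * w)" for w
  have sw: "norm (of_real s * w) \<le> s" if "norm w < 1" for w :: complex
    using that s by (simp add: norm_mult mult_left_le)
  have den: "norm (\<alpha> - of_real s * w) \<ge> 1 - s" if "norm w < 1" for w
    using norm_triangle_ineq2[of \<alpha> "of_real s * w"] sw[OF that] \<alpha> by linarith
  have hG: "G holomorphic_on ball 0 1"
    unfolding G_def
  proof (intro holomorphic_intros)
    fix w :: complex assume "w \<in> ball 0 1"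
    thus "\<alpha> - of_real s * w \<noteq> 0" using den[of w] s by auto
  qed
  have bG: "norm (G w) \<le> 2 / (1 - s)" if w: "norm w < 1" for w
  proof -
    have "norm (\<alpha> + of_real s * w) \<le> 2" using norm_triangle_ineq[of \<alpha> "of_real s * w"] sw[OF w] \<alpha> s by linarith
    thus ?thesis unfolding G_def norm_divide using den[OF w] s by (intro frac_le) auto
  qed
  have Re: "Re (G w) = pois (of_real s * w) \<alpha>" if "norm w < 1" for w
    unfolding G_def by (rule pois_clark[OF \<alpha>]) (use sw[OF that] s in linarith)
  have "(\<lambda>x. G (p x)) \<in> borel_measurable arc_measure"
    unfolding G_def by measurable
  hence "sq_int arc_measure (\<lambda>x. G (p x))" using bG p_disk by (intro sq_int_bounded_arc) auto
  note mult = sq_int_mult_integrable[OF this sq_int_continuous_arc]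
  have i: "integrable arc_measure (\<lambda>x. G (p x) * of_real (pois z x))"
    by (rule mult) (intro continuous_intros continuous_on_pois z)
  have "(\<integral>x. pois (of_real s * p x) \<alpha> * pois z x \<partial>arc_measure) = (\<integral>x. Re (G (p x) * of_real (pois z x)) \<partial>arc_measure)"
    using Re[OF p_disk] by (intro Bochner_Integration.integral_cong refl) simp
  also have "\<dots> = Re (G (\<phi> z))"
    unfolding integral_Re[OF i] by (rule arg_cong[of _ _ Re]) (rule poisson_boundary[OF hG bG z])
  also have "\<dots> = pois (of_real s * \<phi> z) \<alpha>" by (rule Re[OF maps[OF z]])
  finally show ?thesis .
qed

lemma clark_measure:
  assumes \<alpha>: "norm \<alpha> = 1"
  shows "circle_measure (clark_measure \<phi> \<alpha>)" "\<And>z. norm z < 1 \<Longrightarrow> poisson_integral (clark_measure \<phi> \<alpha>) z = pois (\<phi> z) \<alpha>"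
proof -
  have Re: "Re ((\<alpha> + \<phi> z) / (\<alpha> - \<phi> z)) = pois (\<phi> z) \<alpha>" if "norm z < 1" for z
    by (rule pois_clark[OF \<alpha> maps[OF that]])
  have F: "(\<lambda>z. (\<alpha> + \<phi> z) / (\<alpha> - \<phi> z)) holomorphic_on ball 0 1"
  proof (intro holomorphic_intros hol)
    fix z :: complex assume "z \<in> ball 0 1"
    hence "norm (\<phi> z) < norm \<alpha>" using maps[of z] \<alpha> by simp
    thus "\<alpha> - \<phi> z \<noteq> 0" by auto
  qed
  obtain \<mu> where \<mu>: "circle_measure \<mu>" "\<And>z. norm z < 1 \<Longrightarrow> poisson_integral \<mu> z = Re ((\<alpha> + \<phi> z) / (\<alpha> - \<phi> z))"
    using herglotz[OF F] Re pois_nonneg[OF maps] by auto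
  have "clark_measure \<phi> \<alpha> = \<mu>" unfolding clark_measure_def
  proof (rule the_equality)
    show "sets \<mu> = sets arc_measure \<and> finite_measure \<mu> \<and> (\<forall>z\<in>ball 0 1. poisson_integral \<mu> z = Re ((\<alpha> + \<phi> z) / (\<alpha> - \<phi> z)))"
      using \<mu> by (auto simp: circle_measure_def)
    fix \<nu> assume "sets \<nu> = sets arc_measure \<and> finite_measure \<nu> \<and> (\<forall>z\<in>ball 0 1. poisson_integral \<nu> z = Re ((\<alpha> + \<phi> z) / (\<alpha> - \<phi> z)))"
    thus "\<nu> = \<mu>" using \<mu> by (intro poisson_integral_unique) (auto simp: circle_measure_def)
  qed
  thus "circle_measure (clark_measure \<phi> \<alpha>)" "\<And>z. norm z < 1 \<Longrightarrow> poisson_integral (clark_measure \<phi> \<alpha>) z = pois (\<phi> z) \<alpha>"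
    using \<mu> Re by auto
qed

end

section \<open>The singular part of a Clark measure\<close>

definition add_measure :: "'a measure \<Rightarrow> 'a measure \<Rightarrow> 'a measure" where
  "add_measure M N = measure_of (space M) (sets M) (\<lambda>A. emeasure M A + emeasure N A)"

lemma add_measure:
  assumes "sets M = sets N"
  shows "sets (add_measure M N) = sets M" "space (add_measure M N) = space M"
    and "A \<in> sets M \<Longrightarrow> emeasure (add_measure M N) A = emeasure M A + emeasure N A"
proof -
  show s: "sets (add_measure M N) = sets M" and "space (add_measure M N) = space M"
    by (simp_all add: add_measure_def)
  show "emeasure (add_measure M N) A = emeasure M A + emeasure N A" if A: "A \<in> sets M"
  proof (rule emeasure_measure_of[OF add_measure_def])
    show "A \<in> sets (add_measure M N)" using A s by simp
    show "positive (sets (add_measure M N)) (\<lambda>A. emeasure M A + emeasure N A)"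
      by (simp add: positive_def)
    show "countably_additive (sets (add_measure M N)) (\<lambda>A. emeasure M A + emeasure N A)"
      unfolding countably_additive_def s
    proof (intro allI impI)
      fix F :: "nat \<Rightarrow> 'a set" assume F: "range F \<subseteq> sets M" "disjoint_family F"
      have "(\<Sum>i. emeasure M (F i) + emeasure N (F i)) = (\<Sum>i. emeasure M (F i)) + (\<Sum>i. emeasure N (F i))"
        by (rule suminf_add[symmetric]) auto
      thus "(\<Sum>i. emeasure M (F i) + emeasure N (F i)) = emeasure M (\<Union> (range F)) + emeasure N (\<Union> (range F))"
        using suminf_emeasure[OF F] suminf_emeasure[of F N] F assms by simp
    qed
  qed (use sets.space_closed in auto)
qed

lemma nn_integral_add_measure:
  assumes MN: "sets M = sets N" and f: "f \<in> borel_measurable M"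
  shows "(\<integral>\<^sup>+x. f x \<partial>add_measure M N) = (\<integral>\<^sup>+x. f x \<partial>M) + (\<integral>\<^sup>+x. f x \<partial>N)"
  using f
proof (induction rule: borel_measurable_induct)
  case (cong f g)
  have "space N = space M" by (rule sets_eq_imp_space_eq[OF MN[symmetric]])
  thus ?case using cong by (simp add: add_measure(2)[OF MN] cong: nn_integral_cong_simp)
next
  case (set A)
  thus ?case using add_measure[OF MN] MN by simp
next
  case (mult u c)
  have [measurable]: "u \<in> borel_measurable M" "u \<in> borel_measurable N" "u \<in> borel_measurable (add_measure M N)"
    using mult(2) MN add_measure(1)[OF MN] by (simp_all cong: measurable_cong_sets)
  show ?case using mult by (simp add: nn_integral_cmult distrib_left)
next
  case (add u v)
  have [measurable]: "u \<in> borel_measurable M" "u \<in> borel_measurable N" "u \<in> borel_measurable (add_measure M N)"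
    "v \<in> borel_measurable M" "v \<in> borel_measurable N" "v \<in> borel_measurable (add_measure M N)"
    using add MN add_measure(1)[OF MN] by (simp_all cong: measurable_cong_sets)
  show ?case using add by (simp add: nn_integral_add add_ac)
next
  case (seq U)
  have [measurable]: "U i \<in> borel_measurable M" "U i \<in> borel_measurable N" "U i \<in> borel_measurable (add_measure M N)" for i
    using seq(1) MN add_measure(1)[OF MN] by (simp_all cong: measurable_cong_sets)
  have inc: "incseq (\<lambda>i. \<integral>\<^sup>+x. U i x \<partial>M)" "incseq (\<lambda>i. \<integral>\<^sup>+x. U i x \<partial>N)"
    using seq(3) by (auto simp: incseq_def le_fun_def intro!: nn_integral_mono)
  have "(\<integral>\<^sup>+x. (SUP i. U i x) \<partial>K) = (SUP i. \<integral>\<^sup>+x. U i x \<partial>K)" if "\<And>i. U i \<in> borel_measurable K" for K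
    using seq(3) that by (intro nn_integral_monotone_convergence_SUP)
  thus ?case using seq inc by (simp add: image_image SUP_apply ennreal_SUP_add)
qed

lemma circle_measure_add:
  assumes \<mu>: "circle_measure \<mu>" and \<nu>: "circle_measure \<nu>"
  shows "circle_measure (add_measure \<mu> \<nu>)"
    and "A \<in> sets arc_measure \<Longrightarrow> emeasure (add_measure \<mu> \<nu>) A = emeasure \<mu> A + emeasure \<nu> A"
    and "continuous_on (sphere 0 1) h \<Longrightarrow> (\<integral>x. h x \<partial>add_measure \<mu> \<nu>) = (\<integral>x. h x \<partial>\<mu>) + (\<integral>x. (h x :: real) \<partial>\<nu>)"
proof -
  interpret M: finite_measure \<mu> using circle_measureD(2)[OF \<mu>] .
  interpret N: finite_measure \<nu> using circle_measureD(2)[OF \<nu>] .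
  have s: "sets \<mu> = sets \<nu>" using circle_measureD(1)[OF \<mu>] circle_measureD(1)[OF \<nu>] by simp
  show e: "emeasure (add_measure \<mu> \<nu>) A = emeasure \<mu> A + emeasure \<nu> A" if "A \<in> sets arc_measure" for A
    using that circle_measureD(1)[OF \<mu>] by (intro add_measure(3)[OF s]) simp
  have "emeasure (add_measure \<mu> \<nu>) (sphere 0 1) = emeasure \<mu> (sphere 0 1) + emeasure \<nu> (sphere 0 1)"
    by (rule e) simp
  hence "finite_measure (add_measure \<mu> \<nu>)"
    by (intro finite_measureI) (simp add: add_measure(2)[OF s] circle_measureD(3)[OF \<mu>] M.emeasure_eq_measure N.emeasure_eq_measure)
  thus c: "circle_measure (add_measure \<mu> \<nu>)"
    using add_measure(1)[OF s] circle_measureD(1)[OF \<mu>] by (simp add: circle_measure_def)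
  assume h: "continuous_on (sphere 0 1) h"
  have hm: "h \<in> borel_measurable arc_measure" by (rule borel_measurable_arc_continuous[OF h])
  note ih = circle_measure_integrable_continuous[OF _ h]
  have nn: "(\<integral>\<^sup>+x. ennreal (u x) \<partial>add_measure \<mu> \<nu>) = (\<integral>\<^sup>+x. ennreal (u x) \<partial>\<mu>) + (\<integral>\<^sup>+x. ennreal (u x) \<partial>\<nu>)"
    if "u \<in> borel_measurable arc_measure" for u :: "complex \<Rightarrow> real"
    by (rule nn_integral_add_measure[OF s]) (use that in \<open>simp add: circle_measureD(4)[OF \<mu>]\<close>)
  have fin: "(\<integral>\<^sup>+x. ennreal (u x) \<partial>\<rho>) < \<top>" if "circle_measure \<rho>" "u = h \<or> u = (\<lambda>x. - h x)" for u \<rho>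
  proof -
    have "integrable \<rho> u" using that ih by auto
    thus ?thesis using integrableD(2)[of \<rho> u] real_integrable_def[of \<rho> u] by (simp add: less_top)
  qed
  show "(\<integral>x. h x \<partial>add_measure \<mu> \<nu>) = (\<integral>x. h x \<partial>\<mu>) + (\<integral>x. h x \<partial>\<nu>)"
    unfolding real_lebesgue_integral_def[OF ih[OF c]] real_lebesgue_integral_def[OF ih[OF \<mu>]] real_lebesgue_integral_def[OF ih[OF \<nu>]]
    using nn[OF hm] nn[of "\<lambda>x. - h x"] hm fin[OF \<mu>] fin[OF \<nu>] by (simp add: enn2real_plus)
qed

context disk_map
begin

text \<open>The density of the absolutely continuous part of the Clark measure at
  \<open>\<alpha>\<close>.\<close>

definition clark_density :: "complex \<Rightarrow> complex \<Rightarrow> real" where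
  "clark_density \<alpha> x = pois (p x) \<alpha>"

lemma clark_density_nonneg: "0 \<le> clark_density \<alpha> x"
  unfolding clark_density_def by (rule pois_nonneg[OF p_disk])

lemma pois_p_measurable [measurable]: "(\<lambda>x. pois (of_real s * p x) \<alpha>) \<in> borel_measurable arc_measure"
  unfolding pois_def by measurable

lemma clark_density_measurable [measurable]: "clark_density \<alpha> \<in> borel_measurable arc_measure"
  unfolding clark_density_def[abs_def] pois_def by measurable

lemma scaled_p: "0 \<le> s \<Longrightarrow> s < 1 \<Longrightarrow> norm (of_real s * p x) \<le> s" "0 \<le> s \<Longrightarrow> s < 1 \<Longrightarrow> norm (of_real s * p x) < 1"
proof -
  assume s: "0 \<le> s" "s < 1"
  show "norm (of_real s * p x) \<le> s" using s p_disk[of x] by (simp add: norm_mult mult_left_le)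
  thus "norm (of_real s * p x) < 1" using s by linarith
qed

lemma pois_approach_tendsto:
  assumes "norm w < 1" "norm \<alpha> = 1"
  shows "(\<lambda>n. pois (of_real (approach n) * w) \<alpha>) \<longlonglongrightarrow> pois w \<alpha>"
proof -
  have "isCont (\<lambda>z. pois z \<alpha>) w"
    using continuous_on_pois_left[OF assms(2)] assms(1) by (simp add: continuous_on_eq_continuous_at)
  moreover have "(\<lambda>n. of_real (approach n) * w) \<longlonglongrightarrow> of_real 1 * w" by (intro tendsto_intros approach)
  ultimately show ?thesis using isCont_tendsto_compose[of w "\<lambda>z. pois z \<alpha>"] by simp
qed

lemma integrable_pois_scaled:
  assumes "norm \<alpha> = 1" "0 \<le> s" "s < 1"
  shows "integrable arc_measure (\<lambda>x. pois (of_real s * p x) \<alpha>)"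
proof (rule arc.integrable_const_bound[of _ "2 / (1 - s)"])
  show "AE x in arc_measure. norm (pois (of_real s * p x) \<alpha>) \<le> 2 / (1 - s)"
    using pois_upper[OF scaled_p(1)[OF assms(2,3)] assms(3,1)] pois_nonneg[OF scaled_p(2)[OF assms(2,3)]]
    by (intro AE_I2) simp
qed simp

text \<open>Fatou's lemma, in the square mean form applied to square roots: the Poisson formula at 0
  bounds the integrals for \<open>s < 1\<close>.\<close>

lemma integrable_clark_density:
  assumes \<alpha>: "norm \<alpha> = 1"
  shows "integrable arc_measure (clark_density \<alpha>)"
proof -
  define s where "s k t = complex_of_real (sqrt (pois (of_real (approach k) * p t) \<alpha>))" for k t
  define u where "u t = complex_of_real (sqrt (clark_density \<alpha> t))" for t
  have ns: "(norm (s k t))\<^sup>2 = pois (of_real (approach k) * p t) \<alpha>" for k t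
    unfolding s_def using pois_nonneg[OF scaled_p(2)[OF approach(1,2)]] by simp
  have nu: "(norm (u t))\<^sup>2 = clark_density \<alpha> t" for t
    unfolding u_def using clark_density_nonneg by simp
  have "sq_int arc_measure u"
  proof (rule sq_int_fatou(1)[of arc_measure s u "2 / (1 - norm (\<phi> 0))"])
    show "sq_int arc_measure (s k)" for k
      unfolding sq_int_def ns using integrable_pois_scaled[OF \<alpha> approach(1,2)] unfolding s_def by simp
    show "u \<in> borel_measurable arc_measure" unfolding u_def by measurable
    show "AE t in arc_measure. (\<lambda>k. s k t) \<longlonglongrightarrow> u t"
      unfolding s_def u_def clark_density_def by (intro AE_I2 tendsto_intros pois_approach_tendsto p_disk \<alpha>)
    show "\<forall>\<^sub>F k in sequentially. (\<integral>x. (norm (s k x))\<^sup>2 \<partial>arc_measure) \<le> 2 / (1 - norm (\<phi> 0))"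
    proof (intro always_eventually allI)
      fix k
      have "(\<integral>x. (norm (s k x))\<^sup>2 \<partial>arc_measure) = (\<integral>t. pois (of_real (approach k) * p t) \<alpha> * pois 0 t \<partial>arc_measure)"
        unfolding ns by (intro Bochner_Integration.integral_cong refl) (simp add: pois_def)
      also have "\<dots> = pois (of_real (approach k) * \<phi> 0) \<alpha>"
        by (rule poisson_boundary_kernel[OF \<alpha> approach(1,2)]) simp
      also have "\<dots> \<le> 2 / (1 - norm (\<phi> 0))"
        using maps[of 0] \<alpha> approach(1,2)[of k]
        by (intro pois_upper) (auto simp: norm_mult intro!: mult_left_le_one_le)
      finally show "(\<integral>x. (norm (s k x))\<^sup>2 \<partial>arc_measure) \<le> 2 / (1 - norm (\<phi> 0))" .
    qed
  qed
  thus ?thesis unfolding sq_int_def nu by simp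
qed

text \<open>The square of the normalised reproducing kernel at \<open>s * \<alpha>\<close>, composed with \<open>p\<close>.\<close>

definition sing_kernel :: "real \<Rightarrow> complex \<Rightarrow> complex \<Rightarrow> real" where
  "sing_kernel s \<alpha> x = (1 - s\<^sup>2) / (norm (\<alpha> - of_real s * p x))\<^sup>2"

definition ac_kernel :: "real \<Rightarrow> complex \<Rightarrow> complex \<Rightarrow> real" where
  "ac_kernel s \<alpha> x = s\<^sup>2 * ((1 - (norm (p x))\<^sup>2) / (norm (\<alpha> - of_real s * p x))\<^sup>2)"

lemma kernel_measurable [measurable]:
  "sing_kernel s \<alpha> \<in> borel_measurable arc_measure" "ac_kernel s \<alpha> \<in> borel_measurable arc_measure"
  unfolding sing_kernel_def[abs_def] ac_kernel_def[abs_def] by measurable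

text \<open>The identity \<open>1 - s\<^sup>2 t\<^sup>2 = (1 - s\<^sup>2) + s\<^sup>2 (1 - t\<^sup>2)\<close> separates the part of the kernel
  that converges to the density from the part whose mass escapes to the singular measure.\<close>

lemma kernel_split:
  assumes "0 \<le> s"
  shows "pois (of_real s * p x) \<alpha> = sing_kernel s \<alpha> x + ac_kernel s \<alpha> x"
proof -
  have "1 - (norm (of_real s * p x))\<^sup>2 = (1 - s\<^sup>2) + s\<^sup>2 * (1 - (norm (p x))\<^sup>2)"
    using assms by (simp add: norm_mult power_mult_distrib algebra_simps)
  thus ?thesis unfolding pois_def sing_kernel_def ac_kernel_def by (simp only: add_divide_distrib times_divide_eq_right)
qed

lemma sing_kernel_nonneg: "0 \<le> s \<Longrightarrow> s < 1 \<Longrightarrow> 0 \<le> sing_kernel s \<alpha> x"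
  unfolding sing_kernel_def by (auto simp: power_le_one)

text \<open>The distance from \<open>p x\<close> to \<open>\<alpha>\<close> is at most twice the one from \<open>s * p x\<close>, because shrinking
  moves \<open>p x\<close> by at most \<open>1 - s\<close>. Hence dominated convergence applies as \<open>s\<close> tends to 1.\<close>

lemma ac_kernel_bounds:
  assumes s: "0 \<le> s" "s < 1" and \<alpha>: "norm \<alpha> = 1"
  shows "0 \<le> ac_kernel s \<alpha> x" "ac_kernel s \<alpha> x \<le> 4 * clark_density \<alpha> x"
proof -
  have pd: "norm (p x) < 1" by (rule p_disk)
  hence p2: "0 \<le> 1 - (norm (p x))\<^sup>2" by (simp add: power_le_one)
  thus "0 \<le> ac_kernel s \<alpha> x" unfolding ac_kernel_def by (intro mult_nonneg_nonneg divide_nonneg_nonneg) auto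
  define d where "d = norm (\<alpha> - of_real s * p x)"
  have "1 - s \<le> d" using norm_triangle_ineq2[of \<alpha> "of_real s * p x"] scaled_p(1)[OF s, of x] \<alpha> unfolding d_def
    by linarith
  moreover have "norm ((1 - of_real s) * p x) \<le> 1 - s"
  proof -
    have "norm ((1 - complex_of_real s) * p x) = (1 - s) * norm (p x)"
    proof -
      have "1 - complex_of_real s = complex_of_real (1 - s)" by simp
      thus ?thesis using s by (simp add: norm_mult del: of_real_diff)
    qed
    thus ?thesis using s pd by (simp add: mult_left_le)
  qed
  moreover have "norm (\<alpha> - p x) \<le> d + norm ((1 - of_real s) * p x)"
    using norm_triangle_ineq4[of "\<alpha> - of_real s * p x" "(1 - of_real s) * p x"] unfolding d_def by (simp add: algebra_simps)
  ultimately have le: "norm (\<alpha> - p x) \<le> 2 * d" by linarith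
  have pos: "0 < norm (\<alpha> - p x)" using pd \<alpha> by auto
  have dpos: "0 < d" using le pos by linarith
  have "ac_kernel s \<alpha> x \<le> 1 * ((1 - (norm (p x))\<^sup>2) / d\<^sup>2)"
    unfolding ac_kernel_def d_def using s p2 by (intro mult_right_mono divide_nonneg_nonneg) (auto simp: power_le_one)
  also have "\<dots> \<le> 1 * ((1 - (norm (p x))\<^sup>2) / (norm (\<alpha> - p x) / 2)\<^sup>2)"
    using le pos p2 dpos by (intro mult_left_mono divide_left_mono power_mono mult_pos_pos zero_less_power) auto
  also have "\<dots> = 4 * clark_density \<alpha> x" by (simp add: clark_density_def pois_def power_divide)
  finally show "ac_kernel s \<alpha> x \<le> 4 * clark_density \<alpha> x" .
qed

lemma ac_kernel_limit:
  assumes \<alpha>: "norm \<alpha> = 1" and h [measurable]: "h \<in> borel_measurable arc_measure" and B: "\<And>x. x \<in> sphere 0 1 \<Longrightarrow> norm (h x :: real) \<le> B"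
  shows "(\<lambda>n. \<integral>x. h x * ac_kernel (approach n) \<alpha> x \<partial>arc_measure) \<longlonglongrightarrow> (\<integral>x. h x * clark_density \<alpha> x \<partial>arc_measure)"
proof (rule integral_dominated_convergence[where w="\<lambda>x. B * (4 * clark_density \<alpha> x)"])
  show "integrable arc_measure (\<lambda>x. B * (4 * clark_density \<alpha> x))" using integrable_clark_density[OF \<alpha>] by simp
  show "AE x in arc_measure. (\<lambda>n. h x * ac_kernel (approach n) \<alpha> x) \<longlonglongrightarrow> h x * clark_density \<alpha> x"
  proof (rule AE_I2)
    fix x
    have nz: "norm (\<alpha> - of_real 1 * p x) \<noteq> 0" using p_disk[of x] \<alpha> by auto
    have "(\<lambda>n. h x * ac_kernel (approach n) \<alpha> x) \<longlonglongrightarrow> h x * (1\<^sup>2 * ((1 - (norm (p x))\<^sup>2) / (norm (\<alpha> - of_real 1 * p x))\<^sup>2))"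
      unfolding ac_kernel_def using nz by (intro tendsto_intros approach) auto
    thus "(\<lambda>n. h x * ac_kernel (approach n) \<alpha> x) \<longlonglongrightarrow> h x * clark_density \<alpha> x"
      by (simp add: clark_density_def pois_def)
  qed
  show "AE x in arc_measure. norm (h x * ac_kernel (approach n) \<alpha> x) \<le> B * (4 * clark_density \<alpha> x)" for n
  proof (rule AE_I2)
    fix x assume z: "x \<in> space arc_measure"
    have "0 \<le> B" using order_trans[OF norm_ge_zero B] z by simp
    thus "norm (h x * ac_kernel (approach n) \<alpha> x) \<le> B * (4 * clark_density \<alpha> x)"
      unfolding norm_mult using B[of x] z ac_kernel_bounds[OF approach(1,2) \<alpha>, of n x] by (intro mult_mono) auto
  qed
qed measurable

lemma integrable_ac_kernel:
  assumes \<alpha>: "norm \<alpha> = 1" and s: "0 \<le> s" "s < 1"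
  shows "integrable arc_measure (ac_kernel s \<alpha>)"
  by (rule Bochner_Integration.integrable_bound[of arc_measure "\<lambda>x. 4 * clark_density \<alpha> x"])
     (use integrable_clark_density[OF \<alpha>] ac_kernel_bounds[OF s \<alpha>] clark_density_nonneg in \<open>auto intro!: AE_I2\<close>)

lemma integrable_sing_kernel:
  assumes \<alpha>: "norm \<alpha> = 1" and s: "0 \<le> s" "s < 1"
  shows "integrable arc_measure (sing_kernel s \<alpha>)"
  using Bochner_Integration.integrable_diff[OF integrable_pois_scaled[OF \<alpha> s] integrable_ac_kernel[OF \<alpha> s]]
  by (simp add: kernel_split[OF s(1)])

lemma integrable_mult_bounded:
  fixes u h :: "complex \<Rightarrow> real"
  assumes "integrable arc_measure u" "continuous_on (sphere 0 1) h"
  shows "integrable arc_measure (\<lambda>x. h x * u x)"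
proof -
  obtain B where B: "B \<ge> 0" "\<And>x. x \<in> sphere 0 1 \<Longrightarrow> norm (h x) \<le> B" using continuous_circle_bounded[OF assms(2)] by blast
  have [measurable]: "h \<in> borel_measurable arc_measure" "u \<in> borel_measurable arc_measure"
    using assms borel_measurable_arc_continuous by auto
  show ?thesis
  proof (rule Bochner_Integration.integrable_bound[of arc_measure "\<lambda>x. B * u x"])
    show "AE x in arc_measure. norm (h x * u x) \<le> norm (B * u x)"
      using B by (intro AE_I2) (auto simp: abs_mult intro!: mult_right_mono)
  qed (use assms(1) in auto)
qed

text \<open>The Poisson integrals of the densities \<open>pois (s * p x) \<alpha>\<close> are \<open>pois (s * \<phi> z)
  \<alpha>\<close>, which converge to the Poisson integral of the Clark measure.\<close>

lemma clark_limit: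
  fixes h :: "complex \<Rightarrow> real"
  assumes \<alpha>: "norm \<alpha> = 1" and h: "continuous_on (sphere 0 1) h"
  shows "(\<lambda>n. \<integral>x. h x * pois (of_real (approach n) * p x) \<alpha> \<partial>arc_measure) \<longlonglongrightarrow> (\<integral>x. h x \<partial>clark_measure \<phi> \<alpha>)"
proof -
  note vi = integrable_pois_scaled[OF \<alpha> approach(1,2)]
  have vn: "AE x in arc_measure. 0 \<le> pois (of_real (approach n) * p x) \<alpha>" for n
    by (intro AE_I2 pois_nonneg scaled_p approach)
  have "(\<lambda>n. \<integral>x. h x \<partial>density arc_measure (\<lambda>x. ennreal (pois (of_real (approach n) * p x) \<alpha>))) \<longlonglongrightarrow> (\<integral>x. h x \<partial>clark_measure \<phi> \<alpha>)"
  proof (rule poisson_weak_convergence[OF circle_measure_density(1)[OF vi vn] clark_measure(1)[OF \<alpha>] _ h])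
    fix z :: complex assume z: "norm z < 1"
    show "(\<lambda>n. poisson_integral (density arc_measure (\<lambda>x. ennreal (pois (of_real (approach n) * p x) \<alpha>))) z) \<longlonglongrightarrow> poisson_integral (clark_measure \<phi> \<alpha>) z"
      unfolding poisson_integral_density[OF vi vn z] poisson_boundary_kernel[OF \<alpha> approach(1,2) z] clark_measure(2)[OF \<alpha> z]
      by (rule pois_approach_tendsto[OF maps[OF z] \<alpha>])
  qed
  thus ?thesis
    using circle_measure_density(2)[OF vi vn borel_measurable_arc_continuous[OF h]] by (simp add: mult.commute)
qed

text \<open>Let \<open>\<sigma>\<close> be the weak limit of the measures with density \<open>sing_kernel\<close>. By the splitting of
  the kernel the Clark measure is the sum of \<open>\<sigma>\<close> and of the measure \<open>R\<close> with density
  \<open>clark_density\<close>. It remains to see that \<open>\<sigma>\<close> is singular. Let \<open>g\<close> be the density of the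
  absolutely continuous part of the Clark measure; its Poisson integral is at most \<open>pois (\<phi> z)
  \<alpha>\<close>, whose radial limits are \<open>clark_density\<close>, so \<open>g \<le> clark_density\<close> by the theorem of Fatou for
  bounded truncations of \<open>g\<close>. Thus \<open>R\<close> already exhausts the absolutely continuous part.\<close>

theorem clark_singular_part:
  assumes \<alpha>: "norm \<alpha> = 1"
  shows "circle_measure (singular_part arc_measure (clark_measure \<phi> \<alpha>))"
    and "continuous_on (sphere 0 1) h \<Longrightarrow> (\<integral>x. h x \<partial>clark_measure \<phi> \<alpha>)
      = (\<integral>x. h x * clark_density \<alpha> x \<partial>arc_measure) + (\<integral>x. (h x :: real) \<partial>singular_part arc_measure (clark_measure \<phi> \<alpha>))"
    and "continuous_on (sphere 0 1) h \<Longrightarrow>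
      (\<lambda>n. \<integral>x. h x * sing_kernel (approach n) \<alpha> x \<partial>arc_measure) \<longlonglongrightarrow> (\<integral>x. h x \<partial>singular_part arc_measure (clark_measure \<phi> \<alpha>))"
proof -
  define \<mu> where "\<mu> = clark_measure \<phi> \<alpha>"
  note \<mu> = clark_measure[OF \<alpha>, folded \<mu>_def]
  note vi = integrable_sing_kernel[OF \<alpha> approach(1,2)]
  have vn: "AE x in arc_measure. 0 \<le> sing_kernel (approach n) \<alpha> x" for n
    by (intro AE_I2 sing_kernel_nonneg approach)
  note Ri = integrable_clark_density[OF \<alpha>]
  have Rn: "AE x in arc_measure. 0 \<le> clark_density \<alpha> x" by (intro AE_I2 clark_density_nonneg)
  define D where "D n = density arc_measure (\<lambda>x. ennreal (sing_kernel (approach n) \<alpha> x))" for n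
  have D: "circle_measure (D n)" for n unfolding D_def by (rule circle_measure_density(1)[OF vi vn])
  have split: "(\<lambda>n. \<integral>x. h x * sing_kernel (approach n) \<alpha> x \<partial>arc_measure) =
      (\<lambda>n. (\<integral>x. h x * pois (of_real (approach n) * p x) \<alpha> \<partial>arc_measure) - (\<integral>x. h x * ac_kernel (approach n) \<alpha> x \<partial>arc_measure))"
    if h: "continuous_on (sphere 0 1) h" for h :: "complex \<Rightarrow> real"
  proof
    fix n
    show "(\<integral>x. h x * sing_kernel (approach n) \<alpha> x \<partial>arc_measure) =
      (\<integral>x. h x * pois (of_real (approach n) * p x) \<alpha> \<partial>arc_measure) - (\<integral>x. h x * ac_kernel (approach n) \<alpha> x \<partial>arc_measure)"
      unfolding kernel_split[OF approach(1)] distrib_left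
      using integrable_mult_bounded[OF vi h] integrable_mult_bounded[OF integrable_ac_kernel[OF \<alpha> approach(1,2)] h] by simp
  qed
  have lim: "(\<lambda>n. \<integral>x. h x * sing_kernel (approach n) \<alpha> x \<partial>arc_measure) \<longlonglongrightarrow> (\<integral>x. h x \<partial>\<mu>) - (\<integral>x. h x * clark_density \<alpha> x \<partial>arc_measure)"
    if h: "continuous_on (sphere 0 1) h" for h :: "complex \<Rightarrow> real"
  proof -
    obtain B where B: "B \<ge> 0" "\<And>x. x \<in> sphere 0 1 \<Longrightarrow> norm (h x) \<le> B" using continuous_circle_bounded[OF h] by blast
    show ?thesis unfolding split[OF h] \<mu>_def
      by (intro tendsto_diff clark_limit[OF \<alpha> h] ac_kernel_limit[OF \<alpha> borel_measurable_arc_continuous[OF h] B(2)])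
  qed
  obtain \<sigma> where \<sigma>: "circle_measure \<sigma>" "\<And>z. norm z < 1 \<Longrightarrow> poisson_integral \<sigma> z = (\<integral>x. pois z x \<partial>\<mu>) - (\<integral>x. pois z x * clark_density \<alpha> x \<partial>arc_measure)"
  proof (rule poisson_compactness[OF D])
    fix z :: complex assume z: "norm z < 1"
    show "(\<lambda>n. poisson_integral (D n) z) \<longlonglongrightarrow> (\<integral>x. pois z x \<partial>\<mu>) - (\<integral>x. pois z x * clark_density \<alpha> x \<partial>arc_measure)"
      using lim[OF continuous_on_pois[OF z]] unfolding D_def poisson_integral_density[OF vi vn z] by (simp add: mult.commute)
  qed blast
  have Dlim: "(\<lambda>n. \<integral>x. h x * sing_kernel (approach n) \<alpha> x \<partial>arc_measure) \<longlonglongrightarrow> (\<integral>x. h x \<partial>\<sigma>)"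
    if h: "continuous_on (sphere 0 1) h" for h :: "complex \<Rightarrow> real"
  proof -
    have "(\<lambda>n. \<integral>x. h x \<partial>D n) \<longlonglongrightarrow> (\<integral>x. h x \<partial>\<sigma>)"
    proof (rule poisson_weak_convergence[OF D \<sigma>(1) _ h])
      fix z :: complex assume z: "norm z < 1"
      show "(\<lambda>n. poisson_integral (D n) z) \<longlonglongrightarrow> poisson_integral \<sigma> z"
        using lim[OF continuous_on_pois[OF z]] unfolding D_def poisson_integral_density[OF vi vn z] \<sigma>(2)[OF z] by (simp add: mult.commute)
    qed
    thus ?thesis unfolding D_def
      using circle_measure_density(2)[OF vi vn borel_measurable_arc_continuous[OF h]] by (simp add: mult.commute)
  qed
  have eq: "(\<integral>x. h x \<partial>\<mu>) = (\<integral>x. h x * clark_density \<alpha> x \<partial>arc_measure) + (\<integral>x. h x \<partial>\<sigma>)"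
    if h: "continuous_on (sphere 0 1) h" for h :: "complex \<Rightarrow> real"
    using LIMSEQ_unique[OF Dlim[OF h] lim[OF h]] by simp
  define R where "R = density arc_measure (\<lambda>x. ennreal (clark_density \<alpha> x))"
  have R: "circle_measure R" unfolding R_def by (rule circle_measure_density(1)[OF Ri Rn])
  have \<mu>R: "\<mu> = add_measure R \<sigma>"
  proof (rule circle_measure_eqI[OF \<mu>(1) circle_measure_add(1)[OF R \<sigma>(1)]])
    fix h :: "complex \<Rightarrow> real" assume h: "continuous_on (sphere 0 1) h"
    show "(\<integral>x. h x \<partial>\<mu>) = (\<integral>x. h x \<partial>add_measure R \<sigma>)"
      unfolding circle_measure_add(3)[OF R \<sigma>(1) h] eq[OF h] unfolding R_def
      using circle_measure_density(2)[OF Ri Rn borel_measurable_arc_continuous[OF h]] by (simp add: mult.commute)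
  qed
  obtain g where g: "integrable arc_measure g" "\<And>x. 0 \<le> (g x :: real)"
    "circle_measure (singular_part arc_measure \<mu>)"
    "mutually_singular arc_measure (singular_part arc_measure \<mu>)"
    "\<And>A. A \<in> sets arc_measure \<Longrightarrow> emeasure \<mu> A = emeasure (density arc_measure (\<lambda>x. ennreal (g x))) A + emeasure (singular_part arc_measure \<mu>) A"
    using lebesgue_decomposition[OF \<mu>(1)] by blast
  define S where "S = singular_part arc_measure \<mu>"
  note g = g[folded S_def]
  have gn: "AE x in arc_measure. 0 \<le> g x" using g(2) by simp
  define Q where "Q = density arc_measure (\<lambda>x. ennreal (g x))"
  note g = g[folded Q_def]
  have gm [measurable]: "g \<in> borel_measurable arc_measure" using g(1) by auto
  have Q: "circle_measure Q" unfolding Q_def by (rule circle_measure_density(1)[OF g(1) gn])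
  have \<mu>Q: "\<mu> = add_measure Q S"
  proof (rule measure_eqI)
    show "sets \<mu> = sets (add_measure Q S)"
      using circle_measureD(1)[OF \<mu>(1)] circle_measureD(1)[OF circle_measure_add(1)[OF Q g(3)]] by simp
    fix A assume "A \<in> sets \<mu>"
    hence "A \<in> sets arc_measure" using circle_measureD(1)[OF \<mu>(1)] by simp
    thus "emeasure \<mu> A = emeasure (add_measure Q S) A" using circle_measure_add(2)[OF Q g(3)] g(5) by simp
  qed
  have Qle: "(\<integral>x. g x * pois z x \<partial>arc_measure) \<le> pois (\<phi> z) \<alpha>" if z: "norm z < 1" for z
  proof -
    have "pois (\<phi> z) \<alpha> = (\<integral>x. pois z x \<partial>\<mu>)" using \<mu>(2)[OF z] by (simp add: poisson_integral_pois)
    also have "\<dots> = poisson_integral Q z + poisson_integral S z"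
      unfolding \<mu>Q poisson_integral_pois by (rule circle_measure_add(3)[OF Q g(3) continuous_on_pois[OF z]])
    also have "poisson_integral Q z = (\<integral>x. g x * pois z x \<partial>arc_measure)"
      unfolding Q_def by (rule poisson_integral_density[OF g(1) gn z])
    finally show ?thesis using poisson_integral_bounds(1)[OF g(3) _ z] by simp
  qed
  have plim: "AE x in arc_measure. ((\<lambda>r. pois (\<phi> (of_real r * x)) \<alpha>) \<longlongrightarrow> clark_density \<alpha> x) (at_left (1::real))"
    using p_limit
  proof eventually_elim
    case (elim x)
    have "isCont (\<lambda>z. pois z \<alpha>) (p x)"
      using continuous_on_pois_left[OF \<alpha>] p_disk[of x] by (simp add: continuous_on_eq_continuous_at)
    thus ?case unfolding clark_density_def by (rule isCont_tendsto_compose) (rule elim)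
  qed
  \<comment> \<open>The truncations of \<open>g\<close> are bounded, so their Poisson integrals have the expected radial limits.\<close>
  have "AE x in arc_measure. min (g x) (real k) \<le> clark_density \<alpha> x" for k
  proof -
    have "AE x in arc_measure. ((\<lambda>r. \<integral>y. min (g y) (real k) * pois (of_real r * x) y \<partial>arc_measure) \<longlongrightarrow> min (g x) (real k)) (at_left (1::real))"
      by (rule fatou_bounded[of _ "real k"]) (use g(2) in auto)
    with plim AE_space show ?thesis
    proof eventually_elim
      case (elim x)
      have "\<forall>\<^sub>F r in at_left (1::real). r \<in> {0<..<1}" by (rule eventually_at_leftI[of 0]) auto
      hence "\<forall>\<^sub>F r in at_left (1::real). (\<integral>y. min (g y) (real k) * pois (of_real r * x) y \<partial>arc_measure) \<le> pois (\<phi> (of_real r * x)) \<alpha>"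
      proof eventually_elim
        case (elim r)
        hence z: "norm (of_real r * x) < 1" using \<open>x \<in> space arc_measure\<close> by (simp add: norm_mult)
        have mi: "integrable arc_measure (\<lambda>y. min (g y) (real k))"
          by (rule Bochner_Integration.integrable_bound[OF g(1)]) (use g(2) in auto)
        have "(\<integral>y. min (g y) (real k) * pois (of_real r * x) y \<partial>arc_measure) \<le> (\<integral>y. g y * pois (of_real r * x) y \<partial>arc_measure)"
          using integrable_mult_bounded[OF g(1) continuous_on_pois[OF z]] integrable_mult_bounded[OF mi continuous_on_pois[OF z]]
          by (intro integral_mono mult_right_mono pois_nonneg z) (auto simp: mult.commute)
        thus ?case using Qle[OF z] by linarith
      qed
      with elim(1,3) show ?case by (intro tendsto_le[OF trivial_limit_at_left_real elim(1) elim(3)])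
    qed
  qed
  hence "AE x in arc_measure. \<forall>k. min (g x) (real k) \<le> clark_density \<alpha> x" by (simp add: AE_all_countable)
  hence gR: "AE x in arc_measure. g x \<le> clark_density \<alpha> x"
  proof eventually_elim
    case (elim x)
    obtain k :: nat where "g x \<le> real k" using real_arch_simple by blast
    thus ?case using elim[rule_format, of k] by simp
  qed
  have QR: "emeasure Q A \<le> emeasure R A" if A: "A \<in> sets arc_measure" for A
  proof -
    have "emeasure Q A = (\<integral>\<^sup>+x. ennreal (g x) * indicator A x \<partial>arc_measure)"
      unfolding Q_def by (rule emeasure_density[OF _ A]) measurable
    also have "\<dots> \<le> (\<integral>\<^sup>+x. ennreal (clark_density \<alpha> x) * indicator A x \<partial>arc_measure)"
      by (rule nn_integral_mono_AE) (use gR in \<open>eventually_elim, auto simp: indicator_def intro: ennreal_leI\<close>)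
    also have "\<dots> = emeasure R A"
      unfolding R_def by (rule emeasure_density[OF _ A, symmetric]) measurable
    finally show ?thesis .
  qed
  have sing: "mutually_singular arc_measure \<sigma>"
  proof -
    obtain A where A: "A \<in> sets arc_measure" "emeasure arc_measure A = 0" "emeasure S (space S - A) = 0"
      using g(4) unfolding mutually_singular_def by blast
    interpret Rf: finite_measure R using circle_measureD(2)[OF R] .
    define C where "C = sphere 0 1 - A"
    have C: "C \<in> sets arc_measure" using A(1) unfolding C_def by (intro sets.Diff) auto
    have S0: "emeasure S C = 0" using A(3) circle_measureD(3)[OF g(3)] by (simp add: C_def)
    have "emeasure R C + emeasure \<sigma> C = emeasure Q C"
      using g(5)[OF C] S0 circle_measure_add(2)[OF R \<sigma>(1) C] \<mu>R by simp
    also have "\<dots> \<le> emeasure R C" by (rule QR[OF C])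
    finally have "emeasure R C + emeasure \<sigma> C \<le> emeasure R C + 0" by simp
    hence "emeasure \<sigma> C \<le> 0"
      by (subst (asm) ennreal_add_left_cancel_le) (simp add: Rf.emeasure_eq_measure)
    hence "emeasure \<sigma> C = 0" by simp
    thus ?thesis unfolding mutually_singular_def
      using A circle_measureD(1,3)[OF \<sigma>(1)] by (auto simp: C_def)
  qed
  have "S = \<sigma>"
  proof (rule singular_part_unique[where N=\<mu> and M=arc_measure and R=Q and R'=R])
    show "absolutely_continuous arc_measure Q" "absolutely_continuous arc_measure R"
      unfolding Q_def R_def by (rule absolutely_continuousI_density; measurable)+
  qed (use g circle_measureD(1) \<mu>(1) \<sigma>(1) Q R sing \<mu>R circle_measure_add(2)[OF R \<sigma>(1)] in auto)
  hence "singular_part arc_measure (clark_measure \<phi> \<alpha>) = \<sigma>" by (simp add: S_def \<mu>_def)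
  thus "circle_measure (singular_part arc_measure (clark_measure \<phi> \<alpha>))"
    and "continuous_on (sphere 0 1) h \<Longrightarrow> (\<integral>x. h x \<partial>clark_measure \<phi> \<alpha>)
      = (\<integral>x. h x * clark_density \<alpha> x \<partial>arc_measure) + (\<integral>x. (h x :: real) \<partial>singular_part arc_measure (clark_measure \<phi> \<alpha>))"
    and "continuous_on (sphere 0 1) h \<Longrightarrow>
      (\<lambda>n. \<integral>x. h x * sing_kernel (approach n) \<alpha> x \<partial>arc_measure) \<longlonglongrightarrow> (\<integral>x. h x \<partial>singular_part arc_measure (clark_measure \<phi> \<alpha>))"
    using \<sigma>(1) eq Dlim by (simp_all add: \<mu>_def)
qed

end

section \<open>Composition operators\<close>

text \<open>Insert the Poisson majorant of \<open>(norm (f w))\<^sup>2\<close> at \<open>w = q x\<close> and integrate over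
  \<open>x\<close> first. The map \<open>q\<close> will be \<open>p\<close>, and also a dilate of \<open>\<phi>\<close> when the membership of \<open>f o
  \<phi>\<close> in the Hardy space is at stake.\<close>

lemma composition_tonelli:
  fixes h :: "complex \<Rightarrow> real"
  assumes f: "f \<in> hardy2" and q [measurable]: "q \<in> borel_measurable arc_measure" and qd: "\<And>x. x \<in> sphere 0 1 \<Longrightarrow> norm (q x) < 1"
    and h [measurable]: "h \<in> borel_measurable arc_measure" and hn: "\<And>x. 0 \<le> h x"
    and C: "\<And>\<beta>. norm \<beta> = 1 \<Longrightarrow> (\<integral>\<^sup>+x. ennreal (h x * pois (q x) \<beta>) \<partial>arc_measure) \<le> ennreal C" and C0: "0 \<le> C"
  shows "(\<lambda>x. f (q x)) \<in> borel_measurable arc_measure"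
    and "integrable arc_measure (\<lambda>x. h x * (norm (f (q x)))\<^sup>2)"
    and "(\<integral>x. h x * (norm (f (q x)))\<^sup>2 \<partial>arc_measure) \<le> C * (hardy_norm f)\<^sup>2"
proof -
  show fq [measurable]: "(\<lambda>x. f (q x)) \<in> borel_measurable arc_measure"
  proof -
    have "(\<lambda>w. indicator (ball 0 1) w *\<^sub>R f w) \<in> borel_measurable borel"
      using hardy2_holomorphic[OF f] by (intro borel_measurable_continuous_on_indicator holomorphic_on_imp_continuous_on) auto
    from measurable_compose[OF q this] show ?thesis
      by (rule measurable_cong[THEN iffD1, rotated]) (simp add: qd)
  qed
  note [measurable] = bdry_measurable[OF f]
  interpret P: pair_sigma_finite arc_measure arc_measure ..
  let ?B = "\<lambda>\<beta>. (norm (bdry f \<beta>))\<^sup>2"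
  have [measurable]: "snd \<in> borel_measurable (arc_measure \<Otimes>\<^sub>M arc_measure)"
    using measurable_compose[OF measurable_snd[of arc_measure arc_measure] borel_measurable_id_arc] by simp
  have m: "(\<lambda>(x, \<beta>). ennreal (h x) * ennreal (?B \<beta> * pois (q x) \<beta>)) \<in> borel_measurable (arc_measure \<Otimes>\<^sub>M arc_measure)"
    unfolding pois_def case_prod_beta by measurable
  have "(\<integral>\<^sup>+x. ennreal (h x * (norm (f (q x)))\<^sup>2) \<partial>arc_measure) \<le> (\<integral>\<^sup>+x. (\<integral>\<^sup>+\<beta>. ennreal (h x) * ennreal (?B \<beta> * pois (q x) \<beta>) \<partial>arc_measure) \<partial>arc_measure)"
  proof (rule nn_integral_mono)
    fix x assume "x \<in> space arc_measure"
    hence z: "norm (q x) < 1" using qd by simp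
    have i: "integrable arc_measure (\<lambda>\<beta>. ?B \<beta> * pois (q x) \<beta>)" by (rule sq_int_pois_integrable[OF bdry(1)[OF f] z])
    have "ennreal ((norm (f (q x)))\<^sup>2) \<le> ennreal (\<integral>\<beta>. ?B \<beta> * pois (q x) \<beta> \<partial>arc_measure)"
      by (intro ennreal_leI hardy_poisson_le f z)
    also have "\<dots> = (\<integral>\<^sup>+\<beta>. ennreal (?B \<beta> * pois (q x) \<beta>) \<partial>arc_measure)"
      by (rule nn_integral_eq_integral[OF i, symmetric]) (auto intro!: AE_I2 mult_nonneg_nonneg pois_nonneg z)
    finally have le: "ennreal ((norm (f (q x)))\<^sup>2) \<le> (\<integral>\<^sup>+\<beta>. ennreal (?B \<beta> * pois (q x) \<beta>) \<partial>arc_measure)" .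
    have "(\<integral>\<^sup>+\<beta>. ennreal (h x) * ennreal (?B \<beta> * pois (q x) \<beta>) \<partial>arc_measure) = ennreal (h x) * (\<integral>\<^sup>+\<beta>. ennreal (?B \<beta> * pois (q x) \<beta>) \<partial>arc_measure)"
      by (rule nn_integral_cmult) (use i in auto)
    thus "ennreal (h x * (norm (f (q x)))\<^sup>2) \<le> (\<integral>\<^sup>+\<beta>. ennreal (h x) * ennreal (?B \<beta> * pois (q x) \<beta>) \<partial>arc_measure)"
      using le hn[of x] by (simp add: ennreal_mult mult_left_mono)
  qed
  also have "\<dots> = (\<integral>\<^sup>+\<beta>. (\<integral>\<^sup>+x. ennreal (h x) * ennreal (?B \<beta> * pois (q x) \<beta>) \<partial>arc_measure) \<partial>arc_measure)"
    by (rule P.Fubini'[OF m, symmetric])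
  also have "\<dots> \<le> (\<integral>\<^sup>+\<beta>. ennreal C * ennreal (?B \<beta>) \<partial>arc_measure)"
  proof (rule nn_integral_mono)
    fix \<beta> assume "\<beta> \<in> space arc_measure"
    hence b: "norm \<beta> = 1" by simp
    have "(\<integral>\<^sup>+x. ennreal (h x) * ennreal (?B \<beta> * pois (q x) \<beta>) \<partial>arc_measure) = (\<integral>\<^sup>+x. ennreal (?B \<beta>) * ennreal (h x * pois (q x) \<beta>) \<partial>arc_measure)"
    proof (rule nn_integral_cong)
      fix x assume "x \<in> space arc_measure"
      hence "0 \<le> pois (q x) \<beta>" using qd by (intro pois_nonneg) simp
      thus "ennreal (h x) * ennreal (?B \<beta> * pois (q x) \<beta>) = ennreal (?B \<beta>) * ennreal (h x * pois (q x) \<beta>)"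
        using hn[of x] by (simp add: ennreal_mult' ennreal_mult mult_ac)
    qed
    also have "\<dots> = ennreal (?B \<beta>) * (\<integral>\<^sup>+x. ennreal (h x * pois (q x) \<beta>) \<partial>arc_measure)"
      by (rule nn_integral_cmult) (unfold pois_def, measurable)
    also have "\<dots> \<le> ennreal (?B \<beta>) * ennreal C" by (rule mult_left_mono[OF C[OF b]]) simp
    finally show "(\<integral>\<^sup>+x. ennreal (h x) * ennreal (?B \<beta> * pois (q x) \<beta>) \<partial>arc_measure) \<le> ennreal C * ennreal (?B \<beta>)" by (simp add: mult.commute)
  qed
  also have "\<dots> = ennreal C * (\<integral>\<^sup>+\<beta>. ennreal (?B \<beta>) \<partial>arc_measure)" by (rule nn_integral_cmult) measurable
  also have "(\<integral>\<^sup>+\<beta>. ennreal (?B \<beta>) \<partial>arc_measure) = ennreal ((hardy_norm f)\<^sup>2)"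
    unfolding hardy_norm_eq[OF f] L2norm_sq
    by (rule nn_integral_eq_integral) (use bdry(1)[OF f] in \<open>auto simp: sq_int_def\<close>)
  also have "ennreal C * ennreal ((hardy_norm f)\<^sup>2) = ennreal (C * (hardy_norm f)\<^sup>2)" using C0 by (simp add: ennreal_mult)
  finally have le: "(\<integral>\<^sup>+x. ennreal (h x * (norm (f (q x)))\<^sup>2) \<partial>arc_measure) \<le> ennreal (C * (hardy_norm f)\<^sup>2)" .
  show i: "integrable arc_measure (\<lambda>x. h x * (norm (f (q x)))\<^sup>2)"
    by (rule integrableI_nonneg) (use le hn in \<open>auto intro: order_le_less_trans[OF _ ennreal_less_top]\<close>)
  have "(\<integral>\<^sup>+x. ennreal (h x * (norm (f (q x)))\<^sup>2) \<partial>arc_measure) = ennreal (\<integral>x. h x * (norm (f (q x)))\<^sup>2 \<partial>arc_measure)"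
    by (rule nn_integral_eq_integral[OF i]) (use hn in auto)
  with le show "(\<integral>x. h x * (norm (f (q x)))\<^sup>2 \<partial>arc_measure) \<le> C * (hardy_norm f)\<^sup>2"
    using C0 by (simp add: ennreal_le_iff)
qed

context disk_map
begin

text \<open>A bound for the total masses of all Clark measures, which are \<open>pois (\<phi> 0) \<alpha>\<close>.\<close>

definition mass_bound :: real where
  "mass_bound = 2 / (1 - norm (\<phi> 0))"

lemma mass_bound: "0 < mass_bound" "norm \<beta> = 1 \<Longrightarrow> pois (\<phi> 0) \<beta> \<le> mass_bound"
  using maps[of 0] unfolding mass_bound_def by (auto intro!: pois_upper)

lemma clark_density_mass:
  assumes \<beta>: "norm \<beta> = 1"
  shows "(\<integral>x. clark_density \<beta> x \<partial>arc_measure) \<le> mass_bound"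
proof -
  have "(\<integral>x. (1::real) \<partial>clark_measure \<phi> \<beta>) = (\<integral>x. clark_density \<beta> x \<partial>arc_measure) + (\<integral>x. (1::real) \<partial>singular_part arc_measure (clark_measure \<phi> \<beta>))"
    using clark_singular_part(2)[OF \<beta>, of "\<lambda>_. 1"] by simp
  moreover have "(\<integral>x. (1::real) \<partial>clark_measure \<phi> \<beta>) = pois (\<phi> 0) \<beta>"
    using clark_measure(2)[OF \<beta>, of 0] poisson_integral_0[OF clark_measure(1)[OF \<beta>]] circle_measureD(3)[OF clark_measure(1)[OF \<beta>]] by simp
  moreover have "0 \<le> (\<integral>x. (1::real) \<partial>singular_part arc_measure (clark_measure \<phi> \<beta>))" by simp
  ultimately show ?thesis using mass_bound(2)[OF \<beta>] by linarith
qed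

lemma comp_boundary_norm:
  assumes f: "f \<in> hardy2"
  shows "(\<lambda>x. f (p x)) \<in> borel_measurable arc_measure"
    and "integrable arc_measure (\<lambda>x. (norm (f (p x)))\<^sup>2)"
    and "(\<integral>x. (norm (f (p x)))\<^sup>2 \<partial>arc_measure) \<le> mass_bound * (hardy_norm f)\<^sup>2"
proof -
  have C: "(\<integral>\<^sup>+x. ennreal (1 * pois (p x) \<beta>) \<partial>arc_measure) \<le> ennreal mass_bound" if \<beta>: "norm \<beta> = 1" for \<beta>
  proof -
    have "(\<integral>\<^sup>+x. ennreal (clark_density \<beta> x) \<partial>arc_measure) = ennreal (\<integral>x. clark_density \<beta> x \<partial>arc_measure)"
      by (rule nn_integral_eq_integral[OF integrable_clark_density[OF \<beta>]]) (simp add: clark_density_nonneg)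
    also have "\<dots> \<le> ennreal mass_bound" by (intro ennreal_leI clark_density_mass \<beta>)
    finally show ?thesis by (simp add: clark_density_def)
  qed
  note T = composition_tonelli[where h="\<lambda>_. 1", OF f p_measurable p_disk _ _ C]
  show "(\<lambda>x. f (p x)) \<in> borel_measurable arc_measure"
    and "integrable arc_measure (\<lambda>x. (norm (f (p x)))\<^sup>2)"
    and "(\<integral>x. (norm (f (p x)))\<^sup>2 \<partial>arc_measure) \<le> mass_bound * (hardy_norm f)\<^sup>2"
    using T mass_bound(1) by auto
qed

text \<open>Littlewood's subordination theorem. The dilates of \<open>\<phi>\<close> have the constant
  \<open>mass_bound\<close> in the Tonelli estimate, by the mean value property of the harmonic function that
  defines the Clark measure.\<close>

lemma comp_op_mem:
  assumes f: "f \<in> hardy2"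
  shows "comp_op \<phi> f \<in> hardy2"
proof -
  have fh: "(\<lambda>z. f (\<phi> z)) holomorphic_on ball 0 1"
  proof -
    have "\<phi> ` ball 0 1 \<subseteq> ball 0 1" using maps by auto
    from holomorphic_on_compose_gen[OF hol hardy2_holomorphic[OF f] this] show ?thesis by (simp add: o_def)
  qed
  have ch: "comp_op \<phi> f holomorphic_on ball 0 1"
    by (rule holomorphic_transform[OF fh]) (simp add: comp_op_def)
  have "bdd_above ((\<lambda>r. \<integral>x. (norm (comp_op \<phi> f (of_real r * x)))\<^sup>2 \<partial>arc_lebesgue) ` {0..<1::real})"
  proof (rule bdd_aboveI2)
    fix r :: real assume "r \<in> {0..<1}"
    hence r: "0 \<le> r" "r < 1" by auto
    have rz: "norm (of_real r * x) < 1" if "x \<in> sphere 0 1" for x :: complex using that r by (simp add: norm_mult)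
    have C: "(\<integral>\<^sup>+x. ennreal (1 * pois (\<phi> (of_real r * x)) \<beta>) \<partial>arc_measure) \<le> ennreal mass_bound" if \<beta>: "norm \<beta> = 1" for \<beta>
    proof -
      have F: "(\<lambda>z. (\<beta> + \<phi> z) / (\<beta> - \<phi> z)) holomorphic_on ball 0 1"
      proof (intro holomorphic_intros hol)
        fix z :: complex assume "z \<in> ball 0 1"
        hence "norm (\<phi> z) < norm \<beta>" using maps[of z] \<beta> by simp
        thus "\<beta> - \<phi> z \<noteq> 0" by auto
      qed
      have c: "continuous_on (sphere 0 1) (\<lambda>x. Re ((\<beta> + \<phi> (of_real r * x)) / (\<beta> - \<phi> (of_real r * x))))"
        by (intro continuous_on_Re continuous_on_dilate[OF F r])
      have "(\<integral>\<^sup>+x. ennreal (1 * pois (\<phi> (of_real r * x)) \<beta>) \<partial>arc_measure) = (\<integral>\<^sup>+x. ennreal (Re ((\<beta> + \<phi> (of_real r * x)) / (\<beta> - \<phi> (of_real r * x)))) \<partial>arc_measure)"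
        by (rule nn_integral_cong) (use pois_clark[OF \<beta> maps] rz in simp)
      also have "\<dots> = ennreal (\<integral>x. Re ((\<beta> + \<phi> (of_real r * x)) / (\<beta> - \<phi> (of_real r * x))) \<partial>arc_measure)"
        by (rule nn_integral_eq_integral[OF integrable_arc_continuous[OF c]])
           (use pois_clark[OF \<beta> maps] pois_nonneg[OF maps] rz in \<open>auto intro!: AE_I2\<close>)
      also have "(\<integral>x. Re ((\<beta> + \<phi> (of_real r * x)) / (\<beta> - \<phi> (of_real r * x))) \<partial>arc_measure)
          = (\<integral>x. Re ((\<beta> + \<phi> (of_real r * x)) / (\<beta> - \<phi> (of_real r * x))) * pois 0 x \<partial>arc_measure)"
        by (intro Bochner_Integration.integral_cong refl) (simp add: pois_def)
      also have "\<dots> = Re ((\<beta> + \<phi> (of_real r * 0)) / (\<beta> - \<phi> (of_real r * 0)))"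
        by (rule poisson_dilate(2)[OF F r]) simp
      also have "\<dots> = pois (\<phi> 0) \<beta>" using pois_clark[OF \<beta> maps[of 0]] by simp
      finally show ?thesis using mass_bound(2)[OF \<beta>] by (simp add: ennreal_leI)
    qed
    note T = composition_tonelli(3)[where h="\<lambda>_. 1", OF f borel_measurable_arc_continuous[OF continuous_on_dilate[OF hol r]] maps[OF rz] _ _ C]
    have c: "continuous_on (sphere 0 1) (\<lambda>x. (norm (comp_op \<phi> f (of_real r * x)))\<^sup>2)"
      by (intro continuous_intros continuous_on_dilate[OF ch] r)
    have "(\<integral>x. (norm (comp_op \<phi> f (of_real r * x)))\<^sup>2 \<partial>arc_lebesgue) = (\<integral>x. (norm (comp_op \<phi> f (of_real r * x)))\<^sup>2 \<partial>arc_measure)"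
      by (rule integral_completion[OF borel_measurable_arc_continuous[OF c]])
    also have "\<dots> = (\<integral>x. 1 * (norm (f (\<phi> (of_real r * x))))\<^sup>2 \<partial>arc_measure)"
      by (intro Bochner_Integration.integral_cong refl) (use rz in \<open>simp add: comp_op_def\<close>)
    also have "\<dots> \<le> mass_bound * (hardy_norm f)\<^sup>2" by (rule T) (use mass_bound(1) in auto)
    finally show "(\<integral>x. (norm (comp_op \<phi> f (of_real r * x)))\<^sup>2 \<partial>arc_lebesgue) \<le> mass_bound * (hardy_norm f)\<^sup>2" .
  qed
  thus ?thesis using ch unfolding hardy2_def by (auto simp: comp_op_def)
qed

lemma hardy_radial_comp:
  assumes f: "f \<in> hardy2"
  shows "AE x in arc_measure. ((\<lambda>r. f (\<phi> (of_real r * x))) \<longlongrightarrow> f (p x)) (at_left (1::real))"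
  using p_limit
proof eventually_elim
  case (elim x)
  have "isCont f (p x)"
    using p_disk[of x] holomorphic_on_imp_continuous_on[OF hardy2_holomorphic[OF f]] by (simp add: continuous_on_eq_continuous_at)
  thus ?case by (rule isCont_tendsto_compose) (rule elim)
qed

lemma bounded_op_comp_op: "bounded_op (comp_op \<phi>)"
proof (rule bounded_opI[where C="sqrt mass_bound"])
  fix f assume f: "f \<in> hardy2"
  show "comp_op \<phi> f \<in> hardy2" by (rule comp_op_mem[OF f])
  have b: "AE x in arc_measure. bdry (comp_op \<phi> f) x = f (p x)"
  proof (rule bdry_unique[OF comp_op_mem[OF f]], use hardy_radial_comp[OF f] AE_space in eventually_elim)
    case (elim x)
    have "\<forall>\<^sub>F r in at_left (1::real). r \<in> {0<..<1}" by (rule eventually_at_leftI[of 0]) auto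
    hence "\<forall>\<^sub>F r in at_left (1::real). f (\<phi> (of_real r * x)) = comp_op \<phi> f (of_real r * x)"
      by eventually_elim (use elim(2) in \<open>simp add: comp_op_def norm_mult\<close>)
    with elim(1) show ?case by (rule Lim_transform_eventually)
  qed
  have "hardy_norm (comp_op \<phi> f) = L2norm arc_measure (\<lambda>x. f (p x))"
    unfolding hardy_norm_eq[OF comp_op_mem[OF f]]
    by (rule L2norm_cong_AE[OF bdry_measurable[OF comp_op_mem[OF f]] comp_boundary_norm(1)[OF f] b])
  also have "\<dots> \<le> sqrt (mass_bound * (hardy_norm f)\<^sup>2)"
    unfolding L2norm_def by (rule real_sqrt_le_mono[OF comp_boundary_norm(3)[OF f]])
  also have "\<dots> = sqrt mass_bound * hardy_norm f" using hardy_norm_nonneg[OF f] by (simp add: real_sqrt_mult)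
  finally show "hardy_norm (comp_op \<phi> f) \<le> sqrt mass_bound * hardy_norm f" .
next
  fix f g c d assume "f \<in> hardy2" "g \<in> hardy2"
  show "comp_op \<phi> (\<lambda>z. c * f z + d * g z) = (\<lambda>z. c * comp_op \<phi> f z + d * comp_op \<phi> g z)"
    by (auto simp: comp_op_def)
qed (use mass_bound(1) in simp)

abbreviation "shift_comm \<equiv> commutator (toeplitz (\<lambda>x. x)) (comp_op \<phi>)"

lemma bounded_op_shift_comm: "bounded_op shift_comm"
  by (rule bounded_op_commutator[OF bounded_op_toeplitz[OF symbol_id] bounded_op_comp_op])

lemma shift_comm_eval:
  assumes f: "f \<in> hardy2" and z: "norm z < 1"
  shows "shift_comm f z = (z - \<phi> z) * f (\<phi> z)"
  unfolding commutator_def toeplitz_shift[OF f] toeplitz_shift[OF comp_op_mem[OF f]]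
  using z by (simp add: comp_op_def algebra_simps)

text \<open>The radial limit of \<open>f o \<phi>\<close> is \<open>f (p x)\<close> because \<open>p x\<close> lies in the open disk, where
  \<open>f\<close> is continuous.\<close>

lemma shift_comm_norm:
  assumes f: "f \<in> hardy2"
  shows "integrable arc_measure (\<lambda>x. (norm (x - p x))\<^sup>2 * (norm (f (p x)))\<^sup>2)"
    and "(hardy_norm (shift_comm f))\<^sup>2 = (\<integral>x. (norm (x - p x))\<^sup>2 * (norm (f (p x)))\<^sup>2 \<partial>arc_measure)"
proof -
  note D = bounded_op_mem[OF bounded_op_shift_comm f]
  have b: "AE x in arc_measure. bdry (shift_comm f) x = (x - p x) * f (p x)"
  proof (rule bdry_unique[OF D], use hardy_radial_comp[OF f] p_limit AE_space in eventually_elim)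
    case (elim x)
    have "((\<lambda>r. (of_real r * x - \<phi> (of_real r * x)) * f (\<phi> (of_real r * x))) \<longlongrightarrow> (of_real 1 * x - p x) * f (p x)) (at_left (1::real))"
      by (intro tendsto_intros elim)
    hence "((\<lambda>r. (of_real r * x - \<phi> (of_real r * x)) * f (\<phi> (of_real r * x))) \<longlongrightarrow> (x - p x) * f (p x)) (at_left (1::real))" by simp
    moreover have "\<forall>\<^sub>F r in at_left (1::real). r \<in> {0<..<1}" by (rule eventually_at_leftI[of 0]) auto
    hence "\<forall>\<^sub>F r in at_left (1::real). (of_real r * x - \<phi> (of_real r * x)) * f (\<phi> (of_real r * x)) = shift_comm f (of_real r * x)"
      by eventually_elim (use elim(3) in \<open>simp add: shift_comm_eval[OF f] norm_mult\<close>)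
    ultimately show ?case by (rule Lim_transform_eventually)
  qed
  note [measurable] = comp_boundary_norm(1)[OF f] borel_measurable_id_arc
  have m: "(\<lambda>x. (x - p x) * f (p x)) \<in> borel_measurable arc_measure" by measurable
  have s: "sq_int arc_measure (\<lambda>x. (x - p x) * f (p x))"
    by (rule sq_int_cong_AE[OF bdry(1)[OF D] m b])
  thus "integrable arc_measure (\<lambda>x. (norm (x - p x))\<^sup>2 * (norm (f (p x)))\<^sup>2)"
    by (simp add: sq_int_def norm_mult power_mult_distrib)
  have "hardy_norm (shift_comm f) = L2norm arc_measure (\<lambda>x. (x - p x) * f (p x))"
    unfolding hardy_norm_eq[OF D] by (rule L2norm_cong_AE[OF bdry_measurable[OF D] m b])
  thus "(hardy_norm (shift_comm f))\<^sup>2 = (\<integral>x. (norm (x - p x))\<^sup>2 * (norm (f (p x)))\<^sup>2 \<partial>arc_measure)"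
    by (simp add: L2norm_sq norm_mult power_mult_distrib)
qed

section \<open>Compactness forces the identity on the singular supports\<close>

definition unit_kernel :: "complex \<Rightarrow> nat \<Rightarrow> complex \<Rightarrow> complex" where
  "unit_kernel \<alpha> n = (\<lambda>z. of_real (sqrt (1 - (approach n)\<^sup>2)) * hker (of_real (approach n) * \<alpha>) z)"

lemma unit_kernel:
  assumes \<alpha>: "norm \<alpha> = 1"
  shows "weak_null (unit_kernel \<alpha>)"
    and "(norm (unit_kernel \<alpha> n (p x)))\<^sup>2 = sing_kernel (approach n) \<alpha> x"
proof -
  have a: "norm (of_real (approach n) * \<alpha>) < 1" "norm (of_real (approach n) * \<alpha>) = approach n" for n
    using approach(1,2)[of n] \<alpha> by (simp_all add: norm_mult)
  have s: "0 < 1 - (approach n)\<^sup>2" for n using approach(1,2)[of n] by (simp add: abs_square_less_1)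
  note k = hker(1)[OF a(1)]
  show "weak_null (unit_kernel \<alpha>)"
  proof (rule weak_null_coeffI[where M=1])
    show m: "unit_kernel \<alpha> n \<in> hardy2" for n unfolding unit_kernel_def by (intro hardy2_cmult k)
    show "hardy_norm (unit_kernel \<alpha> n) \<le> 1" for n
    proof (rule power2_le_imp_le)
      have "(hardy_norm (unit_kernel \<alpha> n))\<^sup>2 = (1 - (approach n)\<^sup>2) * (hardy_norm (hker (of_real (approach n) * \<alpha>)))\<^sup>2"
        unfolding unit_kernel_def hardy_norm_cmult[OF k] using s[of n] by (simp add: power_mult_distrib)
      also have "\<dots> = 1" unfolding hker(3)[OF a(1)] a(2) using s[of n] by simp
      finally show "(hardy_norm (unit_kernel \<alpha> n))\<^sup>2 \<le> 1\<^sup>2" by simp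
    qed simp
    fix j
    have c: "hcoeff (unit_kernel \<alpha> n) j = of_real (sqrt (1 - (approach n)\<^sup>2)) * cnj (of_real (approach n) * \<alpha>) ^ j" for n
      using hardy2_lincomb(2)[OF k k, of "of_real (sqrt (1 - (approach n)\<^sup>2))" n 0 n] hker(2)[OF a(1), of n]
      by (simp add: unit_kernel_def)
    have "(\<lambda>n. complex_of_real (sqrt (1 - (approach n)\<^sup>2)) * cnj (of_real (approach n) * \<alpha>) ^ j) \<longlonglongrightarrow> of_real (sqrt (1 - 1\<^sup>2)) * cnj (of_real 1 * \<alpha>) ^ j"
      by (intro tendsto_intros approach)
    thus "(\<lambda>n. hcoeff (unit_kernel \<alpha> n) j) \<longlonglongrightarrow> 0" unfolding c by simp
  qed
  have "norm (1 - cnj (of_real (approach n) * \<alpha>) * p x) = norm (\<alpha> - of_real (approach n) * p x)"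
  proof -
    have "\<alpha> * cnj \<alpha> = 1" using \<alpha> by (simp add: complex_norm_square[symmetric])
    hence "\<alpha> * (1 - cnj (of_real (approach n) * \<alpha>) * p x) = \<alpha> - of_real (approach n) * p x"
      by (simp add: algebra_simps)
    thus ?thesis using \<alpha> by (metis norm_mult mult_1)
  qed
  thus "(norm (unit_kernel \<alpha> n (p x)))\<^sup>2 = sing_kernel (approach n) \<alpha> x"
    unfolding unit_kernel_def hker(5)[OF a(1) p_disk] sing_kernel_def using s[of n]
    by (simp add: norm_mult norm_divide power_mult_distrib power_divide del: complex_cnj_mult)
qed

text \<open>Near a point \<open>t0\<close> with \<open>\<phi>' t0 \<noteq> t0\<close> the factor \<open>norm (t - p t)\<close> is bounded below by some
  \<open>c > 0\<close>. Applied to normalised reproducing kernels, compactness therefore forces their squares,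
  composed with \<open>p\<close>, to have vanishing mass near \<open>t0\<close>; but this mass converges to that of the
  singular part.\<close>

lemma compact_imp_fixed_on_support:
  assumes comp: "compact_op shift_comm" and \<alpha>: "norm \<alpha> = 1"
    and t0: "t0 \<in> measure_support (singular_part arc_measure (clark_measure \<phi> \<alpha>))"
    and \<phi>': "AE t in arc_measure. p t = \<phi>' t" and cont: "continuous (at t0 within sphere 0 1) \<phi>'"
  shows "\<phi>' t0 = t0"
proof (rule ccontr)
  assume ne: "\<phi>' t0 \<noteq> t0"
  define \<sigma> where "\<sigma> = singular_part arc_measure (clark_measure \<phi> \<alpha>)"
  note \<sigma> = clark_singular_part(1,3)[OF \<alpha>, folded \<sigma>_def]
  interpret S: finite_measure \<sigma> using circle_measureD(2)[OF \<sigma>(1)] .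
  have z0: "t0 \<in> sphere 0 1" using t0 circle_measureD(3)[OF \<sigma>(1)] unfolding measure_support_def \<sigma>_def by auto
  define c where "c = norm (\<phi>' t0 - t0) / 2"
  have c: "c > 0" using ne by (simp add: c_def)
  have "continuous (at t0 within sphere 0 1) (\<lambda>t. \<phi>' t - t)" by (intro continuous_intros cont)
  then obtain \<delta> where \<delta>: "\<delta> > 0" "\<And>t. t \<in> sphere 0 1 \<Longrightarrow> dist t t0 < \<delta> \<Longrightarrow> dist (\<phi>' t - t) (\<phi>' t0 - t0) < c"
    using c unfolding continuous_within_eps_delta by blast
  have low: "c \<le> norm (t - \<phi>' t)" if "t \<in> sphere 0 1" "dist t t0 < \<delta>" for t
  proof -
    have "norm (\<phi>' t0 - t0) \<le> norm (\<phi>' t - t) + norm ((\<phi>' t0 - t0) - (\<phi>' t - t))"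
      using norm_triangle_ineq[of "\<phi>' t - t" "(\<phi>' t0 - t0) - (\<phi>' t - t)"] by simp
    thus ?thesis using \<delta>(2)[OF that] unfolding c_def dist_norm
      by (simp add: norm_minus_commute[of "\<phi>' t - t" "\<phi>' t0 - t0"] norm_minus_commute[of "t" "\<phi>' t"])
  qed
  define h where "h t = max 0 (1 - dist t t0 / \<delta>)" for t
  have hc: "continuous_on (sphere 0 1) h" unfolding h_def using \<delta>(1) by (intro continuous_intros) auto
  note [measurable] = borel_measurable_arc_continuous[OF hc]
  have h01: "0 \<le> h t" "h t \<le> 1" for t unfolding h_def using \<delta>(1) by auto
  have pw: "AE t in arc_measure. h t * c\<^sup>2 \<le> (norm (t - p t))\<^sup>2"
    using \<phi>' AE_space
  proof eventually_elim
    case (elim t)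
    show ?case
    proof (cases "dist t t0 < \<delta>")
      case True
      hence "c\<^sup>2 \<le> (norm (t - p t))\<^sup>2" using low[of t] elim c by (intro power_mono) auto
      moreover have "h t * c\<^sup>2 \<le> 1 * c\<^sup>2" using h01 by (intro mult_right_mono) auto
      ultimately show ?thesis by simp
    next
      case False
      hence "1 \<le> dist t t0 / \<delta>" using \<delta>(1) by (simp add: le_divide_eq)
      thus ?thesis by (simp add: h_def)
    qed
  qed
  note uk = unit_kernel[OF \<alpha>]
  have lim0: "(\<lambda>n. (hardy_norm (shift_comm (unit_kernel \<alpha> n)))\<^sup>2) \<longlonglongrightarrow> 0"
    using tendsto_power[of _ 0 _ 2] comp uk(1) compact_op_iff[OF bounded_op_shift_comm] by fastforce
  have "(\<lambda>n. (\<integral>t. h t * sing_kernel (approach n) \<alpha> t \<partial>arc_measure) * c\<^sup>2) \<longlonglongrightarrow> 0"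
  proof (rule tendsto_sandwich[OF _ _ tendsto_const lim0])
    show "\<forall>\<^sub>F n in sequentially. 0 \<le> (\<integral>t. h t * sing_kernel (approach n) \<alpha> t \<partial>arc_measure) * c\<^sup>2"
      by (intro always_eventually allI mult_nonneg_nonneg integral_nonneg_AE AE_I2 h01 sing_kernel_nonneg approach) simp
    show "\<forall>\<^sub>F n in sequentially. (\<integral>t. h t * sing_kernel (approach n) \<alpha> t \<partial>arc_measure) * c\<^sup>2 \<le> (hardy_norm (shift_comm (unit_kernel \<alpha> n)))\<^sup>2"
    proof (intro always_eventually allI)
      fix n
      note f = weak_null_mem[OF uk(1), of n]
      have "(\<integral>t. h t * sing_kernel (approach n) \<alpha> t \<partial>arc_measure) * c\<^sup>2 = (\<integral>t. h t * sing_kernel (approach n) \<alpha> t * c\<^sup>2 \<partial>arc_measure)" by simp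
      also have "\<dots> \<le> (\<integral>t. (norm (t - p t))\<^sup>2 * (norm (unit_kernel \<alpha> n (p t)))\<^sup>2 \<partial>arc_measure)"
      proof (rule integral_mono_AE)
        show "integrable arc_measure (\<lambda>t. h t * sing_kernel (approach n) \<alpha> t * c\<^sup>2)"
          by (intro integrable_mult_left integrable_mult_bounded integrable_sing_kernel \<alpha> approach hc)
        show "integrable arc_measure (\<lambda>t. (norm (t - p t))\<^sup>2 * (norm (unit_kernel \<alpha> n (p t)))\<^sup>2)"
          by (rule shift_comm_norm(1)[OF f])
        show "AE t in arc_measure. h t * sing_kernel (approach n) \<alpha> t * c\<^sup>2 \<le> (norm (t - p t))\<^sup>2 * (norm (unit_kernel \<alpha> n (p t)))\<^sup>2"
          using pw
        proof eventually_elim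
          case (elim t)
          have "(h t * c\<^sup>2) * sing_kernel (approach n) \<alpha> t \<le> (norm (t - p t))\<^sup>2 * sing_kernel (approach n) \<alpha> t"
            by (intro mult_right_mono elim sing_kernel_nonneg approach)
          thus ?case unfolding uk(2) by (simp add: mult_ac)
        qed
      qed
      also have "\<dots> = (hardy_norm (shift_comm (unit_kernel \<alpha> n)))\<^sup>2" by (rule shift_comm_norm(2)[OF f, symmetric])
      finally show "(\<integral>t. h t * sing_kernel (approach n) \<alpha> t \<partial>arc_measure) * c\<^sup>2 \<le> (hardy_norm (shift_comm (unit_kernel \<alpha> n)))\<^sup>2" .
    qed
  qed
  moreover have "(\<lambda>n. (\<integral>t. h t * sing_kernel (approach n) \<alpha> t \<partial>arc_measure) * c\<^sup>2) \<longlonglongrightarrow> (\<integral>t. h t \<partial>\<sigma>) * c\<^sup>2"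
    by (intro tendsto_intros \<sigma>(2)[OF hc])
  ultimately have "(\<integral>t. h t \<partial>\<sigma>) * c\<^sup>2 = 0" by (rule LIMSEQ_unique[symmetric])
  hence h0: "(\<integral>t. h t \<partial>\<sigma>) = 0" using c by simp
  have hi: "integrable \<sigma> h" by (rule circle_measure_integrable_continuous[OF \<sigma>(1) hc])
  have "AE t in \<sigma>. h t = 0"
    using integral_nonneg_eq_0_iff_AE[OF hi] h0 h01 by simp
  hence "AE t in \<sigma>. \<not> (t \<in> ball t0 \<delta>)"
  proof eventually_elim
    case (elim t)
    have "1 - dist t t0 / \<delta> \<le> h t" by (simp add: h_def)
    hence "1 \<le> dist t t0 / \<delta>" using elim by simp
    thus ?case using \<delta>(1) by (simp add: le_divide_eq dist_commute)
  qed
  moreover have "{x \<in> space \<sigma>. \<not> x \<notin> ball t0 \<delta>} \<in> sets \<sigma>"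
  proof -
    have "{x \<in> space \<sigma>. \<not> x \<notin> ball t0 \<delta>} = ball t0 \<delta> \<inter> space \<sigma>" by auto
    thus ?thesis by (simp add: circle_measureD(1,3)[OF \<sigma>(1)] sets_restrict_space_iff)
  qed
  ultimately have "emeasure \<sigma> {x \<in> space \<sigma>. \<not> x \<notin> ball t0 \<delta>} = 0"
    using AE_iff_measurable[OF _ refl, of \<sigma> "\<lambda>x. x \<notin> ball t0 \<delta>"] by blast
  moreover have "{x \<in> space \<sigma>. \<not> x \<notin> ball t0 \<delta>} = ball t0 \<delta> \<inter> space \<sigma>" by auto
  ultimately have "emeasure \<sigma> (ball t0 \<delta> \<inter> space \<sigma>) = 0" by simp
  moreover have "emeasure \<sigma> (ball t0 \<delta> \<inter> space \<sigma>) > 0"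
    using t0 \<delta>(1) unfolding measure_support_def \<sigma>_def[symmetric] by auto
  ultimately show False by simp
qed

end

section \<open>Essential commutation with Toeplitz operators\<close>

lemma hardy_norm_lincomb_tendsto_0:
  assumes "\<And>n. X n \<in> hardy2" "\<And>n. Y n \<in> hardy2"
    and "(\<lambda>n. hardy_norm (X n)) \<longlonglongrightarrow> 0" "(\<lambda>n. hardy_norm (Y n)) \<longlonglongrightarrow> 0"
  shows "(\<lambda>n. hardy_norm (\<lambda>z. c * X n z + d * Y n z)) \<longlonglongrightarrow> 0"
proof (rule tendsto_sandwich[OF _ _ tendsto_const])
  have "(\<lambda>n. norm c * hardy_norm (X n) + norm d * hardy_norm (Y n)) \<longlonglongrightarrow> norm c * 0 + norm d * 0"
    by (intro tendsto_intros assms)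
  thus "(\<lambda>n. norm c * hardy_norm (X n) + norm d * hardy_norm (Y n)) \<longlonglongrightarrow> 0" by simp
  show "\<forall>\<^sub>F n in sequentially. 0 \<le> hardy_norm (\<lambda>z. c * X n z + d * Y n z)"
    by (intro always_eventually allI hardy_norm_nonneg hardy2_lincomb assms)
  show "\<forall>\<^sub>F n in sequentially. hardy_norm (\<lambda>z. c * X n z + d * Y n z) \<le> norm c * hardy_norm (X n) + norm d * hardy_norm (Y n)"
  proof (intro always_eventually allI)
    fix n
    show "hardy_norm (\<lambda>z. c * X n z + d * Y n z) \<le> norm c * hardy_norm (X n) + norm d * hardy_norm (Y n)"
      using hardy_norm_triangle[OF hardy2_cmult[OF assms(1)[of n], of c] hardy2_cmult[OF assms(2)[of n], of d]]
      by (simp only: hardy_norm_cmult[OF assms(1)[of n]] hardy_norm_cmult[OF assms(2)[of n]])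
  qed
qed

lemma bounded_op_tendsto_0:
  assumes A: "bounded_op A" and X: "\<And>n. X n \<in> hardy2" "(\<lambda>n. hardy_norm (X n)) \<longlonglongrightarrow> 0"
  shows "(\<lambda>n. hardy_norm (A (X n))) \<longlonglongrightarrow> 0"
proof -
  obtain C where C: "\<And>f. f \<in> hardy2 \<Longrightarrow> hardy_norm (A f) \<le> C * hardy_norm f" using A unfolding bounded_op_def by blast
  show ?thesis
  proof (rule tendsto_sandwich[OF _ _ tendsto_const])
    show "(\<lambda>n. C * hardy_norm (X n)) \<longlonglongrightarrow> 0" using tendsto_mult_left[OF X(2), of C] by simp
    show "\<forall>\<^sub>F n in sequentially. 0 \<le> hardy_norm (A (X n))"
      by (intro always_eventually allI hardy_norm_nonneg) (rule bounded_op_mem[OF A X(1)])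
    show "\<forall>\<^sub>F n in sequentially. hardy_norm (A (X n)) \<le> C * hardy_norm (X n)"
      by (intro always_eventually allI C X(1))
  qed
qed

text \<open>The derivation rule \<open>[A B, C] = A [B, C] + [A, C] B\<close>.\<close>

lemma compact_commutator_comp:
  assumes A: "bounded_op A" and B: "bounded_op B" and C: "bounded_op C"
    and AC: "compact_op (commutator A C)" and BC: "compact_op (commutator B C)"
  shows "compact_op (commutator (\<lambda>f. A (B f)) C)"
  unfolding compact_op_iff[OF bounded_op_commutator[OF bounded_op_comp[OF A B] C]]
proof (intro allI impI)
  fix F assume F: "weak_null F"
  note f = weak_null_mem[OF F]
  note cA = bounded_op_commutator[OF A C] and cB = bounded_op_commutator[OF B C]
  have 1: "(\<lambda>n. hardy_norm (A (commutator B C (F n)))) \<longlonglongrightarrow> 0"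
    by (rule bounded_op_tendsto_0[OF A bounded_op_mem[OF cB f] BC[unfolded compact_op_iff[OF cB], rule_format, OF F]])
  have 2: "(\<lambda>n. hardy_norm (commutator A C (B (F n)))) \<longlonglongrightarrow> 0"
    by (rule AC[unfolded compact_op_iff[OF cA], rule_format, OF weak_null_bounded_op[OF B F]])
  have eq: "commutator (\<lambda>f. A (B f)) C (F n) = (\<lambda>z. 1 * A (commutator B C (F n)) z + 1 * commutator A C (B (F n)) z)" for n
    unfolding commutator_def bounded_op_diff[OF A bounded_op_mem[OF B bounded_op_mem[OF C f]] bounded_op_mem[OF C bounded_op_mem[OF B f]]]
    by simp
  show "(\<lambda>n. hardy_norm (commutator (\<lambda>f. A (B f)) C (F n))) \<longlonglongrightarrow> 0"
    unfolding eq by (rule hardy_norm_lincomb_tendsto_0[OF bounded_op_mem[OF A bounded_op_mem[OF cB f]] bounded_op_mem[OF cA bounded_op_mem[OF B f]] 1 2])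
qed

text \<open>The adjoint and the Toeplitz operator with conjugate symbol are equal on the Hardy space
  only, as operators are arbitrary functions elsewhere.\<close>

lemma compact_op_cong:
  assumes "\<And>f. f \<in> hardy2 \<Longrightarrow> A f = B f"
  shows "compact_op A \<longleftrightarrow> compact_op B"
proof -
  have *: "compact_op B" if "compact_op A" and e: "\<And>f. f \<in> hardy2 \<Longrightarrow> A f = B f" for A B :: hardy_op
    unfolding compact_op_def
  proof (intro conjI allI impI)
    have l: "hardy_linear A" using that(1) by (simp add: compact_op_def)
    show "hardy_linear B"
      unfolding hardy_linear_def
    proof (intro conjI ballI allI)
      fix f assume f: "f \<in> hardy2"
      show "B f \<in> hardy2" unfolding e[OF f, symmetric] using l f unfolding hardy_linear_def by blast
      { fix g assume g: "g \<in> hardy2"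
        show "B (\<lambda>z. f z + g z) = (\<lambda>z. B f z + B g z)"
          unfolding e[OF f, symmetric] e[OF g, symmetric] e[OF hardy2_add[OF f g], symmetric] using l f g unfolding hardy_linear_def by blast }
      fix c
      show "B (\<lambda>z. c * f z) = (\<lambda>z. c * B f z)"
        unfolding e[OF f, symmetric] e[OF hardy2_cmult[OF f], symmetric] using l f unfolding hardy_linear_def by blast
    qed
    fix F :: "nat \<Rightarrow> complex \<Rightarrow> complex"
    assume F: "(\<forall>n. F n \<in> hardy2) \<and> bounded (range (\<lambda>n. hardy_norm (F n)))"
    hence AB: "A (F n) = B (F n)" for n by (intro e) simp
    have "\<exists>g\<in>hardy2. \<exists>r. strict_mono r \<and> (\<lambda>n. hardy_norm (\<lambda>z. A (F (r n)) z - g z)) \<longlonglongrightarrow> 0"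
      using that(1) F unfolding compact_op_def by blast
    thus "\<exists>g\<in>hardy2. \<exists>r. strict_mono r \<and> (\<lambda>n. hardy_norm (\<lambda>z. B (F (r n)) z - g z)) \<longlonglongrightarrow> 0"
      unfolding AB .
  qed
  show ?thesis using *[of A B] *[of B A] assms by auto
qed

text \<open>Here \<open>u\<close> is \<open>-1\<close> on the disk. As it does not depend on \<open>f\<close>, the error \<open>f 0 * u\<close> tends to 0
  in norm along weakly null sequences.\<close>

lemma shift_backward_shift:
  obtains u where "u \<in> hardy2" "\<And>f. f \<in> hardy2 \<Longrightarrow> toeplitz (\<lambda>x. x) (toeplitz cnj f) = (\<lambda>z. f z + f 0 * u z)"
    and "\<And>f. f \<in> hardy2 \<Longrightarrow> toeplitz cnj (toeplitz (\<lambda>x. x) f) = f"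
proof -
  let ?S = "toeplitz (\<lambda>x. x)" and ?B = "toeplitz cnj"
  note S = bounded_op_toeplitz[OF symbol_id] and B = bounded_op_toeplitz[OF symbol_cnj]
  have BS: "?B (?S f) = f" if f: "f \<in> hardy2" for f
    unfolding toeplitz_shift[OF f]
  proof (rule toeplitz_eqI[OF symbol_cnj hardy2_shift(1)[OF f] f], use hardy2_shift(2)[OF f] AE_space in eventually_elim)
    case (elim x)
    have "cnj x * x = 1" using elim(2) by (simp add: mult.commute complex_norm_square[symmetric])
    thus ?case unfolding elim(1) by (simp flip: mult.assoc)
  qed
  define e where "e = hmono 0"
  have e: "e \<in> hardy2" "hcoeff e = (\<lambda>n. if n = 0 then 1 else 0)" using hmono[of 0] by (simp_all add: e_def)
  define u where "u = (\<lambda>z. 1 * ?S (?B e) z + (- 1) * e z)"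
  have u: "u \<in> hardy2" unfolding u_def
    by (rule hardy2_lincomb(1)[OF bounded_op_mem[OF S bounded_op_mem[OF B e(1)]] e(1)])
  have SB: "?S (?B f) = (\<lambda>z. f z + f 0 * u z)" if f: "f \<in> hardy2" for f
  proof -
    define g where "g = hfun (\<lambda>n. hcoeff f (Suc n))"
    have "summable (\<lambda>n. (norm (hcoeff f (Suc n)))\<^sup>2)"
      using hardy2_iff[of f] f summable_Suc_iff[of "\<lambda>n. (norm (hcoeff f n))\<^sup>2"] by blast
    from hfun[OF this] have g: "g \<in> hardy2" "hcoeff g = (\<lambda>n. hcoeff f (Suc n))" unfolding g_def by auto
    have e1: "e z = 1" if "norm z < 1" for z
    proof -
      have "(\<lambda>n. hcoeff e n * z ^ n) sums e z" by (rule hardy2_sums[OF e(1) that])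
      moreover have "(\<lambda>n. hcoeff e n * z ^ n) sums (hcoeff e 0 * z ^ 0)"
        by (rule sums_single[where i=0, THEN sums_cong[THEN iffD1, rotated]]) (simp add: e(2))
      ultimately show ?thesis using sums_unique2 e(2) by fastforce
    qed
    have f0: "hcoeff f 0 = f 0" by (simp add: hcoeff_def)
    have fz: "f = (\<lambda>z. 1 * (z * g z) + f 0 * e z)"
    proof
      fix z show "f z = 1 * (z * g z) + f 0 * e z"
      proof (cases "norm z < 1")
        case True
        have "(\<lambda>n. hcoeff g n * z ^ n) sums g z" by (rule hardy2_sums[OF g(1) True])
        hence "(\<lambda>n. z * (hcoeff f (Suc n) * z ^ n)) sums (z * g z)" unfolding g(2) by (rule sums_mult)
        hence "(\<lambda>n. hcoeff f (Suc n) * z ^ Suc n) sums (z * g z)" by (simp add: mult_ac)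
        hence "(\<lambda>n. hcoeff f n * z ^ n) sums (z * g z + hcoeff f 0 * z ^ 0)" by (rule sums_Suc[where f="\<lambda>n. hcoeff f n * z ^ n"])
        with hardy2_sums[OF f True] have "f z = z * g z + hcoeff f 0 * z ^ 0" by (rule sums_unique2)
        thus ?thesis using e1[OF True] f0 by simp
      next
        case False
        thus ?thesis using hardy2_iff[of f] hardy2_iff[of g] hardy2_iff[of e] f g e by simp
      qed
    qed
    note m = hardy2_shift(1)[OF g(1)]
    have "?B f = (\<lambda>z. 1 * ?B (\<lambda>z. z * g z) z + f 0 * ?B e z)"
      by (subst fz) (rule bounded_op_lincomb[OF B m e(1)])
    also have "?B (\<lambda>z. z * g z) = g" using BS[OF g(1)] unfolding toeplitz_shift[OF g(1)] .
    finally have "?S (?B f) = ?S (\<lambda>z. 1 * g z + f 0 * ?B e z)" by simp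
    also have "\<dots> = (\<lambda>z. 1 * ?S g z + f 0 * ?S (?B e) z)"
      by (rule bounded_op_lincomb[OF S g(1) bounded_op_mem[OF B e(1)]])
    also have "\<dots> = (\<lambda>z. f z + f 0 * u z)"
    proof
      fix z
      have "f z = z * g z + f 0 * e z" using fun_cong[OF fz, of z] by simp
      thus "1 * ?S g z + f 0 * ?S (?B e) z = f z + f 0 * u z"
        unfolding toeplitz_shift[OF g(1)] u_def by (simp add: algebra_simps)
    qed
    finally show ?thesis .
  qed
  show ?thesis by (rule that[OF u SB BS])
qed

lemma weak_null_value_tendsto_0:
  assumes F: "weak_null F" and u: "u \<in> hardy2"
  shows "(\<lambda>n. hardy_norm (\<lambda>z. F n 0 * u z)) \<longlonglongrightarrow> 0"
  unfolding hardy_norm_cmult[OF u]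
  using tendsto_mult_right[OF tendsto_norm[OF weak_null_pointwise[OF F, of 0]], of "hardy_norm u"] by simp

text \<open>With \<open>B S = 1\<close> and \<open>S B f = f + f 0 * u\<close> one has \<open>[B, C] f = - B [S, C] B f - f 0 * B C
  u\<close> and \<open>[S, C] f = - S [B, C] S f + (C S f) 0 * u\<close>; the last terms vanish along weakly null
  sequences.\<close>

theorem compact_commutator_shift_iff:
  assumes C: "bounded_op C"
  shows "compact_op (commutator (toeplitz (\<lambda>x. x)) C) \<longleftrightarrow> compact_op (commutator (toeplitz cnj) C)"
proof -
  let ?S = "toeplitz (\<lambda>x. x)" and ?B = "toeplitz cnj"
  note S = bounded_op_toeplitz[OF symbol_id] and B = bounded_op_toeplitz[OF symbol_cnj]
  note cS = bounded_op_commutator[OF S C] and cB = bounded_op_commutator[OF B C]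
  obtain u where u: "u \<in> hardy2" and SB: "\<And>f. f \<in> hardy2 \<Longrightarrow> ?S (?B f) = (\<lambda>z. f z + f 0 * u z)"
    and BS: "\<And>f. f \<in> hardy2 \<Longrightarrow> ?B (?S f) = f" by (rule shift_backward_shift) blast
  note BC = bounded_op_comp[OF B C]
  have 1: "(\<lambda>n. hardy_norm (commutator ?B C (F n))) \<longlonglongrightarrow> 0"
    if c: "compact_op (commutator ?S C)" and F: "weak_null F" for F
  proof -
    note f = weak_null_mem[OF F]
    note Bf = bounded_op_mem[OF B f] and Cf = bounded_op_mem[OF C f]
    note CBf = bounded_op_mem[OF C Bf]
    have "(\<lambda>n. hardy_norm (commutator ?S C (?B (F n)))) \<longlonglongrightarrow> 0"
      using c[unfolded compact_op_iff[OF cS]] weak_null_bounded_op[OF B F] by blast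
    note X = bounded_op_tendsto_0[OF B bounded_op_mem[OF cS Bf] this]
    note Y = weak_null_value_tendsto_0[OF F bounded_op_mem[OF BC u]]
    have eq: "commutator ?B C (F n) = (\<lambda>z. (- 1) * ?B (commutator ?S C (?B (F n))) z + (- 1) * (F n 0 * ?B (C u) z))" for n
    proof -
      have "?B (C (?S (?B (F n)))) = ?B (C (\<lambda>z. 1 * F n z + F n 0 * u z))" unfolding SB[OF f] by simp
      also have "\<dots> = (\<lambda>z. 1 * ?B (C (F n)) z + F n 0 * ?B (C u) z)" by (rule bounded_op_lincomb[OF BC f u])
      finally have a: "?B (C (?S (?B (F n)))) = (\<lambda>z. 1 * ?B (C (F n)) z + F n 0 * ?B (C u) z)" .
      have "?B (commutator ?S C (?B (F n))) = (\<lambda>z. ?B (?S (C (?B (F n)))) z - ?B (C (?S (?B (F n)))) z)"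
        unfolding commutator_def
        by (rule bounded_op_diff[OF B bounded_op_mem[OF S CBf] bounded_op_mem[OF C bounded_op_mem[OF S Bf]]])
      thus ?thesis unfolding a BS[OF CBf] by (simp add: commutator_def fun_eq_iff)
    qed
    show ?thesis unfolding eq
      by (rule hardy_norm_lincomb_tendsto_0[OF bounded_op_mem[OF B bounded_op_mem[OF cS Bf]] hardy2_cmult[OF bounded_op_mem[OF BC u]] X Y])
  qed
  have 2: "(\<lambda>n. hardy_norm (commutator ?S C (F n))) \<longlonglongrightarrow> 0"
    if c: "compact_op (commutator ?B C)" and F: "weak_null F" for F
  proof -
    note f = weak_null_mem[OF F]
    note Sf = bounded_op_mem[OF S f] and Cf = bounded_op_mem[OF C f]
    note CSf = bounded_op_mem[OF C Sf]
    have "(\<lambda>n. hardy_norm (commutator ?B C (?S (F n)))) \<longlonglongrightarrow> 0"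
      using c[unfolded compact_op_iff[OF cB]] weak_null_bounded_op[OF S F] by blast
    note X = bounded_op_tendsto_0[OF S bounded_op_mem[OF cB Sf] this]
    note Y = weak_null_value_tendsto_0[OF weak_null_bounded_op[OF C weak_null_bounded_op[OF S F]] u]
    have eq: "commutator ?S C (F n) = (\<lambda>z. (- 1) * ?S (commutator ?B C (?S (F n))) z + 1 * (C (?S (F n)) 0 * u z))" for n
    proof -
      have "?S (commutator ?B C (?S (F n))) = (\<lambda>z. ?S (?B (C (?S (F n)))) z - ?S (C (?B (?S (F n)))) z)"
        unfolding commutator_def
        by (rule bounded_op_diff[OF S bounded_op_mem[OF B CSf] bounded_op_mem[OF C bounded_op_mem[OF B Sf]]])
      thus ?thesis unfolding SB[OF CSf] BS[OF f] by (simp add: commutator_def fun_eq_iff)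
    qed
    show ?thesis unfolding eq
      by (rule hardy_norm_lincomb_tendsto_0[OF bounded_op_mem[OF S bounded_op_mem[OF cB Sf]] hardy2_cmult[OF u] X Y])
  qed
  show ?thesis using 1 2 unfolding compact_op_iff[OF cS] compact_op_iff[OF cB] by blast
qed

lemma toeplitz_symbol_lincomb:
  assumes v: "symbol v Bv" and w: "symbol w Bw" and vw: "symbol (\<lambda>x. a * v x + b * w x) Bvw" and f: "f \<in> hardy2"
  shows "toeplitz (\<lambda>x. a * v x + b * w x) f = (\<lambda>z. a * toeplitz v f z + b * toeplitz w f z)"
proof (rule hardy_inner_unique_left)
  note tv = toeplitz(1)[OF v f] and tw = toeplitz(1)[OF w f]
  show "toeplitz (\<lambda>x. a * v x + b * w x) f \<in> hardy2" by (rule toeplitz(1)[OF vw f])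
  show "(\<lambda>z. a * toeplitz v f z + b * toeplitz w f z) \<in> hardy2" by (rule hardy2_lincomb(1)[OF tv tw])
  fix k assume k: "k \<in> hardy2"
  have i: "integrable arc_measure (\<lambda>x. s x * bdry f x * cnj (bdry k x))" if "symbol s B" for s B
    by (rule sq_int_mult_integrable[OF symbol_mult_sq_int(1)[OF that bdry(1)[OF f]] sq_int_cnj[OF bdry(1)[OF k]]])
  have "(\<integral>x. (a * v x + b * w x) * bdry f x * cnj (bdry k x) \<partial>arc_measure)
      = (\<integral>x. a * (v x * bdry f x * cnj (bdry k x)) + b * (w x * bdry f x * cnj (bdry k x)) \<partial>arc_measure)"
    by (simp add: algebra_simps)
  also have "\<dots> = a * (\<integral>x. v x * bdry f x * cnj (bdry k x) \<partial>arc_measure) + b * (\<integral>x. w x * bdry f x * cnj (bdry k x) \<partial>arc_measure)"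
    using i[OF v] i[OF w] by simp
  finally show "hardy_inner (toeplitz (\<lambda>x. a * v x + b * w x) f) k = hardy_inner (\<lambda>z. a * toeplitz v f z + b * toeplitz w f z) k"
    unfolding toeplitz(2)[OF vw f k] hardy_inner_lincomb_left[OF tv tw k] toeplitz(2)[OF v f k] toeplitz(2)[OF w f k] .
qed

lemma toeplitz_mult_shift:
  assumes w: "symbol w B" and wz: "symbol (\<lambda>x. x * w x) B'" and f: "f \<in> hardy2"
  shows "toeplitz (\<lambda>x. x * w x) f = toeplitz w (toeplitz (\<lambda>x. x) f)"
  unfolding toeplitz_shift[OF f]
proof (rule hardy_inner_unique_left)
  note s = hardy2_shift[OF f]
  show "toeplitz (\<lambda>x. x * w x) f \<in> hardy2" by (rule toeplitz(1)[OF wz f])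
  show "toeplitz w (\<lambda>z. z * f z) \<in> hardy2" by (rule toeplitz(1)[OF w s(1)])
  fix k assume k: "k \<in> hardy2"
  have m: "w \<in> borel_measurable arc_measure" using w by (simp add: symbol_def)
  note [measurable] = m bdry_measurable[OF f] bdry_measurable[OF k] bdry_measurable[OF s(1)] borel_measurable_id_arc
  show "hardy_inner (toeplitz (\<lambda>x. x * w x) f) k = hardy_inner (toeplitz w (\<lambda>z. z * f z)) k"
    unfolding toeplitz(2)[OF wz f k] toeplitz(2)[OF w s(1) k]
  proof (rule integral_cong_AE)
    show "AE x in arc_measure. x * w x * bdry f x * cnj (bdry k x) = w x * bdry (\<lambda>z. z * f z) x * cnj (bdry k x)"
      using s(2) by eventually_elim (simp add: mult_ac)
  qed measurable
qed

lemma toeplitz_mult_backward_shift: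
  assumes w: "symbol w B" and wz: "symbol (\<lambda>x. cnj x * w x) B'" and f: "f \<in> hardy2"
  shows "toeplitz (\<lambda>x. cnj x * w x) f = toeplitz cnj (toeplitz w f)"
proof (rule hardy_inner_unique_left)
  note tw = toeplitz(1)[OF w f]
  show "toeplitz (\<lambda>x. cnj x * w x) f \<in> hardy2" by (rule toeplitz(1)[OF wz f])
  show "toeplitz cnj (toeplitz w f) \<in> hardy2" by (rule toeplitz(1)[OF symbol_cnj tw])
  fix k assume k: "k \<in> hardy2"
  note s = hardy2_shift[OF k]
  have m: "w \<in> borel_measurable arc_measure" using w by (simp add: symbol_def)
  note [measurable] = m bdry_measurable[OF f] bdry_measurable[OF k] bdry_measurable[OF s(1)] borel_measurable_id_arc
  have "hardy_inner (toeplitz cnj (toeplitz w f)) k = hardy_inner (toeplitz w f) (\<lambda>z. z * k z)"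
    using toeplitz_adjoint[OF symbol_cnj tw k] by (simp add: toeplitz_shift[OF k])
  also have "\<dots> = (\<integral>x. w x * bdry f x * cnj (bdry (\<lambda>z. z * k z) x) \<partial>arc_measure)"
    by (rule toeplitz(2)[OF w f s(1)])
  also have "\<dots> = (\<integral>x. cnj x * w x * bdry f x * cnj (bdry k x) \<partial>arc_measure)"
  proof (rule integral_cong_AE)
    show "AE x in arc_measure. w x * bdry f x * cnj (bdry (\<lambda>z. z * k z) x) = cnj x * w x * bdry f x * cnj (bdry k x)"
      using s(2) by eventually_elim (simp add: mult_ac)
  qed measurable
  finally show "hardy_inner (toeplitz (\<lambda>x. cnj x * w x) f) k = hardy_inner (toeplitz cnj (toeplitz w f)) k"
    unfolding toeplitz(2)[OF wz f k] by simp
qed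

definition ess_commuting_symbols :: "hardy_op \<Rightarrow> (complex \<Rightarrow> complex) set" where
  "ess_commuting_symbols C = {w. continuous_on (sphere 0 1) w \<and> compact_op (commutator (toeplitz w) C)}"

context
  fixes C :: hardy_op
  assumes C: "bounded_op C"
begin

lemma ess_commuting_1: "(\<lambda>x. 1) \<in> ess_commuting_symbols C"
proof -
  have s: "symbol (\<lambda>x. 1) 1" by (simp add: symbol_def)
  have t: "toeplitz (\<lambda>x. 1) f = f" if "f \<in> hardy2" for f
    by (rule toeplitz_eqI[OF s that that]) simp
  have "compact_op (commutator (toeplitz (\<lambda>x. 1)) C)"
    unfolding compact_op_iff[OF bounded_op_commutator[OF bounded_op_toeplitz[OF s] C]]
  proof (intro allI impI)
    fix F assume F: "weak_null F"
    note f = weak_null_mem[OF F]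
    show "(\<lambda>n. hardy_norm (commutator (toeplitz (\<lambda>x. 1)) C (F n))) \<longlonglongrightarrow> 0"
      unfolding commutator_def t[OF f] t[OF bounded_op_mem[OF C f]] by (simp add: hardy_norm_zero)
  qed
  thus ?thesis by (simp add: ess_commuting_symbols_def)
qed

lemma ess_commuting_lincomb:
  assumes "v \<in> ess_commuting_symbols C" "w \<in> ess_commuting_symbols C"
  shows "(\<lambda>x. a * v x + b * w x) \<in> ess_commuting_symbols C"
proof -
  have cv: "continuous_on (sphere 0 1) v" "compact_op (commutator (toeplitz v) C)"
    and cw: "continuous_on (sphere 0 1) w" "compact_op (commutator (toeplitz w) C)"
    using assms by (auto simp: ess_commuting_symbols_def)
  have c: "continuous_on (sphere 0 1) (\<lambda>x. a * v x + b * w x)" by (intro continuous_intros cv cw)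
  obtain V where V: "symbol v V" by (rule symbol_continuous[OF cv(1)])
  obtain W where W: "symbol w W" by (rule symbol_continuous[OF cw(1)])
  obtain B where B: "symbol (\<lambda>x. a * v x + b * w x) B" by (rule symbol_continuous[OF c])
  note bv = bounded_op_commutator[OF bounded_op_toeplitz[OF V] C]
  note bw = bounded_op_commutator[OF bounded_op_toeplitz[OF W] C]
  have "compact_op (commutator (toeplitz (\<lambda>x. a * v x + b * w x)) C)"
    unfolding compact_op_iff[OF bounded_op_commutator[OF bounded_op_toeplitz[OF B] C]]
  proof (intro allI impI)
    fix F assume F: "weak_null F"
    note f = weak_null_mem[OF F]
    note Cf = bounded_op_mem[OF C f]
    have eq: "commutator (toeplitz (\<lambda>x. a * v x + b * w x)) C (F n)
        = (\<lambda>z. a * commutator (toeplitz v) C (F n) z + b * commutator (toeplitz w) C (F n) z)" for n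
      unfolding commutator_def toeplitz_symbol_lincomb[OF V W B f] toeplitz_symbol_lincomb[OF V W B Cf]
        bounded_op_lincomb[OF C toeplitz(1)[OF V f] toeplitz(1)[OF W f]]
      by (simp add: algebra_simps)
    show "(\<lambda>n. hardy_norm (commutator (toeplitz (\<lambda>x. a * v x + b * w x)) C (F n))) \<longlonglongrightarrow> 0"
      unfolding eq
      by (rule hardy_norm_lincomb_tendsto_0[OF bounded_op_mem[OF bv f] bounded_op_mem[OF bw f]
          cv(2)[unfolded compact_op_iff[OF bv], rule_format, OF F] cw(2)[unfolded compact_op_iff[OF bw], rule_format, OF F]])
  qed
  thus ?thesis using c by (simp add: ess_commuting_symbols_def)
qed

text \<open>The norm of a Toeplitz operator is at most the supremum of its symbol.\<close>

lemma ess_commuting_uniform_limit: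
  assumes w: "continuous_on (sphere 0 1) w"
    and approx: "\<And>e. 0 < e \<Longrightarrow> \<exists>v\<in>ess_commuting_symbols C. \<forall>x\<in>sphere 0 1. norm (w x - v x) \<le> e"
  shows "w \<in> ess_commuting_symbols C"
proof -
  obtain W where W: "symbol w W" by (rule symbol_continuous[OF w])
  note bw = bounded_op_commutator[OF bounded_op_toeplitz[OF W] C]
  obtain K where K: "0 \<le> K" "\<And>f. f \<in> hardy2 \<Longrightarrow> hardy_norm (C f) \<le> K * hardy_norm f"
    using C unfolding bounded_op_def by blast
  have "compact_op (commutator (toeplitz w) C)"
    unfolding compact_op_iff[OF bw]
  proof (intro allI impI)
    fix F assume F: "weak_null F"
    note f = weak_null_mem[OF F]
    note Cf = bounded_op_mem[OF C f]
    obtain M where M: "M \<ge> 0" "\<And>n. hardy_norm (F n) \<le> M" using weak_null_bounded[OF F] by blast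
    show "(\<lambda>n. hardy_norm (commutator (toeplitz w) C (F n))) \<longlonglongrightarrow> 0"
    proof (rule LIMSEQ_I)
      fix \<eta> :: real assume \<eta>: "0 < \<eta>"
      \<comment> \<open>The two error terms of size \<open>e * (K * M)\<close> together leave a quarter of the given bound for the commutator of \<open>v\<close>.\<close>
      define e where "e = \<eta> / (4 * (K * M + 1))"
      have KM: "0 \<le> K * M" using K(1) M(1) by simp
      have e: "0 < e" "2 * e * (K * M) < \<eta> / 2 + \<eta> / 4"
      proof -
        show e0: "0 < e" unfolding e_def using \<eta> KM by (simp add: zero_less_divide_iff)
        have "e * (4 * (K * M + 1)) = \<eta>" unfolding e_def using KM by simp
        thus "2 * e * (K * M) < \<eta> / 2 + \<eta> / 4" using e0 \<eta> by (simp add: algebra_simps)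
      qed
      obtain v where v: "v \<in> ess_commuting_symbols C" "\<forall>x\<in>sphere 0 1. norm (w x - v x) \<le> e" using approx[OF e(1)] by blast
      have cv: "continuous_on (sphere 0 1) v" "compact_op (commutator (toeplitz v) C)" using v(1) by (auto simp: ess_commuting_symbols_def)
      obtain V where V: "symbol v V" by (rule symbol_continuous[OF cv(1)])
      note bv = bounded_op_commutator[OF bounded_op_toeplitz[OF V] C]
      have d: "symbol (\<lambda>x. 1 * w x + (- 1) * v x) e"
        using v(2) borel_measurable_arc_continuous[OF continuous_on_diff[OF w cv(1)]] by (simp add: symbol_def)
      have le: "hardy_norm (commutator (toeplitz w) C (F n)) \<le> hardy_norm (commutator (toeplitz v) C (F n)) + 2 * e * (K * M)" for n
      proof -
        let ?d = "\<lambda>x. 1 * w x + (- 1) * v x"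
        note Tdf = toeplitz(1)[OF d f[of n]] and TdCf = toeplitz(1)[OF d Cf[of n]]
        have eq: "commutator (toeplitz w) C (F n) = (\<lambda>z. commutator (toeplitz v) C (F n) z + (toeplitz ?d (C (F n)) z - C (toeplitz ?d (F n)) z))"
          unfolding commutator_def toeplitz_symbol_lincomb[OF W V d f] toeplitz_symbol_lincomb[OF W V d Cf]
            bounded_op_lincomb[OF C toeplitz(1)[OF W f] toeplitz(1)[OF V f]] by simp
        note CTdf = bounded_op_mem[OF C Tdf]
        have "hardy_norm (commutator (toeplitz w) C (F n)) \<le> hardy_norm (commutator (toeplitz v) C (F n)) + hardy_norm (\<lambda>z. toeplitz ?d (C (F n)) z - C (toeplitz ?d (F n)) z)"
          unfolding eq by (rule hardy_norm_triangle[OF bounded_op_mem[OF bv f] hardy2_diff[OF TdCf CTdf]])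
        moreover have "hardy_norm (\<lambda>z. toeplitz ?d (C (F n)) z - C (toeplitz ?d (F n)) z) \<le> hardy_norm (toeplitz ?d (C (F n))) + hardy_norm (C (toeplitz ?d (F n)))"
          by (rule hardy_norm_triangle_diff[OF TdCf CTdf])
        moreover have "hardy_norm (toeplitz ?d (C (F n))) \<le> e * (K * M)"
        proof -
          have "hardy_norm (toeplitz ?d (C (F n))) \<le> e * hardy_norm (C (F n))" by (rule toeplitz_norm[OF d Cf])
          also have "\<dots> \<le> e * (K * hardy_norm (F n))" by (rule mult_left_mono[OF K(2)[OF f]]) (use e(1) in simp)
          also have "\<dots> \<le> e * (K * M)" using e(1) K(1) M(2)[of n] by (intro mult_left_mono) auto
          finally show ?thesis .
        qed
        moreover have "hardy_norm (C (toeplitz ?d (F n))) \<le> e * (K * M)"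
        proof -
          have "hardy_norm (C (toeplitz ?d (F n))) \<le> K * hardy_norm (toeplitz ?d (F n))" by (rule K(2)[OF Tdf])
          also have "\<dots> \<le> K * (e * hardy_norm (F n))" by (rule mult_left_mono[OF toeplitz_norm[OF d f] K(1)])
          also have "\<dots> \<le> K * (e * M)" using e(1) K(1) M(2)[of n] by (intro mult_left_mono) auto
          finally show ?thesis by (simp add: mult_ac)
        qed
        ultimately show ?thesis by linarith
      qed
      have "(\<lambda>n. hardy_norm (commutator (toeplitz v) C (F n))) \<longlonglongrightarrow> 0" using cv(2) F unfolding compact_op_iff[OF bv] by blast
      hence "\<forall>\<^sub>F n in sequentially. hardy_norm (commutator (toeplitz v) C (F n)) < \<eta> / 4"
        using \<eta> by (intro order_tendstoD(2)) auto
      then obtain N where N: "\<And>n. n \<ge> N \<Longrightarrow> hardy_norm (commutator (toeplitz v) C (F n)) < \<eta> / 4"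
        unfolding eventually_sequentially by blast
      show "\<exists>no. \<forall>n\<ge>no. norm (hardy_norm (commutator (toeplitz w) C (F n)) - 0) < \<eta>"
      proof (intro exI allI impI)
        fix n assume "N \<le> n"
        from N[OF this] le[of n] e(2) have "hardy_norm (commutator (toeplitz w) C (F n)) < \<eta>" by linarith
        thus "norm (hardy_norm (commutator (toeplitz w) C (F n)) - 0) < \<eta>"
          using hardy_norm_nonneg[OF bounded_op_mem[OF bw f], of n] by simp
      qed
    qed
  qed
  thus ?thesis using w by (simp add: ess_commuting_symbols_def)
qed

text \<open>Toeplitz operators are multiplicative when the right factor is analytic or the left one is
  antianalytic.\<close>

lemma ess_commuting_mult:
  assumes S: "compact_op (commutator (toeplitz (\<lambda>x. x)) C)" and w: "w \<in> ess_commuting_symbols C"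
  shows "(\<lambda>x. x * w x) \<in> ess_commuting_symbols C" "(\<lambda>x. cnj x * w x) \<in> ess_commuting_symbols C"
proof -
  have cw: "continuous_on (sphere 0 1) w" "compact_op (commutator (toeplitz w) C)"
    using w by (auto simp: ess_commuting_symbols_def)
  have c: "continuous_on (sphere 0 1) (\<lambda>x. x * w x)" "continuous_on (sphere 0 1) (\<lambda>x. cnj x * w x)"
    by (intro continuous_intros cw)+
  obtain W where W: "symbol w W" by (rule symbol_continuous[OF cw(1)])
  obtain W1 where W1: "symbol (\<lambda>x. x * w x) W1" by (rule symbol_continuous[OF c(1)])
  obtain W2 where W2: "symbol (\<lambda>x. cnj x * w x) W2" by (rule symbol_continuous[OF c(2)])
  note T = bounded_op_toeplitz
  have "compact_op (commutator (toeplitz (\<lambda>x. x * w x)) C) \<longleftrightarrow> compact_op (commutator (\<lambda>f. toeplitz w (toeplitz (\<lambda>x. x) f)) C)"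
    by (rule compact_op_cong) (simp only: commutator_def toeplitz_mult_shift[OF W W1] bounded_op_mem[OF C])
  with compact_commutator_comp[OF T[OF W] T[OF symbol_id] C cw(2) S] c(1)
  show "(\<lambda>x. x * w x) \<in> ess_commuting_symbols C" by (simp add: ess_commuting_symbols_def)
  have "compact_op (commutator (toeplitz (\<lambda>x. cnj x * w x)) C) \<longleftrightarrow> compact_op (commutator (\<lambda>f. toeplitz cnj (toeplitz w f)) C)"
    by (rule compact_op_cong) (simp only: commutator_def toeplitz_mult_backward_shift[OF W W2] bounded_op_mem[OF C])
  with compact_commutator_comp[OF T[OF symbol_cnj] T[OF W] C S[unfolded compact_commutator_shift_iff[OF C]] cw(2)] c(2)
  show "(\<lambda>x. cnj x * w x) \<in> ess_commuting_symbols C" by (simp add: ess_commuting_symbols_def)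
qed

text \<open>A real linear function of \<open>x\<close> is a complex combination of \<open>x\<close> and \<open>cnj x\<close>. Stating the
  claim as stability under multiplication makes the induction over products of polynomials work.\<close>

lemma ess_commuting_polynomial:
  assumes S: "compact_op (commutator (toeplitz (\<lambda>x. x)) C)" and q: "real_polynomial_function q"
    and w: "w \<in> ess_commuting_symbols C"
  shows "(\<lambda>x. of_real (q x) * w x) \<in> ess_commuting_symbols C"
  using q w
proof (induction arbitrary: w)
  case (linear q)
  then interpret q: bounded_linear q by simp
  define a b where "a = (of_real (q 1) - \<i> * of_real (q \<i>)) / 2" and "b = (of_real (q 1) + \<i> * of_real (q \<i>)) / 2"
  have "of_real (q x) = a * x + b * cnj x" for x
  proof -
    have "q x = q (Re x *\<^sub>R 1 + Im x *\<^sub>R \<i>)" by (rule arg_cong[of _ _ q]) (simp add: complex_eq_iff)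
    also have "\<dots> = Re x * q 1 + Im x * q \<i>" by (simp only: q.add q.scaleR real_scaleR_def)
    finally show ?thesis unfolding a_def b_def by (simp add: complex_eq_iff field_simps)
  qed
  hence "(\<lambda>x. of_real (q x) * w x) = (\<lambda>x. a * (x * w x) + b * (cnj x * w x))"
    by (simp add: algebra_simps)
  thus ?case using ess_commuting_lincomb[OF ess_commuting_mult[OF S linear(2)], of a b] by simp
next
  case (const c)
  thus ?case using ess_commuting_lincomb[OF const const, of "of_real c" 0] by simp
next
  case (add f g)
  thus ?case using ess_commuting_lincomb[OF add.IH(1)[OF add.prems] add.IH(2)[OF add.prems], of 1 1] by (simp add: distrib_right)
next
  case (mult f g)
  thus ?case using mult.IH(1)[OF mult.IH(2)[OF mult.prems]] by (simp add: mult.assoc)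
qed

theorem compact_commutator_continuous:
  assumes S: "compact_op (commutator (toeplitz (\<lambda>t. t)) C)" and w: "continuous_on (sphere 0 1) w"
  shows "compact_op (commutator (toeplitz w) C)"
proof -
  have "w \<in> ess_commuting_symbols C"
  proof (rule ess_commuting_uniform_limit[OF w])
    fix e :: real assume "0 < e"
    from Stone_Weierstrass_polynomial_function[OF compact_sphere w this]
    obtain g where g: "polynomial_function g" "\<forall>x\<in>sphere 0 1. norm (w x - g x) < e" by blast
    have "real_polynomial_function (\<lambda>t. Re (g t))" "real_polynomial_function (\<lambda>t. Im (g t))"
      using g(1) bounded_linear_Re bounded_linear_Im unfolding polynomial_function_def by (auto simp: o_def)
    note p = this[THEN ess_commuting_polynomial[OF S _ ess_commuting_1]]
    have "(\<lambda>t. 1 * (of_real (Re (g t)) * 1) + \<i> * (of_real (Im (g t)) * 1)) \<in> ess_commuting_symbols C"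
      by (rule ess_commuting_lincomb[OF p])
    moreover have "(\<lambda>t. 1 * (of_real (Re (g t)) * 1) + \<i> * (of_real (Im (g t)) * 1)) = g"
      by (simp add: fun_eq_iff complex_eq_iff)
    ultimately show "\<exists>v\<in>ess_commuting_symbols C. \<forall>t\<in>sphere 0 1. norm (w t - v t) \<le> e"
      using g(2) by (intro bexI[of _ g]) (auto intro: less_imp_le)
  qed
  thus ?thesis by (simp add: ess_commuting_symbols_def)
qed

end

section \<open>The singular Clark measures live on their closed supports\<close>

text \<open>Lindelof's theorem reduces the cover by null sets to a countable one.\<close>

lemma null_off_support:
  assumes \<sigma>: "circle_measure \<sigma>" and U: "open U" "U \<inter> measure_support \<sigma> = {}"
  shows "emeasure \<sigma> (U \<inter> sphere 0 1) = 0"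
proof -
  note sp = circle_measureD(3)[OF \<sigma>]
  have s: "V \<inter> sphere 0 1 \<in> sets \<sigma>" if "open V" for V
    using that by (simp add: circle_measureD(1)[OF \<sigma>] sets_restrict_space_iff)
  define \<F> where "\<F> = {V. open V \<and> emeasure \<sigma> (V \<inter> sphere 0 1) = 0}"
  obtain \<G> where \<G>: "\<G> \<subseteq> \<F>" "countable \<G>" "\<Union>\<G> = \<Union>\<F>"
    using Lindelof[of \<F>] unfolding \<F>_def by blast
  have "(\<Union>V\<in>\<G>. V \<inter> sphere 0 1) \<in> null_sets \<sigma>"
    using \<G>(1) s by (intro null_sets_UN' \<G>(2)) (auto simp: \<F>_def null_sets_def)
  moreover have "U \<inter> sphere 0 1 \<subseteq> (\<Union>V\<in>\<G>. V \<inter> sphere 0 1)"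
  proof
    fix x assume x: "x \<in> U \<inter> sphere 0 1"
    hence "x \<notin> measure_support \<sigma>" using U(2) by blast
    then obtain V where "open V" "x \<in> V" "\<not> emeasure \<sigma> (V \<inter> sphere 0 1) > 0"
      using x unfolding measure_support_def sp by blast
    hence "V \<in> \<F>" by (simp add: \<F>_def zero_less_iff_neq_zero)
    thus "x \<in> (\<Union>V\<in>\<G>. V \<inter> sphere 0 1)" using \<open>x \<in> V\<close> x \<G>(3) by blast
  qed
  ultimately have "U \<inter> sphere 0 1 \<in> null_sets \<sigma>" by (rule null_sets_subset[OF _ s[OF U(1)]])
  thus ?thesis by auto
qed

context disk_map
begin

abbreviation "E \<equiv> clark_singular_set \<phi>"

lemma support_subset_E:
  "norm \<alpha> = 1 \<Longrightarrow> measure_support (singular_part arc_measure (clark_measure \<phi> \<alpha>)) \<subseteq> E"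
  unfolding clark_singular_set_def by (rule order_trans[OF _ closure_subset]) auto

lemma E_subset_sphere: "E \<subseteq> sphere 0 1"
  unfolding clark_singular_set_def
proof (rule closure_minimal)
  show "(\<Union>\<alpha>\<in>sphere 0 1. measure_support (singular_part arc_measure (clark_measure \<phi> \<alpha>))) \<subseteq> sphere 0 1"
  proof (rule UN_least)
    fix \<alpha> :: complex assume "\<alpha> \<in> sphere 0 1"
    hence "norm \<alpha> = 1" by simp
    from circle_measureD(3)[OF clark_singular_part(1)[OF this]]
    show "measure_support (singular_part arc_measure (clark_measure \<phi> \<alpha>)) \<subseteq> sphere 0 1"
      unfolding measure_support_def by blast
  qed
qed simp

lemma clark_measure_off_E:
  fixes h :: "complex \<Rightarrow> real"
  assumes \<alpha>: "norm \<alpha> = 1" and h: "continuous_on (sphere 0 1) h" and h0: "\<And>x. x \<in> E \<Longrightarrow> h x = 0"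
  shows "(\<integral>x. h x \<partial>clark_measure \<phi> \<alpha>) = (\<integral>x. h x * clark_density \<alpha> x \<partial>arc_measure)"
proof -
  define \<sigma> where "\<sigma> = singular_part arc_measure (clark_measure \<phi> \<alpha>)"
  note \<sigma> = clark_singular_part(1)[OF \<alpha>, folded \<sigma>_def]
  have o: "open (- E)" by (simp add: clark_singular_set_def open_Compl)
  have "emeasure \<sigma> (- E \<inter> sphere 0 1) = 0"
    using support_subset_E[OF \<alpha>] by (intro null_off_support[OF \<sigma> o]) (auto simp: \<sigma>_def)
  moreover have "- E \<inter> sphere 0 1 \<in> sets \<sigma>"
    using o by (simp add: circle_measureD(1)[OF \<sigma>] sets_restrict_space_iff)
  ultimately have "- E \<inter> sphere 0 1 \<in> null_sets \<sigma>" by auto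
  hence "AE x in \<sigma>. h x = 0"
    by (rule AE_I') (use h0 in \<open>auto simp: circle_measureD(3)[OF \<sigma>]\<close>)
  hence "(\<integral>x. h x \<partial>\<sigma>) = 0" by (rule integral_eq_zero_AE)
  thus ?thesis using clark_singular_part(2)[OF \<alpha> h] by (simp add: \<sigma>_def)
qed

section \<open>Uniform integrability of the Clark densities off the singular set\<close>

lemma approach_mono: "m \<le> n \<Longrightarrow> approach m \<le> approach n"
  unfolding approach_def by (simp add: frac_le)

text \<open>The part of the integral of \<open>h\<close> against the absolutely continuous part at
  \<open>\<beta>\<close> that comes from the points where \<open>p\<close> is close to the circle.\<close>

definition outer_mass :: "(complex \<Rightarrow> real) \<Rightarrow> nat \<Rightarrow> complex \<Rightarrow> real" where
  "outer_mass h k \<beta> = (\<integral>x. h x * (if norm (p x) \<le> approach k then 0 else 1) * clark_density \<beta> x \<partial>arc_measure)"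

text \<open>Where \<open>norm (p x)\<close> stays away from 1 the densities are uniformly bounded and depend
  continuously on \<open>\<beta>\<close>.\<close>

lemma inner_mass_tendsto:
  fixes h :: "complex \<Rightarrow> real"
  assumes h: "continuous_on (sphere 0 1) h" and \<beta>: "\<And>n. norm (\<beta> n) = 1" "\<beta> \<longlonglongrightarrow> \<beta>0" and \<beta>0: "norm \<beta>0 = 1"
  shows "(\<lambda>n. \<integral>x. h x * (if norm (p x) \<le> approach k then 1 else 0) * clark_density (\<beta> n) x \<partial>arc_measure)
    \<longlonglongrightarrow> (\<integral>x. h x * (if norm (p x) \<le> approach k then 1 else 0) * clark_density \<beta>0 x \<partial>arc_measure)"
proof -
  obtain B where B: "B \<ge> 0" "\<And>x. x \<in> sphere 0 1 \<Longrightarrow> norm (h x) \<le> B" using continuous_circle_bounded[OF h] by blast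
  note [measurable] = borel_measurable_arc_continuous[OF h]
  show ?thesis
  proof (rule integral_dominated_convergence[where w="\<lambda>_. B * (2 / (1 - approach k))"])
    show "AE x in arc_measure. (\<lambda>n. h x * (if norm (p x) \<le> approach k then 1 else 0) * clark_density (\<beta> n) x)
      \<longlonglongrightarrow> h x * (if norm (p x) \<le> approach k then 1 else 0) * clark_density \<beta>0 x"
    proof (rule AE_I2)
      fix x
      have "(\<lambda>n. pois (p x) (\<beta> n)) \<longlonglongrightarrow> pois (p x) \<beta>0"
        by (rule continuous_on_tendsto_compose[OF continuous_on_pois[OF p_disk] \<beta>(2)]) (use \<beta>(1) \<beta>0 in auto)
      thus "(\<lambda>n. h x * (if norm (p x) \<le> approach k then 1 else 0) * clark_density (\<beta> n) x)
        \<longlonglongrightarrow> h x * (if norm (p x) \<le> approach k then 1 else 0) * clark_density \<beta>0 x"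
        unfolding clark_density_def by (intro tendsto_intros)
    qed
    fix n
    show "AE x in arc_measure. norm (h x * (if norm (p x) \<le> approach k then 1 else 0) * clark_density (\<beta> n) x) \<le> B * (2 / (1 - approach k))"
    proof (rule AE_I2)
      fix x assume z: "x \<in> space arc_measure"
      show "norm (h x * (if norm (p x) \<le> approach k then 1 else 0) * clark_density (\<beta> n) x) \<le> B * (2 / (1 - approach k))"
      proof (cases "norm (p x) \<le> approach k")
        case True
        have "norm (h x) * clark_density (\<beta> n) x \<le> B * (2 / (1 - approach k))"
          unfolding clark_density_def
          by (rule mult_mono[OF B(2) pois_upper[OF True approach(2) \<beta>(1)] B(1) pois_nonneg[OF p_disk]]) (use z in simp)
        thus ?thesis using True clark_density_nonneg[of "\<beta> n" x] by (simp add: abs_mult)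
      qed (use B(1) approach(2)[of k] in simp)
    qed
  qed simp_all
qed

lemma outer_mass_split:
  fixes h :: "complex \<Rightarrow> real"
  assumes h: "continuous_on (sphere 0 1) h" and \<beta>: "norm \<beta> = 1"
  shows "integrable arc_measure (\<lambda>x. h x * (if norm (p x) \<le> approach k then 0 else 1) * clark_density \<beta> x)"
    and "outer_mass h k \<beta> = (\<integral>x. h x * clark_density \<beta> x \<partial>arc_measure)
      - (\<integral>x. h x * (if norm (p x) \<le> approach k then 1 else 0) * clark_density \<beta> x \<partial>arc_measure)"
proof -
  note [measurable] = borel_measurable_arc_continuous[OF h]
  have i: "integrable arc_measure (\<lambda>x. h x * clark_density \<beta> x)"
    by (rule integrable_mult_bounded[OF integrable_clark_density[OF \<beta>] h])
  have i1: "integrable arc_measure (\<lambda>x. h x * (if norm (p x) \<le> approach k then a else b) * clark_density \<beta> x)"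
    if "\<bar>a\<bar> \<le> 1" "\<bar>b\<bar> \<le> 1" for a b :: real
  proof (rule Bochner_Integration.integrable_bound[OF i])
    show "AE x in arc_measure. norm (h x * (if norm (p x) \<le> approach k then a else b) * clark_density \<beta> x) \<le> norm (h x * clark_density \<beta> x)"
    proof (rule AE_I2)
      fix x
      have "\<bar>if norm (p x) \<le> approach k then a else b\<bar> \<le> 1" using that by simp
      from mult_left_mono[OF this, of "\<bar>h x * clark_density \<beta> x\<bar>"]
      show "norm (h x * (if norm (p x) \<le> approach k then a else b) * clark_density \<beta> x) \<le> norm (h x * clark_density \<beta> x)"
        by (simp add: abs_mult mult_ac del: abs_le_iff)
    qed
  qed measurable
  show "integrable arc_measure (\<lambda>x. h x * (if norm (p x) \<le> approach k then 0 else 1) * clark_density \<beta> x)"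
    by (rule i1) auto
  have "outer_mass h k \<beta> = (\<integral>x. h x * clark_density \<beta> x - h x * (if norm (p x) \<le> approach k then 1 else 0) * clark_density \<beta> x \<partial>arc_measure)"
    unfolding outer_mass_def by (intro Bochner_Integration.integral_cong) auto
  also have "\<dots> = (\<integral>x. h x * clark_density \<beta> x \<partial>arc_measure)
      - (\<integral>x. h x * (if norm (p x) \<le> approach k then 1 else 0) * clark_density \<beta> x \<partial>arc_measure)"
    by (rule Bochner_Integration.integral_diff[OF i i1]) auto
  finally show "outer_mass h k \<beta> = (\<integral>x. h x * clark_density \<beta> x \<partial>arc_measure)
      - (\<integral>x. h x * (if norm (p x) \<le> approach k then 1 else 0) * clark_density \<beta> x \<partial>arc_measure)" .
qed

lemma outer_mass_tendsto_0:
  fixes h :: "complex \<Rightarrow> real"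
  assumes h: "continuous_on (sphere 0 1) h" and \<beta>: "norm \<beta> = 1"
  shows "(\<lambda>k. outer_mass h k \<beta>) \<longlonglongrightarrow> 0"
proof -
  note [measurable] = borel_measurable_arc_continuous[OF h]
  have "(\<lambda>k. outer_mass h k \<beta>) \<longlonglongrightarrow> (\<integral>x. 0 \<partial>arc_measure)"
    unfolding outer_mass_def
  proof (rule integral_dominated_convergence[where w="\<lambda>x. norm (h x * clark_density \<beta> x)"])
    show "integrable arc_measure (\<lambda>x. norm (h x * clark_density \<beta> x))"
      by (rule integrable_norm[OF integrable_mult_bounded[OF integrable_clark_density[OF \<beta>] h]])
    show "AE x in arc_measure. (\<lambda>k. h x * (if norm (p x) \<le> approach k then 0 else 1) * clark_density \<beta> x) \<longlonglongrightarrow> 0"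
    proof (rule AE_I2)
      fix x
      have "\<forall>\<^sub>F k in sequentially. norm (p x) < approach k"
        by (rule order_tendstoD(1)[OF approach(4) p_disk])
      hence "\<forall>\<^sub>F k in sequentially. h x * (if norm (p x) \<le> approach k then 0 else 1) * clark_density \<beta> x = 0"
        by eventually_elim simp
      thus "(\<lambda>k. h x * (if norm (p x) \<le> approach k then 0 else 1) * clark_density \<beta> x) \<longlonglongrightarrow> 0"
        by (rule tendsto_eventually)
    qed
    fix k
    show "AE x in arc_measure. norm (h x * (if norm (p x) \<le> approach k then 0 else 1) * clark_density \<beta> x) \<le> norm (h x * clark_density \<beta> x)"
      by (rule AE_I2) (simp add: abs_mult)
  qed measurable
  thus ?thesis by simp
qed

lemma outer_mass_antimono:
  fixes h :: "complex \<Rightarrow> real"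
  assumes h: "continuous_on (sphere 0 1) h" "\<And>x. 0 \<le> h x" and \<beta>: "norm \<beta> = 1" and "j \<le> k"
  shows "outer_mass h k \<beta> \<le> outer_mass h j \<beta>"
  unfolding outer_mass_def
proof (rule integral_mono[OF outer_mass_split(1)[OF h(1) \<beta>] outer_mass_split(1)[OF h(1) \<beta>]])
  fix x
  show "h x * (if norm (p x) \<le> approach k then 0 else 1) * clark_density \<beta> x
      \<le> h x * (if norm (p x) \<le> approach j then 0 else 1) * clark_density \<beta> x"
    using approach_mono[OF \<open>j \<le> k\<close>] h(2)[of x] clark_density_nonneg[of \<beta> x]
    by (intro mult_right_mono mult_left_mono) auto
qed

text \<open>A compactness argument as in Dini's theorem: for fixed \<open>k\<close> the outer mass is the difference
  of a function continuous in \<open>\<beta>\<close>, because \<open>h\<close> vanishes on \<open>E\<close> and Clark measures depend weakly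
  continuously on \<open>\<beta>\<close>, and of the continuous inner mass; it decreases to 0 as \<open>k\<close> grows.\<close>

lemma outer_mass_uniform:
  fixes h :: "complex \<Rightarrow> real"
  assumes h: "continuous_on (sphere 0 1) h" "\<And>x. 0 \<le> h x" and h0: "\<And>x. x \<in> E \<Longrightarrow> h x = 0" and \<epsilon>: "0 < \<epsilon>"
  obtains k where "\<forall>\<beta>. norm \<beta> = 1 \<longrightarrow> outer_mass h k \<beta> \<le> \<epsilon>"
proof (rule ccontr)
  assume "\<not> thesis"
  hence "\<forall>k. \<exists>\<beta>. norm \<beta> = 1 \<and> \<epsilon> < outer_mass h k \<beta>" using that by (meson not_le)
  then obtain \<beta> where \<beta>: "\<And>k. norm (\<beta> k) = 1" "\<And>k. \<epsilon> < outer_mass h k (\<beta> k)" by metis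
  have "compact (sphere (0::complex) 1)" by simp
  then obtain \<gamma> r where \<gamma>: "\<gamma> \<in> sphere (0::complex) 1" and r: "strict_mono r" "(\<beta> \<circ> r) \<longlonglongrightarrow> \<gamma>"
    using \<beta>(1) unfolding compact_def by (metis mem_sphere_0)
  have \<gamma>1: "norm \<gamma> = 1" using \<gamma> by simp
  have \<beta>r: "(\<lambda>n. \<beta> (r n)) \<longlonglongrightarrow> \<gamma>" using r(2) by (simp add: o_def)
  have off: "(\<integral>x. h x * clark_density \<alpha> x \<partial>arc_measure) = (\<integral>x. h x \<partial>clark_measure \<phi> \<alpha>)" if "norm \<alpha> = 1" for \<alpha>
    by (rule clark_measure_off_E[OF that h(1), symmetric]) (rule h0)
  have I: "(\<lambda>n. \<integral>x. h x * clark_density (\<beta> (r n)) x \<partial>arc_measure) \<longlonglongrightarrow> (\<integral>x. h x * clark_density \<gamma> x \<partial>arc_measure)"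
    unfolding off[OF \<beta>(1)] off[OF \<gamma>1]
  proof (rule poisson_weak_convergence[OF clark_measure(1)[OF \<beta>(1)] clark_measure(1)[OF \<gamma>1] _ h(1)])
    fix z :: complex assume z: "norm z < 1"
    show "(\<lambda>n. poisson_integral (clark_measure \<phi> (\<beta> (r n))) z) \<longlonglongrightarrow> poisson_integral (clark_measure \<phi> \<gamma>) z"
      unfolding clark_measure(2)[OF \<beta>(1) z] clark_measure(2)[OF \<gamma>1 z]
      by (rule continuous_on_tendsto_compose[OF continuous_on_pois[OF maps[OF z]] \<beta>r]) (use \<beta>(1) \<gamma> in auto)
  qed
  have "\<epsilon> \<le> outer_mass h j \<gamma>" for j
  proof (rule LIMSEQ_le_const)
    show "(\<lambda>n. outer_mass h j (\<beta> (r n))) \<longlonglongrightarrow> outer_mass h j \<gamma>"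
      unfolding outer_mass_split(2)[OF h(1) \<beta>(1)] outer_mass_split(2)[OF h(1) \<gamma>1]
      by (intro tendsto_diff I inner_mass_tendsto[OF h(1) \<beta>(1) \<beta>r \<gamma>1])
    show "\<exists>N. \<forall>n\<ge>N. \<epsilon> \<le> outer_mass h j (\<beta> (r n))"
    proof (intro exI allI impI)
      fix n assume "j \<le> n"
      hence "j \<le> r n" using seq_suble[OF r(1), of n] by simp
      from outer_mass_antimono[OF h \<beta>(1) this, of "r n"] \<beta>(2)[of "r n"] show "\<epsilon> \<le> outer_mass h j (\<beta> (r n))" by simp
    qed
  qed
  hence "\<epsilon> \<le> 0" by (intro LIMSEQ_le_const[OF outer_mass_tendsto_0[OF h(1) \<gamma>1]]) auto
  thus False using \<epsilon> by simp
qed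

section \<open>Fixing the singular set forces compactness\<close>

lemma inner_composition_tendsto_0:
  fixes h :: "complex \<Rightarrow> real"
  assumes F: "weak_null F" and h: "continuous_on (sphere 0 1) h"
  shows "(\<lambda>n. \<integral>x. h x * (if norm (p x) \<le> approach k then 1 else 0) * (norm (F n (p x)))\<^sup>2 \<partial>arc_measure) \<longlonglongrightarrow> 0"
proof -
  note f = weak_null_mem[OF F]
  obtain B where B: "B \<ge> 0" "\<And>x. x \<in> sphere 0 1 \<Longrightarrow> norm (h x) \<le> B" using continuous_circle_bounded[OF h] by blast
  obtain M where M: "M \<ge> 0" "\<And>n. hardy_norm (F n) \<le> M" using weak_null_bounded[OF F] by blast
  note [measurable] = borel_measurable_arc_continuous[OF h] comp_boundary_norm(1)[OF f]
  define K where "K = (M / sqrt (1 - (approach k)\<^sup>2))\<^sup>2"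
  have a: "0 < 1 - (approach k)\<^sup>2" using approach(1,2)[of k] by (simp add: abs_square_less_1)
  have "(\<lambda>n. \<integral>x. h x * (if norm (p x) \<le> approach k then 1 else 0) * (norm (F n (p x)))\<^sup>2 \<partial>arc_measure) \<longlonglongrightarrow> (\<integral>x. 0 \<partial>arc_measure)"
  proof (rule integral_dominated_convergence[where w="\<lambda>_. B * K"])
    show "AE x in arc_measure. (\<lambda>n. h x * (if norm (p x) \<le> approach k then 1 else 0) * (norm (F n (p x)))\<^sup>2) \<longlonglongrightarrow> 0"
    proof (rule AE_I2)
      fix x
      have "(\<lambda>n. h x * (if norm (p x) \<le> approach k then 1 else 0) * (norm (F n (p x)))\<^sup>2) \<longlonglongrightarrow> h x * (if norm (p x) \<le> approach k then 1 else 0) * (norm (0::complex))\<^sup>2"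
        by (intro tendsto_intros weak_null_pointwise[OF F p_disk])
      thus "(\<lambda>n. h x * (if norm (p x) \<le> approach k then 1 else 0) * (norm (F n (p x)))\<^sup>2) \<longlonglongrightarrow> 0" by simp
    qed
    fix n
    show "AE x in arc_measure. norm (h x * (if norm (p x) \<le> approach k then 1 else 0) * (norm (F n (p x)))\<^sup>2) \<le> B * K"
    proof (rule AE_I2)
      fix x assume z: "x \<in> space arc_measure"
      show "norm (h x * (if norm (p x) \<le> approach k then 1 else 0) * (norm (F n (p x)))\<^sup>2) \<le> B * K"
      proof (cases "norm (p x) \<le> approach k")
        case True
        have "norm (F n (p x)) \<le> hardy_norm (F n) / sqrt (1 - (norm (p x))\<^sup>2)"
          by (rule hardy_pointwise_bound[OF f p_disk])
        also have "\<dots> \<le> M / sqrt (1 - (approach k)\<^sup>2)"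
          using True a M by (intro frac_le real_sqrt_le_mono diff_left_mono power_mono) auto
        finally have "(norm (F n (p x)))\<^sup>2 \<le> K" unfolding K_def by (rule power_mono) simp
        moreover have "norm (h x) \<le> B" using B(2) z by simp
        ultimately have "norm (h x) * (norm (F n (p x)))\<^sup>2 \<le> B * K" by (intro mult_mono B(1)) auto
        thus ?thesis using True by (simp add: abs_mult)
      qed (use B(1) in \<open>simp add: K_def\<close>)
    qed
  qed simp_all
  thus ?thesis by simp
qed

lemma outer_composition_bound:
  fixes h :: "complex \<Rightarrow> real"
  assumes f: "f \<in> hardy2" and h: "continuous_on (sphere 0 1) h" "\<And>x. 0 \<le> h x"
    and \<epsilon>: "0 \<le> \<epsilon>" "\<And>\<beta>. norm \<beta> = 1 \<Longrightarrow> outer_mass h k \<beta> \<le> \<epsilon>"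
  shows "integrable arc_measure (\<lambda>x. h x * (if norm (p x) \<le> approach k then 0 else 1) * (norm (f (p x)))\<^sup>2)"
    and "(\<integral>x. h x * (if norm (p x) \<le> approach k then 0 else 1) * (norm (f (p x)))\<^sup>2 \<partial>arc_measure) \<le> \<epsilon> * (hardy_norm f)\<^sup>2"
proof -
  note [measurable] = borel_measurable_arc_continuous[OF h(1)]
  have C: "(\<integral>\<^sup>+x. ennreal (h x * (if norm (p x) \<le> approach k then 0 else 1) * pois (p x) \<beta>) \<partial>arc_measure) \<le> ennreal \<epsilon>"
    if \<beta>: "norm \<beta> = 1" for \<beta>
  proof -
    have "(\<integral>\<^sup>+x. ennreal (h x * (if norm (p x) \<le> approach k then 0 else 1) * clark_density \<beta> x) \<partial>arc_measure) = ennreal (outer_mass h k \<beta>)"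
      unfolding outer_mass_def
      by (rule nn_integral_eq_integral[OF outer_mass_split(1)[OF h(1) \<beta>]]) (use h(2) in \<open>auto intro!: AE_I2 mult_nonneg_nonneg clark_density_nonneg\<close>)
    also have "\<dots> \<le> ennreal \<epsilon>" by (intro ennreal_leI \<epsilon> \<beta>)
    finally show ?thesis by (simp add: clark_density_def)
  qed
  have m: "(\<lambda>x. h x * (if norm (p x) \<le> approach k then 0 else 1)) \<in> borel_measurable arc_measure" by measurable
  have n: "0 \<le> h x * (if norm (p x) \<le> approach k then 0 else 1)" for x using h(2) by simp
  note T = composition_tonelli[OF f p_measurable p_disk m n C \<epsilon>(1)]
  show "integrable arc_measure (\<lambda>x. h x * (if norm (p x) \<le> approach k then 0 else 1) * (norm (f (p x)))\<^sup>2)" by (rule T(2))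
  show "(\<integral>x. h x * (if norm (p x) \<le> approach k then 0 else 1) * (norm (f (p x)))\<^sup>2 \<partial>arc_measure) \<le> \<epsilon> * (hardy_norm f)\<^sup>2" by (rule T(3))
qed

text \<open>By continuity of \<open>\<phi>'\<close> at the points of \<open>E\<close>, the map \<open>\<phi>'\<close> is within
  \<open>\<epsilon>\<close> of the identity on an open neighbourhood of \<open>E\<close>; the complement is separated from
  \<open>E\<close> by Urysohn's lemma.\<close>

lemma cutoff_function:
  assumes fp: "\<forall>t\<in>E. \<phi>' t = t" and cont: "\<forall>t\<in>E. continuous (at t within sphere 0 1) \<phi>'" and \<epsilon>: "0 < \<epsilon>"
  obtains h :: "complex \<Rightarrow> real" where "continuous_on UNIV h" "\<And>t. 0 \<le> h t" "\<And>t. t \<in> E \<Longrightarrow> h t = 0"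
    "\<And>t. t \<in> sphere 0 1 \<Longrightarrow> h t = 1 \<or> norm (t - \<phi>' t) < \<epsilon>"
proof -
  have "\<exists>\<delta>>0. \<forall>\<xi>\<in>sphere 0 1. dist \<xi> t < \<delta> \<longrightarrow> norm (\<xi> - \<phi>' \<xi>) < \<epsilon>" if t: "t \<in> E" for t
  proof -
    have "continuous (at t within sphere 0 1) (\<lambda>\<xi>. \<xi> - \<phi>' \<xi>)" by (intro continuous_intros cont[rule_format, OF t])
    thus ?thesis using \<epsilon> fp[rule_format, OF t] unfolding continuous_within_eps_delta by simp
  qed
  then obtain \<delta> where \<delta>: "\<And>t. t \<in> E \<Longrightarrow> \<delta> t > 0" "\<And>t \<xi>. t \<in> E \<Longrightarrow> \<xi> \<in> sphere 0 1 \<Longrightarrow> dist \<xi> t < \<delta> t \<Longrightarrow> norm (\<xi> - \<phi>' \<xi>) < \<epsilon>"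
    by metis
  define V where "V = (\<Union>t\<in>E. ball t (\<delta> t))"
  have "open V" unfolding V_def by auto
  hence c: "closed (sphere 0 1 - V)" by (intro closed_Diff) auto
  have cE: "closed E" by (simp add: clark_singular_set_def)
  have "E \<subseteq> V" unfolding V_def using \<delta>(1) by fastforce
  hence "E \<inter> (sphere 0 1 - V) = {}" by auto
  then obtain h :: "complex \<Rightarrow> real" where h: "continuous_on UNIV h" "\<And>x. h x \<in> closed_segment 0 1" "\<And>x. x \<in> E \<Longrightarrow> h x = 0"
    "\<And>x. x \<in> sphere 0 1 - V \<Longrightarrow> h x = 1"
    using Urysohn[OF cE c, of "0::real" 1] by blast
  show ?thesis
  proof (rule that[OF h(1) _ h(3)])
    show "0 \<le> h t" for t using h(2)[of t] by (simp add: closed_segment_eq_real_ivl)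
    fix t :: complex assume z: "t \<in> sphere 0 1"
    show "h t = 1 \<or> norm (t - \<phi>' t) < \<epsilon>"
    proof (cases "t \<in> V")
      case True
      then obtain \<xi> where "\<xi> \<in> E" "dist t \<xi> < \<delta> \<xi>" by (auto simp: V_def dist_commute)
      thus ?thesis using \<delta>(2) z by blast
    qed (use z h(4) in blast)
  qed
qed

text \<open>Near \<open>E\<close> the factor \<open>norm (x - p x)\<close> is at most \<open>\<epsilon>\<close>, elsewhere it is at most 2 and the
  cutoff function is 1. So the norm squared is at most \<open>\<epsilon>\<^sup>2\<close> times a constant plus four times the
  integral of \<open>h x * (norm (F n (p x)))\<^sup>2\<close>, which splits into an inner part that tends to 0 and
  an outer part of size \<open>\<epsilon>\<close>.\<close>

lemma fixed_imp_compact: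
  assumes fp: "\<forall>x\<in>E. \<phi>' x = x" and cont: "\<forall>x\<in>E. continuous (at x within sphere 0 1) \<phi>'"
    and \<phi>': "AE x in arc_measure. p x = \<phi>' x"
  shows "compact_op shift_comm"
  unfolding compact_op_iff[OF bounded_op_shift_comm]
proof (intro allI impI)
  fix F assume F: "weak_null F"
  note f = weak_null_mem[OF F]
  obtain M where M: "M \<ge> 0" "\<And>n. hardy_norm (F n) \<le> M" using weak_null_bounded[OF F] by blast
  \<comment> \<open>The contribution near \<open>E\<close> and the outer part add up to at most \<open>\<epsilon> * K\<close> when \<open>\<epsilon> \<le> 1\<close>.\<close>
  define K where "K = mass_bound * M\<^sup>2 + 4 * M\<^sup>2"
  have K: "0 \<le> K" unfolding K_def using mass_bound(1) by simp
  have sq: "(hardy_norm (F n))\<^sup>2 \<le> M\<^sup>2" for n by (rule power_mono[OF M(2) hardy_norm_nonneg[OF f]])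
  have "(\<lambda>n. (hardy_norm (shift_comm (F n)))\<^sup>2) \<longlonglongrightarrow> 0"
  proof (rule LIMSEQ_I)
    fix \<eta> :: real assume \<eta>: "0 < \<eta>"
    define \<epsilon> where "\<epsilon> = min 1 (\<eta> / (2 * (K + 1)))"
    have \<epsilon>: "0 < \<epsilon>" "\<epsilon> \<le> 1" unfolding \<epsilon>_def using \<eta> K by auto
    have \<epsilon>K: "\<epsilon> * K < \<eta> / 2 + \<eta> / 4"
    proof -
      have "\<epsilon> * K \<le> \<eta> / (2 * (K + 1)) * (K + 1)" using K \<epsilon> \<eta> by (intro mult_mono) (auto simp: \<epsilon>_def)
      also have "\<dots> = \<eta> / 2" using K by (simp add: field_simps)
      finally show ?thesis using \<eta> by simp
    qed
    obtain h :: "complex \<Rightarrow> real" where h: "continuous_on UNIV h" "\<And>x. 0 \<le> h x" "\<And>x. x \<in> E \<Longrightarrow> h x = 0"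
      "\<And>x. x \<in> sphere 0 1 \<Longrightarrow> h x = 1 \<or> norm (x - \<phi>' x) < \<epsilon>"
      by (rule cutoff_function[OF fp cont \<epsilon>(1)]) blast
    have hc: "continuous_on (sphere 0 1) h" by (rule continuous_on_subset[OF h(1)]) simp
    note [measurable] = borel_measurable_arc_continuous[OF hc]
    obtain k where "\<forall>\<beta>. norm \<beta> = 1 \<longrightarrow> outer_mass h k \<beta> \<le> \<epsilon>"
      using outer_mass_uniform[OF hc h(2) h(3) \<epsilon>(1)] by blast
    hence k: "outer_mass h k \<beta> \<le> \<epsilon>" if "norm \<beta> = 1" for \<beta> using that by blast
    have pw: "AE x in arc_measure. (norm (x - p x))\<^sup>2 \<le> \<epsilon>\<^sup>2 + 4 * h x"
      using \<phi>' AE_space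
    proof eventually_elim
      case (elim x)
      have z: "x \<in> sphere 0 1" using elim(2) by simp
      from h(4)[OF z] show ?case
      proof
        assume 1: "h x = 1"
        have "norm (x - p x) \<le> 2" using norm_triangle_ineq4[of x "p x"] p_disk[of x] z by simp
        hence "(norm (x - p x))\<^sup>2 \<le> 2\<^sup>2" by (rule power_mono) simp
        thus ?thesis using 1 by (simp add: add_increasing)
      next
        assume "norm (x - \<phi>' x) < \<epsilon>"
        hence "(norm (x - p x))\<^sup>2 \<le> \<epsilon>\<^sup>2" unfolding elim(1) by (intro power_mono) auto
        thus ?thesis using h(2)[of x] by simp
      qed
    qed
    define J where "J n = (\<integral>x. h x * (if norm (p x) \<le> approach k then 1 else 0) * (norm (F n (p x)))\<^sup>2 \<partial>arc_measure)" for n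
    have main: "(hardy_norm (shift_comm (F n)))\<^sup>2 \<le> \<epsilon> * K + 4 * J n" for n
    proof -
      note i0 = comp_boundary_norm(2)[OF f[of n]]
      note o = outer_composition_bound[OF f[of n] hc h(2) less_imp_le[OF \<epsilon>(1)] k]
      have ih: "integrable arc_measure (\<lambda>x. h x * (norm (F n (p x)))\<^sup>2)"
        by (rule integrable_mult_bounded[OF i0 hc])
      have sp: "h x * (if norm (p x) \<le> approach k then 1 else 0) * (norm (F n (p x)))\<^sup>2 = h x * (norm (F n (p x)))\<^sup>2
          - h x * (if norm (p x) \<le> approach k then 0 else 1) * (norm (F n (p x)))\<^sup>2" for x by simp
      have hJ: "(\<integral>x. h x * (norm (F n (p x)))\<^sup>2 \<partial>arc_measure) \<le> J n + \<epsilon> * M\<^sup>2"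
      proof -
        have "J n = (\<integral>x. h x * (norm (F n (p x)))\<^sup>2 \<partial>arc_measure)
          - (\<integral>x. h x * (if norm (p x) \<le> approach k then 0 else 1) * (norm (F n (p x)))\<^sup>2 \<partial>arc_measure)"
          unfolding J_def sp by (rule Bochner_Integration.integral_diff[OF ih o(1)])
        moreover have "\<epsilon> * (hardy_norm (F n))\<^sup>2 \<le> \<epsilon> * M\<^sup>2" using sq[of n] \<epsilon>(1) by simp
        ultimately show ?thesis using o(2) by linarith
      qed
      have "(hardy_norm (shift_comm (F n)))\<^sup>2 = (\<integral>x. (norm (x - p x))\<^sup>2 * (norm (F n (p x)))\<^sup>2 \<partial>arc_measure)"
        by (rule shift_comm_norm(2)[OF f])
      also have "\<dots> \<le> (\<integral>x. \<epsilon>\<^sup>2 * (norm (F n (p x)))\<^sup>2 + 4 * (h x * (norm (F n (p x)))\<^sup>2) \<partial>arc_measure)"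
      proof (rule integral_mono_AE[OF shift_comm_norm(1)[OF f]])
        show "integrable arc_measure (\<lambda>x. \<epsilon>\<^sup>2 * (norm (F n (p x)))\<^sup>2 + 4 * (h x * (norm (F n (p x)))\<^sup>2))"
          using i0 ih by simp
        show "AE x in arc_measure. (norm (x - p x))\<^sup>2 * (norm (F n (p x)))\<^sup>2 \<le> \<epsilon>\<^sup>2 * (norm (F n (p x)))\<^sup>2 + 4 * (h x * (norm (F n (p x)))\<^sup>2)"
          using pw
        proof eventually_elim
          case (elim x)
          from mult_right_mono[OF elim, of "(norm (F n (p x)))\<^sup>2"] show ?case by (simp add: distrib_right mult.assoc)
        qed
      qed
      also have "\<dots> = \<epsilon>\<^sup>2 * (\<integral>x. (norm (F n (p x)))\<^sup>2 \<partial>arc_measure) + 4 * (\<integral>x. h x * (norm (F n (p x)))\<^sup>2 \<partial>arc_measure)"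
        using i0 ih by simp
      also have "\<dots> \<le> \<epsilon> * (mass_bound * M\<^sup>2) + 4 * (J n + \<epsilon> * M\<^sup>2)"
      proof -
        have "(\<integral>x. (norm (F n (p x)))\<^sup>2 \<partial>arc_measure) \<le> mass_bound * M\<^sup>2"
          using comp_boundary_norm(3)[OF f[of n]] mult_left_mono[OF sq[of n], of mass_bound] mass_bound(1) by linarith
        moreover have "\<epsilon>\<^sup>2 \<le> \<epsilon>" using \<epsilon> by (simp add: power2_eq_square)
        ultimately have "\<epsilon>\<^sup>2 * (\<integral>x. (norm (F n (p x)))\<^sup>2 \<partial>arc_measure) \<le> \<epsilon> * (mass_bound * M\<^sup>2)"
          using \<epsilon>(1) by (intro mult_mono) auto
        thus ?thesis by (intro add_mono mult_left_mono hJ) auto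
      qed
      also have "\<dots> = \<epsilon> * K + 4 * J n" by (simp add: K_def algebra_simps)
      finally show ?thesis .
    qed
    have "J \<longlonglongrightarrow> 0" unfolding J_def by (rule inner_composition_tendsto_0[OF F hc])
    hence "\<forall>\<^sub>F n in sequentially. J n < \<eta> / 16" using \<eta> by (intro order_tendstoD(2)) auto
    then obtain N where N: "\<And>n. n \<ge> N \<Longrightarrow> J n < \<eta> / 16" unfolding eventually_sequentially by blast
    show "\<exists>no. \<forall>n\<ge>no. norm ((hardy_norm (shift_comm (F n)))\<^sup>2 - 0) < \<eta>"
    proof (intro exI allI impI)
      fix n assume "N \<le> n"
      with main[of n] \<epsilon>K N[of n] have "(hardy_norm (shift_comm (F n)))\<^sup>2 < \<eta>" by linarith
      thus "norm ((hardy_norm (shift_comm (F n)))\<^sup>2 - 0) < \<eta>" by simp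
    qed
  qed
  hence "(\<lambda>n. sqrt ((hardy_norm (shift_comm (F n)))\<^sup>2)) \<longlonglongrightarrow> sqrt 0" by (rule tendsto_real_sqrt)
  thus "(\<lambda>n. hardy_norm (shift_comm (F n))) \<longlonglongrightarrow> 0"
    using hardy_norm_nonneg[OF bounded_op_mem[OF bounded_op_shift_comm f]] by simp
qed

lemma compact_imp_fixed:
  assumes comp: "compact_op shift_comm" and cont: "\<forall>t\<in>E. continuous (at t within sphere 0 1) \<phi>'"
    and \<phi>': "AE t in arc_measure. p t = \<phi>' t" and t: "t \<in> E"
  shows "\<phi>' t = t"
proof -
  define U where "U = (\<Union>\<alpha>\<in>sphere 0 1. measure_support (singular_part arc_measure (clark_measure \<phi> \<alpha>)))"
  have UE: "U \<subseteq> E" using closure_subset by (simp add: clark_singular_set_def U_def)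
  obtain x where x: "\<And>n. x n \<in> U" "x \<longlonglongrightarrow> t"
    using t unfolding clark_singular_set_def U_def[symmetric] closure_sequential by blast
  have fx: "\<phi>' (x n) = x n" for n
  proof -
    obtain \<alpha> where "norm \<alpha> = 1" "x n \<in> measure_support (singular_part arc_measure (clark_measure \<phi> \<alpha>))"
      using x(1)[of n] by (auto simp: U_def)
    moreover have "x n \<in> E" using x(1) UE by blast
    ultimately show ?thesis using compact_imp_fixed_on_support[OF comp _ _ \<phi>'] cont by blast
  qed
  have "\<forall>\<^sub>F n in sequentially. x n \<in> sphere 0 1" using x(1) UE E_subset_sphere by (intro always_eventually) blast
  moreover have "(\<phi>' \<longlongrightarrow> \<phi>' t) (at t within sphere 0 1)"
    using cont t by (simp add: continuous_within)
  ultimately have "(\<lambda>n. \<phi>' (x n)) \<longlonglongrightarrow> \<phi>' t"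
    using cont t x(1) UE E_subset_sphere unfolding continuous_within_sequentially o_def
    by (metis (no_types, lifting) subsetD x(2))
  hence "x \<longlonglongrightarrow> \<phi>' t" by (simp add: fx)
  thus ?thesis using x(2) by (rule LIMSEQ_unique)
qed

end

section \<open>The equivalence\<close>

text \<open>A bounded holomorphic function lies in the Hardy space once it is set to 0 off the disk, so
  its radial limits exist almost everywhere.\<close>

lemma disk_map_boundary:
  assumes hol: "\<phi> holomorphic_on ball 0 1" and maps: "\<phi> ` ball 0 1 \<subseteq> ball 0 1"
    and inner: "AE x in arc_lebesgue. norm (radial_limit \<phi> x) < 1"
  obtains p where "disk_map \<phi> p" "AE x in arc_measure. radial_limit \<phi> x = p x"
proof -
  have m: "norm (\<phi> z) < 1" if "norm z < 1" for z using maps that by (auto simp: image_subset_iff)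
  define f where "f = (\<lambda>z. if norm z < 1 then \<phi> z else 0)"
  have f: "f \<in> hardy2" unfolding f_def by (rule hardy2_bounded[OF hol, of 1]) (use m in \<open>auto intro: less_imp_le\<close>)
  have lim: "AE x in arc_measure. ((\<lambda>r. \<phi> (of_real r * x)) \<longlongrightarrow> bdry f x) (at_left (1::real))"
    using bdry(2)[OF f] AE_space
  proof eventually_elim
    case (elim x)
    have "\<forall>\<^sub>F r in at_left (1::real). r \<in> {0<..<1}" by (rule eventually_at_leftI[of 0]) auto
    hence "\<forall>\<^sub>F r in at_left (1::real). f (of_real r * x) = \<phi> (of_real r * x)"
      by eventually_elim (use elim(2) in \<open>simp add: f_def norm_mult\<close>)
    with elim(1) show ?case by (rule Lim_transform_eventually)
  qed
  have r: "AE x in arc_measure. radial_limit \<phi> x = bdry f x"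
    using lim by eventually_elim (simp add: radial_limit_def tendsto_Lim)
  define p where "p = (\<lambda>x. if norm (bdry f x) < 1 then bdry f x else 0)"
  have eq: "AE x in arc_measure. bdry f x = p x"
    using r inner[unfolded AE_completion_iff] by eventually_elim (simp add: p_def)
  note [measurable] = bdry_measurable[OF f]
  show ?thesis
  proof (rule that)
    show "disk_map \<phi> p"
    proof
      show "p \<in> borel_measurable arc_measure" unfolding p_def by measurable
      show "AE x in arc_measure. ((\<lambda>r. \<phi> (of_real r * x)) \<longlongrightarrow> p x) (at_left (1::real))"
        using lim eq by eventually_elim simp
    qed (use hol m in \<open>auto simp: p_def\<close>)
    show "AE x in arc_measure. radial_limit \<phi> x = p x" using r eq by eventually_elim simp
  qed
qed

theorem theorem2:
  fixes \<phi> \<phi>' :: "complex \<Rightarrow> complex"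
  assumes "\<phi> holomorphic_on ball 0 1"
    and "\<phi> ` ball 0 1 \<subseteq> ball 0 1"
    and "AE \<zeta> in arc_lebesgue. norm (radial_limit \<phi> \<zeta>) < 1"
    and "\<phi>' \<in> borel_measurable arc_lebesgue"
    and "bounded (\<phi>' ` sphere 0 1)"
    and "AE \<zeta> in arc_lebesgue. radial_limit \<phi> \<zeta> = \<phi>' \<zeta>"
    and "\<forall>\<zeta>\<in>clark_singular_set \<phi>. continuous (at \<zeta> within sphere 0 1) \<phi>'"
  shows "(compact_op (commutator (toeplitz (\<lambda>\<zeta>. \<zeta>)) (comp_op \<phi>)) \<longleftrightarrow>
            compact_op (commutator (hardy_adjoint (toeplitz (\<lambda>\<zeta>. \<zeta>))) (comp_op \<phi>))) \<and>
         (compact_op (commutator (toeplitz (\<lambda>\<zeta>. \<zeta>)) (comp_op \<phi>)) \<longleftrightarrow>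
            (\<forall>\<zeta>\<in>clark_singular_set \<phi>. \<phi>' \<zeta> = \<zeta>)) \<and>
         (compact_op (commutator (toeplitz (\<lambda>\<zeta>. \<zeta>)) (comp_op \<phi>)) \<longrightarrow>
            (\<forall>w. continuous_on (sphere 0 1) w \<longrightarrow>
               compact_op (commutator (toeplitz w) (comp_op \<phi>))))"
proof -
  obtain p where "disk_map \<phi> p" and p: "AE \<zeta> in arc_measure. radial_limit \<phi> \<zeta> = p \<zeta>"
    by (rule disk_map_boundary[OF assms(1-3)])
  interpret disk_map \<phi> p by fact
  have \<phi>': "AE \<zeta> in arc_measure. p \<zeta> = \<phi>' \<zeta>"
    using p assms(6)[unfolded AE_completion_iff] by eventually_elim simp
  note C = bounded_op_comp_op
  have "compact_op (commutator (hardy_adjoint (toeplitz (\<lambda>\<zeta>. \<zeta>))) (comp_op \<phi>)) \<longleftrightarrow> compact_op (commutator (toeplitz cnj) (comp_op \<phi>))"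
    by (rule compact_op_cong) (simp only: commutator_def hardy_adjoint_shift bounded_op_mem[OF C])
  hence "compact_op shift_comm \<longleftrightarrow> compact_op (commutator (hardy_adjoint (toeplitz (\<lambda>\<zeta>. \<zeta>))) (comp_op \<phi>))"
    using compact_commutator_shift_iff[OF C] by blast
  moreover have "compact_op shift_comm \<longleftrightarrow> (\<forall>\<zeta>\<in>E. \<phi>' \<zeta> = \<zeta>)"
    using compact_imp_fixed[OF _ assms(7) \<phi>'] fixed_imp_compact[OF _ assms(7) \<phi>'] by blast
  moreover have "compact_op (commutator (toeplitz w) (comp_op \<phi>))" if "compact_op shift_comm" "continuous_on (sphere 0 1) w" for w
    by (rule compact_commutator_continuous[OF C that])
  ultimately show ?thesis by blast
qed

end
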